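(* Let $\mathcal{H}$ be a separable Hilbert space and let $(\mathcal{T}^t)_{t\ge 0}$ be a trace preserving quantum dynamical semigroup on $\mathfrak{T}(\mathcal{H})$ with generator $\mathcal{L}$. Then $\mathcal{L}$ admits a generalized standard form if and only if the semigroup is matrix normal. In this case $\mathcal{D}_e\subset\mathcal{D}(M)$, where $\{e_k\}$ is an orthonormal basis witnessing matrix normality and $M$ is the operator of the generalized standard form.
   Context: $\mathfrak{T}(\mathcal{H})$ denotes the Banach space of trace class operators on $\mathcal{H}$ with the trace norm $\|\cdot\|_1$. A trace preserving quantum dynamical semigroup (QDS) is a strongly continuous semigroup $(\mathcal{T}^t)_{t\ge0}$ of trace preserving completely positive maps on $\mathfrak{T}(\mathcal{H})$. Its generator $\mathcal{L}$ is the closed, densely defined operator $\mathcal{L}(\rho)=\lim_{t\to0}\frac1t(\mathcal{T}^t(\rho)-\rho)$ (limit in trace norm), with domain $\mathcal{D}(\mathcal{L})$ the set of $\rho$ for which this limit exists. For an orthonormal basis $\{e_k\}$ of $\mathcal{H}$ let $\mathcal{D}_e=\mathrm{span}\{e_k\}$ (finite linear combinations) and $\mathcal{D}_e^2=\mathrm{span}\{|e_k\rangle\langle e_\ell|\}$. The QDS is called matrix normal if there exists an orthonormal basis $\{e_k\}$ such that $\mathcal{D}_e^2$ is a core for $\mathcal{L}$. Generalized standard form: $\mathcal{L}$ is in generalized standard form if there are a closed densely defined operator $M$ on $\mathcal{H}$ which generates a semigroup on $\mathcal{H}$, and countably many densely defined linear operators $L_k$ on $\mathcal{H}$, each relatively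 bounded with respect to $M$ (so defined on $\mathcal{D}(M)$), such that: (i) for every $\rho$ in the set $\mathcal{D}_0$ of finite sums $\sum_n|\phi_n\rangle\langle\psi_n|$ with all $\phi_n,\psi_n\in\mathcal{D}(M)$ one has $\rho\in\mathcal{D}(\mathcal{L})$ and, for $\rho=|\phi\rangle\langle\psi|$, $\mathcal{L}(\rho)=\sum_k|L_k\phi\rangle\langle L_k\psi|-|M\phi\rangle\langle\psi|-|\phi\rangle\langle M\psi|$ (extended linearly), which is written $\mathcal{L}(\rho)=\sum_kL_k\rho L_k^\dagger-M\rho-\rho M^\dagger$; here $L_k^\dagger,M^\dagger$ are the generalized operators from $\mathcal{H}$ into the conjugate algebraic dual of $\mathcal{D}(M)$ defined by $\langle\eta|L_k^\dagger|\psi\rangle=\langle\psi|L_k\eta\rangle^*$, $\langle\eta|M^\dagger|\psi\rangle=\langle\psi|M\eta\rangle^*$ for $\psi\in\mathcal{H},\eta\in\mathcal{D}(M)$; (ii) $\mathcal{D}(\mathcal{L})$ is the closure of $\mathcal{D}_0$ in the graph norm $\|\rho\|_1+\|\mathcal{L}(\rho)\|_1$; (iii) $\sum_kL_k^\dagger L_k=M+M^\dagger$ as quadratic forms on $\mathcal{D}(M)$, i.e. $\sum_k\|L_k\phi\|^2=\langle\phi|M\phi\rangle+\langle M\phi|\phi\rangle$ for all $\phi\in\mathcal{D}(M)$. *)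

theory Defs
  imports "HOL-Analysis.Analysis"
begin

class chilbert = real_normed_vector + complete_space +
  fixes scaleC :: "complex \<Rightarrow> 'a \<Rightarrow> 'a" (infixr \<open>*\<^sub>C\<close> 75)
    and cinner :: "'a \<Rightarrow> 'a \<Rightarrow> complex"
  assumes scaleC_add_right: "c *\<^sub>C (x + y) = c *\<^sub>C x + c *\<^sub>C y"
    and scaleC_add_left: "(a + b) *\<^sub>C x = a *\<^sub>C x + b *\<^sub>C x"
    and scaleC_scaleC: "a *\<^sub>C (b *\<^sub>C x) = (a * b) *\<^sub>C x"
    and scaleC_one: "1 *\<^sub>C x = x"
    and scaleR_scaleC: "scaleR r x = complex_of_real r *\<^sub>C x"
    and cinner_add_right: "cinner x (y + z) = cinner x y + cinner x z"
    and cinner_scaleC_right: "cinner x (c *\<^sub>C y) = c * cinner x y"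
    and cinner_commute: "cinner y x = cnj (cinner x y)"
    and cinner_self_norm: "cinner x x = complex_of_real ((norm x)\<^sup>2)"

definition separable_space :: "'h::chilbert itself \<Rightarrow> bool" where
  "separable_space _ \<longleftrightarrow> (\<exists>D::'h set. countable D \<and> closure D = UNIV)"

definition clinear :: "('h::chilbert \<Rightarrow> 'h) \<Rightarrow> bool" where
  "clinear f \<longleftrightarrow> (\<forall>x y. f (x + y) = f x + f y) \<and> (\<forall>c x. f (c *\<^sub>C x) = c *\<^sub>C f x)"

definition bounded_clinear :: "('h::chilbert \<Rightarrow> 'h) \<Rightarrow> bool" where
  "bounded_clinear f \<longleftrightarrow> clinear f \<and> (\<exists>K. \<forall>x. norm (f x) \<le> K * norm x)"

definition csubspace :: "'h::chilbert set \<Rightarrow> bool" where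
  "csubspace D \<longleftrightarrow> 0 \<in> D \<and> (\<forall>x\<in>D. \<forall>y\<in>D. x + y \<in> D) \<and> (\<forall>c. \<forall>x\<in>D. c *\<^sub>C x \<in> D)"

text \<open>Linear operator with domain D (only its values on D matter).\<close>
definition clinear_on :: "'h::chilbert set \<Rightarrow> ('h \<Rightarrow> 'h) \<Rightarrow> bool" where
  "clinear_on D f \<longleftrightarrow> csubspace D \<and> (\<forall>x\<in>D. \<forall>y\<in>D. f (x + y) = f x + f y)
      \<and> (\<forall>c. \<forall>x\<in>D. f (c *\<^sub>C x) = c *\<^sub>C f x)"

definition cspan :: "'h::chilbert set \<Rightarrow> 'h set" where
  "cspan S = {y. \<exists>F c. finite F \<and> F \<subseteq> S \<and> y = (\<Sum>x\<in>F. c x *\<^sub>C x)}"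

definition orthonormal_set :: "'h::chilbert set \<Rightarrow> bool" where
  "orthonormal_set B \<longleftrightarrow> (\<forall>x\<in>B. \<forall>y\<in>B. cinner x y = (if x = y then 1 else 0))"

definition is_onb :: "'h::chilbert set \<Rightarrow> bool" where
  "is_onb B \<longleftrightarrow> orthonormal_set B \<and> closure (cspan B) = UNIV"

definition ketbra :: "'h::chilbert \<Rightarrow> 'h \<Rightarrow> ('h \<Rightarrow> 'h)" where
  "ketbra \<phi> \<psi> = (\<lambda>x. cinner \<psi> x *\<^sub>C \<phi>)"

definition orthonormal_fam :: "nat \<Rightarrow> (nat \<Rightarrow> 'h::chilbert) \<Rightarrow> bool" where
  "orthonormal_fam n e \<longleftrightarrow> (\<forall>i<n. \<forall>j<n. cinner (e i) (e j) = (if i = j then 1 else 0))"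

definition tn_set :: "('h::chilbert \<Rightarrow> 'h) \<Rightarrow> real set" where
  "tn_set A = {\<Sum>k<n. cmod (cinner (f k) (A (e k))) | n e f.
                 orthonormal_fam n e \<and> orthonormal_fam n f}"

definition trace_class :: "('h::chilbert \<Rightarrow> 'h) \<Rightarrow> bool" where
  "trace_class A \<longleftrightarrow> clinear A \<and> bdd_above (tn_set A)"

definition trace_norm :: "('h::chilbert \<Rightarrow> 'h) \<Rightarrow> real" where
  "trace_norm A = Sup (tn_set A)"

definition ctrace :: "('h::chilbert \<Rightarrow> 'h) \<Rightarrow> complex" where
  "ctrace A = (\<Sum>\<^sub>\<infinity>b\<in>(SOME B. is_onb B). cinner b (A b))"

definition tc_has_sum :: "('k \<Rightarrow> ('h::chilbert \<Rightarrow> 'h)) \<Rightarrow> 'k set \<Rightarrow> ('h \<Rightarrow> 'h) \<Rightarrow> bool" where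
  "tc_has_sum f K \<sigma> \<longleftrightarrow> trace_class \<sigma> \<and> (\<forall>k\<in>K. trace_class (f k)) \<and>
     ((\<lambda>F. trace_norm (\<lambda>x. (\<Sum>k\<in>F. f k x) - \<sigma> x)) \<longlongrightarrow> 0) (finite_subsets_at_top K)"

text \<open>Positivity of the block operator \<open>[\<rho>\<^sub>i\<^sub>j]\<^sub>i\<^sub>,\<^sub>j\<^sub><\<^sub>n\<close> on \<open>\<complex>\<^sup>n \<otimes> H = H\<^sup>n\<close>.\<close>
definition block_positive :: "nat \<Rightarrow> (nat \<Rightarrow> nat \<Rightarrow> ('h::chilbert \<Rightarrow> 'h)) \<Rightarrow> bool" where
  "block_positive n \<rho> \<longleftrightarrow> (\<forall>x::nat \<Rightarrow> 'h.
      Im (\<Sum>i<n. \<Sum>j<n. cinner (x i) (\<rho> i j (x j))) = 0 \<and>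
      Re (\<Sum>i<n. \<Sum>j<n. cinner (x i) (\<rho> i j (x j))) \<ge> 0)"

text \<open>\<open>id\<^sub>n \<otimes> \<Phi>\<close> is positive on \<open>\<TT>(\<complex>\<^sup>n \<otimes> H)\<close> for all n.\<close>
definition completely_positive :: "(('h::chilbert \<Rightarrow> 'h) \<Rightarrow> ('h \<Rightarrow> 'h)) \<Rightarrow> bool" where
  "completely_positive \<Phi> \<longleftrightarrow> (\<forall>n \<rho>. (\<forall>i<n. \<forall>j<n. trace_class (\<rho> i j)) \<and> block_positive n \<rho>
      \<longrightarrow> block_positive n (\<lambda>i j. \<Phi> (\<rho> i j)))"

definition tp_cp_map :: "(('h::chilbert \<Rightarrow> 'h) \<Rightarrow> ('h \<Rightarrow> 'h)) \<Rightarrow> bool" where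
  "tp_cp_map \<Phi> \<longleftrightarrow>
     (\<forall>\<rho>. trace_class \<rho> \<longrightarrow> trace_class (\<Phi> \<rho>) \<and> ctrace (\<Phi> \<rho>) = ctrace \<rho>) \<and>
     (\<forall>\<rho> \<sigma>. trace_class \<rho> \<longrightarrow> trace_class \<sigma> \<longrightarrow> \<Phi> (\<lambda>x. \<rho> x + \<sigma> x) = (\<lambda>x. \<Phi> \<rho> x + \<Phi> \<sigma> x)) \<and>
     (\<forall>c \<rho>. trace_class \<rho> \<longrightarrow> \<Phi> (\<lambda>x. c *\<^sub>C \<rho> x) = (\<lambda>x. c *\<^sub>C \<Phi> \<rho> x)) \<and>
     completely_positive \<Phi>"

definition tp_qds :: "(real \<Rightarrow> ('h::chilbert \<Rightarrow> 'h) \<Rightarrow> ('h \<Rightarrow> 'h)) \<Rightarrow> bool" where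
  "tp_qds T \<longleftrightarrow>
     (\<forall>t\<ge>0. tp_cp_map (T t)) \<and>
     (\<forall>\<rho>. trace_class \<rho> \<longrightarrow> T 0 \<rho> = \<rho>) \<and>
     (\<forall>s\<ge>0. \<forall>t\<ge>0. \<forall>\<rho>. trace_class \<rho> \<longrightarrow> T (s + t) \<rho> = T s (T t \<rho>)) \<and>
     (\<forall>\<rho>. trace_class \<rho> \<longrightarrow> ((\<lambda>t. trace_norm (\<lambda>x. T t \<rho> x - \<rho> x)) \<longlongrightarrow> 0) (at_right 0))"

definition is_gen :: "(real \<Rightarrow> ('h::chilbert \<Rightarrow> 'h) \<Rightarrow> ('h \<Rightarrow> 'h)) \<Rightarrow> ('h \<Rightarrow> 'h) \<Rightarrow> ('h \<Rightarrow> 'h) \<Rightarrow> bool" where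
  "is_gen T \<rho> \<sigma> \<longleftrightarrow> trace_class \<rho> \<and> trace_class \<sigma> \<and>
     ((\<lambda>t. trace_norm (\<lambda>x. (1 / t) *\<^sub>R (T t \<rho> x - \<rho> x) - \<sigma> x)) \<longlongrightarrow> 0) (at_right 0)"

definition gen_dom :: "(real \<Rightarrow> ('h::chilbert \<Rightarrow> 'h) \<Rightarrow> ('h \<Rightarrow> 'h)) \<Rightarrow> ('h \<Rightarrow> 'h) set" where
  "gen_dom T = {\<rho>. \<exists>\<sigma>. is_gen T \<rho> \<sigma>}"

definition gen :: "(real \<Rightarrow> ('h::chilbert \<Rightarrow> 'h) \<Rightarrow> ('h \<Rightarrow> 'h)) \<Rightarrow> ('h \<Rightarrow> 'h) \<Rightarrow> ('h \<Rightarrow> 'h)" where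
  "gen T \<rho> = (THE \<sigma>. is_gen T \<rho> \<sigma>)"

definition graph_dense :: "(real \<Rightarrow> ('h::chilbert \<Rightarrow> 'h) \<Rightarrow> ('h \<Rightarrow> 'h)) \<Rightarrow> ('h \<Rightarrow> 'h) set \<Rightarrow> bool" where
  "graph_dense T D \<longleftrightarrow> D \<subseteq> gen_dom T \<and>
     (\<forall>\<rho>\<in>gen_dom T. \<exists>R. (\<forall>n. R n \<in> D) \<and>
        (\<lambda>n. trace_norm (\<lambda>x. R n x - \<rho> x) + trace_norm (\<lambda>x. gen T (R n) x - gen T \<rho> x)) \<longlonglongrightarrow> 0)"

definition is_core :: "(real \<Rightarrow> ('h::chilbert \<Rightarrow> 'h) \<Rightarrow> ('h \<Rightarrow> 'h)) \<Rightarrow> ('h \<Rightarrow> 'h) set \<Rightarrow> bool" where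
  "is_core T D \<longleftrightarrow> graph_dense T D"

definition ketbra_span :: "'h::chilbert set \<Rightarrow> ('h \<Rightarrow> 'h) set" where
  "ketbra_span B = {\<rho>. \<exists>F c. finite F \<and> F \<subseteq> B \<times> B \<and>
      \<rho> = (\<lambda>x. \<Sum>p\<in>F. c p *\<^sub>C ketbra (fst p) (snd p) x)}"

definition matrix_normal_witness :: "(real \<Rightarrow> ('h::chilbert \<Rightarrow> 'h) \<Rightarrow> ('h \<Rightarrow> 'h)) \<Rightarrow> 'h set \<Rightarrow> bool" where
  "matrix_normal_witness T B \<longleftrightarrow> is_onb B \<and> is_core T (ketbra_span B)"

definition matrix_normal :: "(real \<Rightarrow> ('h::chilbert \<Rightarrow> 'h) \<Rightarrow> ('h \<Rightarrow> 'h)) \<Rightarrow> bool" where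
  "matrix_normal T \<longleftrightarrow> (\<exists>B. matrix_normal_witness T B)"

definition closed_op :: "'h::chilbert set \<Rightarrow> ('h \<Rightarrow> 'h) \<Rightarrow> bool" where
  "closed_op DM M \<longleftrightarrow> (\<forall>X x y. (\<forall>n. X n \<in> DM) \<longrightarrow> X \<longlonglongrightarrow> x \<longrightarrow> (\<lambda>n. M (X n)) \<longlonglongrightarrow> y
      \<longrightarrow> x \<in> DM \<and> M x = y)"

definition densely_defined :: "'h::chilbert set \<Rightarrow> ('h \<Rightarrow> 'h) \<Rightarrow> bool" where
  "densely_defined DM M \<longleftrightarrow> clinear_on DM M \<and> closure DM = UNIV"

definition generates_C0 :: "'h::chilbert set \<Rightarrow> ('h \<Rightarrow> 'h) \<Rightarrow> bool" where
  "generates_C0 DA A \<longleftrightarrow> (\<exists>S :: real \<Rightarrow> 'h \<Rightarrow> 'h.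
     (\<forall>t\<ge>0. bounded_clinear (S t)) \<and> S 0 = id \<and>
     (\<forall>s\<ge>0. \<forall>t\<ge>0. S (s + t) = S s \<circ> S t) \<and>
     (\<forall>x. ((\<lambda>t. S t x) \<longlongrightarrow> x) (at_right 0)) \<and>
     DA = {x. \<exists>y. ((\<lambda>t. (1 / t) *\<^sub>R (S t x - x)) \<longlongrightarrow> y) (at_right 0)} \<and>
     (\<forall>x\<in>DA. ((\<lambda>t. (1 / t) *\<^sub>R (S t x - x)) \<longlongrightarrow> A x) (at_right 0)))"

definition D0 :: "'h::chilbert set \<Rightarrow> ('h \<Rightarrow> 'h) set" where
  "D0 DM = {\<rho>. \<exists>F \<phi> \<psi>. finite (F::nat set) \<and> (\<forall>n\<in>F. \<phi> n \<in> DM \<and> \<psi> n \<in> DM) \<and>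
      \<rho> = (\<lambda>x. \<Sum>n\<in>F. ketbra (\<phi> n) (\<psi> n) x)}"

text \<open>Generalized standard form with data: countable index set \<open>K\<close>, the operator \<open>M\<close> with
  domain \<open>DM\<close>, and operators \<open>L k\<close> (k \<in> K), considered on \<open>\<D>(M)\<close>.
  The semigroup generated by \<open>M\<close> is \<open>e\<^sup>-\<^sup>t\<^sup>M\<close> (generator \<open>-M\<close>).\<close>
definition gen_standard_form ::
  "(real \<Rightarrow> ('h::chilbert \<Rightarrow> 'h) \<Rightarrow> ('h \<Rightarrow> 'h)) \<Rightarrow> nat set \<Rightarrow> 'h set \<Rightarrow> ('h \<Rightarrow> 'h) \<Rightarrow> (nat \<Rightarrow> 'h \<Rightarrow> 'h) \<Rightarrow> bool" where
  "gen_standard_form T K DM M L \<longleftrightarrow>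
     closed_op DM M \<and> densely_defined DM M \<and> generates_C0 DM (\<lambda>x. - M x) \<and>
     (\<forall>k\<in>K. clinear_on DM (L k) \<and>
        (\<exists>a b. \<forall>\<phi>\<in>DM. norm (L k \<phi>) \<le> a * norm (M \<phi>) + b * norm \<phi>)) \<and>
     \<comment> \<open>(i)\<close>
     D0 DM \<subseteq> gen_dom T \<and>
     (\<forall>\<phi>\<in>DM. \<forall>\<psi>\<in>DM. \<exists>\<sigma>. tc_has_sum (\<lambda>k. ketbra (L k \<phi>) (L k \<psi>)) K \<sigma> \<and>
        is_gen T (ketbra \<phi> \<psi>) (\<lambda>x. \<sigma> x - ketbra (M \<phi>) \<psi> x - ketbra \<phi> (M \<psi>) x)) \<and>
     \<comment> \<open>(ii)\<close>
     graph_dense T (D0 DM) \<and>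
     \<comment> \<open>(iii)\<close>
     (\<forall>\<phi>\<in>DM. ((\<lambda>k. complex_of_real ((norm (L k \<phi>))\<^sup>2)) has_sum
                 (cinner \<phi> (M \<phi>) + cinner (M \<phi>) \<phi>)) K)"

definition has_gen_standard_form :: "(real \<Rightarrow> ('h::chilbert \<Rightarrow> 'h) \<Rightarrow> ('h \<Rightarrow> 'h)) \<Rightarrow> bool" where
  "has_gen_standard_form T \<longleftrightarrow> (\<exists>K DM M L. gen_standard_form T K DM M L)"

end

theory Submission
  imports Defs
begin

text \<open>From a standard form to matrix normality: conservativity bounds the jump part
  \<open>J(\<phi>,\<psi>) = \<Sum>\<^sub>k |L\<^sub>k \<phi>\<rangle>\<langle>L\<^sub>k \<psi>|\<close> by the graph norm of \<open>M\<close>, so that \<open>|\<phi>\<rangle>\<langle>\<psi>| \<mapsto> \<L>(|\<phi>\<rangle>\<langle>\<psi>|)\<close> is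
  continuous for the graph norm; hence Gram-Schmidt applied to a countable core of \<open>M\<close> gives a
  suitable basis.

  Conversely, let \<open>e\<close> be a unit vector in \<open>\<D>\<^sub>e\<close> and put
  \<open>M \<phi> = - \<L>(|\<phi>\<rangle>\<langle>e|) e + \<langle>e|\<L>(|e\<rangle>\<langle>e|) e\<rangle> \<phi> / 2\<close>, which is Lindblad's formula in the gauge
  \<open>\<langle>e|L\<^sub>k e\<rangle> = 0\<close>. By conditional complete positivity
  \<open>J(\<phi>,\<psi>) = \<L>(|\<phi>\<rangle>\<langle>\<psi>|) + |M \<phi>\<rangle>\<langle>\<psi>| + |\<phi>\<rangle>\<langle>M \<psi>|\<close> is a completely positive kernel, and trace preservation
  gives \<open>tr J(\<phi>,\<phi>) = 2 Re \<langle>\<phi>|M \<phi>\<rangle>\<close>, so \<open>M\<close> is accretive. The crucial point is that the closure of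
  \<open>M\<close> is maximal accretive. If \<open>z\<close> were orthogonal to the range of \<open>1 + h M\<close>, then extending \<open>M\<close>
  by \<open>M z = z / h\<close> and \<open>J\<close> by zero would extend \<open>\<L>\<close> to a map that is dissipative for the trace norm
  but does not preserve the trace at \<open>|z\<rangle>\<langle>z|\<close>; since \<open>1 - \<L>\<close> has dense range on the core, no
  dissipative extension of \<open>\<L>\<close> can do that. The semigroup generated by \<open>-M\<close> is obtained from the backward Euler
  scheme, and the operators \<open>L\<^sub>k\<close> from iterated Schur complements of \<open>J\<close>.\<close>

section \<open>Complex Hilbert spaces\<close>

\<comment> \<open>Maximality comes from a resolvent argument. If L' is dissipative and extends the
  generator L, then |x - \<xi>| \<le> |(1 - L) x - (1 - L') \<xi>| for x in the core. Dense range
  lets (1 - L) x approach (1 - L') \<xi>, which forces x to approach \<xi>; as L takes values of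
  trace zero, the trace of L' \<xi> must vanish. For \<xi> = |z><z| it is instead -2/h times the
  squared norm of z. Dissipativity of L' rests only on the inequality tr J(\<phi>,\<phi>) \<le> 2 Re
  <\<phi>, N \<phi>> for the extension N of M, and this survives because the new direction adds a
  nonnegative term to the right side.

  The trace norm is a supremum over pairs of finite orthonormal families. The role of the polar
  decomposition is played by the singular value decomposition of finite rank operators and by
  positive 2 x 2 operator blocks, in which the traces of the diagonal entries bound the trace norm
  of an off-diagonal one. This block bound gives the contractivity of completely positive trace
  preserving maps, the bound on J and the dissipativity of the extension.\<close>
subclass (in chilbert) banach ..

section \<open>Inner product calculus up to the Cauchy-Schwarz inequality\<close>

lemma cinner_add_left: "cinner (x + y) (z::'h::chilbert) = cinner x z + cinner y z"
  by (metis cinner_add_right cinner_commute complex_cnj_add)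

lemma cinner_scaleC_left: "cinner (c *\<^sub>C x) (z::'h::chilbert) = cnj c * cinner x z"
  by (metis cinner_commute cinner_scaleC_right complex_cnj_mult)

lemma cinner_zero_right [simp]: "cinner (x::'h::chilbert) 0 = 0"
  using cinner_add_right[of x 0 0] by simp

lemma cinner_zero_left [simp]: "cinner 0 (x::'h::chilbert) = 0"
  using cinner_add_left[of 0 0 x] by simp

lemma cinner_minus_right [simp]: "cinner (x::'h::chilbert) (- y) = - cinner x y"
  using cinner_add_right[of x y "-y"] by (simp add: eq_neg_iff_add_eq_0 add.commute)

lemma cinner_minus_left [simp]: "cinner (- x) (y::'h::chilbert) = - cinner x y"
  using cinner_add_left[of x "-x" y] by (simp add: eq_neg_iff_add_eq_0 add.commute)

lemma cinner_diff_right: "cinner (x::'h::chilbert) (y - z) = cinner x y - cinner x z"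
  using cinner_add_right[of x y "-z"] by simp

lemma cinner_diff_left: "cinner (x - y) (z::'h::chilbert) = cinner x z - cinner y z"
  using cinner_add_left[of x "-y" z] by simp

lemma cinner_sum_right: "cinner (x::'h::chilbert) (\<Sum>i\<in>A. f i) = (\<Sum>i\<in>A. cinner x (f i))"
  by (induction A rule: infinite_finite_induct) (auto simp: cinner_add_right)

lemma cinner_sum_left: "cinner (\<Sum>i\<in>A. f i) (x::'h::chilbert) = (\<Sum>i\<in>A. cinner (f i) x)"
  by (induction A rule: infinite_finite_induct) (auto simp: cinner_add_left)

lemma cinner_scaleR_right: "cinner (x::'h::chilbert) (r *\<^sub>R y) = of_real r * cinner x y"
  by (simp add: scaleR_scaleC cinner_scaleC_right)

lemma cinner_scaleR_left: "cinner (r *\<^sub>R x) (y::'h::chilbert) = of_real r * cinner x y"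
  by (simp add: scaleR_scaleC cinner_scaleC_left)

lemmas cinner_lin = cinner_add_left cinner_add_right cinner_scaleC_left cinner_scaleC_right
  cinner_diff_left cinner_diff_right cinner_scaleR_left cinner_scaleR_right
  cinner_sum_left cinner_sum_right

lemma scaleC_zero_left [simp]: "0 *\<^sub>C (x::'h::chilbert) = 0"
  using scaleC_add_left[of 0 0 x] by simp

lemma scaleC_zero_right [simp]: "c *\<^sub>C (0::'h::chilbert) = 0"
  using scaleC_add_right[of c "0::'h" 0] by simp

lemma scaleC_minus_left [simp]: "(- c) *\<^sub>C (x::'h::chilbert) = - (c *\<^sub>C x)"
  using scaleC_add_left[of c "-c" x] by (simp add: eq_neg_iff_add_eq_0 add.commute)

lemma scaleC_minus_right [simp]: "c *\<^sub>C (- x::'h::chilbert) = - (c *\<^sub>C x)"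
  using scaleC_add_right[of c x "-x"] by (simp add: eq_neg_iff_add_eq_0 add.commute)

lemma scaleC_diff_right: "c *\<^sub>C (x - y::'h::chilbert) = c *\<^sub>C x - c *\<^sub>C y"
  using scaleC_add_right[of c x "-y"] by simp

lemma scaleC_diff_left: "(a - b) *\<^sub>C (x::'h::chilbert) = a *\<^sub>C x - b *\<^sub>C x"
  using scaleC_add_left[of a "-b" x] by simp

lemma scaleC_sum_right: "c *\<^sub>C (\<Sum>i\<in>A. f i :: 'h::chilbert) = (\<Sum>i\<in>A. c *\<^sub>C f i)"
  by (induction A rule: infinite_finite_induct) (auto simp: scaleC_add_right)

lemma scaleC_sum_left: "(\<Sum>i\<in>A. f i) *\<^sub>C (x :: 'h::chilbert) = (\<Sum>i\<in>A. f i *\<^sub>C x)"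
  by (induction A rule: infinite_finite_induct) (auto simp: scaleC_add_left)

declare scaleC_one [simp] scaleC_scaleC [simp]

lemma cinner_self_Re: "Re (cinner (x::'h::chilbert) x) = (norm x)\<^sup>2"
  and cinner_self_Im [simp]: "Im (cinner x x) = 0"
  by (simp_all add: cinner_self_norm)

lemma cinner_cnj: "cnj (cinner x (y::'h::chilbert)) = cinner y x"
  by (metis cinner_commute)

lemma norm_add_sq: "(norm (x + y::'h::chilbert))\<^sup>2 = (norm x)\<^sup>2 + (norm y)\<^sup>2 + 2 * Re (cinner x y)"
proof -
  have "Re (cinner y x) = Re (cinner x y)" by (metis cinner_commute complex_cnj cnj.simps(1))
  then show ?thesis
    by (simp add: cinner_self_Re[symmetric] cinner_lin)
qed

lemma norm_diff_sq: "(norm (x - y::'h::chilbert))\<^sup>2 = (norm x)\<^sup>2 + (norm y)\<^sup>2 - 2 * Re (cinner x y)"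
  using norm_add_sq[of x "-y"] by simp

lemma norm_scaleC [simp]: "norm (c *\<^sub>C (x::'h::chilbert)) = cmod c * norm x"
proof -
  have "cinner (c *\<^sub>C x) (c *\<^sub>C x) = (c * cnj c) * cinner x x"
    by (simp add: cinner_scaleC_left cinner_scaleC_right)
  also have "\<dots> = of_real ((cmod c)\<^sup>2) * of_real ((norm x)\<^sup>2)"
    using complex_norm_square[of c] cinner_self_norm[of x] by metis
  also have "\<dots> = of_real ((cmod c * norm x)\<^sup>2)"
    unfolding of_real_mult[symmetric] power_mult_distrib[symmetric] ..
  finally have "(norm (c *\<^sub>C x))\<^sup>2 = (cmod c * norm x)\<^sup>2"
    using cinner_self_norm[of "c *\<^sub>C x"] of_real_eq_iff by metis
  then show ?thesis using power2_eq_imp_eq norm_ge_zero mult_nonneg_nonneg by metis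
qed

lemma div_sq_mult: "m > 0 \<Longrightarrow> (c / m)\<^sup>2 * m = c\<^sup>2 / (m::real)"
  by (simp add: power2_eq_square)

text \<open>Pythagoras for the component of \<open>y\<close> orthogonal to \<open>x\<close>.
  Nonnegativity of the left side is the Cauchy-Schwarz inequality; the exact value serves the
  projection argument for closed subspaces.\<close>

lemma norm_diff_proj:
  fixes x y :: "'h::chilbert"
  assumes "x \<noteq> 0"
  shows "(norm (y - (cinner x y / of_real ((norm x)\<^sup>2)) *\<^sub>C x))\<^sup>2 = (norm y)\<^sup>2 - (cmod (cinner x y))\<^sup>2 / (norm x)\<^sup>2"
proof -
  define m where "m = (norm x)\<^sup>2"
  define c where "c = cinner x y"
  have m: "m > 0" using assms by (simp add: m_def)
  have "cinner y x = cnj c" unfolding c_def by (rule cinner_commute)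
  then have "(norm (y - (c / of_real m) *\<^sub>C x))\<^sup>2 = (norm y)\<^sup>2 + (cmod (c / of_real m))\<^sup>2 * m - 2 * Re (c / of_real m * cnj c)"
    unfolding norm_diff_sq cinner_scaleC_right norm_scaleC power_mult_distrib m_def by simp
  also have "c / of_real m * cnj c = (c * cnj c) / of_real m" by simp
  also have "\<dots> = of_real ((cmod c)\<^sup>2 / m)" unfolding complex_norm_square[symmetric] of_real_divide ..
  also have "cmod (c / of_real m) = cmod c / m" using m unfolding norm_divide norm_of_real by simp
  also have "(cmod c / m)\<^sup>2 * m = (cmod c)\<^sup>2 / m" by (rule div_sq_mult[OF m])
  finally show ?thesis unfolding m_def[symmetric] c_def[symmetric] Re_complex_of_real by linarith
qed

lemma cinner_cauchy_schwarz: "cmod (cinner x (y::'h::chilbert)) \<le> norm x * norm y"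
proof (cases "x = 0")
  case False
  then have nx: "(norm x)\<^sup>2 > 0" by simp
  have "(cmod (cinner x y))\<^sup>2 / (norm x)\<^sup>2 \<le> (norm y)\<^sup>2"
    using norm_diff_proj[OF False, of y] zero_le_power2 diff_ge_0_iff_ge by metis
  then have "(cmod (cinner x y))\<^sup>2 \<le> (norm x * norm y)\<^sup>2"
    using nx by (simp add: pos_divide_le_eq power_mult_distrib mult.commute)
  then show ?thesis by (rule power2_le_imp_le) simp
qed simp

lemma bounded_bilinear_cinner: "bounded_bilinear (cinner :: 'h::chilbert \<Rightarrow> 'h \<Rightarrow> complex)"
proof
  show "\<exists>K. \<forall>a b::'h. norm (cinner a b) \<le> norm a * norm b * K"
    using cinner_cauchy_schwarz by (metis mult.right_neutral)
qed (auto simp: cinner_lin scaleR_conv_of_real)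

lemma bounded_bilinear_scaleC: "bounded_bilinear (scaleC :: complex \<Rightarrow> 'h::chilbert \<Rightarrow> 'h)"
proof
  show "\<exists>K. \<forall>a (b::'h). norm (a *\<^sub>C b) \<le> norm a * norm b * K"
    by (metis mult.right_neutral norm_scaleC order_refl)
qed (auto simp: scaleC_add_right scaleC_add_left scaleR_scaleC scaleR_conv_of_real mult.commute)

lemmas tendsto_cinner [tendsto_intros] = bounded_bilinear.tendsto[OF bounded_bilinear_cinner]
lemmas tendsto_scaleC [tendsto_intros] = bounded_bilinear.tendsto[OF bounded_bilinear_scaleC]

section \<open>Complex subspaces, spans and their closures\<close>

lemma csubspace_0: "csubspace D \<Longrightarrow> 0 \<in> D"
  and csubspace_add: "csubspace D \<Longrightarrow> x \<in> D \<Longrightarrow> y \<in> D \<Longrightarrow> x + y \<in> D"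
  and csubspace_scale: "csubspace D \<Longrightarrow> x \<in> D \<Longrightarrow> c *\<^sub>C x \<in> D"
  unfolding csubspace_def by auto

lemma csubspace_neg: "csubspace D \<Longrightarrow> x \<in> D \<Longrightarrow> - x \<in> D"
  using csubspace_scale[of D x "-1"] by simp

lemma csubspace_diff: "csubspace D \<Longrightarrow> x \<in> D \<Longrightarrow> y \<in> D \<Longrightarrow> x - y \<in> D"
  using csubspace_add[of D x "-y"] csubspace_neg[of D y] by simp

lemma csubspace_sum: "csubspace D \<Longrightarrow> (\<And>i. i \<in> I \<Longrightarrow> f i \<in> D) \<Longrightarrow> sum f I \<in> D"
  by (induction I rule: infinite_finite_induct) (auto intro: csubspace_0 csubspace_add)

lemma csubspace_scaleR: "csubspace D \<Longrightarrow> x \<in> D \<Longrightarrow> r *\<^sub>R x \<in> D"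
  by (simp add: scaleR_scaleC csubspace_scale)

lemma cspan_subset: "csubspace D \<Longrightarrow> S \<subseteq> D \<Longrightarrow> cspan S \<subseteq> D"
  unfolding cspan_def by (auto intro!: csubspace_sum csubspace_scale)

lemma cspanI: "finite F \<Longrightarrow> F \<subseteq> S \<Longrightarrow> (\<Sum>v\<in>F. c v *\<^sub>C v) \<in> cspan S"
  unfolding cspan_def by (rule CollectI, rule exI[of _ F], rule exI[of _ c]) auto

lemma cspanE:
  assumes "x \<in> cspan S"
  obtains F c where "finite F" "F \<subseteq> S" "x = (\<Sum>v\<in>F. c v *\<^sub>C v)"
proof -
  have "\<exists>F c. finite F \<and> F \<subseteq> S \<and> x = (\<Sum>v\<in>F. c v *\<^sub>C v)"
    using assms by (simp only: cspan_def mem_Collect_eq)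
  then show ?thesis by (elim exE conjE) (rule that)
qed

lemma cspan_superset: "S \<subseteq> cspan S"
proof
  fix x assume "x \<in> S"
  then show "x \<in> cspan S" unfolding cspan_def
    by (intro CollectI exI[of _ "{x}"] exI[of _ "\<lambda>_. 1"]) auto
qed

lemma cspan_base: "x \<in> S \<Longrightarrow> x \<in> cspan S"
  using cspan_superset[of S] by (rule subsetD)

lemma cspan_mono: "S \<subseteq> S' \<Longrightarrow> cspan S \<subseteq> cspan S'"
  unfolding cspan_def by blast

lemma csubspace_cspan: "csubspace (cspan (S::'h::chilbert set))"
  unfolding csubspace_def
proof (intro conjI ballI allI)
  show "0 \<in> cspan S" unfolding cspan_def by (intro CollectI exI[of _ "{}"]) auto
next
  fix x y assume "x \<in> cspan S" "y \<in> cspan S"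
  obtain F c where F: "finite F" "F \<subseteq> S" and Fx: "x = (\<Sum>v\<in>F. c v *\<^sub>C v)"
    using \<open>x \<in> cspan S\<close> by (rule cspanE)
  obtain G d where G: "finite G" "G \<subseteq> S" and Gy: "y = (\<Sum>v\<in>G. d v *\<^sub>C v)"
    using \<open>y \<in> cspan S\<close> by (rule cspanE)
  let ?c = "\<lambda>v. if v \<in> F then c v else 0" and ?d = "\<lambda>v. if v \<in> G then d v else 0"
  have x: "(\<Sum>v\<in>F. c v *\<^sub>C v) = (\<Sum>v\<in>F \<union> G. ?c v *\<^sub>C v)"
    by (rule sum.mono_neutral_cong_left) (use F G in auto)
  have y: "(\<Sum>v\<in>G. d v *\<^sub>C v) = (\<Sum>v\<in>F \<union> G. ?d v *\<^sub>C v)"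
    by (rule sum.mono_neutral_cong_left) (use F G in auto)
  have "x + y = (\<Sum>v\<in>F \<union> G. ?c v *\<^sub>C v) + (\<Sum>v\<in>F \<union> G. ?d v *\<^sub>C v)"
    unfolding Fx Gy x y ..
  also have "\<dots> = (\<Sum>v\<in>F \<union> G. (?c v + ?d v) *\<^sub>C v)"
    by (simp only: scaleC_add_left sum.distrib)
  finally have "x + y = (\<Sum>v\<in>F \<union> G. (?c v + ?d v) *\<^sub>C v)" .
  then show "x + y \<in> cspan S" by (rule ssubst) (rule cspanI; use F G in simp)
next
  fix a x assume "x \<in> cspan S"
  then obtain F c where F: "finite F" "F \<subseteq> S" and Fx: "x = (\<Sum>v\<in>F. c v *\<^sub>C v)"
    by (rule cspanE)
  have "a *\<^sub>C x = (\<Sum>v\<in>F. (a * c v) *\<^sub>C v)" unfolding Fx by (simp add: scaleC_sum_right)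
  then show "a *\<^sub>C x \<in> cspan S" by (rule ssubst) (rule cspanI[OF F])
qed

lemma csubspace_UNIV: "csubspace (UNIV::'h::chilbert set)"
  by (simp add: csubspace_def)

lemma csubspace_closure:
  assumes "csubspace (D::'h::chilbert set)" shows "csubspace (closure D)"
  unfolding csubspace_def
proof (intro conjI ballI allI)
  show "0 \<in> closure D" using csubspace_0[OF assms] closure_subset by blast
next
  fix x y assume "x \<in> closure D" "y \<in> closure D"
  then obtain X Y where "\<And>n. X n \<in> D" "X \<longlonglongrightarrow> x" "\<And>n. Y n \<in> D" "Y \<longlonglongrightarrow> y"
    unfolding closure_sequential by blast
  then show "x + y \<in> closure D" unfolding closure_sequential
    by (intro exI[of _ "\<lambda>n. X n + Y n"]) (auto intro: tendsto_intros csubspace_add[OF assms])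
next
  fix c x assume "x \<in> closure D"
  then obtain X where "\<And>n. X n \<in> D" "X \<longlonglongrightarrow> x"
    unfolding closure_sequential by blast
  then show "c *\<^sub>C x \<in> closure D" unfolding closure_sequential
    by (intro exI[of _ "\<lambda>n. c *\<^sub>C X n"]) (auto intro!: tendsto_intros csubspace_scale[OF assms])
qed

section \<open>Finite orthonormal systems and Bessel's inequality\<close>

lemma norm_sum_orthonormal:
  assumes "finite I" "\<And>i j. i \<in> I \<Longrightarrow> j \<in> I \<Longrightarrow> cinner (e i) (e j) = (if i = j then 1 else 0)"
  shows "(norm (\<Sum>i\<in>I. c i *\<^sub>C (e i::'h::chilbert)))\<^sup>2 = (\<Sum>i\<in>I. (cmod (c i))\<^sup>2)"
proof -
  have "cinner (\<Sum>i\<in>I. c i *\<^sub>C e i) (\<Sum>j\<in>I. c j *\<^sub>C e j) = (\<Sum>i\<in>I. \<Sum>j\<in>I. cnj (c i) * c j * (if i = j then 1 else 0))"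
    by (simp add: cinner_lin sum_distrib_left mult.assoc assms(2) cong: sum.cong)
       (intro sum.cong refl, simp add: assms(2))
  also have "\<dots> = (\<Sum>i\<in>I. cnj (c i) * c i)"
    using assms(1) by (simp add: sum.delta if_distrib cong: if_cong)
  finally have "Re (cinner (\<Sum>i\<in>I. c i *\<^sub>C e i) (\<Sum>j\<in>I. c j *\<^sub>C e j)) = (\<Sum>i\<in>I. Re (cnj (c i) * c i))" by simp
  moreover have "Re (cnj z * z) = (cmod z)\<^sup>2" for z by (simp add: cmod_power2) (simp add: power2_eq_square)
  ultimately show ?thesis by (simp add: cinner_self_Re)
qed

text \<open>Pythagoras for the projection onto a finite orthonormal system. Bessel's inequality and
  the convergence of basis expansions both rest on this identity.\<close>

lemma norm_diff_orthonormal: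
  assumes "finite I" "\<And>i j. i \<in> I \<Longrightarrow> j \<in> I \<Longrightarrow> cinner (e i) (e j) = (if i = j then 1 else 0)"
  shows "(norm (x - (\<Sum>i\<in>I. cinner (e i) x *\<^sub>C (e i::'h::chilbert))))\<^sup>2 = (norm x)\<^sup>2 - (\<Sum>i\<in>I. (cmod (cinner (e i) x))\<^sup>2)"
proof -
  have "cinner x (\<Sum>i\<in>I. cinner (e i) x *\<^sub>C e i) = (\<Sum>i\<in>I. cnj (cinner (e i) x) * cinner (e i) x)"
    by (simp add: cinner_lin cinner_cnj mult.commute)
  then have "Re (cinner x (\<Sum>i\<in>I. cinner (e i) x *\<^sub>C e i)) = (\<Sum>i\<in>I. Re (cnj (cinner (e i) x) * cinner (e i) x))" by simp
  moreover have "Re (cnj z * z) = (cmod z)\<^sup>2" for z by (simp add: cmod_power2) (simp add: power2_eq_square)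
  ultimately show ?thesis
    by (simp add: norm_diff_sq norm_sum_orthonormal[OF assms])
qed

lemma bessel:
  assumes "finite I" "\<And>i j. i \<in> I \<Longrightarrow> j \<in> I \<Longrightarrow> cinner (e i) (e j) = (if i = j then 1 else 0)"
  shows "(\<Sum>i\<in>I. (cmod (cinner (e i) (x::'h::chilbert)))\<^sup>2) \<le> (norm x)\<^sup>2"
proof -
  have "0 \<le> (norm (x - (\<Sum>i\<in>I. cinner (e i) x *\<^sub>C e i)))\<^sup>2" by simp
  then show ?thesis using norm_diff_orthonormal[OF assms, of x] by linarith
qed

lemma orthonormal_famD:
  "orthonormal_fam n e \<Longrightarrow> i \<in> {..<n} \<Longrightarrow> j \<in> {..<n} \<Longrightarrow> cinner (e i) (e j) = (if i = j then 1 else 0)"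
  by (simp add: orthonormal_fam_def)

lemma orthonormal_fam_norm: "orthonormal_fam n e \<Longrightarrow> i < n \<Longrightarrow> norm (e i::'h::chilbert) = 1"
  using orthonormal_famD[of n e i i] cinner_self_Re[of "e i"] by (simp add: power2_eq_1_iff)
     (metis norm_ge_zero neg_0_le_iff_le not_one_le_zero)

lemma bessel_fam:
  "orthonormal_fam n e \<Longrightarrow> (\<Sum>i<n. (cmod (cinner (e i) (x::'h::chilbert)))\<^sup>2) \<le> (norm x)\<^sup>2"
  by (rule bessel) (auto simp: orthonormal_fam_def)

lemma sum_mult_le_sqrt:
  fixes a b :: "'i \<Rightarrow> real"
  shows "(\<Sum>i\<in>I. \<bar>a i\<bar> * \<bar>b i\<bar>) \<le> sqrt (\<Sum>i\<in>I. (a i)\<^sup>2) * sqrt (\<Sum>i\<in>I. (b i)\<^sup>2)"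
  using L2_set_mult_ineq[of a b I] by (simp add: L2_set_def)

text \<open>Cauchy-Schwarz for the sum followed by two Bessel inequalities. This is the trace norm
  bound for |x><y|, tested on an arbitrary pair of families.\<close>

lemma bessel_bilinear:
  assumes "orthonormal_fam n e" "orthonormal_fam n f"
  shows "(\<Sum>i<n. cmod (cinner (f i) (x::'h::chilbert)) * cmod (cinner y (e i))) \<le> norm x * norm y"
proof -
  have y: "cmod (cinner y (e i)) = cmod (cinner (e i) y)" for i
    by (metis cinner_commute complex_mod_cnj)
  have "(\<Sum>i<n. cmod (cinner (f i) x) * cmod (cinner y (e i)))
     \<le> sqrt (\<Sum>i<n. (cmod (cinner (f i) x))\<^sup>2) * sqrt (\<Sum>i<n. (cmod (cinner (e i) y))\<^sup>2)"
    using sum_mult_le_sqrt[of "\<lambda>i. cmod (cinner (f i) x)" "\<lambda>i. cmod (cinner (e i) y)" "{..<n}"] by (simp add: y)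
  also have "\<dots> \<le> sqrt ((norm x)\<^sup>2) * sqrt ((norm y)\<^sup>2)"
    by (intro mult_mono real_sqrt_le_mono bessel_fam assms) (auto intro: sum_nonneg)
  finally show ?thesis by simp
qed

text \<open>The minimal distance to a closed convex set is attained by the parallelogram law.\<close>
lemma ex_orthogonal_vector:
  assumes W: "csubspace W" and nd: "closure W \<noteq> (UNIV::'h::chilbert set)"
  shows "\<exists>\<zeta>. \<zeta> \<noteq> 0 \<and> (\<forall>w\<in>W. cinner w \<zeta> = 0)"
proof -
  obtain v where v: "v \<notin> closure W" using nd by auto
  define d where "d = infdist v W"
  have Wne: "W \<noteq> {}" using csubspace_0[OF W] by auto
  have dle: "d \<le> dist v w" if "w \<in> W" for w unfolding d_def by (rule infdist_le[OF that])
  have d0: "d \<ge> 0" unfolding d_def by (rule infdist_nonneg)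
  have "\<exists>w\<in>W. dist v w < d + 1 / Suc n" for n
  proof -
    have "infdist v W < d + 1 / Suc n" by (simp add: d_def)
    then show ?thesis using Wne unfolding infdist_def
      by (subst (asm) if_not_P) (auto simp: cInf_less_iff)
  qed
  then obtain w where w: "\<And>n. w n \<in> W" "\<And>n. dist v (w n) < d + 1 / Suc n" by metis
  \<comment> \<open>The midpoint of \<open>w m\<close> and \<open>w n\<close> lies in
    \<open>W\<close>, hence at distance at least \<open>d\<close> from \<open>v\<close>; this is
    where 4 d^2 comes from.\<close>
  have par: "(dist (w m) (w n))\<^sup>2 \<le> 2 * (dist v (w m))\<^sup>2 + 2 * (dist v (w n))\<^sup>2 - 4 * d\<^sup>2" for m n
  proof -
    let ?a = "v - w m" and ?b = "v - w n"
    have "(1/2) *\<^sub>R (w m + w n) \<in> W" by (intro csubspace_scaleR csubspace_add W w)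
    then have "d \<le> norm (v - (1/2) *\<^sub>R (w m + w n))" using dle by (simp add: dist_norm)
    also have "v - (1/2) *\<^sub>R (w m + w n) = (1/2) *\<^sub>R (?a + ?b)"
      by (simp add: algebra_simps flip: scaleR_add_left)
    finally have "2 * d \<le> norm (?a + ?b)" by simp
    then have "(2 * d)\<^sup>2 \<le> (norm (?a + ?b))\<^sup>2" using d0 by (intro power_mono) auto
    moreover have "(norm (?a + ?b))\<^sup>2 + (norm (?a - ?b))\<^sup>2 = 2 * (norm ?a)\<^sup>2 + 2 * (norm ?b)\<^sup>2"
      by (simp only: norm_add_sq norm_diff_sq) simp
    moreover have "norm (?a - ?b) = dist (w m) (w n)" by (simp add: dist_norm norm_minus_commute)
    ultimately show ?thesis by (simp add: dist_norm power_mult_distrib)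
  qed
  have lim: "(\<lambda>n. (dist v (w n))) \<longlonglongrightarrow> d"
  proof (rule tendsto_sandwich[of "\<lambda>_. d" _ _ "\<lambda>n. d + 1 / Suc n"])
    show "(\<lambda>n. d + 1 / real (Suc n)) \<longlonglongrightarrow> d"
      using tendsto_add[OF tendsto_const[of d] LIMSEQ_inverse_real_of_nat] by (simp add: inverse_eq_divide)
  qed (auto intro!: always_eventually less_imp_le[OF w(2)] dle w(1) simp del: of_nat_Suc)
  have "Cauchy w"
  proof (rule metric_CauchyI)
    fix e :: real assume e: "e > 0"
    have "(\<lambda>n. (dist v (w n))\<^sup>2) \<longlonglongrightarrow> d\<^sup>2" by (intro tendsto_intros lim)
    then have "\<forall>\<^sub>F n in sequentially. (dist v (w n))\<^sup>2 < d\<^sup>2 + e\<^sup>2 / 4"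
      by (rule order_tendstoD) (use e in auto)
    then obtain N where N: "\<And>n. n \<ge> N \<Longrightarrow> (dist v (w n))\<^sup>2 < d\<^sup>2 + e\<^sup>2 / 4"
      unfolding eventually_sequentially by auto
    have "dist (w m) (w n) < e" if "m \<ge> N" "n \<ge> N" for m n
    proof -
      have "(dist (w m) (w n))\<^sup>2 < e\<^sup>2"
        using par[of m n] N[OF that(1)] N[OF that(2)] by linarith
      then show ?thesis using e by (simp add: power2_less_imp_less)
    qed
    then show "\<exists>M. \<forall>m\<ge>M. \<forall>n\<ge>M. dist (w m) (w n) < e" by blast
  qed
  then obtain u where u: "w \<longlonglongrightarrow> u" using Cauchy_convergent convergent_def by blast
  have uc: "u \<in> closure W" using w u closure_sequential by blast
  have du: "dist v u = d"
    using LIMSEQ_unique[OF tendsto_dist[OF tendsto_const u] lim] .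
  define \<zeta> where "\<zeta> = v - u"
  have "\<zeta> \<noteq> 0" using uc v by (auto simp: \<zeta>_def)
  have orth: "cinner z \<zeta> = 0" if z: "z \<in> W" for z
  proof (rule ccontr)
    assume nz: "cinner z \<zeta> \<noteq> 0"
    then have z0: "norm z > 0" by auto
    \<comment> \<open>Coefficient of the projection of \<zeta> onto \<open>z\<close>. If it were
      nonzero, u + a z would be strictly closer to \<open>v\<close> than \<open>u\<close> is,
      although points of the closure of \<open>W\<close> stay at distance at least
      \<open>d\<close>.\<close>
    define a where "a = cinner z \<zeta> / of_real ((norm z)\<^sup>2)"
    have "u + a *\<^sub>C z \<in> closure W"
      by (intro csubspace_add csubspace_scale csubspace_closure W uc) (use z closure_subset in blast)
    then obtain X where X: "\<And>n. X n \<in> W" "X \<longlonglongrightarrow> u + a *\<^sub>C z" unfolding closure_sequential by blast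
    have "d \<le> dist v (u + a *\<^sub>C z)"
      by (rule LIMSEQ_le_const[OF tendsto_dist[OF tendsto_const X(2)]]) (use dle X in auto)
    also have "\<dots> = norm (\<zeta> - a *\<^sub>C z)" by (simp add: dist_norm \<zeta>_def algebra_simps)
    finally have "d\<^sup>2 \<le> (norm (\<zeta> - a *\<^sub>C z))\<^sup>2" using d0 by (intro power_mono)
    also have "\<dots> = (norm \<zeta>)\<^sup>2 - (cmod (cinner z \<zeta>))\<^sup>2 / (norm z)\<^sup>2"
      unfolding a_def by (rule norm_diff_proj) (use z0 in auto)
    also have "norm \<zeta> = d" using du by (simp add: \<zeta>_def dist_norm)
    finally have "(cmod (cinner z \<zeta>))\<^sup>2 / (norm z)\<^sup>2 \<le> 0" by simp
    then show False using nz z0 by (simp add: divide_simps)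
  qed
  then show ?thesis using \<open>\<zeta> \<noteq> 0\<close> by blast
qed

text \<open>The residual of \<open>v\<close> off the span of \<open>B\<close> is either zero, and
  \<open>B\<close> suffices, or normalizes to one further vector. Keeping \<open>B\<close> inside
  \<open>B'\<close> is what permits a union over countably many steps later.\<close>

lemma gram_schmidt_step:
  assumes D: "csubspace (D::'h::chilbert set)" and B: "finite B" "B \<subseteq> D" "orthonormal_set B" and v: "v \<in> D"
  shows "\<exists>B'. finite B' \<and> B' \<subseteq> D \<and> orthonormal_set B' \<and> B \<subseteq> B' \<and> v \<in> cspan B'"
proof -
  define p where "p = (\<Sum>b\<in>B. cinner b v *\<^sub>C b)"
  define w where "w = v - p"
  have pB: "p \<in> cspan B" unfolding p_def by (intro cspanI B order_refl)
  have onB: "cinner b c = (if b = c then 1 else 0)" if "b \<in> B" "c \<in> B" for b c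
    using that B(3) by (simp add: orthonormal_set_def)
  have orth: "cinner b w = 0" if "b \<in> B" for b
  proof -
    have "cinner b p = (\<Sum>c\<in>B. cinner c v * (if b = c then 1 else 0))"
      unfolding p_def by (simp add: cinner_lin onB that cong: sum.cong)
    also have "\<dots> = cinner b v" using B(1) that by (simp add: if_distrib cong: if_cong)
    finally show ?thesis by (simp add: w_def cinner_lin)
  qed
  show ?thesis
  proof (cases "w = 0")
    case True
    then have "v \<in> cspan B" using pB by (simp add: w_def)
    then show ?thesis using B by (intro exI[of _ B]) auto
  next
    case False
    define e where "e = (1 / norm w) *\<^sub>R w"
    have "p \<in> D" using cspan_subset[OF D B(2)] pB by blast
    then have eD: "e \<in> D" unfolding e_def w_def by (intro csubspace_scaleR csubspace_diff D v)
    have ee: "cinner e e = 1" using False by (simp add: cinner_self_norm e_def)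
    have be: "cinner b e = 0" "cinner e b = 0" if "b \<in> B" for b
      using orth[OF that] cinner_cnj[of b w] by (auto simp: e_def cinner_lin)
    have on: "orthonormal_set (insert e B)"
      unfolding orthonormal_set_def using ee be onB by (metis insertE zero_neq_one)
    have "e \<in> cspan (insert e B)" by (rule cspan_base) simp
    moreover have "p \<in> cspan (insert e B)" using pB cspan_mono[of B "insert e B"] by blast
    moreover have "v = norm w *\<^sub>R e + p" using False by (simp add: e_def w_def)
    ultimately have "v \<in> cspan (insert e B)"
      by (auto intro!: csubspace_add csubspace_scaleR csubspace_cspan)
    then show ?thesis using B eD on by (intro exI[of _ "insert e B"]) auto
  qed
qed

lemma gram_schmidt_finite:
  assumes D: "csubspace (D::'h::chilbert set)" and "finite S" "S \<subseteq> D"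
  shows "\<exists>B. finite B \<and> B \<subseteq> D \<and> orthonormal_set B \<and> S \<subseteq> cspan B"
  using assms(2,3)
proof (induction S)
  case empty
  then show ?case by (intro exI[of _ "{}"]) (auto simp: orthonormal_set_def)
next
  case (insert v S)
  then obtain B where B: "finite B" "B \<subseteq> D" "orthonormal_set B" "S \<subseteq> cspan B" by auto
  obtain B' where "finite B'" "B' \<subseteq> D" "orthonormal_set B'" "B \<subseteq> B'" "v \<in> cspan B'"
    using gram_schmidt_step[OF D B(1-3), of v] insert.prems by auto
  moreover have "cspan B \<subseteq> cspan B'" by (rule cspan_mono) fact
  ultimately show ?case using B(4) by (intro exI[of _ B']) auto
qed

section \<open>Expansions in orthonormal sets and bases\<close>

lemma orthonormal_setD:
  "orthonormal_set B \<Longrightarrow> i \<in> B \<Longrightarrow> j \<in> B \<Longrightarrow> cinner i j = (if i = j then 1 else 0)"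
  by (simp add: orthonormal_set_def)

lemma orthonormal_set_expansion:
  assumes B: "finite B" "orthonormal_set B" and v: "v \<in> cspan B"
  shows "(\<Sum>b\<in>B. cinner b v *\<^sub>C b) = (v::'h::chilbert)"
proof -
  obtain F c where F: "finite F" "F \<subseteq> B" and Fv: "v = (\<Sum>x\<in>F. c x *\<^sub>C x)"
    using v by (rule cspanE)
  have "cinner b v = (if b \<in> F then c b else 0)" if "b \<in> B" for b
  proof -
    have "cinner b v = (\<Sum>x\<in>F. c x * (if b = x then 1 else 0))"
      unfolding Fv cinner_sum_right cinner_scaleC_right
      by (intro sum.cong refl) (use that F orthonormal_setD[OF B(2)] in auto)
    then show ?thesis using F(1) by (simp add: if_distrib cong: if_cong)
  qed
  then have "(\<Sum>b\<in>B. cinner b v *\<^sub>C b) = (\<Sum>b\<in>B. (if b \<in> F then c b else 0) *\<^sub>C b)" by simp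
  also have "\<dots> = v" unfolding Fv
    by (rule sum.mono_neutral_cong_right) (use B F in auto)
  finally show ?thesis .
qed

text \<open>Once a finite \<open>F\<close> supports an approximant \<open>y\<close> of
  \<open>x\<close>, every larger finite \<open>Y\<close> does at least as well: projecting onto the
  span of \<open>Y\<close> fixes \<open>y\<close>, and passing to the residual does not increase the
  norm of x - y.\<close>

lemma onb_expansion:
  assumes B: "is_onb (B::'h::chilbert set)"
  shows "((\<lambda>b. cinner b x *\<^sub>C b) has_sum x) B"
  unfolding has_sum_def tendsto_iff eventually_finite_subsets_at_top
proof (intro allI impI)
  fix e :: real assume e: "e > 0"
  have on: "orthonormal_set B" using B by (simp add: is_onb_def)
  have "x \<in> closure (cspan B)" using B by (simp add: is_onb_def)
  then obtain y where y: "y \<in> cspan B" "dist y x < e"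
    using e closure_approachable by blast
  obtain F c where F: "finite F" "F \<subseteq> B" and Fy: "y = (\<Sum>b\<in>F. c b *\<^sub>C b)"
    using y(1) by (rule cspanE)
  show "\<exists>X. finite X \<and> X \<subseteq> B \<and> (\<forall>Y. finite Y \<and> X \<subseteq> Y \<and> Y \<subseteq> B \<longrightarrow> dist (\<Sum>b\<in>Y. cinner b x *\<^sub>C b) x < e)"
  proof (intro exI[of _ F] conjI allI impI)
    fix Y assume Y: "finite Y \<and> F \<subseteq> Y \<and> Y \<subseteq> B"
    then have onY: "orthonormal_set Y" using on unfolding orthonormal_set_def by (meson subsetD)
    have ort: "cinner i j = (if i = j then 1 else 0)" if "i \<in> Y" "j \<in> Y" for i j
      using orthonormal_setD[OF onY that] .
    have yY: "y \<in> cspan Y" unfolding Fy using Y F by (intro csubspace_sum csubspace_cspan csubspace_scale cspan_base) (use Y F in blast)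
    let ?p = "\<lambda>z. \<Sum>b\<in>Y. cinner b z *\<^sub>C b"
    have "?p y = y" using orthonormal_set_expansion[OF _ onY yY] Y by blast
    then have "x - ?p x = (x - y) - ?p (x - y)"
      by (simp add: cinner_diff_right scaleC_diff_left sum_subtractf)
    also have "(norm \<dots>)\<^sup>2 = (norm (x - y))\<^sup>2 - (\<Sum>b\<in>Y. (cmod (cinner b (x - y)))\<^sup>2)"
      by (rule norm_diff_orthonormal) (use Y ort in auto)
    also have "\<dots> \<le> (norm (x - y))\<^sup>2" by (simp add: sum_nonneg)
    finally have "norm (x - ?p x) \<le> norm (x - y)" by (rule power2_le_imp_le) simp
    then show "dist (?p x) x < e" using y(2) by (simp add: dist_norm norm_minus_commute)
  qed (use F in auto)
qed

lemma onb_parseval: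
  assumes B: "is_onb (B::'h::chilbert set)"
  shows "((\<lambda>b. cinner y b * cinner b x) has_sum cinner y x) B"
proof -
  have "((\<lambda>b. cinner y (cinner b x *\<^sub>C b)) has_sum cinner y x) B"
    using has_sum_bounded_linear[OF bounded_bilinear.bounded_linear_right[OF bounded_bilinear_cinner] onb_expansion[OF B, of x], of y]
    by simp
  then show ?thesis by (simp add: cinner_scaleC_right mult.commute)
qed

text \<open>Mutually orthogonal families can be tested together, which makes lower bounds of the
  trace norm additive.\<close>

lemma orthonormal_fam_append:
  assumes e: "orthonormal_fam n e" and f: "orthonormal_fam m f"
    and ef: "\<And>i j. i < n \<Longrightarrow> j < m \<Longrightarrow> cinner (e i) (f j) = 0"
  shows "orthonormal_fam (n + m) (\<lambda>i. if i < n then e i else f (i - n))"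
  unfolding orthonormal_fam_def
proof (intro allI impI)
  fix i j assume ij: "i < n + m" "j < n + m"
  have fe: "cinner (f a) (e b) = 0" if "a < m" "b < n" for a b
    using ef[OF that(2,1)] cinner_commute[of "f a" "e b"] by simp
  consider "i < n" "j < n" | "i < n" "\<not> j < n" | "\<not> i < n" "j < n" | "\<not> i < n" "\<not> j < n" by blast
  then show "cinner (if i < n then e i else f (i - n)) (if j < n then e j else f (j - n)) = (if i = j then 1 else 0)"
  proof cases
    case 1 then show ?thesis using e by (simp add: orthonormal_fam_def)
  next
    case 2 then show ?thesis using ef[of i "j - n"] ij by auto
  next
    case 3 then show ?thesis using fe[of "i - n" j] ij by auto
  next
    case 4
    then have "i - n < m" "j - n < m" "i - n = j - n \<longleftrightarrow> i = j" using ij by auto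
    then show ?thesis using f 4 by (simp add: orthonormal_fam_def)
  qed
qed

lemma orthonormal_fam_Suc:
  assumes "orthonormal_fam m e" "cinner g g = 1" "\<And>i. i < m \<Longrightarrow> cinner g (e i) = 0"
  shows "orthonormal_fam (Suc m) (\<lambda>i. if i < m then e i else g)"
proof -
  have "cinner (e i) g = 0" if "i < m" for i
    using assms(3)[OF that] cinner_commute[of "e i" g] by simp
  then have "orthonormal_fam (m + 1) (\<lambda>i. if i < m then e i else (\<lambda>_. g) (i - m))"
    using assms by (intro orthonormal_fam_append) (auto simp: orthonormal_fam_def)
  then show ?thesis by simp
qed

section \<open>Singular values of finite rank operators\<close>

text \<open>The finite rank operator that is the sum of the |x j><y j|, as a plain function. Its
  singular values are found at this level, ahead of any trace class structure; exchanging the two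
  families gives the adjoint.\<close>

definition rank_sum :: "nat \<Rightarrow> (nat \<Rightarrow> 'h::chilbert) \<Rightarrow> (nat \<Rightarrow> 'h) \<Rightarrow> 'h \<Rightarrow> 'h" where
  "rank_sum n x y = (\<lambda>v. \<Sum>j<n. cinner (y j) v *\<^sub>C x j)"

lemma rank_sum_adjoint: "cinner u (rank_sum n x y v) = cinner (rank_sum n y x u) v"
  unfolding rank_sum_def
  by (simp add: cinner_lin) (intro sum.cong refl, metis cinner_commute mult.commute)

lemma rank_sum_scaleC: "rank_sum n x y (c *\<^sub>C v) = c *\<^sub>C rank_sum n x y v"
  unfolding rank_sum_def by (simp add: cinner_lin scaleC_sum_right)

lemma rank_sum_diff: "rank_sum n x y (u - v) = rank_sum n x y u - rank_sum n x y v"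
  unfolding rank_sum_def by (simp add: cinner_lin scaleC_diff_left sum_subtractf)

lemma rank_sum_in_cspan: "rank_sum n x y v \<in> cspan (x ` {..<n})"
  unfolding rank_sum_def
  by (intro csubspace_sum csubspace_cspan csubspace_scale cspan_base) simp

lemma rank_sum_bound: "norm (rank_sum n x y v) \<le> (\<Sum>j<n. norm (y j) * norm (x j)) * norm v"
  unfolding rank_sum_def sum_distrib_right
proof (rule sum_norm_le)
  fix i
  have "norm (cinner (y i) v *\<^sub>C x i) = cmod (cinner (y i) v) * norm (x i)" by simp
  also have "\<dots> \<le> (norm (y i) * norm v) * norm (x i)"
    by (intro mult_right_mono cinner_cauchy_schwarz) simp
  finally show "norm (cinner (y i) v *\<^sub>C x i) \<le> norm (y i) * norm (x i) * norm v"
    by (simp add: mult_ac)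
qed

text \<open>Bolzano-Weierstrass one coordinate at a time, passing to a further subsequence each
  time. A bounded sequence of vectors need not have a convergent subsequence, but finitely many of
  its coordinates do.\<close>

lemma simultaneous_subsequence:
  fixes c :: "nat \<Rightarrow> nat \<Rightarrow> complex"
  assumes "\<And>j. j < n \<Longrightarrow> bounded (range (c j))"
  shows "\<exists>r::nat \<Rightarrow> nat. strict_mono r \<and> (\<forall>j<n. convergent (\<lambda>m. c j (r m)))"
  using assms
proof (induction n)
  case 0
  then show ?case by (intro exI[of _ id]) (auto simp: strict_mono_def)
next
  case (Suc n)
  then obtain r where r: "strict_mono (r::nat \<Rightarrow> nat)" "\<And>j. j < n \<Longrightarrow> convergent (\<lambda>m. c j (r m))" by auto
  have "bounded (range (\<lambda>m. c n (r m)))"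
    by (rule bounded_subset[OF Suc.prems[of n]]) auto
  then obtain l s where s: "strict_mono (s::nat \<Rightarrow> nat)" "((\<lambda>m. c n (r m)) \<circ> s) \<longlonglongrightarrow> l"
    using bounded_imp_convergent_subsequence by blast
  have "convergent (\<lambda>m. c j ((r \<circ> s) m))" if "j < Suc n" for j
  proof (cases "j = n")
    case True
    then show ?thesis using s(2) by (auto simp: convergent_def o_def)
  next
    case False
    then have "convergent ((\<lambda>m. c j (r m)) \<circ> s)"
      using r(2)[of j] that s(1) by (intro convergent_subseq_convergent) auto
    then show ?thesis by (simp add: o_def)
  qed
  then show ?case using strict_mono_o[OF r(1) s(1)] by blast
qed

text \<open>Along a maximizing sequence the finitely many coordinates \<open>cinner (y j) v\<close> converge, hence so
  do the images \<open>A v\<close> and then, via \<open>A* A v - s\<^sup>2 v \<longlonglongrightarrow> 0\<close>, the vectors themselves.\<close>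
lemma ex_maximal_singular_vector:
  fixes x y :: "nat \<Rightarrow> 'h::chilbert"
  assumes nz: "rank_sum n x y \<noteq> (\<lambda>_. 0)"
  shows "\<exists>s g h. s > 0 \<and> norm g = 1 \<and> norm h = 1 \<and> rank_sum n x y h = s *\<^sub>R g \<and> rank_sum n y x g = s *\<^sub>R h"
proof -
  let ?A = "rank_sum n x y" and ?At = "rank_sum n y x"
  let ?S = "(\<lambda>v. norm (?A v)) ` {v. norm v \<le> 1}"
  define s where "s = Sup ?S"
  have bdd: "bdd_above ?S"
  proof (rule bdd_aboveI2)
    fix v :: 'h assume "v \<in> {v. norm v \<le> 1}"
    then have "(\<Sum>j<n. norm (y j) * norm (x j)) * norm v \<le> (\<Sum>j<n. norm (y j) * norm (x j)) * 1"
      by (intro mult_left_mono sum_nonneg) auto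
    then show "norm (?A v) \<le> (\<Sum>j<n. norm (y j) * norm (x j))"
      using rank_sum_bound[of n x y v] by simp
  qed
  have le_s: "norm (?A v) \<le> s * norm v" for v
  proof (cases "v = 0")
    case True
    then show ?thesis using rank_sum_bound[of n x y 0] by simp
  next
    case False
    have "norm (?A (complex_of_real (1 / norm v) *\<^sub>C v)) \<le> s"
      unfolding s_def using False by (intro cSup_upper bdd imageI) (simp add: norm_divide)
    then show ?thesis using False by (simp add: rank_sum_scaleC norm_divide divide_le_eq)
  qed
  obtain v0 where v0: "?A v0 \<noteq> 0" using nz by auto
  then have "0 < s * norm v0" using le_s[of v0] by (meson less_le_trans zero_less_norm_iff)
  then have s0: "s > 0" by (metis norm_not_less_zero zero_less_mult_iff)
  have "\<exists>v. norm v \<le> 1 \<and> s - 1 / Suc m < norm (?A v)" for m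
  proof -
    have "s - 1 / Suc m < Sup ?S" by (simp add: s_def)
    then obtain w where "w \<in> ?S" "s - 1 / Suc m < w"
      by (rule less_cSupE[where X = ?S]) (auto intro: exI[of _ 0])
    then show ?thesis by auto
  qed
  then obtain w where w: "\<And>m. norm (w m) \<le> 1" "\<And>m. s - 1 / Suc m < norm (?A (w m))" by metis
  have "bounded (range (\<lambda>m. cinner (y j) (w m)))" for j
  proof (rule boundedI)
    fix z assume "z \<in> range (\<lambda>m. cinner (y j) (w m))"
    then obtain m where "z = cinner (y j) (w m)" by auto
    then show "norm z \<le> norm (y j) * 1"
      using cinner_cauchy_schwarz[of "y j" "w m"] mult_left_mono[OF w(1)[of m] norm_ge_zero[of "y j"]] by simp
  qed
  then obtain r where r: "strict_mono (r::nat \<Rightarrow> nat)" "\<And>j. j < n \<Longrightarrow> convergent (\<lambda>m. cinner (y j) (w (r m)))"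
    using simultaneous_subsequence[of n "\<lambda>j m. cinner (y j) (w m)"] by blast
  then obtain l where l: "\<And>j. j < n \<Longrightarrow> (\<lambda>m. cinner (y j) (w (r m))) \<longlonglongrightarrow> l j"
    unfolding convergent_def by metis
  define u where "u = (\<Sum>j<n. l j *\<^sub>C x j)"
  have Aw: "(\<lambda>m. ?A (w (r m))) \<longlonglongrightarrow> u"
    unfolding rank_sum_def u_def by (intro tendsto_intros l) auto
  have "(\<lambda>m. norm (?A (w (r m)))) \<longlonglongrightarrow> s"
  proof (rule tendsto_sandwich[of "\<lambda>m. s - 1 / Suc (r m)" _ _ "\<lambda>m. s"])
    have "(\<lambda>m. s - 1 / real (Suc m)) \<longlonglongrightarrow> s"
      using tendsto_diff[OF tendsto_const[of s] LIMSEQ_inverse_real_of_nat] by (simp add: inverse_eq_divide)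
    then show "(\<lambda>m. s - 1 / real (Suc (r m))) \<longlonglongrightarrow> s"
      using LIMSEQ_subseq_LIMSEQ[OF _ r(1)] by (force simp: o_def)
    show "\<forall>\<^sub>F m in sequentially. s - 1 / real (Suc (r m)) \<le> norm (?A (w (r m)))"
      by (intro always_eventually allI less_imp_le w)
    have "norm (?A (w m)) \<le> s" for m
      using le_s[of "w m"] mult_left_mono[OF w(1)[of m] less_imp_le[OF s0]] by simp
    then show "\<forall>\<^sub>F m in sequentially. norm (?A (w (r m))) \<le> s" by simp
  qed simp
  then have nA: "(\<lambda>m. norm (?A (w (r m)))) \<longlonglongrightarrow> s" .
  have nu: "norm u = s" using LIMSEQ_unique[OF tendsto_norm[OF Aw] nA] .
  have AtA: "(\<lambda>m. ?At (?A (w (r m)))) \<longlonglongrightarrow> ?At u"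
    unfolding rank_sum_def[of n y x] by (intro tendsto_intros Aw)
  \<comment> \<open>Expanding the square gives the cross term s^2 |A v|^2, so the bound tends to
    zero when the norm of \<open>A v\<close> tends to \<open>s\<close>.\<close>
  have est: "(norm (?At (?A v) - s\<^sup>2 *\<^sub>R v))\<^sup>2 \<le> 2 * (s\<^sup>2 * s\<^sup>2) - 2 * s\<^sup>2 * (norm (?A v))\<^sup>2" if v: "norm v \<le> 1" for v
  proof -
    have nAv: "norm (?A v) \<le> s" using le_s[of v] mult_left_mono[OF v less_imp_le[OF s0]] by simp
    \<comment> \<open>The bound \<open>s\<close> is known for \<open>A\<close> only; the adjoint
      relation transfers it to the adjoint applied to \<open>A v\<close>.\<close>
    have "(norm (?At (?A v)))\<^sup>2 = Re (cinner (?A v) (?A (?At (?A v))))"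
      by (simp add: cinner_self_Re[symmetric] rank_sum_adjoint)
    also have "\<dots> \<le> norm (?A v) * norm (?A (?At (?A v)))"
      using cinner_cauchy_schwarz complex_Re_le_cmod order_trans by blast
    also have "\<dots> \<le> s * (s * norm (?At (?A v)))"
      by (intro mult_mono nAv le_s) (use s0 in auto)
    finally have "(norm (?At (?A v)))\<^sup>2 \<le> s\<^sup>2 * norm (?At (?A v))" by (simp add: power2_eq_square)
    then have n1: "norm (?At (?A v)) \<le> s\<^sup>2"
      by (cases "norm (?At (?A v)) = 0") (auto simp: power2_eq_square[of "norm _"])
    then have "(norm (?At (?A v)))\<^sup>2 \<le> s\<^sup>2 * s\<^sup>2" using power_mono[OF n1, of 2] by (simp add: power2_eq_square[of "s\<^sup>2"])
    moreover have "(norm (s\<^sup>2 *\<^sub>R v))\<^sup>2 \<le> s\<^sup>2 * s\<^sup>2"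
    proof -
      have "norm (s\<^sup>2 *\<^sub>R v) \<le> s\<^sup>2" using mult_left_mono[OF v, of "s\<^sup>2"] by simp
      from power_mono[OF this, of 2] show ?thesis by (simp add: power2_eq_square[of "s\<^sup>2"])
    qed
    moreover have "Re (cinner (?At (?A v)) (s\<^sup>2 *\<^sub>R v)) = s\<^sup>2 * (norm (?A v))\<^sup>2"
      by (simp only: cinner_scaleR_right rank_sum_adjoint[symmetric] cinner_self_norm of_real_mult[symmetric] Re_complex_of_real)
    ultimately show ?thesis by (simp add: norm_diff_sq)
  qed
  have "(\<lambda>m. 2 * (s\<^sup>2 * s\<^sup>2) - 2 * s\<^sup>2 * (norm (?A (w (r m))))\<^sup>2) \<longlonglongrightarrow> 2 * (s\<^sup>2 * s\<^sup>2) - 2 * s\<^sup>2 * s\<^sup>2"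
    by (intro tendsto_intros nA)
  then have up: "(\<lambda>m. 2 * (s\<^sup>2 * s\<^sup>2) - 2 * s\<^sup>2 * (norm (?A (w (r m))))\<^sup>2) \<longlonglongrightarrow> 0"
    by (simp only: mult.assoc diff_self)
  have "(\<lambda>m. (norm (?At (?A (w (r m))) - s\<^sup>2 *\<^sub>R w (r m)))\<^sup>2) \<longlonglongrightarrow> 0"
    by (rule tendsto_sandwich[OF _ _ tendsto_const[of 0] up]; intro always_eventually allI zero_le_power2 est w(1))
  then have "(\<lambda>m. ?At (?A (w (r m))) - s\<^sup>2 *\<^sub>R w (r m)) \<longlonglongrightarrow> 0"
    by (simp add: tendsto_norm_zero_iff)
  from tendsto_diff[OF AtA this] have "(\<lambda>m. s\<^sup>2 *\<^sub>R w (r m)) \<longlonglongrightarrow> ?At u" by simp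
  from tendsto_scaleR[OF tendsto_const[of "1 / s\<^sup>2"] this] s0
  have wlim: "(\<lambda>m. w (r m)) \<longlonglongrightarrow> (1 / s\<^sup>2) *\<^sub>R ?At u" by simp
  define h where "h = (1 / s\<^sup>2) *\<^sub>R ?At u"
  define g where "g = (1 / s) *\<^sub>R u"
  have "(\<lambda>m. ?A (w (r m))) \<longlonglongrightarrow> ?A h"
    unfolding rank_sum_def[of n x y] h_def by (intro tendsto_intros wlim)
  then have Ah: "?A h = u" using Aw LIMSEQ_unique by blast
  have "norm h \<le> 1" unfolding h_def
    by (rule LIMSEQ_le_const2[OF tendsto_norm[OF wlim]]) (use w in auto)
  moreover have "s \<le> s * norm h" using le_s[of h] nu Ah by simp
  ultimately have nh: "norm h = 1" using s0 by simp
  have ng: "norm g = 1" using nu s0 by (simp add: g_def)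
  have "?A h = s *\<^sub>R g" using Ah s0 by (simp add: g_def)
  moreover have "?At g = s *\<^sub>R h"
    using s0 by (simp add: g_def h_def scaleR_scaleC rank_sum_scaleC power2_eq_square)
  ultimately show ?thesis using s0 nh ng by blast
qed

text \<open>After splitting off the leading singular pair, the projections of the \<open>y j\<close> onto the complement
  of \<open>h\<close> are linearly dependent, which makes one of the rank-one terms superfluous.\<close>
lemma singular_value_decomposition:
  fixes x y :: "nat \<Rightarrow> 'h::chilbert"
  shows "\<exists>m s g h. orthonormal_fam m g \<and> orthonormal_fam m h \<and> (\<forall>i<m. s i > (0::real)) \<and>
      (\<forall>i<m. g i \<in> range (rank_sum n x y)) \<and> (\<forall>i<m. h i \<in> cspan (y ` {..<n})) \<and>
      rank_sum n x y = (\<lambda>v. \<Sum>i<m. s i *\<^sub>R (cinner (h i) v *\<^sub>C g i))"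
proof (induction n arbitrary: x y)
  case 0
  show ?case by (intro exI[of _ 0]) (auto simp: orthonormal_fam_def rank_sum_def)
next
  case (Suc n)
  let ?A = "rank_sum (Suc n) x y" and ?At = "rank_sum (Suc n) y x"
  show ?case
  proof (cases "?A = (\<lambda>_. 0)")
    case True
    then show ?thesis by (intro exI[of _ 0]) (auto simp: orthonormal_fam_def)
  next
    case False
    then obtain s g h where sgh: "s > 0" "norm g = 1" "norm h = 1" "?A h = s *\<^sub>R g" "?At g = s *\<^sub>R h"
      using ex_maximal_singular_vector by blast
    have hh: "cinner h h = 1" and gg: "cinner g g = 1" using sgh by (simp_all add: cinner_self_norm)
    define y' where "y' j = y j - cinner h (y j) *\<^sub>C h" for j
    have hy': "cinner h (y' j) = 0" for j by (simp add: y'_def cinner_lin hh)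
    \<comment> \<open>Coefficients of \<open>h\<close> in terms of the \<open>y j\<close>, read off
      from the adjoint relation for \<open>g\<close>. Projecting off \<open>h\<close> turns this
      expansion into a linear relation among the \<open>y' j\<close>.\<close>
    define a where "a j = cinner (x j) g / of_real s" for j
    have h_eq: "h = (\<Sum>j<Suc n. a j *\<^sub>C y j)"
    proof -
      have "h = (1 / s) *\<^sub>R ?At g" using sgh by simp
      also have "\<dots> = (\<Sum>j<Suc n. a j *\<^sub>C y j)"
        unfolding rank_sum_def scaleR_scaleC scaleC_sum_right by (simp add: a_def)
      finally show ?thesis .
    qed
    have rel: "(\<Sum>j<Suc n. a j *\<^sub>C y' j) = 0"
    proof -
      have "(\<Sum>j<Suc n. a j *\<^sub>C y' j) = (\<Sum>j<Suc n. a j *\<^sub>C y j) - (\<Sum>j<Suc n. a j * cinner h (y j)) *\<^sub>C h"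
        by (simp only: y'_def scaleC_diff_right sum_subtractf scaleC_sum_left scaleC_scaleC)
      also have "(\<Sum>j<Suc n. a j * cinner h (y j)) = cinner h (\<Sum>j<Suc n. a j *\<^sub>C y j)"
        by (simp only: cinner_sum_right cinner_scaleC_right)
      finally show ?thesis unfolding h_eq[symmetric] hh by simp
    qed
    have h_ne: "h \<noteq> 0" using sgh(3) by auto
    have "\<exists>k<Suc n. a k \<noteq> 0"
    proof (rule ccontr)
      assume "\<not> (\<exists>k<Suc n. a k \<noteq> 0)"
      then have "h = 0" by (subst h_eq) (simp del: sum.lessThan_Suc)
      then show False using h_ne by simp
    qed
    then obtain k where k: "k < Suc n" "a k \<noteq> 0" by blast
    define \<pi> where "\<pi> j = (if j < k then j else Suc j)" for j
    have \<pi>: "bij_betw \<pi> {..<n} ({..<Suc n} - {k})"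
      unfolding bij_betw_def
    proof
      show "inj_on \<pi> {..<n}" by (auto simp: inj_on_def \<pi>_def split: if_splits)
      show "\<pi> ` {..<n} = {..<Suc n} - {k}"
      proof (intro set_eqI iffI)
        fix j assume j: "j \<in> {..<Suc n} - {k}"
        show "j \<in> \<pi> ` {..<n}"
        proof (cases "j < k")
          case True then show ?thesis using k by (intro image_eqI[of _ _ j]) (auto simp: \<pi>_def)
        next
          case False then show ?thesis using j k by (intro image_eqI[of _ _ "j - 1"]) (auto simp: \<pi>_def)
        qed
      qed (use k in \<open>auto simp: \<pi>_def split: if_splits\<close>)
    qed
    have split: "(\<Sum>j<Suc n. f j) = f k + (\<Sum>j<n. f (\<pi> j))" for f :: "nat \<Rightarrow> 'h"
      using k by (subst sum.remove[of _ k]) (auto simp: sum.reindex_bij_betw[OF \<pi>] simp del: sum.lessThan_Suc)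
    define b where "b j = - (a j / a k)" for j
    have yk: "y' k = (\<Sum>j<n. b (\<pi> j) *\<^sub>C y' (\<pi> j))"
    proof -
      have "a k *\<^sub>C y' k = - (\<Sum>j<n. a (\<pi> j) *\<^sub>C y' (\<pi> j))"
        using rel unfolding split by (simp add: eq_neg_iff_add_eq_0)
      then have "(1 / a k) *\<^sub>C a k *\<^sub>C y' k = (1 / a k) *\<^sub>C (- (\<Sum>j<n. a (\<pi> j) *\<^sub>C y' (\<pi> j)))" by simp
      then show ?thesis using k by (simp add: scaleC_sum_right b_def sum_negf)
    qed
    \<comment> \<open>Eliminating \<open>y' k\<close> by the relation moves its coefficients,
      conjugated because \<open>cinner\<close> is antilinear on the left, onto the vectors
      \<open>x\<close>.\<close>
    define X where "X j = x (\<pi> j) + cnj (b (\<pi> j)) *\<^sub>C x k" for j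
    define Y where "Y j = y' (\<pi> j)" for j
    have A': "rank_sum n X Y v = ?A v - cinner h v *\<^sub>C (s *\<^sub>R g)" for v
    proof -
      have "?A v - cinner h v *\<^sub>C (s *\<^sub>R g) = ?A (v - cinner h v *\<^sub>C h)"
        by (simp add: rank_sum_diff rank_sum_scaleC sgh(4))
      also have "\<dots> = (\<Sum>j<Suc n. cinner (y' j) v *\<^sub>C x j)"
        unfolding rank_sum_def y'_def
        by (intro sum.cong refl) (simp add: cinner_lin cinner_cnj mult.commute)
      also have "\<dots> = cinner (y' k) v *\<^sub>C x k + (\<Sum>j<n. cinner (Y j) v *\<^sub>C x (\<pi> j))"
        unfolding split Y_def ..
      also have "cinner (y' k) v = (\<Sum>j<n. cnj (b (\<pi> j)) * cinner (Y j) v)"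
        by (subst yk) (simp add: cinner_lin Y_def)
      also have "\<dots> *\<^sub>C x k + (\<Sum>j<n. cinner (Y j) v *\<^sub>C x (\<pi> j)) = rank_sum n X Y v"
        unfolding rank_sum_def X_def
        by (simp add: scaleC_add_right scaleC_sum_left sum.distrib mult.commute add.commute)
      finally show ?thesis ..
    qed
    obtain m s' g' h' where IH: "orthonormal_fam m g'" "orthonormal_fam m h'" "\<forall>i<m. s' i > (0::real)"
      "\<forall>i<m. g' i \<in> range (rank_sum n X Y)" "\<forall>i<m. h' i \<in> cspan (Y ` {..<n})"
      "rank_sum n X Y = (\<lambda>v. \<Sum>i<m. s' i *\<^sub>R (cinner (h' i) v *\<^sub>C g' i))"
      using Suc.IH[of X Y] by blast
    have hspan: "h \<in> cspan (y ` {..<Suc n})"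
      unfolding h_eq by (intro csubspace_sum csubspace_cspan csubspace_scale cspan_base) simp
    have gh': "cinner h (h' i) = 0" if "i < m" for i
    proof -
      have "csubspace {v. cinner h v = 0}" by (auto simp: csubspace_def cinner_lin)
      then have "cspan (Y ` {..<n}) \<subseteq> {v. cinner h v = 0}"
        by (rule cspan_subset) (auto simp: Y_def hy')
      then show ?thesis using IH(5) that by blast
    qed
    \<comment> \<open>The reduced operator subtracts from \<open>A v\<close> exactly its component
      along \<open>g\<close>, since <g, A v> = s <h, v>.\<close>
    have gg': "cinner g (g' i) = 0" if "i < m" for i
    proof -
      have "g' i \<in> range (rank_sum n X Y)" using IH(4) that by simp
      then obtain v where "g' i = rank_sum n X Y v" by (rule rangeE)
      then have v: "g' i = ?A v - cinner h v *\<^sub>C (s *\<^sub>R g)" unfolding A' .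
      have "cinner g (?A v) = cinner (s *\<^sub>R h) v" by (simp add: rank_sum_adjoint sgh(5))
      then show ?thesis by (simp add: v cinner_lin gg)
    qed
    have h'span: "h' i \<in> cspan (y ` {..<Suc n})" if "i < m" for i
    proof -
      have "Y ` {..<n} \<subseteq> cspan (y ` {..<Suc n})"
      proof
        fix z assume "z \<in> Y ` {..<n}"
        then obtain j where j: "j < n" "z = y' (\<pi> j)" by (auto simp: Y_def)
        have "\<pi> j < Suc n" using j(1) by (auto simp: \<pi>_def)
        then have "y (\<pi> j) \<in> cspan (y ` {..<Suc n})" by (intro cspan_base) simp
        then show "z \<in> cspan (y ` {..<Suc n})" unfolding j(2) y'_def
          by (intro csubspace_diff csubspace_scale csubspace_cspan hspan)
      qed
      then show ?thesis using cspan_subset[OF csubspace_cspan] IH(5) that by blast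
    qed
    have g'range: "g' i \<in> range ?A" if "i < m" for i
    proof -
      have "g' i \<in> range (rank_sum n X Y)" using IH(4) that by simp
      then obtain v where "g' i = rank_sum n X Y v" by (rule rangeE)
      then have v: "g' i = ?A v - cinner h v *\<^sub>C (s *\<^sub>R g)" unfolding A' .
      have "g' i = ?A (v - cinner h v *\<^sub>C h)"
        by (simp add: v rank_sum_diff rank_sum_scaleC sgh(4))
      then show ?thesis by blast
    qed
    have grange: "g \<in> range ?A"
    proof (rule image_eqI)
      show "g = ?A (complex_of_real (1 / s) *\<^sub>C h)"
        using sgh(1) by (simp add: rank_sum_scaleC sgh(4) scaleR_scaleC)
    qed simp
    define S where "S i = (if i < m then s' i else s)" for i
    define G where "G i = (if i < m then g' i else g)" for i
    define H where "H i = (if i < m then h' i else h)" for i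
    have "orthonormal_fam (Suc m) G" unfolding G_def
      by (rule orthonormal_fam_Suc[OF IH(1) gg gg'])
    moreover have "orthonormal_fam (Suc m) H" unfolding H_def
      by (rule orthonormal_fam_Suc[OF IH(2) hh gh'])
    moreover have "?A v = (\<Sum>i<Suc m. S i *\<^sub>R (cinner (H i) v *\<^sub>C G i))" for v
      using A'[of v] fun_cong[OF IH(6), of v]
      by (simp add: S_def G_def H_def scaleR_scaleC mult.commute algebra_simps)
    moreover have "\<forall>i<Suc m. S i > 0" using IH(3) sgh(1) by (simp add: S_def)
    moreover have "\<forall>i<Suc m. G i \<in> range ?A" using g'range grange by (simp add: G_def)
    moreover have "\<forall>i<Suc m. H i \<in> cspan (y ` {..<Suc n})" using h'span hspan by (simp add: H_def)
    ultimately show ?thesis by blast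
  qed
qed

section \<open>The Banach space of trace class operators\<close>

lemma clinear_add: "clinear f \<Longrightarrow> f (x + y) = f x + f y"
  and clinear_scaleC: "clinear f \<Longrightarrow> f (c *\<^sub>C x) = c *\<^sub>C f x"
  by (auto simp: clinear_def)

lemma clinear_0: "clinear f \<Longrightarrow> f 0 = 0"
  using clinear_scaleC[of f 0 0] by simp

lemma clinear_minus: "clinear f \<Longrightarrow> f (- x) = - f x"
  using clinear_scaleC[of f "-1" x] by simp

lemma clinear_diff: "clinear f \<Longrightarrow> f (x - y) = f x - f y"
  using clinear_add[of f x "- y"] by (simp add: clinear_minus)

lemma clinear_sum: "clinear f \<Longrightarrow> f (\<Sum>i\<in>I. g i) = (\<Sum>i\<in>I. f (g i))"
  by (induction I rule: infinite_finite_induct) (auto simp: clinear_0 clinear_add)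

lemma clinear_scaleR: "clinear f \<Longrightarrow> f (r *\<^sub>R x) = r *\<^sub>R f x"
  by (simp add: scaleR_scaleC clinear_scaleC)

lemma tn_set_memI: "orthonormal_fam n e \<Longrightarrow> orthonormal_fam n f \<Longrightarrow>
    (\<Sum>k<n. cmod (cinner (f k) (A (e k)))) \<in> tn_set A"
  unfolding tn_set_def by blast

text \<open>The empty families (\<open>n = 0\<close>) contribute the empty sum, so the supremum is
  never taken over the empty set, not even in the zero space.\<close>

lemma tn_set_zero: "0 \<in> tn_set A"
  using tn_set_memI[of 0 _ _ A] by (simp add: orthonormal_fam_def)

lemma trace_norm_upper:
  "trace_class A \<Longrightarrow> orthonormal_fam n e \<Longrightarrow> orthonormal_fam n f \<Longrightarrow>
    (\<Sum>k<n. cmod (cinner (f k) (A (e k)))) \<le> trace_norm A"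
  unfolding trace_norm_def trace_class_def by (intro cSup_upper tn_set_memI) auto

lemma trace_norm_nonneg: "trace_class A \<Longrightarrow> 0 \<le> trace_norm A"
  unfolding trace_norm_def trace_class_def by (intro cSup_upper tn_set_zero) auto

lemma tn_set_bdd:
  assumes "\<And>n e f. orthonormal_fam n e \<Longrightarrow> orthonormal_fam n f \<Longrightarrow> (\<Sum>k<n. cmod (cinner (f k) (A (e k)))) \<le> C"
    and "x \<in> tn_set A"
  shows "x \<le> C"
  using assms unfolding tn_set_def by blast

lemma trace_classI:
  assumes "clinear A"
    and "\<And>n e f. orthonormal_fam n e \<Longrightarrow> orthonormal_fam n f \<Longrightarrow> (\<Sum>k<n. cmod (cinner (f k) (A (e k)))) \<le> C"
  shows "trace_class A"
  unfolding trace_class_def using tn_set_bdd[OF assms(2)] assms(1) by (meson bdd_aboveI)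

lemma trace_norm_le:
  assumes "\<And>n e f. orthonormal_fam n e \<Longrightarrow> orthonormal_fam n f \<Longrightarrow> (\<Sum>k<n. cmod (cinner (f k) (A (e k)))) \<le> C"
  shows "trace_norm A \<le> C"
  unfolding trace_norm_def
proof (rule cSup_least)
  show "tn_set A \<noteq> {}" using tn_set_zero[of A] by blast
qed (rule tn_set_bdd[OF assms])

lemma orthonormal_fam_single: "norm e = 1 \<Longrightarrow> orthonormal_fam 1 (\<lambda>_. e)"
  by (simp add: orthonormal_fam_def cinner_self_norm)

lemma trace_class_clinear: "trace_class A \<Longrightarrow> clinear A"
  by (simp add: trace_class_def)

text \<open>The one-element families x/|x| and A x/|A x| show that the trace norm dominates the
  operator norm. Definiteness of the norm and pointwise convergence of Cauchy sequences depend on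
  it.\<close>

lemma trace_norm_op_bound:
  assumes A: "trace_class A" shows "norm (A x) \<le> trace_norm A * norm x"
proof (cases "x = 0 \<or> A x = 0")
  case True
  then show ?thesis using A trace_norm_nonneg[OF A] clinear_0[OF trace_class_clinear[OF A]] by auto
next
  case False
  define e where "e = (1 / norm x) *\<^sub>R x"
  define f where "f = (1 / norm (A x)) *\<^sub>R A x"
  have "norm e = 1" "norm f = 1" using False by (simp_all add: e_def f_def)
  then have "cmod (cinner f (A e)) \<le> trace_norm A"
    using trace_norm_upper[OF A orthonormal_fam_single[of e] orthonormal_fam_single[of f]] by simp
  also have "A e = (1 / norm x) *\<^sub>R A x" unfolding e_def by (rule clinear_scaleR[OF trace_class_clinear[OF A]])
  also have "cinner f ((1 / norm x) *\<^sub>R A x) = of_real ((1 / norm (A x)) * (1 / norm x) * (norm (A x))\<^sup>2)"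
    unfolding f_def cinner_scaleR_left cinner_scaleR_right cinner_self_norm by simp
  also have "cmod \<dots> = (1 / norm (A x)) * (1 / norm x) * (norm (A x))\<^sup>2"
    by (simp only: norm_of_real) simp
  also have "\<dots> = norm (A x) / norm x" using False by (simp add: power2_eq_square)
  finally show ?thesis using False by (simp add: pos_divide_le_eq)
qed

lemma trace_class_zero: "trace_class (\<lambda>_. 0::'h::chilbert)"
  by (rule trace_classI[where C = 0]) (auto simp: clinear_def)

lemma trace_class_add:
  assumes A: "trace_class A" and B: "trace_class B"
  shows "trace_class (\<lambda>x. A x + B x)" "trace_norm (\<lambda>x. A x + B x) \<le> trace_norm A + trace_norm B"
proof -
  have *: "(\<Sum>k<n. cmod (cinner (f k) (A (e k) + B (e k)))) \<le> trace_norm A + trace_norm B"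
    if on: "orthonormal_fam n e" "orthonormal_fam n f" for n e f
  proof -
    have "(\<Sum>k<n. cmod (cinner (f k) (A (e k) + B (e k))))
       \<le> (\<Sum>k<n. cmod (cinner (f k) (A (e k))) + cmod (cinner (f k) (B (e k))))"
      unfolding cinner_add_right by (intro sum_mono norm_triangle_ineq)
    also have "\<dots> \<le> trace_norm A + trace_norm B"
      unfolding sum.distrib by (intro add_mono trace_norm_upper A B on)
    finally show ?thesis .
  qed
  have "clinear (\<lambda>x. A x + B x)"
    using A B by (simp add: trace_class_def clinear_def scaleC_add_right)
  then show "trace_class (\<lambda>x. A x + B x)" using * by (rule trace_classI)
  show "trace_norm (\<lambda>x. A x + B x) \<le> trace_norm A + trace_norm B" using * by (rule trace_norm_le)
qed

lemma trace_class_scaleC: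
  assumes A: "trace_class A"
  shows "trace_class (\<lambda>x. c *\<^sub>C A x)" "trace_norm (\<lambda>x. c *\<^sub>C A x) = cmod c * trace_norm A"
proof -
  have tc: "trace_class (\<lambda>x. c *\<^sub>C A x) \<and> trace_norm (\<lambda>x. c *\<^sub>C A x) \<le> cmod c * trace_norm A"
    if A: "trace_class A" for A :: "'a \<Rightarrow> 'a" and c
  proof -
    have *: "(\<Sum>k<n. cmod (cinner (f k) (c *\<^sub>C A (e k)))) \<le> cmod c * trace_norm A"
      if on: "orthonormal_fam n e" "orthonormal_fam n f" for n e f
      unfolding cinner_scaleC_right norm_mult sum_distrib_left[symmetric]
      by (intro mult_left_mono trace_norm_upper A on) simp
    have "clinear (\<lambda>x. c *\<^sub>C A x)"
      using A by (simp add: trace_class_def clinear_def scaleC_add_right mult.commute)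
    from trace_classI[where A = "\<lambda>x. c *\<^sub>C A x", OF this *] trace_norm_le[where A = "\<lambda>x. c *\<^sub>C A x", OF *]
    show ?thesis by (rule conjI)
  qed
  show 1: "trace_class (\<lambda>x. c *\<^sub>C A x)" using tc[OF A] by blast
  show "trace_norm (\<lambda>x. c *\<^sub>C A x) = cmod c * trace_norm A"
  proof (cases "c = 0")
    case True
    have "trace_norm (\<lambda>x. 0 *\<^sub>C A x) \<le> cmod 0 * trace_norm A" using tc[OF A] by blast
    then show ?thesis using True trace_norm_nonneg[OF 1] by simp
  next
    case False
    \<comment> \<open>The inequality already proved, applied to the operator \<open>c A\<close> and
      the scalar 1/c, is the reverse inequality.\<close>
    have "trace_norm (\<lambda>x. inverse c *\<^sub>C (c *\<^sub>C A x)) \<le> cmod (inverse c) * trace_norm (\<lambda>x. c *\<^sub>C A x)"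
      using tc[OF 1] by blast
    then have "trace_norm A \<le> cmod (inverse c) * trace_norm (\<lambda>x. c *\<^sub>C A x)" using False by simp
    then have "cmod c * trace_norm A \<le> trace_norm (\<lambda>x. c *\<^sub>C A x)"
      using False by (simp add: norm_inverse inverse_eq_divide norm_divide pos_le_divide_eq mult.commute)
    then show ?thesis using tc[OF A, of c] by simp
  qed
qed

lemma trace_class_uminus: "trace_class A \<Longrightarrow> trace_class (\<lambda>x. - A x)"
  using trace_class_scaleC(1)[of A "-1"] by simp

lemma trace_class_diff: "trace_class A \<Longrightarrow> trace_class B \<Longrightarrow> trace_class (\<lambda>x. A x - B x)"
  using trace_class_add(1)[of A "\<lambda>x. - B x"] trace_class_uminus[of B] by simp

lemma trace_class_scaleR: "trace_class A \<Longrightarrow> trace_class (\<lambda>x. r *\<^sub>R A x)"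
  unfolding scaleR_scaleC by (rule trace_class_scaleC)

lemma trace_norm_scaleR: "trace_class A \<Longrightarrow> trace_norm (\<lambda>x. r *\<^sub>R A x) = \<bar>r\<bar> * trace_norm A"
  unfolding scaleR_scaleC by (simp add: trace_class_scaleC(2))

lemma ketbra_clinear: "clinear (ketbra \<phi> \<psi>)"
  by (simp add: clinear_def ketbra_def cinner_lin scaleC_add_left)

lemma ketbra_trace_bound:
  assumes "orthonormal_fam n e" "orthonormal_fam n f"
  shows "(\<Sum>k<n. cmod (cinner (f k) (ketbra \<phi> \<psi> (e k)))) \<le> norm \<phi> * norm \<psi>"
  using bessel_bilinear[OF assms, of \<phi> \<psi>] by (simp add: ketbra_def cinner_scaleC_right norm_mult mult.commute)

lemma trace_class_ketbra: "trace_class (ketbra \<phi> \<psi>)"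
  by (rule trace_classI[OF ketbra_clinear ketbra_trace_bound])

text \<open>As a type, the trace class operators can be made an instance of a normed space, so that
  limits, series and bounded linear maps in trace norm are those of the general theory.\<close>

typedef (overloaded) 'h tc = "{A :: 'h::chilbert \<Rightarrow> 'h. trace_class A}"
  morphisms tc_op Abs_tc
  using trace_class_zero by auto

setup_lifting type_definition_tc

lemma trace_class_tc_op [simp]: "trace_class (tc_op \<rho>)"
  using tc_op[of \<rho>] by simp

lemmas tc_clinear = trace_class_clinear[OF trace_class_tc_op]

lemma tc_op_Abs [simp]: "trace_class A \<Longrightarrow> tc_op (Abs_tc A) = A"
  by (simp add: Abs_tc_inverse)

lemma tc_eqI: "(\<And>x. tc_op \<rho> x = tc_op \<sigma> x) \<Longrightarrow> \<rho> = \<sigma>"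
  by (metis ext tc_op_inject)

instantiation tc :: (chilbert) real_normed_vector
begin

lift_definition zero_tc :: "'a tc" is "\<lambda>_. 0" by (rule trace_class_zero)
lift_definition plus_tc :: "'a tc \<Rightarrow> 'a tc \<Rightarrow> 'a tc" is "\<lambda>A B x. A x + B x" by (rule trace_class_add)
lift_definition minus_tc :: "'a tc \<Rightarrow> 'a tc \<Rightarrow> 'a tc" is "\<lambda>A B x. A x - B x" by (rule trace_class_diff)
lift_definition uminus_tc :: "'a tc \<Rightarrow> 'a tc" is "\<lambda>A x. - A x" by (rule trace_class_uminus)
lift_definition scaleR_tc :: "real \<Rightarrow> 'a tc \<Rightarrow> 'a tc" is "\<lambda>r A x. r *\<^sub>R A x" by (rule trace_class_scaleR)
lift_definition norm_tc :: "'a tc \<Rightarrow> real" is trace_norm .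
definition dist_tc :: "'a tc \<Rightarrow> 'a tc \<Rightarrow> real" where "dist_tc a b = norm (a - b)"
definition sgn_tc :: "'a tc \<Rightarrow> 'a tc" where "sgn_tc a = inverse (norm a) *\<^sub>R a"
definition [code del]: "(uniformity :: ('a tc \<times> 'a tc) filter) = (INF e\<in>{0<..}. principal {(x, y). dist x y < e})"
definition open_tc :: "'a tc set \<Rightarrow> bool" where
  "open_tc U \<longleftrightarrow> (\<forall>x\<in>U. eventually (\<lambda>(x', y). x' = x \<longrightarrow> y \<in> U) uniformity)"

instance
proof
  fix a b c :: "'a tc" and r s :: real
  show "a + b + c = a + (b + c)" by transfer (simp add: add.assoc)
  show "a + b = b + a" by transfer (simp add: add.commute)
  show "0 + a = a" by transfer simp
  show "- a + a = 0" by transfer simp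
  show "a - b = a + - b" by transfer simp
  show "r *\<^sub>R (a + b) = r *\<^sub>R a + r *\<^sub>R b" by transfer (simp add: scaleR_add_right)
  show "(r + s) *\<^sub>R a = r *\<^sub>R a + s *\<^sub>R a" by transfer (simp add: scaleR_add_left)
  show "r *\<^sub>R s *\<^sub>R a = (r * s) *\<^sub>R a" by transfer simp
  show "1 *\<^sub>R a = a" by transfer simp
  show "dist a b = norm (a - b)" by (rule dist_tc_def)
  show "sgn a = inverse (norm a) *\<^sub>R a" by (rule sgn_tc_def)
  show "(uniformity :: ('a tc \<times> 'a tc) filter) = (INF e\<in>{0<..}. principal {(x, y). dist x y < e})"
    by (rule uniformity_tc_def)
  show "open U \<longleftrightarrow> (\<forall>x\<in>U. eventually (\<lambda>(x', y). x' = x \<longrightarrow> y \<in> U) uniformity)" for U :: "'a tc set"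
    by (rule open_tc_def)
  show "norm (a + b) \<le> norm a + norm b" by transfer (rule trace_class_add)
  show "norm (r *\<^sub>R a) = \<bar>r\<bar> * norm a" by transfer (rule trace_norm_scaleR)
  show "(norm a = 0) = (a = 0)"
  proof
    assume "norm a = 0"
    then have "tc_op a x = 0" for x
      using trace_norm_op_bound[of "tc_op a" x] by (simp add: norm_tc.rep_eq)
    then show "a = 0" by (intro tc_eqI) (simp add: zero_tc.rep_eq)
  next
    assume "a = 0"
    have "trace_norm (\<lambda>_. 0::'a) \<le> 0" by (rule trace_norm_le) simp
    then have "trace_norm (\<lambda>_. 0::'a) = 0" using trace_norm_nonneg[OF trace_class_zero] by (rule antisym)
    then show "norm a = 0" using \<open>a = 0\<close> by (simp add: norm_tc.rep_eq zero_tc.rep_eq)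
  qed
qed

end

lemmas tc_op_simps = zero_tc.rep_eq plus_tc.rep_eq minus_tc.rep_eq uminus_tc.rep_eq scaleR_tc.rep_eq

lemma tc_op_sum: "tc_op (\<Sum>i\<in>I. f i) x = (\<Sum>i\<in>I. tc_op (f i) x)"
  by (induction I rule: infinite_finite_induct) (auto simp: tc_op_simps)

lemma tc_op_bound: "norm (tc_op \<rho> x) \<le> norm \<rho> * norm x"
  unfolding norm_tc.rep_eq by (rule trace_norm_op_bound) simp

lemma tc_norm_upper:
  "orthonormal_fam n e \<Longrightarrow> orthonormal_fam n f \<Longrightarrow> (\<Sum>k<n. cmod (cinner (f k) (tc_op \<rho> (e k)))) \<le> norm \<rho>"
  unfolding norm_tc.rep_eq by (rule trace_norm_upper) auto

lemma tc_norm_le: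
  "(\<And>n e f. orthonormal_fam n e \<Longrightarrow> orthonormal_fam n f \<Longrightarrow> (\<Sum>k<n. cmod (cinner (f k) (tc_op \<rho> (e k)))) \<le> C) \<Longrightarrow> norm \<rho> \<le> C"
  unfolding norm_tc.rep_eq by (rule trace_norm_le)

lemma bounded_linear_tc_op: "bounded_linear (\<lambda>\<rho>. tc_op \<rho> x)"
  by (rule bounded_linear_intro[where K = "norm x"]) (auto simp: tc_op_simps tc_op_bound)

lemmas tendsto_tc_op [tendsto_intros] = bounded_linear.tendsto[OF bounded_linear_tc_op]

text \<open>The limit operator is found pointwise. Every single sum in the definition of the trace
  norm passes to the limit, so the Cauchy estimate carries over uniformly in the families and gives
  both trace class membership and convergence in norm.\<close>

instance tc :: (chilbert) banach
proof
  fix X :: "nat \<Rightarrow> 'a tc" assume X: "Cauchy X"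
  have "Cauchy (\<lambda>n. tc_op (X n) x)" for x
    by (rule bounded_linear.Cauchy[OF bounded_linear_tc_op X])
  then obtain A where A: "\<And>x. (\<lambda>n. tc_op (X n) x) \<longlonglongrightarrow> A x"
    unfolding Cauchy_convergent_iff convergent_def by metis
  have lin: "clinear A" unfolding clinear_def
  proof (intro conjI allI)
    fix x y c
    have "(\<lambda>n. tc_op (X n) (x + y)) \<longlonglongrightarrow> A x + A y"
      unfolding clinear_add[OF tc_clinear] by (intro tendsto_intros A)
    then show "A (x + y) = A x + A y" using A LIMSEQ_unique by blast
    have "(\<lambda>n. tc_op (X n) (c *\<^sub>C x)) \<longlonglongrightarrow> c *\<^sub>C A x"
      unfolding clinear_scaleC[OF tc_clinear] by (intro tendsto_intros A)
    then show "A (c *\<^sub>C x) = c *\<^sub>C A x" using A LIMSEQ_unique by blast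
  qed
  have est: "(\<Sum>k<m. cmod (cinner (f k) (tc_op (X n) (e k) - A (e k)))) \<le> C"
    if C: "\<And>j. j \<ge> N \<Longrightarrow> norm (X n - X j) \<le> C" and on: "orthonormal_fam m e" "orthonormal_fam m f" for n N C m e f
  proof (rule LIMSEQ_le_const2)
    show "(\<lambda>j. \<Sum>k<m. cmod (cinner (f k) (tc_op (X n) (e k) - tc_op (X j) (e k))))
        \<longlonglongrightarrow> (\<Sum>k<m. cmod (cinner (f k) (tc_op (X n) (e k) - A (e k))))"
      by (intro tendsto_intros A)
    show "\<exists>N. \<forall>j\<ge>N. (\<Sum>k<m. cmod (cinner (f k) (tc_op (X n) (e k) - tc_op (X j) (e k)))) \<le> C"
      using tc_norm_upper[OF on, of "X n - X _"] C by (intro exI[of _ N]) (auto simp: tc_op_simps intro: order_trans)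
  qed
  have ex: "\<exists>N. \<forall>n\<ge>N. \<forall>j\<ge>N. norm (X n - X j) \<le> e" if "e > 0" for e
    using CauchyD[OF X that] less_imp_le by blast
  obtain N where N: "\<And>n j. n \<ge> N \<Longrightarrow> j \<ge> N \<Longrightarrow> norm (X n - X j) \<le> 1" using ex[of 1] by auto
  have "trace_class (\<lambda>x. tc_op (X N) x - A x)"
  proof (rule trace_classI[where C = 1])
    show "clinear (\<lambda>x. tc_op (X N) x - A x)"
      using lin tc_clinear[of "X N"] by (simp add: clinear_def scaleC_diff_right)
  qed (rule est[of N N], use N in auto)
  then have "trace_class (\<lambda>x. tc_op (X N) x - (tc_op (X N) x - A x))"
    by (rule trace_class_diff[OF trace_class_tc_op])
  then have tA: "trace_class A" by simp
  have "X \<longlonglongrightarrow> Abs_tc A"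
  proof (rule LIMSEQ_I)
    fix r :: real assume "r > 0"
    then obtain N where N: "\<And>n j. n \<ge> N \<Longrightarrow> j \<ge> N \<Longrightarrow> norm (X n - X j) \<le> r / 2" using ex[of "r/2"] by auto
    have "norm (X n - Abs_tc A) \<le> r / 2" if "n \<ge> N" for n
      by (rule tc_norm_le) (use est[of N n "r/2"] N that tA in \<open>auto simp: tc_op_simps\<close>)
    then show "\<exists>no. \<forall>n\<ge>no. norm (X n - Abs_tc A) < r"
      using \<open>r > 0\<close> by (intro exI[of _ N]) force
  qed
  then show "convergent X" by (auto simp: convergent_def)
qed

text \<open>The normed space instance carries real scalars only; complex multiples are a separate
  operation, compatible with it by \<open>scaleR_cmul\<close>.\<close>

lift_definition cmul :: "complex \<Rightarrow> 'h::chilbert tc \<Rightarrow> 'h tc" is "\<lambda>c A x. c *\<^sub>C A x" by (rule trace_class_scaleC)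
lift_definition kb :: "'h::chilbert \<Rightarrow> 'h \<Rightarrow> 'h tc" is ketbra by (rule trace_class_ketbra)

lemma tc_op_kb: "tc_op (kb \<phi> \<psi>) x = cinner \<psi> x *\<^sub>C \<phi>"
  by (simp add: kb.rep_eq ketbra_def)

lemma norm_cmul [simp]: "norm (cmul c \<rho>) = cmod c * norm \<rho>"
  by transfer (rule trace_class_scaleC)

lemma cmul_add_right: "cmul c (\<rho> + \<sigma>) = cmul c \<rho> + cmul c \<sigma>" by transfer (simp add: scaleC_add_right)
lemma cmul_add_left: "cmul (a + b) \<rho> = cmul a \<rho> + cmul b \<rho>" by transfer (simp add: scaleC_add_left)
lemma cmul_cmul [simp]: "cmul a (cmul b \<rho>) = cmul (a * b) \<rho>" by transfer simp
lemma cmul_one [simp]: "cmul 1 \<rho> = \<rho>" by transfer simp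
lemma scaleR_cmul: "r *\<^sub>R \<rho> = cmul (of_real r) \<rho>" by transfer (simp add: scaleR_scaleC)
lemma cmul_zero_left [simp]: "cmul 0 \<rho> = 0" by transfer simp
lemma cmul_zero_right [simp]: "cmul c 0 = 0" by transfer simp
lemma cmul_minus_left: "cmul (- c) \<rho> = - cmul c \<rho>" by transfer simp
lemma cmul_diff_right: "cmul c (\<rho> - \<sigma>) = cmul c \<rho> - cmul c \<sigma>" by transfer (simp add: scaleC_diff_right)
lemma cmul_sum_right: "cmul c (\<Sum>i\<in>I. f i) = (\<Sum>i\<in>I. cmul c (f i))"
  by (induction I rule: infinite_finite_induct) (auto simp: cmul_add_right)

lemma cmul_sum_left: "cmul (\<Sum>i\<in>I. c i) \<rho> = (\<Sum>i\<in>I. cmul (c i) \<rho>)"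
  by (induction I rule: infinite_finite_induct) (auto simp: cmul_add_left)

lemma bounded_linear_cmul: "bounded_linear (cmul c)"
  by (rule bounded_linear_intro[where K = "cmod c"]) (auto simp: cmul_add_right scaleR_cmul mult.commute)

lemmas tendsto_cmul [tendsto_intros] = bounded_linear.tendsto[OF bounded_linear_cmul]

lemma kb_add_left: "kb (\<phi> + \<phi>') \<psi> = kb \<phi> \<psi> + kb \<phi>' \<psi>"
  by (rule tc_eqI) (simp add: tc_op_kb tc_op_simps scaleC_add_right)
lemma kb_add_right: "kb \<phi> (\<psi> + \<psi>') = kb \<phi> \<psi> + kb \<phi> \<psi>'"
  by (rule tc_eqI) (simp add: tc_op_kb tc_op_simps cinner_lin scaleC_add_left)
lemma kb_scaleC_left: "kb (c *\<^sub>C \<phi>) \<psi> = cmul c (kb \<phi> \<psi>)"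
  by (rule tc_eqI) (simp add: tc_op_kb cmul.rep_eq mult.commute)
lemma kb_scaleC_right: "kb \<phi> (c *\<^sub>C \<psi>) = cmul (cnj c) (kb \<phi> \<psi>)"
  by (rule tc_eqI) (simp add: tc_op_kb cmul.rep_eq cinner_lin)

lemma norm_kb_le: "norm (kb \<phi> \<psi>) \<le> norm \<phi> * norm \<psi>"
  by (rule tc_norm_le) (simp add: kb.rep_eq ketbra_trace_bound)

lemma bounded_bilinear_kb: "bounded_bilinear (kb :: 'h::chilbert \<Rightarrow> 'h \<Rightarrow> 'h tc)"
proof
  show "\<exists>K. \<forall>a b::'h. norm (kb a b) \<le> norm a * norm b * K"
    by (intro exI[of _ 1]) (simp add: norm_kb_le)
qed (auto simp: kb_add_left kb_add_right scaleR_scaleC scaleR_cmul kb_scaleC_left kb_scaleC_right)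

lemmas tendsto_kb [tendsto_intros] = bounded_bilinear.tendsto[OF bounded_bilinear_kb]

section \<open>The trace as a bounded linear functional\<close>

definition tr :: "'h::chilbert tc \<Rightarrow> complex" where "tr \<rho> = ctrace (tc_op \<rho>)"

text \<open>\<open>ctrace\<close> sums over a basis picked by \<open>SOME\<close>, so the properties
  of \<open>tr\<close> are derived under the assumption that a basis exists;
  \<open>separable_has_onb\<close> discharges it.\<close>

definition has_onb :: "'h::chilbert itself \<Rightarrow> bool" where
  "has_onb _ \<longleftrightarrow> (\<exists>B::'h set. is_onb B)"

lemma some_onb: "has_onb TYPE('h::chilbert) \<Longrightarrow> is_onb (SOME B::'h set. is_onb B)"
  unfolding has_onb_def by (rule someI_ex)

text \<open>An enumeration of the set serves as both families in the supremum.\<close>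

lemma finite_orthonormal_sum_le:
  assumes F: "finite F" "orthonormal_set F"
  shows "(\<Sum>b\<in>F. cmod (cinner b (tc_op \<rho> b))) \<le> norm \<rho>"
proof -
  obtain e where e: "bij_betw e {..<card F} F"
    using ex_bij_betw_nat_finite[OF F(1)] by (auto simp: atLeast0LessThan)
  have "orthonormal_fam (card F) e" unfolding orthonormal_fam_def
  proof (intro allI impI)
    fix i j assume "i < card F" "j < card F"
    then have "e i \<in> F" "e j \<in> F" "e i = e j \<longleftrightarrow> i = j"
      using e by (auto simp: bij_betw_def inj_on_def)
    then show "cinner (e i) (e j) = (if i = j then 1 else 0)" using orthonormal_setD[OF F(2)] by simp
  qed
  from tc_norm_upper[OF this this, of \<rho>] show ?thesis
    by (simp add: sum.reindex_bij_betw[OF e, of "\<lambda>b. cmod (cinner b (tc_op \<rho> b))"])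
qed

lemma tr_abs_summable:
  assumes B: "is_onb B"
  shows "(\<lambda>b. norm (cinner b (tc_op \<rho> b))) summable_on B"
proof (rule nonneg_bdd_above_summable_on)
  show "bdd_above (sum (\<lambda>b. cmod (cinner b (tc_op \<rho> b))) ` {F. F \<subseteq> B \<and> finite F})"
  proof (rule bdd_aboveI2)
    fix F assume "F \<in> {F. F \<subseteq> B \<and> finite F}"
    then have "finite F" "orthonormal_set F" using B by (auto simp: is_onb_def orthonormal_set_def subset_iff)
    then show "(\<Sum>b\<in>F. cmod (cinner b (tc_op \<rho> b))) \<le> norm \<rho>" by (rule finite_orthonormal_sum_le)
  qed
qed simp

lemma tr_has_sum:
  assumes "has_onb TYPE('h::chilbert)"
  shows "((\<lambda>b. cinner b (tc_op \<rho> b)) has_sum tr \<rho>) (SOME B::'h set. is_onb B)"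
  unfolding tr_def ctrace_def
  by (rule has_sum_infsum[OF abs_summable_summable[OF tr_abs_summable[OF some_onb[OF assms]]]])

context assumes onb: "has_onb TYPE('h::chilbert)"
begin

lemma tr_add: "tr (\<rho> + \<sigma>) = tr \<rho> + tr (\<sigma>::'h tc)"
  by (rule has_sum_unique[OF tr_has_sum[OF onb]])
     (simp add: tc_op_simps cinner_lin has_sum_add[OF tr_has_sum[OF onb] tr_has_sum[OF onb]])

lemma tr_cmul: "tr (cmul c \<rho>) = c * tr (\<rho>::'h tc)"
  by (rule has_sum_unique[OF tr_has_sum[OF onb]])
     (simp add: cmul.rep_eq cinner_lin has_sum_cmult_right[OF tr_has_sum[OF onb]])

lemma tr_kb: "tr (kb \<phi> \<psi>) = cinner \<psi> (\<phi>::'h)"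
  by (rule has_sum_unique[OF tr_has_sum[OF onb]])
     (simp add: tc_op_kb cinner_lin onb_parseval[OF some_onb[OF onb]])

lemma tr_norm: "cmod (tr \<rho>) \<le> norm (\<rho>::'h tc)"
proof (rule tendsto_upperbound)
  show "((\<lambda>F. norm (\<Sum>b\<in>F. cinner b (tc_op \<rho> b))) \<longlongrightarrow> cmod (tr \<rho>)) (finite_subsets_at_top (SOME B::'h set. is_onb B))"
    using tr_has_sum[OF onb, of \<rho>] unfolding has_sum_def by (rule tendsto_norm)
  show "\<forall>\<^sub>F F in finite_subsets_at_top (SOME B::'h set. is_onb B). norm (\<Sum>b\<in>F. cinner b (tc_op \<rho> b)) \<le> norm \<rho>"
  proof (rule eventually_finite_subsets_at_top_weakI)
    fix F assume F: "finite F" "F \<subseteq> (SOME B::'h set. is_onb B)"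
    then have "orthonormal_set F" using some_onb[OF onb] unfolding is_onb_def orthonormal_set_def by (meson subsetD)
    from order_trans[OF norm_sum finite_orthonormal_sum_le[OF F(1) this]]
    show "norm (\<Sum>b\<in>F. cinner b (tc_op \<rho> b)) \<le> norm \<rho>" .
  qed
qed simp

lemma bounded_linear_tr: "bounded_linear (tr :: 'h tc \<Rightarrow> complex)"
  by (rule bounded_linear_intro[where K = 1]) (auto simp: tr_add scaleR_cmul tr_cmul tr_norm scaleR_conv_of_real)

lemmas tr_lin = bounded_linear.linear[OF bounded_linear_tr]

lemma tr_sum: "tr (\<Sum>i\<in>I. f i :: 'h tc) = (\<Sum>i\<in>I. tr (f i))"
  by (rule linear_sum[OF tr_lin])

lemma tr_diff: "tr (\<rho> - \<sigma>) = tr \<rho> - tr (\<sigma>::'h tc)"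
  by (rule linear_diff[OF tr_lin])

lemma tendsto_tr: "(f \<longlongrightarrow> \<rho>) F \<Longrightarrow> ((\<lambda>x. tr (f x)) \<longlongrightarrow> tr (\<rho>::'h tc)) F"
  by (rule bounded_linear.tendsto[OF bounded_linear_tr])

end

section \<open>Positive forms and positive trace class operators\<close>

definition nonneg_c :: "complex \<Rightarrow> bool" where "nonneg_c z \<longleftrightarrow> Im z = 0 \<and> Re z \<ge> 0"

lemma nonneg_c_sum: "(\<And>i. i \<in> I \<Longrightarrow> nonneg_c (f i)) \<Longrightarrow> nonneg_c (\<Sum>i\<in>I. f i)"
  by (induction I rule: infinite_finite_induct) (auto simp: nonneg_c_def)

lemma nonneg_c_add: "nonneg_c a \<Longrightarrow> nonneg_c b \<Longrightarrow> nonneg_c (a + b)"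
  by (auto simp: nonneg_c_def)

lemma nonneg_c_of_real: "nonneg_c (of_real r) \<longleftrightarrow> r \<ge> 0"
  by (auto simp: nonneg_c_def)

lemma nonneg_c_scaleR: "r \<ge> 0 \<Longrightarrow> nonneg_c z \<Longrightarrow> nonneg_c (of_real r * z)"
  by (auto simp: nonneg_c_def)

lemma nonneg_c_cnj_mult: "nonneg_c (z * cnj z)"
  using complex_norm_square[of z] nonneg_c_of_real[of "(cmod z)\<^sup>2"] by simp

lemma nonneg_c_limit:
  assumes "F \<noteq> bot" "(f \<longlongrightarrow> z) F" "\<forall>\<^sub>F x in F. nonneg_c (f x)"
  shows "nonneg_c z"
proof -
  have "closed {z. nonneg_c z}" unfolding nonneg_c_def
    by (intro closed_Collect_conj closed_Collect_eq closed_Collect_le continuous_intros)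
  then show ?thesis using Lim_in_closed_set[OF _ _ assms(1,2), of "{z. nonneg_c z}"] assms(3) by simp
qed

lemma nonneg_c_has_sum:
  assumes "(f has_sum z) A" "\<And>x. x \<in> A \<Longrightarrow> nonneg_c (f x)"
  shows "nonneg_c z"
  using assms(1) unfolding has_sum_def
  by (rule nonneg_c_limit[rotated]) (auto intro!: nonneg_c_sum assms(2) eventually_finite_subsets_at_top_weakI)

text \<open>Phase averaging: a quadratic form that is nonnegative on all unimodular multiples is Hermitian
  and satisfies the AM-GM version of the Cauchy-Schwarz inequality.\<close>
lemma nonneg_form_offdiagonal:
  assumes nn: "\<And>u. cmod u = 1 \<Longrightarrow> nonneg_c (a + u * z + cnj u * w + b)"
    and a: "Im a = 0" and b: "Im b = 0"
  shows "w = cnj z" "2 * cmod z \<le> Re a + Re b"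
proof -
  have "Im z + Im w = 0" using nn[of 1] a b by (simp add: nonneg_c_def)
  moreover have "Re z - Re w = 0" using nn[of \<i>] a b by (simp add: nonneg_c_def)
  ultimately show w: "w = cnj z" by (simp add: complex_eq_iff)
  show "2 * cmod z \<le> Re a + Re b"
  proof (cases "z = 0")
    case True then show ?thesis using nn[of 1] w by (simp add: nonneg_c_def)
  next
    case False
    \<comment> \<open>The phase that rotates \<open>z\<close> to the negative real axis, the worst
      case for nonnegativity.\<close>
    define u where "u = - cnj z / of_real (cmod z)"
    have "cmod u = 1" using False by (simp add: u_def norm_divide)
    moreover have uz: "u * z = - of_real (cmod z)"
    proof -
      have "u * z = - (z * cnj z) / of_real (cmod z)" by (simp add: u_def mult.commute)
      also have "z * cnj z = of_real ((cmod z)\<^sup>2)" by (rule complex_norm_square[symmetric])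
      finally show ?thesis using False by (simp add: power2_eq_square)
    qed
    moreover have "cnj u * w = cnj (u * z)" by (simp add: w)
    ultimately show ?thesis using nn[of u] by (simp add: nonneg_c_def)
  qed
qed

definition tc_pos :: "'h::chilbert tc \<Rightarrow> bool" where
  "tc_pos \<rho> \<longleftrightarrow> (\<forall>x. nonneg_c (cinner x (tc_op \<rho> x)))"

lemma tc_pos_offdiagonal:
  assumes "tc_pos \<rho>"
  shows "cinner y (tc_op \<rho> x) = cnj (cinner x (tc_op \<rho> y))"
    "2 * cmod (cinner x (tc_op \<rho> y)) \<le> Re (cinner x (tc_op \<rho> x)) + Re (cinner y (tc_op \<rho> y))"
proof -
  have nn: "nonneg_c (cinner x (tc_op \<rho> x) + u * cinner x (tc_op \<rho> y) + cnj u * cinner y (tc_op \<rho> x) + cinner y (tc_op \<rho> y))"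
    if u: "cmod u = 1" for u
  proof -
    have "u * cnj u = 1" using complex_norm_square[of u] u by simp
    then have uu: "u * (cnj u * z) = z" "cnj u * (u * z) = z" for z by (simp_all add: mult.assoc[symmetric] mult.commute)
    have "nonneg_c (cinner (x + u *\<^sub>C y) (tc_op \<rho> (x + u *\<^sub>C y)))" using assms by (simp add: tc_pos_def)
    also have "cinner (x + u *\<^sub>C y) (tc_op \<rho> (x + u *\<^sub>C y)) =
       cinner x (tc_op \<rho> x) + u * cinner x (tc_op \<rho> y) + cnj u * cinner y (tc_op \<rho> x) + cinner y (tc_op \<rho> y)"
      by (simp add: clinear_add[OF tc_clinear] clinear_scaleC[OF tc_clinear] cinner_lin distrib_left uu)
    finally show ?thesis .
  qed
  have "Im (cinner v (tc_op \<rho> v)) = 0" for v using assms by (simp add: tc_pos_def nonneg_c_def)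
  from nonneg_form_offdiagonal[OF nn this this]
  show "cinner y (tc_op \<rho> x) = cnj (cinner x (tc_op \<rho> y))"
    "2 * cmod (cinner x (tc_op \<rho> y)) \<le> Re (cinner x (tc_op \<rho> x)) + Re (cinner y (tc_op \<rho> y))" by blast+
qed

lemma tc_pos_symmetric: "tc_pos \<rho> \<Longrightarrow> cinner (tc_op \<rho> x) y = cinner x (tc_op \<rho> y)"
  using tc_pos_offdiagonal(1)[of \<rho> y x] cinner_commute[of "tc_op \<rho> x" y] by (simp add: cinner_commute[of x])

lemma tc_pos_kb: "tc_pos (kb \<phi> \<phi>)"
  unfolding tc_pos_def tc_op_kb cinner_scaleC_right
proof
  fix x
  have "cinner \<phi> x * cinner x \<phi> = cinner \<phi> x * cnj (cinner \<phi> x)" by (simp add: cinner_cnj)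
  then show "nonneg_c (cinner \<phi> x * cinner x \<phi>)" by (simp only: nonneg_c_cnj_mult)
qed

context assumes onb: "has_onb TYPE('h::chilbert)"
begin

lemma tr_pos: "tc_pos (\<rho>::'h tc) \<Longrightarrow> nonneg_c (tr \<rho>)"
  using nonneg_c_has_sum[OF tr_has_sum[OF onb, of \<rho>]] by (simp add: tc_pos_def)

text \<open>Compressing to the orthogonal complement of the family leaves a positive operator.\<close>
lemma tc_pos_partial_trace_le:
  fixes \<rho> :: "'h tc"
  assumes pos: "tc_pos \<rho>" and f: "orthonormal_fam n f"
  shows "(\<Sum>k<n. Re (cinner (f k) (tc_op \<rho> (f k)))) \<le> Re (tr \<rho>)"
proof -
  let ?A = "tc_op \<rho>"
  define P where "P x = (\<Sum>k<n. cinner (f k) x *\<^sub>C f k)" for x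
  \<comment> \<open>The compression (1 - P) \<rho> (1 - P), written as \<rho> minus P \<rho> and (1
    - P) \<rho> P. Both corrections have finite rank, and the second has trace zero.\<close>
  define \<sigma> where "\<sigma> = \<rho> - (\<Sum>k<n. kb (f k) (?A (f k))) - (\<Sum>k<n. kb (?A (f k) - P (?A (f k))) (f k))"
  have \<sigma>: "tc_op \<sigma> x = ?A x - P (?A x) - (?A (P x) - P (?A (P x)))" for x
  proof -
    have "P (?A x) = (\<Sum>k<n. cinner (?A (f k)) x *\<^sub>C f k)"
      by (simp add: P_def tc_pos_symmetric[OF pos])
    moreover have "?A (P x) = (\<Sum>k<n. cinner (f k) x *\<^sub>C ?A (f k))"
      by (simp add: P_def clinear_sum[OF tc_clinear] clinear_scaleC[OF tc_clinear])
    moreover have "P (\<Sum>k<n. c k *\<^sub>C z k) = (\<Sum>k<n. c k *\<^sub>C P (z k))" for c z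
      unfolding P_def cinner_sum_right cinner_scaleC_right scaleC_sum_left scaleC_sum_right scaleC_scaleC
      by (rule sum.swap)
    ultimately show ?thesis
      by (simp add: \<sigma>_def tc_op_simps tc_op_sum tc_op_kb scaleC_diff_right sum_subtractf)
  qed
  have Psym: "cinner (P x) y = cinner x (P y)" for x y
    unfolding P_def by (simp add: cinner_lin cinner_cnj mult.commute)
  have "tc_pos \<sigma>" unfolding tc_pos_def
  proof
    fix x
    have "cinner x (tc_op \<sigma> x) = cinner (x - P x) (?A (x - P x))"
      by (simp add: \<sigma> cinner_lin Psym clinear_diff[OF tc_clinear])
    then show "nonneg_c (cinner x (tc_op \<sigma> x))" using pos by (simp add: tc_pos_def)
  qed
  then have "0 \<le> Re (tr \<sigma>)" using tr_pos by (simp add: nonneg_c_def)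
  moreover have "cinner (f k) (P z) = cinner (f k) z" if "k < n" for k z
  proof -
    have "cinner (f k) (P z) = (\<Sum>j<n. cinner (f j) z * (if k = j then 1 else 0))"
      unfolding P_def cinner_sum_right cinner_scaleC_right
      by (intro sum.cong refl) (use f that in \<open>simp add: orthonormal_fam_def\<close>)
    then show ?thesis using that by (simp add: if_distrib cong: if_cong)
  qed
  then have "tr \<sigma> = tr \<rho> - (\<Sum>k<n. cinner (?A (f k)) (f k))"
    by (simp add: \<sigma>_def tr_diff[OF onb] tr_sum[OF onb] tr_kb[OF onb] cinner_diff_right)
  ultimately show ?thesis by (simp add: tc_pos_symmetric[OF pos])
qed

text \<open>In a positive operator block with diagonal \<open>a\<close>, \<open>b\<close> the
  off-diagonal entry is controlled by the traces of the diagonal: the pointwise AM-GM bound is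
  summed over the two families, and what appears are partial traces of \<open>a\<close> and
  \<open>b\<close>.\<close>

lemma norm_le_diagonal_blocks:
  fixes a b \<rho> :: "'h tc"
  assumes "tc_pos a" "tc_pos b"
    and "\<And>x y. 2 * cmod (cinner x (tc_op \<rho> y)) \<le> Re (cinner x (tc_op a x)) + Re (cinner y (tc_op b y))"
  shows "norm \<rho> \<le> (Re (tr a) + Re (tr b)) / 2"
proof (rule tc_norm_le)
  fix n e f assume on: "orthonormal_fam n (e::nat \<Rightarrow> 'h)" "orthonormal_fam n (f::nat \<Rightarrow> 'h)"
  have "2 * (\<Sum>k<n. cmod (cinner (f k) (tc_op \<rho> (e k))))
     \<le> (\<Sum>k<n. Re (cinner (f k) (tc_op a (f k))) + Re (cinner (e k) (tc_op b (e k))))"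
    unfolding sum_distrib_left by (intro sum_mono assms(3))
  also have "\<dots> \<le> Re (tr a) + Re (tr b)"
    unfolding sum.distrib by (intro add_mono tc_pos_partial_trace_le assms on)
  finally show "(\<Sum>k<n. cmod (cinner (f k) (tc_op \<rho> (e k)))) \<le> (Re (tr a) + Re (tr b)) / 2" by simp
qed

lemma tc_pos_norm: "tc_pos (\<rho>::'h tc) \<Longrightarrow> norm \<rho> = Re (tr \<rho>)"
proof -
  assume p: "tc_pos \<rho>"
  have "norm \<rho> \<le> Re (tr \<rho>)"
    using norm_le_diagonal_blocks[OF p p tc_pos_offdiagonal(2)[OF p]] by simp
  moreover have "Re (tr \<rho>) \<le> norm \<rho>" using tr_norm[OF onb, of \<rho>] complex_Re_le_cmod order_trans by blast
  ultimately show ?thesis by simp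
qed

end

text \<open>No coefficients are needed, since scalars can be absorbed into the left vectors when
  \<open>D\<close> is a subspace. Through \<open>tc_op\<close> this is \<open>D0 D\<close>, and for
  a span it is \<open>ketbra_span\<close>.\<close>

definition fr :: "'h::chilbert set \<Rightarrow> 'h tc set" where
  "fr D = {\<rho>. \<exists>n x y. (\<forall>j<n. x j \<in> D \<and> y j \<in> D) \<and> \<rho> = (\<Sum>j<n::nat. kb (x j) (y j))}"

lemma frI: "(\<And>j. j < (n::nat) \<Longrightarrow> x j \<in> D) \<Longrightarrow> (\<And>j. j < n \<Longrightarrow> y j \<in> D) \<Longrightarrow> (\<Sum>j<n. kb (x j) (y j)) \<in> fr D"
  unfolding fr_def by (rule CollectI, rule exI[of _ n], rule exI[of _ x], rule exI[of _ y]) simp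

lemma frE:
  assumes "\<rho> \<in> fr D"
  obtains n x y where "\<And>j. j < n \<Longrightarrow> x j \<in> D" "\<And>j. j < n \<Longrightarrow> y j \<in> D" "\<rho> = (\<Sum>j<n::nat. kb (x j) (y j))"
  using assms unfolding fr_def by blast

lemma sum_lessThan_append:
  fixes f :: "nat \<Rightarrow> 'b::comm_monoid_add"
  shows "(\<Sum>k<n + m. f k) = (\<Sum>k<n. f k) + (\<Sum>k<m. f (n + k))"
  by (induction m) (auto simp: add.assoc)

lemma fr_zero: "0 \<in> fr D"
  using frI[where n = 0 and D = D] by simp

lemma fr_kb: "\<phi> \<in> D \<Longrightarrow> \<psi> \<in> D \<Longrightarrow> kb \<phi> \<psi> \<in> fr D"
  using frI[of 1 "\<lambda>_. \<phi>" D "\<lambda>_. \<psi>"] by (simp add: lessThan_Suc)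

lemma fr_add:
  assumes "\<rho> \<in> fr D" "\<sigma> \<in> fr D" shows "\<rho> + \<sigma> \<in> fr D"
proof -
  obtain n x y where 1: "\<And>j. j < n \<Longrightarrow> x j \<in> D" "\<And>j. j < n \<Longrightarrow> y j \<in> D" "\<rho> = (\<Sum>j<n::nat. kb (x j) (y j))"
    using assms(1) by (rule frE) blast
  obtain m x' y' where 2: "\<And>j. j < m \<Longrightarrow> x' j \<in> D" "\<And>j. j < m \<Longrightarrow> y' j \<in> D" "\<sigma> = (\<Sum>j<m::nat. kb (x' j) (y' j))"
    using assms(2) by (rule frE) blast
  let ?x = "\<lambda>j. if j < n then x j else x' (j - n)" and ?y = "\<lambda>j. if j < n then y j else y' (j - n)"
  have "(\<Sum>j<n + m. kb (?x j) (?y j)) \<in> fr D" by (rule frI) (use 1 2 in auto)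
  then show ?thesis by (simp add: sum_lessThan_append 1(3) 2(3))
qed

lemma fr_cmul:
  assumes D: "csubspace D" and "\<rho> \<in> fr D" shows "cmul c \<rho> \<in> fr D"
proof -
  obtain n x y where 1: "\<And>j. j < n \<Longrightarrow> x j \<in> D" "\<And>j. j < n \<Longrightarrow> y j \<in> D" "\<rho> = (\<Sum>j<n::nat. kb (x j) (y j))"
    using assms(2) by (rule frE) blast
  have "(\<Sum>j<n. kb (c *\<^sub>C x j) (y j)) \<in> fr D" by (rule frI) (use 1 csubspace_scale[OF D] in auto)
  then show ?thesis by (simp add: 1(3) cmul_sum_right kb_scaleC_left)
qed

lemma fr_diff: "csubspace D \<Longrightarrow> \<rho> \<in> fr D \<Longrightarrow> \<sigma> \<in> fr D \<Longrightarrow> \<rho> - \<sigma> \<in> fr D"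
  using fr_add[of \<rho> D "cmul (-1) \<sigma>"] fr_cmul[of D \<sigma> "-1"] by (simp add: cmul_minus_left)

lemma fr_mono: "D \<subseteq> D' \<Longrightarrow> fr D \<subseteq> fr D'"
  unfolding fr_def by blast

lemma tc_op_rank_sum: "tc_op (\<Sum>j<n. kb (x j) (y j)) = rank_sum n x y"
  by (rule ext) (simp add: tc_op_sum tc_op_kb rank_sum_def)

text \<open>The point is that the singular vectors stay in \<open>D\<close>, where unbounded forms
  can be evaluated: the left ones lie in the range of \<rho>, the right ones in the span of the
  \<open>y j\<close>. Testing \<rho> on the singular families themselves bounds the sum of the
  singular values.\<close>

lemma fr_svd:
  assumes D: "csubspace (D::'h::chilbert set)" and "\<rho> \<in> fr D"
  obtains m s g h where "orthonormal_fam m g" "orthonormal_fam m h" "\<And>i. i < m \<Longrightarrow> s i > (0::real)"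
    "\<And>i. i < m \<Longrightarrow> g i \<in> D" "\<And>i. i < m \<Longrightarrow> h i \<in> D"
    "\<rho> = (\<Sum>i<m. s i *\<^sub>R kb (g i) (h i))" "(\<Sum>i<m. s i) \<le> norm \<rho>"
proof -
  obtain n x y where xy: "\<And>j. j < n \<Longrightarrow> x j \<in> D" "\<And>j. j < n \<Longrightarrow> y j \<in> D" "\<rho> = (\<Sum>j<n::nat. kb (x j) (y j))"
    using assms(2) by (rule frE) blast
  obtain m s g h where svd: "orthonormal_fam m g" "orthonormal_fam m h" "\<forall>i<m. s i > (0::real)"
      "\<forall>i<m. g i \<in> range (rank_sum n x y)" "\<forall>i<m. h i \<in> cspan (y ` {..<n})"
      "rank_sum n x y = (\<lambda>v. \<Sum>i<m. s i *\<^sub>R (cinner (h i) v *\<^sub>C g i))"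
    using singular_value_decomposition[of n x y] by blast
  have "cspan (x ` {..<n}) \<subseteq> D" "cspan (y ` {..<n}) \<subseteq> D"
    using xy by (auto intro!: cspan_subset[OF D])
  moreover have "g i \<in> cspan (x ` {..<n})" if i: "i < m" for i
  proof -
    have "g i \<in> range (rank_sum n x y)" using svd(4) i by simp
    then obtain v where "g i = rank_sum n x y v" by (rule rangeE)
    then show ?thesis using rank_sum_in_cspan by simp
  qed
  ultimately have gh: "g i \<in> D" "h i \<in> D" if "i < m" for i using svd(5) that by auto
  have eq: "\<rho> = (\<Sum>i<m. s i *\<^sub>R kb (g i) (h i))"
    by (rule tc_eqI) (simp add: xy(3) tc_op_rank_sum svd(6) tc_op_sum tc_op_simps tc_op_kb)
  have "cinner (g k) (tc_op \<rho> (h k)) = of_real (s k)" if k: "k < m" for k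
  proof -
    have "cinner (g k) (tc_op \<rho> (h k)) = (\<Sum>i<m. of_real (s i) * (cinner (h i) (h k) * cinner (g k) (g i)))"
      by (simp add: eq tc_op_sum tc_op_simps tc_op_kb cinner_lin)
    also have "\<dots> = (\<Sum>i<m. if k = i then of_real (s i) else 0)"
      by (intro sum.cong refl) (use svd(1,2) k in \<open>simp add: orthonormal_fam_def\<close>)
    finally show ?thesis using k by simp
  qed
  then have "(\<Sum>k<m. s k) = (\<Sum>k<m. cmod (cinner (g k) (tc_op \<rho> (h k))))"
    using svd(3) by (intro sum.cong refl) (simp add: less_imp_le)
  also have "\<dots> \<le> norm \<rho>" by (rule tc_norm_upper[OF svd(2,1)])
  finally show ?thesis using that svd(1,2,3) gh eq by blast
qed

section \<open>Riesz vectors and density of the finite rank operators\<close>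

lemma riesz_representation:
  fixes f :: "'h::chilbert \<Rightarrow> complex"
  assumes add: "\<And>x y. f (x + y) = f x + f y" and scale: "\<And>c x. f (c *\<^sub>C x) = c * f x"
    and bound: "\<And>x. cmod (f x) \<le> K * norm x"
  obtains u where "\<And>x. f x = cinner u x"
proof (cases "\<exists>x. f x \<noteq> 0")
  case False
  then show ?thesis using that[of 0] by simp
next
  case True
  then obtain x0 where x0: "f x0 \<noteq> 0" by blast
  let ?W = "{x. f x = 0}"
  have f0: "f 0 = 0" using scale[of 0 0] by simp
  have W: "csubspace ?W" by (auto simp: csubspace_def add scale f0)
  have bl: "bounded_linear f"
    by (rule bounded_linear_intro[where K = K])
       (use bound in \<open>auto simp: add scale scaleR_scaleC scaleR_conv_of_real mult.commute\<close>)
  have "closed ?W" using bl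
    by (intro closed_Collect_eq continuous_on_const linear_continuous_on)
  then have "closure ?W = ?W" by (rule closure_closed)
  then have "closure ?W \<noteq> UNIV" using x0 by auto
  then obtain z where z: "z \<noteq> 0" "\<And>w. f w = 0 \<Longrightarrow> cinner w z = 0"
    using ex_orthogonal_vector[OF W] by blast
  have fz: "f z \<noteq> 0"
  proof
    assume "f z = 0"
    then have "cinner z z = 0" by (rule z(2))
    then show False using z(1) by (simp add: cinner_self_norm)
  qed
  show ?thesis
  proof (rule that[of "cnj (f z / cinner z z) *\<^sub>C z"])
    fix x
    have "f (x - (f x / f z) *\<^sub>C z) = f x + f ((- (f x / f z)) *\<^sub>C z)" by (simp flip: add)
    then have "f (x - (f x / f z) *\<^sub>C z) = 0" using fz by (simp only: scale) simp
    then have "cinner (x - (f x / f z) *\<^sub>C z) z = 0" by (rule z(2))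
    then have "cnj (cinner (x - (f x / f z) *\<^sub>C z) z) = cnj 0" by (rule arg_cong)
    then have "cinner z (x - (f x / f z) *\<^sub>C z) = 0" by (simp only: cinner_cnj complex_cnj_zero)
    then have "cinner z x = f x / f z * cinner z z" by (simp add: cinner_lin)
    moreover have "cinner z z \<noteq> 0" using z(1) by (simp add: cinner_self_norm)
    ultimately show "f x = cinner (cnj (f z / cinner z z) *\<^sub>C z) x"
      using fz by (simp add: cinner_scaleC_left)
  qed
qed

text \<open>The value of the adjoint of \<rho> at the single vector \<open>y\<close>; this is enough
  to write P \<rho> as a finite sum of rank-one operators.\<close>

lemma tc_adjoint_vector:
  obtains u where "\<And>x. cinner y (tc_op \<rho> x) = cinner u x"
proof (rule riesz_representation)
  show "cmod (cinner y (tc_op \<rho> x)) \<le> (norm y * norm \<rho>) * norm x" for x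
    using order_trans[OF cinner_cauchy_schwarz mult_left_mono[OF tc_op_bound norm_ge_zero]]
    by (simp add: mult.assoc)
qed (auto simp: clinear_add[OF tc_clinear] clinear_scaleC[OF tc_clinear] cinner_lin)

lemma ex_unimodular: "\<exists>c. cmod c = 1 \<and> c * z = of_real (cmod z)"
proof (cases "z = 0")
  case True then show ?thesis by (intro exI[of _ 1]) simp
next
  case False
  have "cnj z / of_real (cmod z) * z = (z * cnj z) / of_real (cmod z)" by simp
  also have "\<dots> = of_real (cmod z)"
    using False unfolding complex_norm_square[symmetric] by (simp add: power2_eq_square)
  finally show ?thesis using False by (intro exI[of _ "cnj z / of_real (cmod z)"]) (simp add: norm_divide)
qed

context assumes onb: "has_onb TYPE('h::chilbert)"
begin

text \<open>If orthonormal families \<open>e\<close>, \<open>f\<close> almost attain the trace norm of \<open>\<rho>\<close>, then the corner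
  \<open>(1 - P) \<rho> (1 - Q)\<close> has small trace norm, since families orthogonal to \<open>e\<close> and \<open>f\<close> can be appended;
  the singular value decomposition reduces general families to this case.\<close>
lemma finite_rank_dense:
  fixes \<rho> :: "'h tc"
  assumes \<epsilon>: "\<epsilon> > 0"
  shows "\<exists>\<sigma>\<in>fr UNIV. norm (\<rho> - \<sigma>) \<le> \<epsilon>"
proof -
  let ?A = "tc_op \<rho>"
  have "norm \<rho> - \<epsilon> < Sup (tn_set ?A)" using \<epsilon> by (simp add: norm_tc.rep_eq trace_norm_def)
  then obtain z where "z \<in> tn_set ?A" "norm \<rho> - \<epsilon> < z"
    by (rule less_cSupE) (use tn_set_zero[of ?A] in blast)
  then obtain n e f where on: "orthonormal_fam n e" "orthonormal_fam n f"
    and big: "norm \<rho> - \<epsilon> < (\<Sum>k<n. cmod (cinner (f k) (?A (e k))))"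
    unfolding tn_set_def by blast
  define P where "P x = (\<Sum>k<n. cinner (f k) x *\<^sub>C f k)" for x
  define Q where "Q x = (\<Sum>k<n. cinner (e k) x *\<^sub>C e k)" for x
  have Psym: "cinner (P x) y = cinner x (P y)" for x y
    unfolding P_def by (simp add: cinner_lin cinner_cnj mult.commute)
  have proj: "cinner (g k) (\<Sum>k<n. cinner (g k) x *\<^sub>C g k) = cinner (g k) x"
    if "orthonormal_fam n g" "k < n" for g k and x :: 'h
  proof -
    have "cinner (g k) (\<Sum>k<n. cinner (g k) x *\<^sub>C g k) = (\<Sum>j<n. cinner (g j) x * (if k = j then 1 else 0))"
      unfolding cinner_sum_right cinner_scaleC_right
      by (intro sum.cong refl) (use that in \<open>simp add: orthonormal_fam_def\<close>)
    then show ?thesis using that by (simp add: if_distrib cong: if_cong)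
  qed
  have "\<forall>k. \<exists>u. \<forall>x. cinner (f k) (?A x) = cinner u x"
    using tc_adjoint_vector by (intro allI) blast
  then obtain u where u: "\<And>k x. cinner (f k) (?A x) = cinner (u k) x"
    by (auto dest!: choice)
  \<comment> \<open>P \<rho> + (1 - P) \<rho> Q, so that the remainder is the corner (1 - P) \<rho>
    (1 - Q).\<close>
  define \<sigma> where "\<sigma> = (\<Sum>k<n. kb (f k) (u k)) + (\<Sum>k<n. kb (?A (e k) - P (?A (e k))) (e k))"
  have "\<sigma> \<in> fr UNIV" unfolding \<sigma>_def by (intro fr_add frI) auto
  moreover have \<sigma>: "tc_op (\<rho> - \<sigma>) x = ?A (x - Q x) - P (?A (x - Q x))" for x
  proof -
    have "P (?A x) = (\<Sum>k<n. cinner (u k) x *\<^sub>C f k)" by (simp add: P_def u)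
    moreover have "?A (Q x) = (\<Sum>k<n. cinner (e k) x *\<^sub>C ?A (e k))"
      by (simp add: Q_def clinear_sum[OF tc_clinear] clinear_scaleC[OF tc_clinear])
    moreover have "P (\<Sum>k<n. c k *\<^sub>C z k) = (\<Sum>k<n. c k *\<^sub>C P (z k))" for c z
      unfolding P_def cinner_sum_right cinner_scaleC_right scaleC_sum_left scaleC_sum_right scaleC_scaleC
      by (rule sum.swap)
    moreover have "P (x - y) = P x - P y" for x y
      by (simp add: P_def cinner_lin scaleC_diff_left sum_subtractf)
    ultimately show ?thesis
      by (simp add: \<sigma>_def tc_op_simps tc_op_sum tc_op_kb scaleC_diff_right sum_subtractf clinear_diff[OF tc_clinear])
  qed
  moreover have "norm (\<rho> - \<sigma>) \<le> \<epsilon>"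
  proof (rule tc_norm_le)
    fix m e' f' assume on': "orthonormal_fam m (e'::nat \<Rightarrow> 'h)" "orthonormal_fam m (f'::nat \<Rightarrow> 'h)"
    define U where "U j = f' j - P (f' j)" for j
    define V where "V j = e' j - Q (e' j)" for j
    have entry: "cinner (f' j) (tc_op (\<rho> - \<sigma>) (e' j)) = cinner (U j) (?A (V j))" for j
      unfolding \<sigma> U_def V_def by (simp add: cinner_lin Psym)
    have "\<forall>j. \<exists>c. cmod c = 1 \<and> c * cinner (U j) (?A (V j)) = of_real (cmod (cinner (U j) (?A (V j))))"
      by (intro allI ex_unimodular)
    then obtain c where c: "\<And>j. cmod (c j) = 1" "\<And>j. c j * cinner (U j) (?A (V j)) = of_real (cmod (cinner (U j) (?A (V j))))"
      by (auto dest!: choice)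
    \<comment> \<open>The phases make every matrix entry real and nonnegative, so that the sum of
      absolute values becomes the trace of a single operator.\<close>
    define V' where "V' j = c j *\<^sub>C V j" for j
    obtain r s g h where svd: "orthonormal_fam r g" "orthonormal_fam r h" "\<forall>i<r. s i > (0::real)"
      "\<forall>i<r. g i \<in> range (rank_sum m V' U)" "\<forall>i<r. h i \<in> cspan (U ` {..<m})"
      "rank_sum m V' U = (\<lambda>v. \<Sum>i<r. s i *\<^sub>R (cinner (h i) v *\<^sub>C g i))"
      using singular_value_decomposition[of m V' U] by blast
    have eV: "cinner (e k) (V j) = 0" if "k < n" for k j
      using proj[OF on(1) that, of "e' j"] by (simp add: V_def Q_def cinner_lin)
    have fU: "cinner (f k) (U j) = 0" if "k < n" for k j
      using proj[OF on(2) that, of "f' j"] by (simp add: U_def P_def cinner_lin)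
    have eg: "cinner (e k) (g i) = 0" if k: "k < n" and i: "i < r" for k i
    proof -
      have "g i \<in> range (rank_sum m V' U)" using svd(4) i by simp
      then obtain v where "g i = rank_sum m V' U v" by (rule rangeE)
      then show ?thesis by (simp add: rank_sum_def cinner_lin V'_def eV[OF k])
    qed
    have fh: "cinner (f k) (h i) = 0" if k: "k < n" and i: "i < r" for k i
    proof -
      have "csubspace {v. cinner (f k) v = 0}" by (auto simp: csubspace_def cinner_lin)
      then have "cspan (U ` {..<m}) \<subseteq> {v. cinner (f k) v = 0}"
        by (rule cspan_subset) (auto simp: fU[OF k])
      then show ?thesis using svd(5) i by blast
    qed
    \<comment> \<open>The operator built from \<open>V'\<close> and \<open>U\<close> is (1 - Q) W (1
      - P), where W is the sum of c j |e' j><f' j|. W is a contraction by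
      \<open>bessel_bilinear\<close>, hence no singular value exceeds 1.\<close>
    have s1: "s i \<le> 1" if i: "i < r" for i
    proof -
      have "rank_sum m V' U (h i) = s i *\<^sub>R g i"
      proof -
        have "rank_sum m V' U (h i) = (\<Sum>k<r. if k = i then s k *\<^sub>R g k else 0)"
          unfolding svd(6) by (intro sum.cong refl) (use svd(2) i in \<open>simp add: orthonormal_fam_def\<close>)
        then show ?thesis using i by simp
      qed
      then have "of_real (s i) = cinner (g i) (rank_sum m V' U (h i))"
        using svd(1) i by (simp add: cinner_lin orthonormal_fam_def)
      also have "\<dots> = (\<Sum>j<m. cinner (U j) (h i) * (c j * cinner (g i) (V j)))"
        by (simp add: rank_sum_def cinner_lin V'_def mult.assoc)
      also have "\<dots> = (\<Sum>j<m. cinner (f' j) (h i) * (c j * cinner (g i) (e' j)))"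
      proof (intro sum.cong refl)
        fix j
        have "cinner (P (f' j)) (h i) = 0" unfolding Psym by (simp add: P_def fh[OF _ i])
        moreover have "cinner (g i) (Q (e' j)) = 0"
        proof -
          have "cinner (g i) (e k) = 0" if "k < n" for k
            using eg[OF that i] cinner_commute[of "g i" "e k"] by simp
          then show ?thesis by (simp add: Q_def cinner_lin)
        qed
        ultimately show "cinner (U j) (h i) * (c j * cinner (g i) (V j)) = cinner (f' j) (h i) * (c j * cinner (g i) (e' j))"
          by (simp add: U_def V_def cinner_lin)
      qed
      finally have "cmod (of_real (s i)) \<le> (\<Sum>j<m. cmod (cinner (f' j) (h i)) * cmod (cinner (g i) (e' j)))"
        using sum_norm_le[of "{..<m}" "\<lambda>j. cinner (f' j) (h i) * (c j * cinner (g i) (e' j))"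
            "\<lambda>j. cmod (cinner (f' j) (h i)) * cmod (cinner (g i) (e' j))"]
        by (simp add: norm_mult c(1))
      also have "\<dots> \<le> norm (h i) * norm (g i)" by (rule bessel_bilinear[OF on'])
      also have "\<dots> = 1" using orthonormal_fam_norm[OF svd(1) i] orthonormal_fam_norm[OF svd(2) i] by simp
      finally show ?thesis by simp
    qed
    have opeq: "(\<Sum>j<m. kb (?A (V' j)) (U j)) = (\<Sum>i<r. s i *\<^sub>R kb (?A (g i)) (h i))"
    proof (rule tc_eqI)
      fix x
      have "?A (rank_sum m V' U x) = ?A (\<Sum>i<r. s i *\<^sub>R (cinner (h i) x *\<^sub>C g i))" by (simp only: svd(6))
      then show "tc_op (\<Sum>j<m. kb (?A (V' j)) (U j)) x = tc_op (\<Sum>i<r. s i *\<^sub>R kb (?A (g i)) (h i)) x"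
        by (simp add: tc_op_sum tc_op_kb tc_op_simps rank_sum_def clinear_sum[OF tc_clinear]
            clinear_scaleC[OF tc_clinear] clinear_scaleR[OF tc_clinear])
    qed
    have "of_real (\<Sum>j<m. cmod (cinner (U j) (?A (V j)))) = tr (\<Sum>j<m. kb (?A (V' j)) (U j))"
      by (simp add: tr_sum[OF onb] tr_kb[OF onb] V'_def clinear_scaleC[OF tc_clinear] cinner_lin c(2))
    also have "\<dots> = (\<Sum>i<r. of_real (s i) * cinner (h i) (?A (g i)))"
      unfolding opeq by (simp add: tr_sum[OF onb] tr_kb[OF onb] scaleR_cmul tr_cmul[OF onb])
    finally have "cmod (of_real (\<Sum>j<m. cmod (cinner (U j) (?A (V j))))) \<le> (\<Sum>i<r. cmod (cinner (h i) (?A (g i))))"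
    proof (simp only:, intro sum_norm_le)
      fix i assume "i \<in> {..<r}"
      then show "cmod (of_real (s i) * cinner (h i) (?A (g i))) \<le> cmod (cinner (h i) (?A (g i)))"
        using s1[of i] svd(3) by (auto simp: norm_mult intro!: mult_left_le_one_le)
    qed
    moreover have "0 \<le> (\<Sum>j<m. cmod (cinner (U j) (?A (V j))))" by (simp add: sum_nonneg)
    ultimately have small: "(\<Sum>j<m. cmod (cinner (U j) (?A (V j)))) \<le> (\<Sum>i<r. cmod (cinner (h i) (?A (g i))))"
      by (simp only: norm_of_real abs_of_nonneg)
    \<comment> \<open>The appended families are admissible, and \<open>e\<close>, \<open>f\<close>
      alone already exhaust the norm up to \<epsilon>; only \<epsilon> is left for the
      corner.\<close>
    have "(\<Sum>k<n. cmod (cinner (f k) (?A (e k)))) + (\<Sum>i<r. cmod (cinner (h i) (?A (g i)))) \<le> norm \<rho>"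
      using tc_norm_upper[OF orthonormal_fam_append[OF on(1) svd(1) eg] orthonormal_fam_append[OF on(2) svd(2) fh], of \<rho>]
      by (simp add: sum_lessThan_append)
    then show "(\<Sum>k<m. cmod (cinner (f' k) (tc_op (\<rho> - \<sigma>) (e' k)))) \<le> \<epsilon>"
      using small big unfolding entry by linarith
  qed
  ultimately show ?thesis by blast
qed

end

section \<open>Completely positive maps contract the trace norm\<close>

text \<open>Positivity of the operator matrix with rows (a, \<rho>) and (\<rho>', b) on the direct
  sum of two copies of the space. The lower left entry is listed separately; positivity forces it to
  be the adjoint of \<rho>.\<close>

definition block2_pos :: "'h::chilbert tc \<Rightarrow> 'h tc \<Rightarrow> 'h tc \<Rightarrow> 'h tc \<Rightarrow> bool" where
  "block2_pos a \<rho> \<rho>' b \<longleftrightarrow> (\<forall>x y. nonneg_c (cinner x (tc_op a x) + cinner x (tc_op \<rho> y) + cinner y (tc_op \<rho>' x) + cinner y (tc_op b y)))"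

lemma block2_pos_add:
  "block2_pos a \<rho> \<rho>' b \<Longrightarrow> block2_pos c \<sigma> \<sigma>' d \<Longrightarrow> block2_pos (a + c) (\<rho> + \<sigma>) (\<rho>' + \<sigma>') (b + d)"
  unfolding block2_pos_def
proof (intro allI, goal_cases)
  case (1 x y)
  from nonneg_c_add[OF 1(1)[rule_format, of x y] 1(2)[rule_format, of x y]]
  show ?case by (simp add: tc_op_simps cinner_lin algebra_simps)
qed

lemma block2_pos_zero: "block2_pos 0 0 0 0"
  by (simp add: block2_pos_def tc_op_simps nonneg_c_def)

lemma block2_pos_sum:
  "(\<And>i. i \<in> I \<Longrightarrow> block2_pos (a i) (\<rho> i) (\<rho>' i) (b i)) \<Longrightarrow>
    block2_pos (\<Sum>i\<in>I. a i) (\<Sum>i\<in>I. \<rho> i) (\<Sum>i\<in>I. \<rho>' i) (\<Sum>i\<in>I. b i)"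
  by (induction I rule: infinite_finite_induct) (auto intro: block2_pos_add block2_pos_zero)

text \<open>The matrix is r times the rank-one positive operator of the vector (g, h).\<close>

lemma block2_pos_kb:
  assumes "r \<ge> 0"
  shows "block2_pos (r *\<^sub>R kb g g) (r *\<^sub>R kb g h) (r *\<^sub>R kb h g) (r *\<^sub>R kb h h)"
  unfolding block2_pos_def
proof (intro allI)
  fix x y
  let ?w = "cinner x g + cinner y h"
  have "nonneg_c (of_real r * (?w * cnj ?w))" by (rule nonneg_c_scaleR[OF assms nonneg_c_cnj_mult])
  also have "of_real r * (?w * cnj ?w) = cinner x (tc_op (r *\<^sub>R kb g g) x) + cinner x (tc_op (r *\<^sub>R kb g h) y)
      + cinner y (tc_op (r *\<^sub>R kb h g) x) + cinner y (tc_op (r *\<^sub>R kb h h) y)"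
    by (simp add: tc_op_simps tc_op_kb cinner_lin cinner_cnj algebra_simps)
  finally show "nonneg_c \<dots>" .
qed

lemma block2_pos_limit:
  assumes "\<And>n::nat. block2_pos (a n) (\<rho> n) (\<rho>' n) (b n)"
    and "a \<longlonglongrightarrow> a0" "\<rho> \<longlonglongrightarrow> \<rho>0" "\<rho>' \<longlonglongrightarrow> \<rho>'0" "b \<longlonglongrightarrow> b0"
  shows "block2_pos a0 \<rho>0 \<rho>'0 b0"
  unfolding block2_pos_def
proof (intro allI)
  fix x y
  have "(\<lambda>n. cinner x (tc_op (a n) x) + cinner x (tc_op (\<rho> n) y) + cinner y (tc_op (\<rho>' n) x) + cinner y (tc_op (b n) y))
    \<longlonglongrightarrow> cinner x (tc_op a0 x) + cinner x (tc_op \<rho>0 y) + cinner y (tc_op \<rho>'0 x) + cinner y (tc_op b0 y)"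
    by (intro tendsto_intros assms)
  then show "nonneg_c (cinner x (tc_op a0 x) + cinner x (tc_op \<rho>0 y) + cinner y (tc_op \<rho>'0 x) + cinner y (tc_op b0 y))"
    by (rule nonneg_c_limit[rotated]) (use assms(1) in \<open>auto simp: block2_pos_def\<close>)
qed

text \<open>With singular values s, g, h the diagonal entries are the sums of s |g><g| and s |h><h|,
  that is the absolute values of the adjoint of \<rho> and of \<rho> itself.\<close>

lemma fr_block2:
  fixes \<rho> :: "'h::chilbert tc"
  assumes "\<rho> \<in> fr UNIV"
  obtains a \<rho>' b where "block2_pos a \<rho> \<rho>' b" "norm a \<le> norm \<rho>" "norm \<rho>' \<le> norm \<rho>" "norm b \<le> norm \<rho>"
proof -
  obtain m s g h where svd: "orthonormal_fam m g" "orthonormal_fam m h" "\<And>i. i < m \<Longrightarrow> s i > (0::real)"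
    and "\<And>i. i < m \<Longrightarrow> g i \<in> UNIV" "\<And>i. i < m \<Longrightarrow> h i \<in> UNIV"
    and \<rho>: "\<rho> = (\<Sum>i<m. s i *\<^sub>R kb (g i) (h i))" "(\<Sum>i<m. s i) \<le> norm \<rho>"
    by (rule fr_svd[OF csubspace_UNIV assms]) blast
  have n: "norm (\<Sum>i<m. s i *\<^sub>R kb (x i) (y i)) \<le> norm \<rho>"
    if "orthonormal_fam m x" "orthonormal_fam m y" for x y :: "nat \<Rightarrow> 'h"
  proof -
    have "norm (\<Sum>i<m. s i *\<^sub>R kb (x i) (y i)) \<le> (\<Sum>i<m. s i)"
    proof (rule sum_norm_le)
      fix i assume i: "i \<in> {..<m}"
      then have "norm (kb (x i) (y i)) \<le> 1"
        using norm_kb_le[of "x i" "y i"] orthonormal_fam_norm[OF that(1)] orthonormal_fam_norm[OF that(2)] by simp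
      then show "norm (s i *\<^sub>R kb (x i) (y i)) \<le> s i"
        using svd(3)[of i] i mult_left_mono[of "norm (kb (x i) (y i))" 1 "s i"] by simp
    qed
    then show ?thesis using \<rho>(2) by linarith
  qed
  show ?thesis
  proof (rule that)
    show "block2_pos (\<Sum>i<m. s i *\<^sub>R kb (g i) (g i)) \<rho> (\<Sum>i<m. s i *\<^sub>R kb (h i) (g i)) (\<Sum>i<m. s i *\<^sub>R kb (h i) (h i))"
      unfolding \<rho>(1) by (intro block2_pos_sum block2_pos_kb) (use svd(3) less_imp_le in auto)
  qed (intro n svd)+
qed

context assumes onb: "has_onb TYPE('h::chilbert)"
begin

text \<open>A series of finite rank differences converges to \<rho>. Each term has its own block,
  and the sums of these blocks converge because the norms are summable with total at most the norm
  of \<rho> plus \<epsilon>.\<close>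

lemma ex_block2:
  fixes \<rho> :: "'h tc"
  assumes \<epsilon>: "\<epsilon> > 0"
  obtains a \<rho>' b where "block2_pos a \<rho> \<rho>' b" "norm a \<le> norm \<rho> + \<epsilon>" "norm b \<le> norm \<rho> + \<epsilon>"
proof -
  have "\<exists>\<sigma>\<in>fr UNIV. norm (\<rho> - \<sigma>) \<le> \<epsilon> / 4 * (1/2)^n" for n
    by (rule finite_rank_dense[OF onb]) (use \<epsilon> in simp)
  then obtain \<sigma> where \<sigma>: "\<And>n. \<sigma> n \<in> fr UNIV" "\<And>n. norm (\<rho> - \<sigma> n) \<le> \<epsilon> / 4 * (1/2)^n" by metis
  define x where "x n = (case n of 0 \<Rightarrow> \<sigma> 0 | Suc k \<Rightarrow> \<sigma> (Suc k) - \<sigma> k)" for n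
  have xfr: "x n \<in> fr UNIV" for n
    by (cases n) (auto simp: x_def \<sigma> intro: fr_diff[OF csubspace_UNIV])
  have part: "(\<Sum>k<Suc n. x k) = \<sigma> n" for n
    by (induction n) (auto simp: x_def)
  \<comment> \<open>Approximation errors \<epsilon>/4 (1/2)^n make consecutive differences at most
    3\<epsilon>/8 (1/2)^k, in total 3\<epsilon>/4; the remaining \<epsilon>/4 belongs to the initial
    term.\<close>
  define M where "M n = (case n of 0 \<Rightarrow> norm \<rho> + \<epsilon> / 4 | Suc k \<Rightarrow> 3 * \<epsilon> / 8 * (1/2)^k)" for n
  have xM: "norm (x n) \<le> M n" for n
  proof (cases n)
    case 0
    have "norm (\<sigma> 0) \<le> norm \<rho> + norm (\<rho> - \<sigma> 0)" by (metis add_diff_cancel_left' diff_diff_eq2 norm_triangle_ineq4 diff_add_cancel)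
    then show ?thesis using \<sigma>(2)[of 0] by (simp add: 0 x_def M_def)
  next
    case (Suc k)
    have "norm (\<sigma> (Suc k) - \<sigma> k) = norm ((\<rho> - \<sigma> k) - (\<rho> - \<sigma> (Suc k)))" by simp
    also have "\<dots> \<le> \<epsilon> / 4 * (1/2)^k + \<epsilon> / 4 * (1/2)^(Suc k)"
      using norm_triangle_ineq4[of "\<rho> - \<sigma> k" "\<rho> - \<sigma> (Suc k)"] \<sigma>(2)[of k] \<sigma>(2)[of "Suc k"] by linarith
    also have "\<dots> = 3 * \<epsilon> / 8 * (1/2)^k" by simp
    finally show ?thesis by (simp add: Suc x_def M_def)
  qed
  have "(\<lambda>k. 3 * \<epsilon> / 8 * (1/2)^k) sums (3 * \<epsilon> / 8 * (1 / (1 - 1/2)))"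
    by (intro sums_mult geometric_sums) simp
  then have "(\<lambda>k. M (Suc k)) sums (3 * \<epsilon> / 4)" by (simp add: M_def)
  then have Msums: "M sums (3 * \<epsilon> / 4 + M 0)" by (rule sums_Suc)
  have "\<exists>a \<rho>' b. block2_pos a (x n) \<rho>' b \<and> norm a \<le> norm (x n) \<and> norm \<rho>' \<le> norm (x n) \<and> norm b \<le> norm (x n)" for n
    using fr_block2[OF xfr[of n]] by metis
  then obtain a \<rho>' b where ab: "\<And>n. block2_pos (a n) (x n) (\<rho>' n) (b n)" "\<And>n. norm (a n) \<le> norm (x n)"
    "\<And>n. norm (\<rho>' n) \<le> norm (x n)" "\<And>n. norm (b n) \<le> norm (x n)" by metis
  have sm: "summable f \<and> norm (suminf f) \<le> norm \<rho> + \<epsilon>" if "\<And>n. norm (f n) \<le> norm (x n)" for f :: "nat \<Rightarrow> 'h tc"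
  proof -
    have fM: "norm (f n) \<le> M n" for n using that[of n] xM[of n] by linarith
    have s: "summable (\<lambda>n. norm (f n))"
      by (rule summable_comparison_test'[OF sums_summable[OF Msums], of 0]) (use fM in simp)
    have "norm (suminf f) \<le> (\<Sum>n. norm (f n))" by (rule summable_norm[OF s])
    also have "\<dots> \<le> suminf M" by (rule suminf_le[OF fM s sums_summable[OF Msums]])
    also have "\<dots> = norm \<rho> + \<epsilon>" using sums_unique[OF Msums] by (simp add: M_def)
    finally show ?thesis using summable_norm_cancel[OF s] by blast
  qed
  have lim: "(\<lambda>n. \<Sum>k<Suc n. f k) \<longlonglongrightarrow> suminf f" if "\<And>n. norm (f n) \<le> norm (x n)" for f :: "nat \<Rightarrow> 'h tc"
    using LIMSEQ_Suc[OF summable_LIMSEQ] sm[OF that] by blast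
  have "\<sigma> \<longlonglongrightarrow> \<rho>"
  proof (rule Lim_transform2[OF tendsto_const])
    show "(\<lambda>n. \<rho> - \<sigma> n) \<longlonglongrightarrow> 0"
    proof (rule Lim_null_comparison)
      show "\<forall>\<^sub>F n in sequentially. norm (\<rho> - \<sigma> n) \<le> \<epsilon> / 4 * (1/2)^n" using \<sigma>(2) by simp
      show "(\<lambda>n. \<epsilon> / 4 * (1/2)^n) \<longlonglongrightarrow> 0"
        by (intro tendsto_mult_right_zero LIMSEQ_power_zero) simp
    qed
  qed
  then have "(\<lambda>n. \<Sum>k<Suc n. x k) \<longlonglongrightarrow> \<rho>" unfolding part .
  then have "block2_pos (suminf a) \<rho> (suminf \<rho>') (suminf b)"
    by (rule block2_pos_limit[OF block2_pos_sum[OF ab(1)] lim[OF ab(2)] _ lim[OF ab(3)] lim[OF ab(4)]])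
  then show ?thesis using that sm[of a] sm[of b] ab(2,4) by blast
qed

end

section \<open>Completely positive trace preserving maps as contractions\<close>

definition tc_map :: "(('h::chilbert \<Rightarrow> 'h) \<Rightarrow> 'h \<Rightarrow> 'h) \<Rightarrow> 'h tc \<Rightarrow> 'h tc" where
  "tc_map \<Phi> \<rho> = Abs_tc (\<Phi> (tc_op \<rho>))"

lemma tc_op_tc_map: "tp_cp_map \<Phi> \<Longrightarrow> tc_op (tc_map \<Phi> \<rho>) = \<Phi> (tc_op \<rho>)"
  unfolding tc_map_def by (rule tc_op_Abs) (simp add: tp_cp_map_def)

lemma tc_map_add: "tp_cp_map \<Phi> \<Longrightarrow> tc_map \<Phi> (\<rho> + \<sigma>) = tc_map \<Phi> \<rho> + tc_map \<Phi> \<sigma>"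
  by (rule tc_eqI) (simp add: tc_op_tc_map tc_op_simps tp_cp_map_def plus_tc.rep_eq)

lemma tc_map_cmul: "tp_cp_map \<Phi> \<Longrightarrow> tc_map \<Phi> (cmul c \<rho>) = cmul c (tc_map \<Phi> \<rho>)"
  by (rule tc_eqI) (simp add: tc_op_tc_map tp_cp_map_def cmul.rep_eq)

lemma tr_tc_map: "tp_cp_map \<Phi> \<Longrightarrow> tr (tc_map \<Phi> \<rho>) = tr \<rho>"
  unfolding tr_def tc_op_tc_map by (simp add: tp_cp_map_def)

lemma tc_map_linear: "tp_cp_map \<Phi> \<Longrightarrow> linear (tc_map \<Phi>)"
  by (rule linearI) (auto simp: tc_map_add tc_map_cmul scaleR_cmul)

lemma tc_map_block_positive:
  assumes \<Phi>: "tp_cp_map \<Phi>"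
    and pos: "\<And>x :: nat \<Rightarrow> 'h::chilbert. nonneg_c (\<Sum>i<n. \<Sum>j<n. cinner (x i) (tc_op (\<rho> i j) (x j)))"
  shows "nonneg_c (\<Sum>i<n. \<Sum>j<n. cinner (x i) (tc_op (tc_map \<Phi> (\<rho> i j)) (x j)))"
proof -
  have "completely_positive \<Phi>" using \<Phi> by (simp add: tp_cp_map_def)
  moreover have "block_positive n (\<lambda>i j. tc_op (\<rho> i j))"
    using pos by (simp add: block_positive_def nonneg_c_def)
  ultimately have "block_positive n (\<lambda>i j. \<Phi> (tc_op (\<rho> i j)))"
    unfolding completely_positive_def by simp
  then show ?thesis by (simp add: block_positive_def nonneg_c_def tc_op_tc_map[OF \<Phi>])
qed

lemma tc_map_block2:
  assumes \<Phi>: "tp_cp_map \<Phi>" and pos: "block2_pos a \<rho> \<rho>' b"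
  shows "block2_pos (tc_map \<Phi> a) (tc_map \<Phi> \<rho>) (tc_map \<Phi> \<rho>') (tc_map \<Phi> b)"
  unfolding block2_pos_def
proof (intro allI)
  fix x y
  define R where "R i j = (if i = 0 then (if j = 0 then a else \<rho>) else (if j = 0 then \<rho>' else b))" for i j :: nat
  have "nonneg_c (\<Sum>i<2. \<Sum>j<2. cinner (v i) (tc_op (R i j) (v j)))" for v :: "nat \<Rightarrow> 'a"
    using pos[unfolded block2_pos_def, rule_format, of "v 0" "v 1"]
    by (simp add: numeral_2_eq_2 R_def add.assoc)
  from tc_map_block_positive[OF \<Phi> this, of "\<lambda>i. if i = 0 then x else y"]
  show "nonneg_c (cinner x (tc_op (tc_map \<Phi> a) x) + cinner x (tc_op (tc_map \<Phi> \<rho>) y) + cinner y (tc_op (tc_map \<Phi> \<rho>') x) + cinner y (tc_op (tc_map \<Phi> b) y))"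
    by (simp add: numeral_2_eq_2 R_def add.assoc)
qed

lemma block2_pos_bounds:
  assumes "block2_pos a \<rho> \<rho>' b"
  shows "tc_pos a" "tc_pos b"
    "cinner y (tc_op \<rho>' x) = cnj (cinner x (tc_op \<rho> y))"
    "2 * cmod (cinner x (tc_op \<rho> y)) \<le> Re (cinner x (tc_op a x)) + Re (cinner y (tc_op b y))"
proof -
  have z: "tc_op s 0 = 0" for s :: "'a tc" by (rule clinear_0[OF tc_clinear])
  show a: "tc_pos a" unfolding tc_pos_def
    using assms[unfolded block2_pos_def, rule_format, of _ 0] by (simp add: z)
  show b: "tc_pos b" unfolding tc_pos_def
    using assms[unfolded block2_pos_def, rule_format, of 0] by (simp add: z)
  have nn: "nonneg_c (cinner x (tc_op a x) + u * cinner x (tc_op \<rho> y) + cnj u * cinner y (tc_op \<rho>' x) + cinner y (tc_op b y))"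
    if u: "cmod u = 1" for u
  proof -
    have "u * cnj u = 1" using complex_norm_square[of u] u by simp
    then have uu: "u * (cnj u * z) = z" "cnj u * (u * z) = z" for z by (simp_all add: mult.assoc[symmetric] mult.commute)
    show ?thesis using assms[unfolded block2_pos_def, rule_format, of x "u *\<^sub>C y"]
      by (simp add: clinear_scaleC[OF tc_clinear] cinner_lin uu)
  qed
  have im: "Im (cinner x (tc_op a x)) = 0" "Im (cinner y (tc_op b y)) = 0"
    using a b by (auto simp: tc_pos_def nonneg_c_def)
  show "cinner y (tc_op \<rho>' x) = cnj (cinner x (tc_op \<rho> y))"
    "2 * cmod (cinner x (tc_op \<rho> y)) \<le> Re (cinner x (tc_op a x)) + Re (cinner y (tc_op b y))"
    by (rule nonneg_form_offdiagonal[OF nn im]; assumption?)+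
qed

text \<open>Embed \<rho> as a corner of a positive block with diagonal norms at most the norm of
  \<rho> plus \<epsilon>. The entrywise image under \<Phi> is again positive and has diagonal
  entries of the same traces, which bound the corner.\<close>

lemma tc_map_contraction:
  fixes \<rho> :: "'h::chilbert tc"
  assumes onb: "has_onb TYPE('h)" and \<Phi>: "tp_cp_map \<Phi>"
  shows "norm (tc_map \<Phi> \<rho>) \<le> norm \<rho>"
proof (rule field_le_epsilon)
  fix \<epsilon> :: real assume "\<epsilon> > 0"
  then obtain a \<rho>' b where ab: "block2_pos a \<rho> \<rho>' b" "norm a \<le> norm \<rho> + \<epsilon>" "norm b \<le> norm \<rho> + \<epsilon>"
    using ex_block2[OF onb, of \<epsilon> \<rho>] by metis
  note bp = block2_pos_bounds[OF tc_map_block2[OF \<Phi> ab(1)]]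
  have "norm (tc_map \<Phi> \<rho>) \<le> (Re (tr (tc_map \<Phi> a)) + Re (tr (tc_map \<Phi> b))) / 2"
    by (rule norm_le_diagonal_blocks[OF onb bp(1,2,4)])
  also have "\<dots> = (Re (tr a) + Re (tr b)) / 2" by (simp add: tr_tc_map[OF \<Phi>])
  also have "\<dots> \<le> (norm a + norm b) / 2"
    by (intro divide_right_mono add_mono order_trans[OF complex_Re_le_cmod tr_norm[OF onb]]) simp
  also have "\<dots> \<le> norm \<rho> + \<epsilon>" using ab by simp
  finally show "norm (tc_map \<Phi> \<rho>) \<le> norm \<rho> + \<epsilon>" .
qed

section \<open>Contraction semigroups and their generators\<close>

text \<open>Serves twice: for the dynamical semigroup on trace class operators and for the semigroup
  generated by -M on the Hilbert space.\<close>

locale contraction_semigroup =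
  fixes U :: "real \<Rightarrow> 'x::real_normed_vector \<Rightarrow> 'x"
  assumes lin: "t \<ge> 0 \<Longrightarrow> linear (U t)"
    and contr: "t \<ge> 0 \<Longrightarrow> norm (U t x) \<le> norm x"
    and zero: "U 0 x = x"
    and add: "s \<ge> 0 \<Longrightarrow> t \<ge> 0 \<Longrightarrow> U (s + t) x = U s (U t x)"
    and cont: "((\<lambda>t. U t x) \<longlongrightarrow> x) (at_right 0)"
begin

text \<open>The generator as a graph, so that each statement about its value also carries membership
  in the domain.\<close>

definition gens :: "'x \<Rightarrow> 'x \<Rightarrow> bool" where
  "gens x y \<longleftrightarrow> ((\<lambda>t. (1 / t) *\<^sub>R (U t x - x)) \<longlongrightarrow> y) (at_right 0)"

lemma pos_eventually: "\<forall>\<^sub>F t in at_right (0::real). t > 0"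
  by (simp add: eventually_at_right_less)

lemma bl: "t \<ge> 0 \<Longrightarrow> bounded_linear (U t)"
  using lin[of t] contr[of t]
  by (intro bounded_linear_intro[where K = 1]) (auto simp: linear_add linear_scale)

lemma commute: "s \<ge> 0 \<Longrightarrow> t \<ge> 0 \<Longrightarrow> U s (U t x) = U t (U s x)"
  by (metis add add.commute)

lemma gens_unique: "gens x y \<Longrightarrow> gens x z \<Longrightarrow> y = z"
  unfolding gens_def by (rule tendsto_unique[rotated]) auto

lemma gens_add:
  assumes "gens x y" "gens x' y'" shows "gens (x + x') (y + y')"
proof -
  have "\<forall>\<^sub>F t in at_right 0. (1 / t) *\<^sub>R (U t x - x) + (1 / t) *\<^sub>R (U t x' - x') = (1 / t) *\<^sub>R (U t (x + x') - (x + x'))"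
    using pos_eventually by eventually_elim (simp add: linear_add[OF lin] algebra_simps)
  then show ?thesis unfolding gens_def
    using tendsto_add[OF assms[unfolded gens_def]] by (rule Lim_transform_eventually[rotated])
qed

text \<open>A bounded operator commuting with the semigroup maps the graph of the generator into
  itself. Instances are real and complex multiples and the semigroup operators themselves.\<close>

lemma gens_linear_map:
  assumes "gens x y" and f: "bounded_linear f" and comm: "\<And>t z. t > 0 \<Longrightarrow> U t (f z) = f (U t z)"
  shows "gens (f x) (f y)"
proof -
  have "\<forall>\<^sub>F t in at_right 0. f ((1 / t) *\<^sub>R (U t x - x)) = (1 / t) *\<^sub>R (U t (f x) - f x)"
    using pos_eventually
    by eventually_elim (simp add: comm bounded_linear.linear[OF f] linear_scale linear_diff)
  then show ?thesis unfolding gens_def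
    using bounded_linear.tendsto[OF f assms(1)[unfolded gens_def]] by (rule Lim_transform_eventually[rotated])
qed

lemma gens_scaleR: "gens x y \<Longrightarrow> gens (r *\<^sub>R x) (r *\<^sub>R y)"
  by (rule gens_linear_map[OF _ bounded_linear_scaleR_right]) (auto simp: linear_scale[OF lin])

lemma gens_invariant: "gens x y \<Longrightarrow> s \<ge> 0 \<Longrightarrow> gens (U s x) (U s y)"
  by (rule gens_linear_map[OF _ bl]) (auto intro: commute)

lemma gens_zero: "gens 0 0"
  unfolding gens_def
  by (rule Lim_transform_eventually[OF tendsto_const])
     (use pos_eventually in eventually_elim, simp add: linear_0[OF lin])

lemma gens_diff: "gens x y \<Longrightarrow> gens x' y' \<Longrightarrow> gens (x - x') (y - y')"
  using gens_add[of x y "(-1) *\<^sub>R x'" "(-1) *\<^sub>R y'"] gens_scaleR[of x' y' "-1"] by simp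

lemma gens_sum: "(\<And>i. i \<in> I \<Longrightarrow> gens (x i) (y i)) \<Longrightarrow> gens (\<Sum>i\<in>I. x i) (\<Sum>i\<in>I. y i)"
  by (induction I rule: infinite_finite_induct) (auto intro: gens_zero gens_add)

text \<open>Before the limit the right side is the norm of (1 + h/t) x - (h/t) U t x, which
  contractivity bounds below by (1 + h/t - h/t) |x|.\<close>

lemma gens_dissipative:
  assumes g: "gens x y" and h: "h \<ge> 0" shows "norm x \<le> norm (x - h *\<^sub>R y)"
proof (rule tendsto_lowerbound)
  show "((\<lambda>t. norm (x - h *\<^sub>R ((1 / t) *\<^sub>R (U t x - x)))) \<longlongrightarrow> norm (x - h *\<^sub>R y)) (at_right 0)"
    using g unfolding gens_def by (intro tendsto_intros)
  show "\<forall>\<^sub>F t in at_right 0. norm x \<le> norm (x - h *\<^sub>R ((1 / t) *\<^sub>R (U t x - x)))"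
    using pos_eventually
  proof eventually_elim
    case (elim t)
    have "x - h *\<^sub>R ((1 / t) *\<^sub>R (U t x - x)) = (1 + h / t) *\<^sub>R x - (h / t) *\<^sub>R U t x"
      by (simp add: algebra_simps)
    moreover have "norm ((1 + h / t) *\<^sub>R x) - norm ((h / t) *\<^sub>R U t x) \<le> norm ((1 + h / t) *\<^sub>R x - (h / t) *\<^sub>R U t x)"
      by (rule norm_triangle_ineq2)
    moreover have "norm ((h / t) *\<^sub>R U t x) \<le> (h / t) * norm x"
      using elim h contr[of t x] by (simp add: divide_right_mono mult_left_mono)
    moreover have "norm ((1 + h / t) *\<^sub>R x) = (1 + h / t) * norm x" using elim h by simp
    ultimately show ?case by (simp add: algebra_simps)
  qed
qed simp

lemma inverse_Suc_at_right: "t > 0 \<Longrightarrow> filterlim (\<lambda>n. t / real (Suc n)) (at_right 0) sequentially"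
proof (rule tendsto_imp_filterlim_at_right)
  show "(\<lambda>n. t / real (Suc n)) \<longlonglongrightarrow> 0"
    using tendsto_mult[OF tendsto_const[of t] LIMSEQ_inverse_real_of_nat] by (simp add: divide_inverse)
qed auto

lemma U_telescope: "t \<ge> 0 \<Longrightarrow> (\<Sum>j<n. U (real j * t) (U t x - x)) = U (real n * t) x - x"
proof (induction n)
  case (Suc n)
  have "U (real n * t) (U t x) = U (real (Suc n) * t) x"
    using Suc.prems add[of "real n * t" t x] by (simp add: algebra_simps)
  then show ?case using Suc by (simp add: linear_diff[OF lin])
qed (simp add: zero)

text \<open>Stands in for writing U t x - x as the integral of U s y: the increment is a sum over
  equal steps of difference quotients, which tend to \<open>y\<close> as the steps shrink.\<close>

lemma gens_mean_value:
  assumes g: "gens x y" and t: "t > 0" and C: "\<And>s. 0 \<le> s \<Longrightarrow> s \<le> t \<Longrightarrow> norm (U s y - w) \<le> C"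
  shows "norm (U t x - x - t *\<^sub>R w) \<le> t * C"
proof (rule LIMSEQ_le_const)
  define d where "d n = (1 / (t / real (Suc n))) *\<^sub>R (U (t / real (Suc n)) x - x)" for n
  have "d \<longlonglongrightarrow> y" unfolding d_def
    using filterlim_compose[OF g[unfolded gens_def] inverse_Suc_at_right[OF t]] .
  then have "(\<lambda>n. t * (norm (d n - y) + C)) \<longlonglongrightarrow> t * (norm (y - y) + C)" by (intro tendsto_intros)
  then show "(\<lambda>n. t * (norm (d n - y) + C)) \<longlonglongrightarrow> t * C" by simp
  have "norm (U t x - x - t *\<^sub>R w) \<le> t * (norm (d n - y) + C)" for n
  proof -
    define \<delta> where "\<delta> = t / real (Suc n)"
    have \<delta>: "\<delta> > 0" and n\<delta>: "real (Suc n) * \<delta> = t" using t by (simp_all add: \<delta>_def)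
    have d: "d n = (1 / \<delta>) *\<^sub>R (U \<delta> x - x)" by (simp only: d_def \<delta>_def)
    have "U t x - x = (\<Sum>j<Suc n. U (real j * \<delta>) (U \<delta> x - x))"
      using U_telescope[where t = \<delta> and n = "Suc n" and x = x] \<delta> unfolding n\<delta> by simp
    also have "\<dots> = (\<Sum>j<Suc n. \<delta> *\<^sub>R U (real j * \<delta>) (d n))"
    proof (intro sum.cong refl)
      fix j
      have "U \<delta> x - x = \<delta> *\<^sub>R d n" using \<delta> by (simp add: d)
      moreover have "linear (U (real j * \<delta>))" using \<delta> by (intro lin mult_nonneg_nonneg) auto
      ultimately show "U (real j * \<delta>) (U \<delta> x - x) = \<delta> *\<^sub>R U (real j * \<delta>) (d n)"
        by (simp only: linear_scale)
    qed
    finally have 1: "U t x - x = (\<Sum>j<Suc n. \<delta> *\<^sub>R U (real j * \<delta>) (d n))" .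
    have 2: "t *\<^sub>R w = (\<Sum>j<Suc n. \<delta> *\<^sub>R w)" by (simp only: scaleR_sum_left[symmetric] sum_constant card_lessThan n\<delta>)
    have "U t x - x - t *\<^sub>R w = (\<Sum>j<Suc n. \<delta> *\<^sub>R (U (real j * \<delta>) (d n) - w))"
      unfolding 1 2 by (simp only: sum_subtractf[symmetric] scaleR_diff_right)
    also have "norm \<dots> \<le> (\<Sum>j<Suc n. \<delta> * (norm (d n - y) + C))"
    proof (rule sum_norm_le)
      fix j assume j: "j \<in> {..<Suc n}"
      let ?s = "real j * \<delta>"
      have "real j * \<delta> \<le> real (Suc n) * \<delta>" using j \<delta> by (intro mult_right_mono) auto
      then have s: "0 \<le> ?s" "?s \<le> t" using \<delta> unfolding n\<delta> by auto
      have "U ?s (d n) - w = U ?s (d n - y) + (U ?s y - w)" using s by (simp add: linear_diff[OF lin])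
      also have "norm \<dots> \<le> norm (d n - y) + C"
        using contr[OF s(1), of "d n - y"] C[OF s] by (intro norm_triangle_mono)
      finally show "norm (\<delta> *\<^sub>R (U ?s (d n) - w)) \<le> \<delta> * (norm (d n - y) + C)"
        using \<delta> by (simp add: mult_left_mono)
    qed
    also have "\<dots> = t * (norm (d n - y) + C)" by (simp only: sum_constant card_lessThan mult.assoc[symmetric] n\<delta>)
    finally show ?thesis .
  qed
  then show "\<exists>N. \<forall>n\<ge>N. norm (U t x - x - t *\<^sub>R w) \<le> t * (norm (d n - y) + C)" by blast
qed

text \<open>The mean value estimate for \<open>X n\<close>, compared with the fixed vector
  \<open>y\<close>, has an error governed by Y n - y and by the continuity of U s y at zero. It
  passes to the limit in \<open>n\<close> for each fixed \<open>t\<close>.\<close>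

lemma gens_closed:
  assumes g: "\<And>n::nat. gens (X n) (Y n)" and X: "X \<longlonglongrightarrow> x" and Y: "Y \<longlonglongrightarrow> y"
  shows "gens x y"
  unfolding gens_def tendsto_iff
proof (intro allI impI)
  fix e :: real assume e: "e > 0"
  have "\<forall>\<^sub>F t in at_right 0. dist (U t y) y < e / 2"
    using cont[of y] e unfolding tendsto_iff by (meson half_gt_zero)
  then obtain b where b: "b > 0" "\<And>s. 0 < s \<Longrightarrow> s < b \<Longrightarrow> dist (U s y) y < e / 2"
    unfolding eventually_at_right_field by auto
  have *: "dist ((1 / t) *\<^sub>R (U t x - x)) y < e" if t: "0 < t" "t < b" for t
  proof -
    have "norm (U t x - x - t *\<^sub>R y) \<le> t * (0 + e / 2)"
    proof (rule LIMSEQ_le)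
      show "(\<lambda>n. norm (U t (X n) - X n - t *\<^sub>R y)) \<longlonglongrightarrow> norm (U t x - x - t *\<^sub>R y)"
        using t by (intro tendsto_intros X bounded_linear.tendsto[OF bl]) auto
      have "(\<lambda>n. t * (norm (Y n - y) + e / 2)) \<longlonglongrightarrow> t * (norm (y - y) + e / 2)"
        by (intro tendsto_intros Y)
      then show "(\<lambda>n. t * (norm (Y n - y) + e / 2)) \<longlonglongrightarrow> t * (0 + e / 2)" by simp
      have "norm (U t (X n) - X n - t *\<^sub>R y) \<le> t * (norm (Y n - y) + e / 2)" for n
      proof (rule gens_mean_value[OF g t(1)])
        fix s assume s: "0 \<le> s" "s \<le> t"
        have "norm (U s y - y) \<le> e / 2"
          using b(2)[of s] s t zero[of y] e by (cases "s = 0") (auto simp: dist_norm)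
        moreover have "U s (Y n) - y = U s (Y n - y) + (U s y - y)" using s by (simp add: linear_diff[OF lin])
        ultimately show "norm (U s (Y n) - y) \<le> norm (Y n - y) + e / 2"
          using contr[OF s(1), of "Y n - y"] by (simp only: norm_triangle_mono)
      qed
      then show "\<exists>N. \<forall>n\<ge>N. norm (U t (X n) - X n - t *\<^sub>R y) \<le> t * (norm (Y n - y) + e / 2)" by blast
    qed
    moreover have "(1 / t) *\<^sub>R (U t x - x) - y = (1 / t) *\<^sub>R (U t x - x - t *\<^sub>R y)"
      using t by (simp add: algebra_simps)
    ultimately have "dist ((1 / t) *\<^sub>R (U t x - x)) y \<le> (1 / t) * (t * (e / 2))"
      using t unfolding dist_norm by (simp only: norm_scaleR add_0_left) (simp add: pos_divide_le_eq mult.commute)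
    also have "\<dots> < e" using t e by simp
    finally show ?thesis .
  qed
  show "\<forall>\<^sub>F t in at_right 0. dist ((1 / t) *\<^sub>R (U t x - x)) y < e"
    unfolding eventually_at_right_field using b(1) * by blast
qed

text \<open>A Riemann sum for \<open>(1/h) \<integral> exp(-t/h) U t x dt\<close>, with the geometric weights chosen so that
  \<open>z - h w\<close> telescopes up to the error of the difference quotient.\<close>
lemma gens_approx_resolvent:
  assumes g: "gens x y" and h: "h > 0" and e: "e > 0"
  shows "\<exists>z w. gens z w \<and> norm (z - h *\<^sub>R w - x) < e"
proof -
  \<comment> \<open>The weights turn an error \<eta> in the difference quotient into at most h
    \<eta> = e/2 in the resolvent equation.\<close>
  define \<eta> where "\<eta> = e / (2 * h)"
  have \<eta>: "\<eta> > 0" using h e by (simp add: \<eta>_def)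
  have "\<forall>\<^sub>F t in at_right 0. dist ((1 / t) *\<^sub>R (U t x - x)) y < \<eta>"
    using g \<eta> unfolding gens_def tendsto_iff by blast
  then have "\<forall>\<^sub>F t in at_right 0. dist ((1 / t) *\<^sub>R (U t x - x)) y < \<eta> \<and> t > 0"
    using pos_eventually by eventually_elim simp
  then obtain \<delta> where d: "dist ((1 / \<delta>) *\<^sub>R (U \<delta> x - x)) y < \<eta>" "\<delta> > 0"
    using eventually_happens trivial_limit_at_right_real by blast
  define v where "v = (1 / \<delta>) *\<^sub>R (U \<delta> x - x)"
  \<comment> \<open>1/(1 + \<delta>/h), the discrete counterpart of exp(-\<delta>/h).\<close>
  define q where "q = h / (h + \<delta>)"
  have q: "0 < q" "q < 1" using h d by (simp_all add: q_def)
  have "(\<lambda>n. q ^ n * norm x) \<longlonglongrightarrow> 0"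
    by (intro tendsto_mult_left_zero LIMSEQ_power_zero) (use q in simp)
  then have "\<forall>\<^sub>F n in sequentially. q ^ n * norm x < e / 2"
    using order_tendstoD(2)[of _ 0 sequentially "e / 2"] e by simp
  then obtain n where n: "q ^ n * norm x < e / 2" unfolding eventually_sequentially by blast
  define z where "z = (\<Sum>j<n. (\<delta> / h * q ^ Suc j) *\<^sub>R U (real j * \<delta>) x)"
  define w where "w = (\<Sum>j<n. (\<delta> / h * q ^ Suc j) *\<^sub>R U (real j * \<delta>) y)"
  have "gens z w" unfolding z_def w_def
    by (intro gens_sum gens_scaleR gens_invariant g) (use d in simp)
  moreover have "norm (z - h *\<^sub>R w - x) < e"
  proof -
    \<comment> \<open>It telescopes because (\<delta>/h) (x - h v) = x/q - U \<delta> x, and each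
      further factor \<open>q\<close> matches one more step of length \<delta>.\<close>
    have tel: "(\<Sum>j<m. (\<delta> / h * q ^ Suc j) *\<^sub>R U (real j * \<delta>) (x - h *\<^sub>R v)) = x - q ^ m *\<^sub>R U (real m * \<delta>) x" for m
    proof (induction m)
      case 0 then show ?case by (simp add: zero)
    next
      case (Suc m)
      have "(\<delta> / h) *\<^sub>R (x - h *\<^sub>R v) = (1 / q) *\<^sub>R x - U \<delta> x"
        using h d by (simp add: v_def q_def algebra_simps add_divide_distrib)
      moreover have "U (real m * \<delta>) ((1 / q) *\<^sub>R x - U \<delta> x) = (1 / q) *\<^sub>R U (real m * \<delta>) x - U (real (Suc m) * \<delta>) x"
        using d add[of "real m * \<delta>" \<delta> x] by (simp add: linear_diff[OF lin] linear_scale[OF lin] algebra_simps)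
      ultimately have "(\<delta> / h) *\<^sub>R U (real m * \<delta>) (x - h *\<^sub>R v) = (1 / q) *\<^sub>R U (real m * \<delta>) x - U (real (Suc m) * \<delta>) x"
        using d by (metis lin linear_scale less_imp_le mult_nonneg_nonneg of_nat_0_le_iff)
      then have "q ^ Suc m *\<^sub>R ((\<delta> / h) *\<^sub>R U (real m * \<delta>) (x - h *\<^sub>R v)) = q ^ m *\<^sub>R U (real m * \<delta>) x - q ^ Suc m *\<^sub>R U (real (Suc m) * \<delta>) x"
        using q by (simp add: scaleR_diff_right)
      then show ?case using Suc by (simp add: mult.commute del: of_nat_Suc power_Suc)
    qed
    have "z - h *\<^sub>R w = (\<Sum>j<n. (\<delta> / h * q ^ Suc j) *\<^sub>R U (real j * \<delta>) (x - h *\<^sub>R y))"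
      unfolding z_def w_def using d
      by (simp add: linear_diff[OF lin] linear_scale[OF lin] scaleR_sum_right sum_subtractf scaleR_diff_right mult.commute mult.left_commute)
    also have "\<dots> = (\<Sum>j<n. (\<delta> / h * q ^ Suc j) *\<^sub>R U (real j * \<delta>) (x - h *\<^sub>R v)) + (\<Sum>j<n. (\<delta> / h * q ^ Suc j) *\<^sub>R U (real j * \<delta>) (h *\<^sub>R (v - y)))"
      unfolding sum.distrib[symmetric] using d
      by (intro sum.cong refl) (simp add: scaleR_add_right[symmetric] linear_add[OF lin, symmetric] algebra_simps)
    finally have "z - h *\<^sub>R w - x = (\<Sum>j<n. (\<delta> / h * q ^ Suc j) *\<^sub>R U (real j * \<delta>) (h *\<^sub>R (v - y))) - q ^ n *\<^sub>R U (real n * \<delta>) x"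
      unfolding tel by simp
    then have "norm (z - h *\<^sub>R w - x) \<le> norm (\<Sum>j<n. (\<delta> / h * q ^ Suc j) *\<^sub>R U (real j * \<delta>) (h *\<^sub>R (v - y))) + norm (q ^ n *\<^sub>R U (real n * \<delta>) x)"
      by (simp only: norm_triangle_ineq4)
    also have "norm (q ^ n *\<^sub>R U (real n * \<delta>) x) \<le> q ^ n * norm x"
      using q d contr[of "real n * \<delta>" x] by (simp add: mult_left_mono)
    also have "norm (\<Sum>j<n. (\<delta> / h * q ^ Suc j) *\<^sub>R U (real j * \<delta>) (h *\<^sub>R (v - y))) \<le> (\<Sum>j<n. \<delta> / h * q ^ Suc j * (h * \<eta>))"
    proof (rule sum_norm_le)
      fix j
      have "norm (U (real j * \<delta>) (h *\<^sub>R (v - y))) \<le> norm (h *\<^sub>R (v - y))" using d by (intro contr) simp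
      also have "\<dots> \<le> h * \<eta>" using h d(1) by (simp add: v_def dist_norm)
      finally show "norm ((\<delta> / h * q ^ Suc j) *\<^sub>R U (real j * \<delta>) (h *\<^sub>R (v - y))) \<le> \<delta> / h * q ^ Suc j * (h * \<eta>)"
        using q h d unfolding norm_scaleR by (intro mult_mono) (auto simp: abs_mult)
    qed
    also have "\<dots> = \<delta> * \<eta> * q * (\<Sum>j<n. q ^ j)"
      using h by (simp add: sum_distrib_left sum_distrib_right mult_ac)
    also have "\<dots> \<le> \<delta> * \<eta> * q * (1 / (1 - q))"
    proof (intro mult_left_mono)
      have "(\<Sum>j<n. q ^ j) = (1 - q ^ n) / (1 - q)" using q by (simp add: sum_gp_strict)
      also have "\<dots> \<le> 1 / (1 - q)" using q by (intro divide_right_mono) auto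
      finally show "(\<Sum>j<n. q ^ j) \<le> 1 / (1 - q)" .
    qed (use d \<eta> q in auto)
    also have "\<delta> * \<eta> * q * (1 / (1 - q)) = e / 2"
    proof -
      have "1 - q = \<delta> / (h + \<delta>)" using h d by (simp add: q_def field_simps)
      then have "q * (1 / (1 - q)) = h / \<delta>" using h d by (simp add: q_def)
      then have "\<delta> * \<eta> * (q * (1 / (1 - q))) = h * \<eta>" using d by simp
      then show ?thesis using h by (simp add: \<eta>_def mult.assoc)
    qed
    finally show ?thesis using n by linarith
  qed
  ultimately show ?thesis by blast
qed

end

section \<open>Powers of commuting contractions\<close>

lemma clinear_funpow: "clinear A \<Longrightarrow> clinear (A ^^ n)"
  by (induction n) (auto simp: clinear_def)

lemma contraction_funpow:
  fixes A :: "'h::real_normed_vector \<Rightarrow> 'h"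
  assumes A: "\<And>x. norm (A x) \<le> norm x" shows "norm ((A ^^ n) x) \<le> norm x"
proof (induction n)
  case (Suc n)
  have "norm (A ((A ^^ n) x)) \<le> norm ((A ^^ n) x)" by (rule A)
  then show ?case using Suc by simp
qed simp

lemma commute_funpow:
  assumes "\<And>x. A (B x) = B (A x)" shows "(A ^^ m) ((B ^^ n) x) = (B ^^ n) ((A ^^ m) x)"
proof -
  have AB: "A ((B ^^ n) x) = (B ^^ n) (A x)" for x by (induction n) (auto simp: assms)
  show ?thesis by (induction m) (auto simp: AB)
qed

text \<open>The difference of the powers grows by one term of size at most |A x - B x| per factor:
  A^(n+1) - B^(n+1) = A (A^n - B^n) + B^n (A - B), with all factors commuting and
  contractive.\<close>

lemma funpow_diff_bound:
  fixes A B :: "'h::chilbert \<Rightarrow> 'h"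
  assumes A: "clinear A" "\<And>x. norm (A x) \<le> norm x" and B: "clinear B" "\<And>x. norm (B x) \<le> norm x"
    and AB: "\<And>x. A (B x) = B (A x)"
  shows "norm ((A ^^ n) x - (B ^^ n) x) \<le> real n * norm (A x - B x)"
proof (induction n)
  case (Suc n)
  have "(A ^^ Suc n) x - (B ^^ Suc n) x = A ((A ^^ n) x - (B ^^ n) x) + (A ((B ^^ n) x) - B ((B ^^ n) x))"
    by (simp add: clinear_diff[OF A(1)])
  also have "A ((B ^^ n) x) - B ((B ^^ n) x) = (B ^^ n) (A x - B x)"
    using commute_funpow[of A B 1 n x] AB
    by (simp add: clinear_diff[OF clinear_funpow[OF B(1)]] funpow_swap1)
  finally have "norm ((A ^^ Suc n) x - (B ^^ Suc n) x) \<le> norm (A ((A ^^ n) x - (B ^^ n) x)) + norm ((B ^^ n) (A x - B x))"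
    by (simp only: norm_triangle_ineq)
  also have "\<dots> \<le> real n * norm (A x - B x) + norm (A x - B x)"
    by (intro add_mono order_trans[OF A(2) Suc] contraction_funpow B(2))
  finally show ?case by (simp add: algebra_simps)
qed simp

text \<open>A maximal accretive operator in the sense of Lumer and Phillips. Accretivity is given in
  norm form, that 1 + h M is expansive; with surjectivity this makes every resolvent an everywhere
  defined contraction.\<close>

locale accretive_generator =
  fixes D :: "'h::chilbert set" and M :: "'h \<Rightarrow> 'h"
  assumes lin: "clinear_on D M"
    and accretive: "x \<in> D \<Longrightarrow> h > 0 \<Longrightarrow> norm x \<le> norm (x + h *\<^sub>R M x)"
    and onto: "h > 0 \<Longrightarrow> \<exists>x\<in>D. x + h *\<^sub>R M x = y"
    and dense: "closure D = UNIV"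
begin

lemma D: "csubspace D"
  and M_add: "x \<in> D \<Longrightarrow> y \<in> D \<Longrightarrow> M (x + y) = M x + M y"
  and M_scaleC: "x \<in> D \<Longrightarrow> M (c *\<^sub>C x) = c *\<^sub>C M x"
  using lin by (auto simp: clinear_on_def)

lemma M_scaleR: "x \<in> D \<Longrightarrow> M (r *\<^sub>R x) = r *\<^sub>R M x"
  by (simp add: scaleR_scaleC M_scaleC)

lemma M_diff: "x \<in> D \<Longrightarrow> y \<in> D \<Longrightarrow> M (x - y) = M x - M y"
  using M_add[of x "(-1) *\<^sub>C y"] M_scaleC[of y "-1"] csubspace_neg[OF D, of y] by simp

text \<open>The resolvent of \<open>M\<close>, i.e. one backward Euler step of length
  \<open>h\<close>. The identity at \<open>h = 0\<close> lets the later estimates include time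
  zero.\<close>

definition R :: "real \<Rightarrow> 'h \<Rightarrow> 'h" where
  "R h y = (if h = 0 then y else (SOME x. x \<in> D \<and> x + h *\<^sub>R M x = y))"

lemma R_D: "h > 0 \<Longrightarrow> R h y \<in> D" and R_eq: "h > 0 \<Longrightarrow> R h y + h *\<^sub>R M (R h y) = y"
  using someI_ex[of "\<lambda>x. x \<in> D \<and> x + h *\<^sub>R M x = y"] onto[of h y] by (auto simp: R_def)

lemma R_0 [simp]: "R 0 y = y"
  by (simp add: R_def)

lemma R_inverse:
  assumes h: "h \<ge> 0" and x: "x \<in> D" shows "R h (x + h *\<^sub>R M x) = x"
proof (cases "h = 0")
  case False
  with h have h: "h > 0" by simp
  let ?r = "R h (x + h *\<^sub>R M x)"
  have "norm (?r - x) \<le> norm ((?r - x) + h *\<^sub>R M (?r - x))"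
    by (intro accretive csubspace_diff D R_D h x)
  also have "(?r - x) + h *\<^sub>R M (?r - x) = (?r + h *\<^sub>R M ?r) - (x + h *\<^sub>R M x)"
    using R_D[OF h] x by (simp add: M_diff scaleR_diff_right)
  also have "\<dots> = 0" using R_eq[OF h] by simp
  finally show ?thesis by simp
qed simp

lemma R_unique: "h \<ge> 0 \<Longrightarrow> x \<in> D \<Longrightarrow> x + h *\<^sub>R M x = y \<Longrightarrow> R h y = x"
  using R_inverse by blast

lemma R_add: "h \<ge> 0 \<Longrightarrow> R h (x + y) = R h x + R h y"
proof (cases "h = 0")
  case False
  assume "h \<ge> 0"
  with False have h: "h > 0" by simp
  have "R h x + R h y + h *\<^sub>R M (R h x + R h y) = (R h x + h *\<^sub>R M (R h x)) + (R h y + h *\<^sub>R M (R h y))"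
    using R_D[OF h] by (simp add: M_add scaleR_add_right)
  then have "R h x + R h y + h *\<^sub>R M (R h x + R h y) = x + y" using R_eq[OF h] by simp
  then show ?thesis using h by (intro R_unique csubspace_add D R_D) auto
qed simp

lemma R_scaleC: "h \<ge> 0 \<Longrightarrow> R h (c *\<^sub>C x) = c *\<^sub>C R h x"
proof (cases "h = 0")
  case False
  assume "h \<ge> 0"
  with False have h: "h > 0" by simp
  have "c *\<^sub>C R h x + h *\<^sub>R M (c *\<^sub>C R h x) = c *\<^sub>C (R h x + h *\<^sub>R M (R h x))"
    using R_D[OF h] by (simp add: M_scaleC scaleC_add_right scaleR_scaleC mult.commute)
  then have "c *\<^sub>C R h x + h *\<^sub>R M (c *\<^sub>C R h x) = c *\<^sub>C x" using R_eq[OF h] by simp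
  then show ?thesis using h by (intro R_unique csubspace_scale D R_D) auto
qed simp

lemma R_clinear: "h \<ge> 0 \<Longrightarrow> clinear (R h)"
  by (simp add: clinear_def R_add R_scaleC)

lemma R_contr: "h \<ge> 0 \<Longrightarrow> norm (R h x) \<le> norm x"
  using accretive[of "R h x" h] R_D[of h x] R_eq[of h x] by (cases "h = 0") auto

lemma MR: "h > 0 \<Longrightarrow> M (R h x) = (1 / h) *\<^sub>R (x - R h x)"
proof -
  assume h: "h > 0"
  have "h *\<^sub>R M (R h x) = x - R h x" using R_eq[OF h, of x] by (simp add: algebra_simps)
  then have "(1 / h) *\<^sub>R (h *\<^sub>R M (R h x)) = (1 / h) *\<^sub>R (x - R h x)" by simp
  then show ?thesis using h by simp
qed

lemma R_invariant: "h \<ge> 0 \<Longrightarrow> x \<in> D \<Longrightarrow> R h x \<in> D"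
  by (cases "h = 0") (auto intro: R_D)

lemma MR_commute:
  assumes h: "h \<ge> 0" and x: "x \<in> D" shows "M (R h x) = R h (M x)"
proof (cases "h = 0")
  case False
  with h have h0: "h > 0" by simp
  have "x = R h x + h *\<^sub>R R h (M x)"
    using R_inverse[OF h x] by (simp add: R_add[OF h] scaleR_scaleC R_scaleC[OF h])
  then have "h *\<^sub>R R h (M x) = x - R h x" by (simp add: algebra_simps)
  then have "(1 / h) *\<^sub>R (h *\<^sub>R R h (M x)) = (1 / h) *\<^sub>R (x - R h x)" by simp
  then show ?thesis using MR[OF h0] h0 by simp
qed simp

lemma R_commute:
  assumes a: "a \<ge> 0" and b: "b \<ge> 0" shows "R a (R b x) = R b (R a x)"
proof (cases "a = 0 \<or> b = 0")
  case False
  with a b have ab: "a > 0" "b > 0" by auto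
  let ?u = "R b (R a x)"
  have "?u + a *\<^sub>R M ?u = R b (R a x + a *\<^sub>R M (R a x))"
    using MR_commute[OF b R_D[OF ab(1)], of x] by (simp add: R_add[OF b] scaleR_scaleC R_scaleC[OF b])
  also have "\<dots> = R b x" by (simp add: R_eq[OF ab(1)])
  finally show ?thesis using ab by (intro R_unique R_D) auto
qed auto

text \<open>The domain of M^2, where errors of second order in the step length can be
  expressed.\<close>

definition D2 :: "'h set" where "D2 = {x \<in> D. M x \<in> D}"

lemma R_D2: "h > 0 \<Longrightarrow> x \<in> D \<Longrightarrow> R h x \<in> D2"
  by (auto simp: D2_def R_D MR_commute)

text \<open>Because \<open>(1 + a M)(1 + b M) = 1 + (a + b) M + a b M\<^sup>2\<close>. This drives the convergence of the Euler
  scheme and the semigroup law.\<close>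
lemma R_product_estimate:
  assumes a: "a \<ge> 0" and b: "b \<ge> 0" and x: "x \<in> D2"
  shows "norm (R (a + b) x - R a (R b x)) \<le> a * b * norm (M (M x))"
proof -
  have xD: "x \<in> D" "M x \<in> D" using x by (auto simp: D2_def)
  let ?v = "R (a + b) x"
  have v: "?v \<in> D" "M ?v = R (a + b) (M x)" "M ?v \<in> D" "M (M ?v) = R (a + b) (M (M x))"
    using a b xD by (auto simp: R_invariant MR_commute)
  have vx: "x = ?v + (a + b) *\<^sub>R M ?v"
    using R_inverse[of "a + b" x] xD a b by (simp add: v R_add scaleR_scaleC R_scaleC)
  have bv: "?v + b *\<^sub>R M ?v \<in> D" using v by (intro csubspace_add csubspace_scaleR D)
  have "(?v + b *\<^sub>R M ?v) + a *\<^sub>R M (?v + b *\<^sub>R M ?v) = ?v + (a + b) *\<^sub>R M ?v + (a * b) *\<^sub>R M (M ?v)"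
    using v csubspace_scaleR[OF D v(3), of b] by (simp add: M_add M_scaleR algebra_simps)
  then have "R a (x + (a * b) *\<^sub>R M (M ?v)) = ?v + b *\<^sub>R M ?v"
    using vx by (intro R_unique a bv) simp
  then have "R b (R a (x + (a * b) *\<^sub>R M (M ?v))) = ?v" using R_inverse[OF b v(1)] by simp
  then have "?v - R a (R b x) = R b (R a ((a * b) *\<^sub>R M (M ?v)))"
    using R_commute[OF a b, of x] by (simp add: R_add[OF a] R_add[OF b] algebra_simps)
  also have "norm \<dots> \<le> norm ((a * b) *\<^sub>R M (M ?v))"
    using order_trans[OF R_contr[OF b] R_contr[OF a]] .
  also have "\<dots> \<le> a * b * norm (M (M x))"
    using a b R_contr[of "a + b" "M (M x)"] by (simp add: v(4) abs_of_nonneg mult_left_mono)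
  finally show ?thesis .
qed

section \<open>Dyadic backward Euler approximants\<close>

lemma dyadic_nonneg: "t \<ge> 0 \<Longrightarrow> t / 2 ^ k \<ge> (0::real)"
  by simp

definition E :: "nat \<Rightarrow> real \<Rightarrow> 'h \<Rightarrow> 'h" where "E k t = R (t / 2 ^ k) ^^ (2 ^ k)"

lemma E_Suc: "E (Suc k) t = (\<lambda>x. R (t / 2 ^ k / 2) (R (t / 2 ^ k / 2) x)) ^^ (2 ^ k)"
proof -
  have "E (Suc k) t = (R (t / 2 ^ k / 2) ^^ 2) ^^ (2 ^ k)"
    by (simp add: E_def funpow_mult mult.commute)
  moreover have "R (t / 2 ^ k / 2) ^^ 2 = (\<lambda>x. R (t / 2 ^ k / 2) (R (t / 2 ^ k / 2) x))"
    by (simp add: numeral_2_eq_2 fun_eq_iff)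
  ultimately show ?thesis by simp
qed

lemma E_clinear: "t \<ge> 0 \<Longrightarrow> clinear (E k t)"
  unfolding E_def by (intro clinear_funpow R_clinear dyadic_nonneg)

lemma E_contr: "t \<ge> 0 \<Longrightarrow> norm (E k t x) \<le> norm x"
  unfolding E_def by (intro contraction_funpow R_contr dyadic_nonneg)

lemma ER_commute: "s \<ge> 0 \<Longrightarrow> t \<ge> 0 \<Longrightarrow> E k s (R t x) = R t (E k s x)"
  unfolding E_def using commute_funpow[of "R (s / 2 ^ k)" "R t" "2 ^ k" 1 x] R_commute[of "s / 2 ^ k" t] by simp

text \<open>Refinement replaces each of the 2^k steps of length h by two of length h/2, at the cost
  (h/2)^2 |M^2 x| per step.\<close>

lemma E_step:
  assumes t: "t \<ge> 0" and x: "x \<in> D2"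
  shows "norm (E k t x - E (Suc k) t x) \<le> t\<^sup>2 / 4 * norm (M (M x)) * (1/2) ^ k"
proof -
  let ?h = "t / 2 ^ k"
  have h: "?h \<ge> 0" "?h / 2 \<ge> 0" using t by auto
  have "norm (E k t x - E (Suc k) t x) \<le> real (2 ^ k) * norm (R ?h x - R (?h / 2) (R (?h / 2) x))"
    unfolding E_Suc unfolding E_def
  proof (intro funpow_diff_bound R_clinear R_contr h)
    show "clinear (\<lambda>x. R (?h / 2) (R (?h / 2) x))"
      using R_clinear[OF h(2)] by (simp add: clinear_def)
    show "norm (R (?h / 2) (R (?h / 2) x)) \<le> norm x" for x
      by (rule order_trans[OF R_contr R_contr]) (rule h)+
    show "R ?h (R (?h / 2) (R (?h / 2) x)) = R (?h / 2) (R (?h / 2) (R ?h x))" for x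
      by (simp only: R_commute[OF h])
  qed
  also have "norm (R ?h x - R (?h / 2) (R (?h / 2) x)) \<le> ?h / 2 * (?h / 2) * norm (M (M x))"
    using R_product_estimate[OF h(2) h(2) x] by simp
  also have "real (2 ^ k) * (?h / 2 * (?h / 2) * norm (M (M x))) = t\<^sup>2 / 4 * norm (M (M x)) * (1/2) ^ k"
    by (simp add: power2_eq_square power_divide field_simps)
  finally show ?thesis by simp
qed

lemma E_Cauchy_bound:
  assumes t: "t \<ge> 0" and x: "x \<in> D2"
  shows "norm (E k t x - E (k + m) t x) \<le> t\<^sup>2 / 2 * norm (M (M x)) * (1/2) ^ k"
proof -
  let ?c = "t\<^sup>2 / 4 * norm (M (M x))"
  have "norm (E k t x - E (k + m) t x) \<le> ?c * (2 * (1/2) ^ k - 2 * (1/2) ^ (k + m))"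
  proof (induction m)
    case (Suc m)
    have "norm (E k t x - E (k + Suc m) t x) \<le> norm (E k t x - E (k + m) t x) + norm (E (k + m) t x - E (Suc (k + m)) t x)"
      using norm_triangle_ineq[of "E k t x - E (k + m) t x" "E (k + m) t x - E (Suc (k + m)) t x"] by simp
    also have "\<dots> \<le> ?c * (2 * (1/2) ^ k - 2 * (1/2) ^ (k + m)) + ?c * (1/2) ^ (k + m)"
      by (intro add_mono Suc E_step t x)
    also have "\<dots> = ?c * (2 * (1/2) ^ k - 2 * (1/2) ^ (k + Suc m))" by (simp add: algebra_simps)
    finally show ?case .
  qed simp
  also have "\<dots> \<le> ?c * (2 * (1/2) ^ k)" by (intro mult_left_mono) auto
  finally show ?thesis by (simp add: mult_ac)
qed

lemma R_tendsto_D: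
  assumes x: "x \<in> D" and h: "h \<ge> 0" shows "norm (R h x - x) \<le> h * norm (M x)"
proof (cases "h = 0")
  case False
  with h have h0: "h > 0" by simp
  have "x - R h x = h *\<^sub>R M (R h x)" using MR[OF h0, of x] h0 by simp
  then have "norm (R h x - x) = h * norm (R h (M x))" using h0 by (simp add: norm_minus_commute MR_commute[OF h x])
  also have "\<dots> \<le> h * norm (M x)" using h R_contr[OF h] by (intro mult_left_mono) auto
  finally show ?thesis .
qed simp

lemma R_tendsto:
  assumes x: "x \<in> D" shows "((\<lambda>h. R h x) \<longlongrightarrow> x) (at_right 0)"
proof (rule Lim_transform2[OF tendsto_const])
  show "((\<lambda>h. x - R h x) \<longlongrightarrow> 0) (at_right 0)"
  proof (rule Lim_null_comparison)
    show "\<forall>\<^sub>F h in at_right 0. norm (x - R h x) \<le> h * norm (M x)"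
      using eventually_at_right_less[of 0]
      by eventually_elim (use R_tendsto_D[OF x] in \<open>simp add: norm_minus_commute\<close>)
    have "((\<lambda>h. h * norm (M x)) \<longlongrightarrow> 0 * norm (M x)) (at_right 0)" by (intro tendsto_intros)
    then show "((\<lambda>h. h * norm (M x)) \<longlongrightarrow> 0) (at_right 0)" by simp
  qed
qed

lemma R_seq_D: "x \<in> D \<Longrightarrow> (\<lambda>n. R (1 / real (Suc n)) x) \<longlonglongrightarrow> x"
proof (erule filterlim_compose[OF R_tendsto])
  show "filterlim (\<lambda>n. 1 / real (Suc n)) (at_right 0) sequentially"
    by (rule tendsto_imp_filterlim_at_right)
       (use LIMSEQ_inverse_real_of_nat in \<open>auto simp: inverse_eq_divide\<close>)
qed

lemma dense_approx: "e > 0 \<Longrightarrow> \<exists>y\<in>D. norm (x - y) < e"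
  using dense closure_approachable[of x D] by (auto simp: dist_norm norm_minus_commute)

lemma R_seq: "(\<lambda>n. R (1 / real (Suc n)) x) \<longlonglongrightarrow> x"
  unfolding tendsto_iff
proof (intro allI impI)
  fix e :: real assume e: "e > 0"
  obtain y where y: "y \<in> D" "norm (x - y) < e / 3" using dense_approx[of "e/3" x] e by auto
  have "\<forall>\<^sub>F n in sequentially. dist (R (1 / real (Suc n)) y) y < e / 3"
    using R_seq_D[OF y(1)] e unfolding tendsto_iff by (meson divide_pos_pos zero_less_numeral)
  then show "\<forall>\<^sub>F n in sequentially. dist (R (1 / real (Suc n)) x) x < e"
  proof eventually_elim
    case (elim n)
    let ?h = "1 / real (Suc n)"
    have h: "?h \<ge> 0" by simp
    have "R ?h x - x = R ?h (x - y) + (R ?h y - y) - (x - y)" by (simp only: clinear_diff[OF R_clinear[OF h]]) simp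
    also have "norm \<dots> \<le> norm (R ?h (x - y)) + norm (R ?h y - y) + norm (x - y)"
      by (intro order_trans[OF norm_triangle_ineq4] add_mono norm_triangle_ineq order_refl)
    also have "\<dots> < e" using R_contr[OF h, of "x - y"] y(2) elim unfolding dist_norm by linarith
    finally show ?case by (simp only: dist_norm)
  qed
qed

lemma D2_dense: "closure D2 = UNIV"
proof -
  have "D \<subseteq> closure D2"
  proof
    fix x assume x: "x \<in> D"
    then show "x \<in> closure D2" unfolding closure_sequential
      by (intro exI[of _ "\<lambda>n. R (1 / real (Suc n)) x"]) (auto intro: R_D2 R_seq simp del: of_nat_Suc)
  qed
  then have "closure D \<subseteq> closure D2" by (simp add: closure_minimal)
  then show ?thesis using dense by auto
qed

lemma D2_approx: "e > 0 \<Longrightarrow> \<exists>y\<in>D2. norm (x - y) < e"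
  using D2_dense closure_approachable[of x D2] by (auto simp: dist_norm norm_minus_commute)

text \<open>On \<open>D2\<close> the approximants are Cauchy with a geometric rate; uniform
  contractivity extends convergence to the closure of \<open>D2\<close>.\<close>

lemma E_convergent:
  assumes t: "t \<ge> 0" shows "convergent (\<lambda>k. E k t x)"
proof -
  have "Cauchy (\<lambda>k. E k t x)"
  unfolding Cauchy_altdef2
  proof (intro allI impI)
    fix e :: real assume e: "e > 0"
    obtain y where y: "y \<in> D2" "norm (x - y) < e / 4" using D2_approx[of "e/4" x] e by auto
    define c where "c = t\<^sup>2 / 2 * norm (M (M y))"
    have "(\<lambda>k. c * (1/2) ^ k) \<longlonglongrightarrow> 0"
      by (intro tendsto_mult_right_zero LIMSEQ_power_zero) simp
    then have "\<forall>\<^sub>F k in sequentially. c * (1/2) ^ k < e / 4"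
      by (rule order_tendstoD(2)) (use e in simp)
    then obtain N where N: "c * (1/2) ^ N < e / 4" unfolding eventually_sequentially by blast
    have "norm (E N t x - E m t x) < e / 4 + e / 4 + e / 4" if "m \<ge> N" for m
    proof -
      have d: "norm (E k t x - E k t y) < e / 4" for k
      proof -
        have "E k t x - E k t y = E k t (x - y)" by (simp add: clinear_diff[OF E_clinear[OF t]])
        then show ?thesis using E_contr[OF t, of k "x - y"] y(2) by simp
      qed
      have "norm (E N t y - E m t y) < e / 4" using E_Cauchy_bound[OF t y(1), of N "m - N", folded c_def] that N by simp
      then have "norm (E N t x - E N t y + (E N t y - E m t y)) < e / 4 + e / 4"
        using norm_triangle_ineq[of "E N t x - E N t y" "E N t y - E m t y"] d[of N] by linarith
      then have "norm ((E N t x - E N t y + (E N t y - E m t y)) - (E m t x - E m t y)) < e / 4 + e / 4 + e / 4"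
        using norm_triangle_ineq4[of "E N t x - E N t y + (E N t y - E m t y)" "E m t x - E m t y"] d[of m] by linarith
      then show ?thesis by simp
    qed
    then have "dist (E m t x) (E N t x) < e" if "m \<ge> N" for m
      using that e by (force simp: dist_norm norm_minus_commute)
    then show "\<exists>N. \<forall>m\<ge>N. dist (E m t x) (E N t x) < e" by blast
  qed
  then show ?thesis by (simp add: Cauchy_convergent_iff)
qed

section \<open>The limit semigroup and its generator\<close>

definition S :: "real \<Rightarrow> 'h \<Rightarrow> 'h" where "S t x = lim (\<lambda>k. E k t x)"

lemma E_tendsto: "t \<ge> 0 \<Longrightarrow> (\<lambda>k. E k t x) \<longlonglongrightarrow> S t x"
  using E_convergent unfolding S_def convergent_LIMSEQ_iff by blast

lemma S_clinear:
  assumes t: "t \<ge> 0" shows "clinear (S t)"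
  unfolding clinear_def
proof (intro conjI allI)
  fix x y c
  have "(\<lambda>k. E k t (x + y)) \<longlonglongrightarrow> S t x + S t y"
    unfolding clinear_add[OF E_clinear[OF t]] by (intro tendsto_intros E_tendsto t)
  then show "S t (x + y) = S t x + S t y" using E_tendsto[OF t] LIMSEQ_unique by blast
  have "(\<lambda>k. E k t (c *\<^sub>C x)) \<longlonglongrightarrow> c *\<^sub>C S t x"
    unfolding clinear_scaleC[OF E_clinear[OF t]] by (intro tendsto_intros E_tendsto t)
  then show "S t (c *\<^sub>C x) = c *\<^sub>C S t x" using E_tendsto[OF t] LIMSEQ_unique by blast
qed

lemma S_contr:
  assumes t: "t \<ge> 0" shows "norm (S t x) \<le> norm x"
  by (rule LIMSEQ_le_const2[OF tendsto_norm[OF E_tendsto[OF t]]]) (use E_contr[OF t] in blast)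

lemma S_bounded_linear: "t \<ge> 0 \<Longrightarrow> bounded_linear (S t)"
  using S_contr S_clinear
  by (intro bounded_linear_intro[where K = 1]) (auto simp: clinear_add clinear_scaleR)

lemma S_zero: "S 0 x = x"
proof -
  have id: "(R 0 ^^ n) x = x" for n by (induction n) auto
  have "E k 0 x = x" for k by (simp add: E_def id)
  then show ?thesis using E_tendsto[of 0 x] by (simp add: LIMSEQ_const_iff)
qed

lemma S_R_commute:
  assumes "s \<ge> 0" "t \<ge> 0" shows "S s (R t x) = R t (S s x)"
proof -
  have "bounded_linear (R t)" using assms R_clinear R_contr
    by (intro bounded_linear_intro[where K = 1]) (auto simp: clinear_add clinear_scaleR)
  then have "(\<lambda>k. R t (E k s x)) \<longlonglongrightarrow> R t (S s x)" by (rule bounded_linear.tendsto) (intro E_tendsto assms)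
  then show ?thesis using E_tendsto[OF assms(1), of "R t x"] LIMSEQ_unique
    by (simp only: ER_commute[OF assms]) blast
qed

lemma S_commute:
  assumes s: "s \<ge> 0" and t: "t \<ge> 0" shows "S s (S t x) = S t (S s x)"
proof -
  have SE: "S s (E k t x) = E k t (S s x)" for k
    unfolding E_def using commute_funpow[of "S s" "R (t / 2 ^ k)" 1 "2 ^ k" x] S_R_commute[OF s] t by simp
  have "(\<lambda>k. S s (E k t x)) \<longlonglongrightarrow> S s (S t x)"
    by (rule bounded_linear.tendsto[OF S_bounded_linear[OF s]]) (intro E_tendsto t)
  then show ?thesis using E_tendsto[OF t, of "S s x"] LIMSEQ_unique unfolding SE by blast
qed

lemma S_R_estimate:
  assumes t: "t \<ge> 0" and x: "x \<in> D2"
  shows "norm (R t x - S t x) \<le> t\<^sup>2 / 2 * norm (M (M x))"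
proof (rule LIMSEQ_le_const2)
  have E0: "E 0 t x = R t x" by (simp add: E_def)
  show "(\<lambda>m. norm (R t x - E m t x)) \<longlonglongrightarrow> norm (R t x - S t x)" by (intro tendsto_intros E_tendsto t)
  show "\<exists>N. \<forall>m\<ge>N. norm (R t x - E m t x) \<le> t\<^sup>2 / 2 * norm (M (M x))"
    using E_Cauchy_bound[OF t x, of 0] by (simp add: E0)
qed

lemma funpow_tendsto:
  fixes A :: "nat \<Rightarrow> 'h \<Rightarrow> 'h"
  assumes A: "\<And>k. clinear (A k)" "\<And>k x. norm (A k x) \<le> norm x" and lim: "\<And>x. (\<lambda>k. A k x) \<longlonglongrightarrow> B x"
  shows "(\<lambda>k. (A k ^^ n) x) \<longlonglongrightarrow> (B ^^ n) x"
proof (induction n)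
  case (Suc n)
  let ?y = "(B ^^ n) x"
  have "(\<lambda>k. A k ((A k ^^ n) x - ?y)) \<longlonglongrightarrow> 0"
  proof (rule Lim_null_comparison)
    show "\<forall>\<^sub>F k in sequentially. norm (A k ((A k ^^ n) x - ?y)) \<le> norm ((A k ^^ n) x - ?y)"
      using A(2) by simp
    have "(\<lambda>k. norm ((A k ^^ n) x - ?y)) \<longlonglongrightarrow> norm (?y - ?y)" by (intro tendsto_intros Suc)
    then show "(\<lambda>k. norm ((A k ^^ n) x - ?y)) \<longlonglongrightarrow> 0" by simp
  qed
  from tendsto_add[OF this lim[of ?y]] show ?case by (simp add: clinear_diff[OF A(1)])
qed simp

text \<open>\<open>E (m + k) t\<close> consists of 2^k copies of \<open>E m (t / 2^k)\<close>.
  Dyadic division of a single time is thus available ahead of the semigroup law, and it is what the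
  proof of that law uses.\<close>

lemma S_power:
  assumes t: "t \<ge> 0" shows "S t x = (S (t / 2 ^ k) ^^ (2 ^ k)) x"
proof -
  have "E (m + k) t = E m (t / 2 ^ k) ^^ (2 ^ k)" for m
    by (simp add: E_def funpow_mult power_add mult.commute)
  moreover have "(\<lambda>m. (E m (t / 2 ^ k) ^^ (2 ^ k)) x) \<longlonglongrightarrow> (S (t / 2 ^ k) ^^ (2 ^ k)) x"
    using t by (intro funpow_tendsto E_clinear E_contr E_tendsto) auto
  ultimately have "(\<lambda>m. E (m + k) t x) \<longlonglongrightarrow> (S (t / 2 ^ k) ^^ (2 ^ k)) x" by simp
  then show ?thesis using LIMSEQ_unique[OF LIMSEQ_ignore_initial_segment[OF E_tendsto[OF t], of k x]] by simp
qed

text \<open>Exchange \<open>S\<close> for the resolvent one factor at a time: S (a + b), R (a + b),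
  R a R b, R a S b, S a S b. All four errors are of second order in the times.\<close>

lemma S_product_estimate:
  assumes a: "a \<ge> 0" and b: "b \<ge> 0" and x: "x \<in> D2"
  shows "norm (S (a + b) x - S a (S b x)) \<le> 2 * (a + b)\<^sup>2 * norm (M (M x))"
proof -
  let ?c = "norm (M (M x))"
  have 1: "norm (S (a + b) x - R (a + b) x) \<le> (a + b)\<^sup>2 / 2 * ?c"
    using S_R_estimate[of "a + b" x] a b x by (simp add: norm_minus_commute)
  have 2: "norm (R (a + b) x - R a (R b x)) \<le> a * b * ?c" by (rule R_product_estimate[OF a b x])
  have "R a (R b x) - R a (S b x) = R a (R b x - S b x)" by (simp add: clinear_diff[OF R_clinear[OF a]])
  then have 3: "norm (R a (R b x) - R a (S b x)) \<le> b\<^sup>2 / 2 * ?c"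
    using order_trans[OF R_contr[OF a] S_R_estimate[OF b x]] by simp
  have "R a (S b x) - S a (S b x) = S b (R a x - S a x)"
    by (simp add: clinear_diff[OF S_clinear[OF b]] S_R_commute[OF b a] S_commute[OF a b])
  then have 4: "norm (R a (S b x) - S a (S b x)) \<le> a\<^sup>2 / 2 * ?c"
    using order_trans[OF S_contr[OF b] S_R_estimate[OF a x]] by simp
  have "norm (S (a + b) x - S a (S b x)) \<le> (a + b)\<^sup>2 / 2 * ?c + a * b * ?c + b\<^sup>2 / 2 * ?c + a\<^sup>2 / 2 * ?c"
    using norm_triangle_ineq[of "S (a + b) x - R (a + b) x" "R (a + b) x - R a (R b x)"]
      norm_triangle_ineq[of "S (a + b) x - R a (R b x)" "R a (R b x) - R a (S b x)"]
      norm_triangle_ineq[of "S (a + b) x - R a (S b x)" "R a (S b x) - S a (S b x)"] 1 2 3 4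
    by simp
  also have "\<dots> = (a + b)\<^sup>2 * ?c" by (simp add: power2_eq_square field_simps)
  also have "\<dots> \<le> 2 * (a + b)\<^sup>2 * ?c" by (intro mult_right_mono) auto
  finally show ?thesis .
qed

text \<open>Cutting both times into 2^k parts produces 2^k defects of order 4^(-k), which vanish in
  the limit; density of \<open>D2\<close> and boundedness give all vectors.\<close>

lemma S_add:
  assumes s: "s \<ge> 0" and t: "t \<ge> 0" shows "S (s + t) x = S s (S t x)"
proof -
  have D2: "S (s + t) x = S s (S t x)" if x: "x \<in> D2" for x
  proof -
    let ?c = "2 * (s + t)\<^sup>2 * norm (M (M x))"
    have "norm (S (s + t) x - S s (S t x)) \<le> ?c * (1/2) ^ k" for k
    proof -
      let ?a = "s / 2 ^ k" and ?b = "t / 2 ^ k"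
      have ab: "?a \<ge> 0" "?b \<ge> 0" "?a + ?b \<ge> 0" using s t by auto
      have comp: "(A ^^ n) ((B ^^ n) x) = ((\<lambda>x. A (B x)) ^^ n) x" if "\<And>x. A (B x) = B (A x)" for A B :: "'h \<Rightarrow> 'h" and n
      proof (induction n)
        case (Suc n)
        have "A ((A ^^ n) (B ((B ^^ n) x))) = A (B ((A ^^ n) ((B ^^ n) x)))"
          using commute_funpow[of A B n 1 "(B ^^ n) x"] that by simp
        then show ?case using Suc by simp
      qed simp
      have "S s (S t x) = (S ?a ^^ 2 ^ k) ((S ?b ^^ 2 ^ k) x)" using S_power[OF s] S_power[OF t] by metis
      also have "\<dots> = ((\<lambda>x. S ?a (S ?b x)) ^^ 2 ^ k) x" by (rule comp) (rule S_commute[OF ab(1,2)])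
      finally have "S (s + t) x - S s (S t x) = (S (?a + ?b) ^^ 2 ^ k) x - ((\<lambda>x. S ?a (S ?b x)) ^^ 2 ^ k) x"
        using S_power[of "s + t" x k] s t by (simp add: add_divide_distrib)
      also have "norm \<dots> \<le> real (2 ^ k) * norm (S (?a + ?b) x - S ?a (S ?b x))"
      proof (intro funpow_diff_bound S_clinear S_contr ab)
        show "clinear (\<lambda>x. S ?a (S ?b x))"
          using S_clinear[OF ab(1)] S_clinear[OF ab(2)] by (simp add: clinear_def)
        show "norm (S ?a (S ?b x)) \<le> norm x" for x
          by (rule order_trans[OF S_contr S_contr]) (rule ab)+
        show "S (?a + ?b) (S ?a (S ?b x)) = S ?a (S ?b (S (?a + ?b) x))" for x
          by (simp only: S_commute[OF ab(3) ab(1)] S_commute[OF ab(3) ab(2)])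
      qed
      also have "\<dots> \<le> real (2 ^ k) * (2 * (?a + ?b)\<^sup>2 * norm (M (M x)))"
        by (intro mult_left_mono S_product_estimate ab x) simp
      also have "\<dots> = ?c * (1/2) ^ k"
        by (simp add: power2_eq_square power_divide field_simps)
      finally show ?thesis .
    qed
    moreover have "(\<lambda>k. ?c * (1/2) ^ k) \<longlonglongrightarrow> 0"
      by (intro tendsto_mult_right_zero LIMSEQ_power_zero) simp
    ultimately have "norm (S (s + t) x - S s (S t x)) \<le> 0"
      by (intro LIMSEQ_le_const) blast+
    then show ?thesis by simp
  qed
  obtain X where X: "\<And>n. X n \<in> D2" "X \<longlonglongrightarrow> x" using D2_dense closure_sequential[of x D2] by auto
  have "(\<lambda>n. S (s + t) (X n)) \<longlonglongrightarrow> S (s + t) x" "(\<lambda>n. S s (S t (X n))) \<longlonglongrightarrow> S s (S t x)"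
    using s t by (intro bounded_linear.tendsto[OF S_bounded_linear] X; simp)+
  then show ?thesis using D2[OF X(1)] LIMSEQ_unique by simp
qed

text \<open>With the resolvent in place of \<open>S\<close> the difference quotient is exactly -R t
  (M x), and the replacement costs only t/2 |M^2 x|.\<close>

lemma S_gen_D2:
  assumes x: "x \<in> D2" shows "((\<lambda>t. (1 / t) *\<^sub>R (S t x - x)) \<longlongrightarrow> - M x) (at_right 0)"
proof (rule Lim_transform2)
  have xD: "x \<in> D" "M x \<in> D" using x by (auto simp: D2_def)
  show "((\<lambda>t. - R t (M x)) \<longlongrightarrow> - M x) (at_right 0)" by (intro tendsto_intros R_tendsto xD)
  show "((\<lambda>t. - R t (M x) - (1 / t) *\<^sub>R (S t x - x)) \<longlongrightarrow> 0) (at_right 0)"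
  proof (rule Lim_null_comparison)
    have "((\<lambda>t. t / 2 * norm (M (M x))) \<longlongrightarrow> 0 / 2 * norm (M (M x))) (at_right 0)" by (intro tendsto_intros) auto
    then show "((\<lambda>t. t / 2 * norm (M (M x))) \<longlongrightarrow> 0) (at_right 0)" by simp
    show "\<forall>\<^sub>F t in at_right 0. norm (- R t (M x) - (1 / t) *\<^sub>R (S t x - x)) \<le> t / 2 * norm (M (M x))"
      using eventually_at_right_less[of 0]
    proof eventually_elim
      case (elim t)
      have "R t (M x) = (1 / t) *\<^sub>R (x - R t x)" using MR[OF elim, of x] MR_commute[of t x] xD elim by simp
      then have "- R t (M x) - (1 / t) *\<^sub>R (S t x - x) = (1 / t) *\<^sub>R (R t x - S t x)" by (simp add: algebra_simps)
      then have "norm (- R t (M x) - (1 / t) *\<^sub>R (S t x - x)) = (1 / t) * norm (R t x - S t x)" using elim by simp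
      also have "\<dots> \<le> (1 / t) * (t\<^sup>2 / 2 * norm (M (M x)))"
        using elim by (intro mult_left_mono S_R_estimate x) auto
      also have "\<dots> = t / 2 * norm (M (M x))" using elim by (simp add: power2_eq_square)
      finally show ?case .
    qed
  qed
qed

lemma S_cont: "((\<lambda>t. S t x) \<longlongrightarrow> x) (at_right 0)"
  unfolding tendsto_iff
proof (intro allI impI)
  fix e :: real assume e: "e > 0"
  obtain y where y: "y \<in> D2" "norm (x - y) < e / 4" using D2_approx[of "e/4" x] e by auto
  then have yD: "y \<in> D" by (simp add: D2_def)
  have "((\<lambda>t. t\<^sup>2 / 2 * norm (M (M y)) + t * norm (M y)) \<longlongrightarrow> 0\<^sup>2 / 2 * norm (M (M y)) + 0 * norm (M y)) (at_right 0)"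
    by (intro tendsto_intros) auto
  then have "\<forall>\<^sub>F t in at_right 0. t\<^sup>2 / 2 * norm (M (M y)) + t * norm (M y) < e / 4"
    by (rule order_tendstoD(2)) (use e in simp)
  with eventually_at_right_less[of 0] show "\<forall>\<^sub>F t in at_right 0. dist (S t x) x < e"
  proof eventually_elim
    case (elim t)
    have 1: "norm (S t (x - y)) < e / 4" using S_contr[of t "x - y"] y(2) elim by simp
    have 2: "norm (R t y - S t y) \<le> t\<^sup>2 / 2 * norm (M (M y))" using elim by (intro S_R_estimate y) simp
    have 3: "norm (R t y - y) \<le> t * norm (M y)" using elim by (intro R_tendsto_D yD) simp
    have "S t x - x = S t (x - y) - (R t y - S t y) + (R t y - y) - (x - y)"
      using elim by (simp add: clinear_diff[OF S_clinear])
    also have "norm \<dots> \<le> norm (S t (x - y)) + norm (R t y - S t y) + norm (R t y - y) + norm (x - y)"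
      by (intro order_trans[OF norm_triangle_ineq4] add_mono order_trans[OF norm_triangle_ineq] order_refl)
    also have "\<dots> < e" using 1 2 3 y(2) elim e by linarith
    finally show ?case by (simp add: dist_norm)
  qed
qed

sublocale S: contraction_semigroup S
  by (intro contraction_semigroup.intro S_contr S_zero S_add S_cont bounded_linear.linear[OF S_bounded_linear])

text \<open>Resolvents of small step move \<open>x\<close> into \<open>D2\<close> and commute with
  \<open>M\<close>, so closedness of the generator extends the formula from \<open>D2\<close> to
  \<open>D\<close>.\<close>

lemma S_gens: "x \<in> D \<Longrightarrow> S.gens x (- M x)"
proof -
  assume x: "x \<in> D"
  let ?h = "\<lambda>n. 1 / real (Suc n)"
  have h: "?h n > 0" for n by simp
  show ?thesis
  proof (rule S.gens_closed)
    show "S.gens (R (?h n) x) (- M (R (?h n) x))" for n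
      unfolding S.gens_def by (rule S_gen_D2[OF R_D2[OF h x]])
    show "(\<lambda>n. R (?h n) x) \<longlonglongrightarrow> x" by (rule R_seq)
    show "(\<lambda>n. - M (R (?h n) x)) \<longlonglongrightarrow> - M x"
      using MR_commute[OF less_imp_le[OF h] x] by (simp only:) (intro tendsto_intros R_seq)
  qed
qed

text \<open>The generator is dissipative and extends -M, while 1 + M is already onto; hence the
  extension cannot be proper.\<close>

lemma S_gens_iff: "S.gens x y \<longleftrightarrow> x \<in> D \<and> y = - M x"
proof
  assume g: "S.gens x y"
  obtain z where z: "z \<in> D" "z + 1 *\<^sub>R M z = x - y" using onto[of 1 "x - y"] by auto
  have "norm (x - z) \<le> norm ((x - z) - 1 *\<^sub>R (y - (- M z)))"
    by (rule S.gens_dissipative[OF S.gens_diff[OF g S_gens[OF z(1)]]]) simp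
  also have "(x - z) - 1 *\<^sub>R (y - (- M z)) = (x - y) - (z + M z)" by (simp add: algebra_simps)
  also have "\<dots> = 0" using z(2) by simp
  finally have "x = z" by simp
  then show "x \<in> D \<and> y = - M x" using z(1) S.gens_unique[OF g S_gens] by simp
next
  assume "x \<in> D \<and> y = - M x"
  then show "S.gens x y" using S_gens by simp
qed

theorem generates: "generates_C0 D (\<lambda>x. - M x)"
  unfolding generates_C0_def
proof (intro exI[of _ S] conjI allI impI ballI)
  show "bounded_clinear (S t)" if "t \<ge> 0" for t
    unfolding bounded_clinear_def using S_clinear[OF that] S_contr[OF that] by (auto intro: exI[of _ 1])
  show "S 0 = id" by (rule ext) (simp add: S_zero)
  show "S (s + t) = S s \<circ> S t" if "s \<ge> 0" "t \<ge> 0" for s t by (rule ext) (simp add: S_add that)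
  show "D = {x. \<exists>y. ((\<lambda>t. (1 / t) *\<^sub>R (S t x - x)) \<longlongrightarrow> y) (at_right 0)}"
    using S_gens_iff unfolding S.gens_def by blast
qed (use S_cont S_gens in \<open>auto simp: S.gens_def\<close>)

end

section \<open>Completely positive kernels\<close>

definition sesq :: "'h::chilbert set \<Rightarrow> ('h \<Rightarrow> 'h \<Rightarrow> 'h tc) \<Rightarrow> bool" where
  "sesq D J \<longleftrightarrow>
    (\<forall>\<phi>\<in>D. \<forall>\<phi>'\<in>D. \<forall>\<psi>\<in>D. J (\<phi> + \<phi>') \<psi> = J \<phi> \<psi> + J \<phi>' \<psi> \<and> J \<psi> (\<phi> + \<phi>') = J \<psi> \<phi> + J \<psi> \<phi>') \<and>
    (\<forall>c. \<forall>\<phi>\<in>D. \<forall>\<psi>\<in>D. J (c *\<^sub>C \<phi>) \<psi> = cmul c (J \<phi> \<psi>) \<and> J \<phi> (c *\<^sub>C \<psi>) = cmul (cnj c) (J \<phi> \<psi>))"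

lemma sesqD:
  assumes "sesq D J" "\<phi> \<in> D" "\<psi> \<in> D"
  shows "\<phi>' \<in> D \<Longrightarrow> J (\<phi> + \<phi>') \<psi> = J \<phi> \<psi> + J \<phi>' \<psi>"
    "\<psi>' \<in> D \<Longrightarrow> J \<phi> (\<psi> + \<psi>') = J \<phi> \<psi> + J \<phi> \<psi>'"
    "J (c *\<^sub>C \<phi>) \<psi> = cmul c (J \<phi> \<psi>)"
    "J \<phi> (c *\<^sub>C \<psi>) = cmul (cnj c) (J \<phi> \<psi>)"
  using assms unfolding sesq_def by blast+

lemma sesq_zero:
  assumes D: "csubspace D" and J: "sesq D J" and "\<phi> \<in> D"
  shows "J 0 \<phi> = 0" "J \<phi> 0 = 0"
  using sesqD(3)[OF J csubspace_0[OF D] assms(3), of 0] sesqD(4)[OF J assms(3) csubspace_0[OF D], of 0] by auto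

lemma sesq_diff:
  assumes D: "csubspace D" and J: "sesq D J" and "\<phi> \<in> D" "\<phi>' \<in> D" "\<psi> \<in> D"
  shows "J (\<phi> - \<phi>') \<psi> = J \<phi> \<psi> - J \<phi>' \<psi>" "J \<psi> (\<phi> - \<phi>') = J \<psi> \<phi> - J \<psi> \<phi>'"
proof -
  have n: "(-1) *\<^sub>C \<phi>' \<in> D" using csubspace_scale[OF D assms(4)] .
  show "J (\<phi> - \<phi>') \<psi> = J \<phi> \<psi> - J \<phi>' \<psi>"
    using sesqD(1)[OF J assms(3,5) n] sesqD(3)[OF J assms(4,5), of "-1"] by (simp add: cmul_minus_left)
  show "J \<psi> (\<phi> - \<phi>') = J \<psi> \<phi> - J \<psi> \<phi>'"
    using sesqD(2)[OF J assms(5,3) n] sesqD(4)[OF J assms(5,4), of "-1"] by (simp add: cmul_minus_left)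
qed

lemma sesq_sum:
  assumes D: "csubspace D" and J: "sesq D J" and "\<And>i. i \<in> I \<Longrightarrow> f i \<in> D" "\<phi> \<in> D"
  shows "J (\<Sum>i\<in>I. f i) \<phi> = (\<Sum>i\<in>I. J (f i) \<phi>)" "J \<phi> (\<Sum>i\<in>I. f i) = (\<Sum>i\<in>I. J \<phi> (f i))"
proof -
  have "J (\<Sum>i\<in>I. f i) \<phi> = (\<Sum>i\<in>I. J (f i) \<phi>) \<and> J \<phi> (\<Sum>i\<in>I. f i) = (\<Sum>i\<in>I. J \<phi> (f i))"
    using assms(3)
  proof (induction I rule: infinite_finite_induct)
    case (insert i I)
    then show ?case using sesqD(1,2)[OF J] assms(4) csubspace_sum[OF D, of I f] by simp
  qed (auto simp: sesq_zero[OF D J assms(4)])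
  then show "J (\<Sum>i\<in>I. f i) \<phi> = (\<Sum>i\<in>I. J (f i) \<phi>)" "J \<phi> (\<Sum>i\<in>I. f i) = (\<Sum>i\<in>I. J \<phi> (f i))" by auto
qed

text \<open>The right side depends on the pairs only through the matrix entries of the operator they
  sum to.\<close>

lemma sesq_expansion:
  assumes D: "csubspace D" and J: "sesq D J" and B: "finite B" "orthonormal_set B" "B \<subseteq> D"
    and u: "\<And>i. i \<in> I \<Longrightarrow> u i \<in> cspan B" and v: "\<And>i. i \<in> I \<Longrightarrow> v i \<in> cspan B"
  shows "(\<Sum>i\<in>I. J (u i) (v i)) = (\<Sum>b\<in>B. \<Sum>c\<in>B. cmul (cinner b (tc_op (\<Sum>i\<in>I. kb (u i) (v i)) c)) (J b c))"
proof -
  have "J (u i) (v i) = (\<Sum>b\<in>B. \<Sum>c\<in>B. cmul (cinner b (u i) * cinner (v i) c) (J b c))" if i: "i \<in> I" for i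
  proof -
    have BD: "b \<in> D" if "b \<in> B" for b using that B(3) by blast
    have sD: "(\<Sum>c\<in>B. cinner c w *\<^sub>C c) \<in> D" for w by (intro csubspace_sum csubspace_scale D BD)
    have "J (u i) (v i) = J (\<Sum>b\<in>B. cinner b (u i) *\<^sub>C b) (\<Sum>c\<in>B. cinner c (v i) *\<^sub>C c)"
      using orthonormal_set_expansion[OF B(1,2) u[OF i]] orthonormal_set_expansion[OF B(1,2) v[OF i]] by simp
    also have "\<dots> = (\<Sum>b\<in>B. J (cinner b (u i) *\<^sub>C b) (\<Sum>c\<in>B. cinner c (v i) *\<^sub>C c))"
      by (intro sesq_sum(1)[OF D J] csubspace_scale D BD sD)
    also have "\<dots> = (\<Sum>b\<in>B. cmul (cinner b (u i)) (\<Sum>c\<in>B. J b (cinner c (v i) *\<^sub>C c)))"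
    proof (intro sum.cong refl)
      fix b assume b: "b \<in> B"
      have "J (cinner b (u i) *\<^sub>C b) (\<Sum>c\<in>B. cinner c (v i) *\<^sub>C c) = cmul (cinner b (u i)) (J b (\<Sum>c\<in>B. cinner c (v i) *\<^sub>C c))"
        by (rule sesqD(3)[OF J BD[OF b] sD])
      also have "J b (\<Sum>c\<in>B. cinner c (v i) *\<^sub>C c) = (\<Sum>c\<in>B. J b (cinner c (v i) *\<^sub>C c))"
        by (intro sesq_sum(2)[OF D J] csubspace_scale D BD b)
      finally show "J (cinner b (u i) *\<^sub>C b) (\<Sum>c\<in>B. cinner c (v i) *\<^sub>C c) = cmul (cinner b (u i)) (\<Sum>c\<in>B. J b (cinner c (v i) *\<^sub>C c))" .
    qed
    also have "\<dots> = (\<Sum>b\<in>B. \<Sum>c\<in>B. cmul (cinner b (u i) * cinner (v i) c) (J b c))"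
      by (intro sum.cong refl) (simp add: cmul_sum_right sesqD(4)[OF J BD BD] cinner_cnj)
    finally show ?thesis .
  qed
  then have "(\<Sum>i\<in>I. J (u i) (v i)) = (\<Sum>i\<in>I. \<Sum>b\<in>B. \<Sum>c\<in>B. cmul (cinner b (u i) * cinner (v i) c) (J b c))" by simp
  also have "\<dots> = (\<Sum>b\<in>B. \<Sum>i\<in>I. \<Sum>c\<in>B. cmul (cinner b (u i) * cinner (v i) c) (J b c))" by (rule sum.swap)
  also have "\<dots> = (\<Sum>b\<in>B. \<Sum>c\<in>B. \<Sum>i\<in>I. cmul (cinner b (u i) * cinner (v i) c) (J b c))"
    by (intro sum.cong refl sum.swap)
  also have "\<dots> = (\<Sum>b\<in>B. \<Sum>c\<in>B. cmul (\<Sum>i\<in>I. cinner b (u i) * cinner (v i) c) (J b c))"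
    by (simp only: cmul_sum_left)
  also have "\<dots> = (\<Sum>b\<in>B. \<Sum>c\<in>B. cmul (cinner b (tc_op (\<Sum>i\<in>I. kb (u i) (v i)) c)) (J b c))"
    by (simp add: tc_op_sum tc_op_kb cinner_lin mult.commute)
  finally show ?thesis .
qed

text \<open>Universal property of the algebraic tensor product: a sesquilinear map factors through
  finite rank operators. One finite orthonormal set spanning all the vectors involved makes the
  matrix entries coordinates for both sums.\<close>

lemma sesq_well_defined:
  assumes D: "csubspace D" and J: "sesq D J"
    and u: "\<And>i. i \<in> I \<Longrightarrow> u i \<in> D \<and> v i \<in> D" and u': "\<And>i. i \<in> I' \<Longrightarrow> u' i \<in> D \<and> v' i \<in> D"
    and fin: "finite I" "finite I'" and eq: "(\<Sum>i\<in>I. kb (u i) (v i)) = (\<Sum>i\<in>I'. kb (u' i) (v' i))"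
  shows "(\<Sum>i\<in>I. J (u i) (v i)) = (\<Sum>i\<in>I'. J (u' i) (v' i))"
proof -
  let ?S = "u ` I \<union> v ` I \<union> u' ` I' \<union> v' ` I'"
  have "finite ?S" "?S \<subseteq> D" using fin u u' by auto
  from gram_schmidt_finite[OF D this]
  obtain B where B: "finite B" "B \<subseteq> D" "orthonormal_set B" "?S \<subseteq> cspan B"
    by (elim exE conjE)
  have "(\<Sum>i\<in>I. J (u i) (v i)) = (\<Sum>b\<in>B. \<Sum>c\<in>B. cmul (cinner b (tc_op (\<Sum>i\<in>I. kb (u i) (v i)) c)) (J b c))"
    by (rule sesq_expansion[OF D J B(1,3,2)]) (use B(4) in auto)
  also have "\<dots> = (\<Sum>i\<in>I'. J (u' i) (v' i))"
    unfolding eq by (rule sesq_expansion[OF D J B(1,3,2), symmetric]) (use B(4) in auto)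
  finally show ?thesis .
qed

text \<open>An operator-valued positive definite kernel: complete positivity of the map sending
  |\<phi>><\<psi>| to \<open>J \<phi> \<psi>\<close>, expressed on the blocks |\<phi> i><\<phi> j|
  alone.\<close>

definition cp_kernel :: "'h::chilbert set \<Rightarrow> ('h \<Rightarrow> 'h \<Rightarrow> 'h tc) \<Rightarrow> bool" where
  "cp_kernel D J \<longleftrightarrow> (\<forall>n \<phi> \<eta>. (\<forall>i<n. \<phi> i \<in> D) \<longrightarrow>
     nonneg_c (\<Sum>i<n::nat. \<Sum>j<n. cinner (\<eta> i) (tc_op (J (\<phi> i) (\<phi> j)) (\<eta> j))))"

lemma cp_kernelD:
  "cp_kernel D J \<Longrightarrow> (\<And>i. i < n \<Longrightarrow> \<phi> i \<in> D) \<Longrightarrow> nonneg_c (\<Sum>i<n::nat. \<Sum>j<n. cinner (\<eta> i) (tc_op (J (\<phi> i) (\<phi> j)) (\<eta> j)))"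
  unfolding cp_kernel_def by simp

lemma cp_kernel_block2:
  assumes J: "cp_kernel D J" and \<phi>: "\<phi> \<in> D" and \<psi>: "\<psi> \<in> D"
  shows "block2_pos (J \<phi> \<phi>) (J \<phi> \<psi>) (J \<psi> \<phi>) (J \<psi> \<psi>)"
  unfolding block2_pos_def
proof (intro allI)
  fix x y
  have "nonneg_c (\<Sum>i<2. \<Sum>j<2. cinner (if i = (0::nat) then x else y)
      (tc_op (J (if i = 0 then \<phi> else \<psi>) (if j = (0::nat) then \<phi> else \<psi>)) (if j = 0 then x else y)))"
    by (rule cp_kernelD[OF J]) (use \<phi> \<psi> in simp)
  then
  show "nonneg_c (cinner x (tc_op (J \<phi> \<phi>) x) + cinner x (tc_op (J \<phi> \<psi>) y) + cinner y (tc_op (J \<psi> \<phi>) x) + cinner y (tc_op (J \<psi> \<psi>) y))"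
    by (simp add: numeral_2_eq_2 add.assoc)
qed

lemma cp_kernel_pos: "cp_kernel D J \<Longrightarrow> \<phi> \<in> D \<Longrightarrow> tc_pos (J \<phi> \<phi>)"
  using block2_pos_bounds(1)[OF cp_kernel_block2] by blast

lemma cp_kernel_hermitian:
  "cp_kernel D J \<Longrightarrow> \<phi> \<in> D \<Longrightarrow> \<psi> \<in> D \<Longrightarrow> cinner y (tc_op (J \<psi> \<phi>) x) = cnj (cinner x (tc_op (J \<phi> \<psi>) y))"
  using block2_pos_bounds(3)[OF cp_kernel_block2] by blast

lemma cp_kernel_norm:
  assumes onb: "has_onb TYPE('h::chilbert)" and J: "cp_kernel D J" and "\<phi> \<in> D" "(\<psi>::'h) \<in> D"
  shows "norm (J \<phi> \<psi>) \<le> (Re (tr (J \<phi> \<phi>)) + Re (tr (J \<psi> \<psi>))) / 2"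
  using norm_le_diagonal_blocks[OF onb] block2_pos_bounds(1,2,4)[OF cp_kernel_block2[OF J assms(3,4)]] by blast

text \<open>With the singular value decomposition \<open>\<rho> = \<Sum> s\<^sub>i |g\<^sub>i\<rangle>\<langle>h\<^sub>i|\<close>, the functional
  \<open>A \<mapsto> \<Sum> \<langle>g\<^sub>j|A h\<^sub>j\<rangle>\<close> attains the trace norm at \<open>\<rho>\<close> and is tangent to the decomposition.\<close>
lemma standard_form_dissipative:
  assumes onb: "has_onb TYPE('h::chilbert)" and D: "csubspace (D::'h set)"
    and J: "sesq D J" "cp_kernel D J" and N: "clinear_on D N"
    and sub: "\<And>\<phi>. \<phi> \<in> D \<Longrightarrow> Re (tr (J \<phi> \<phi>)) \<le> 2 * Re (cinner \<phi> (N \<phi>))"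
    and K: "\<And>\<phi> \<psi>. K \<phi> \<psi> = J \<phi> \<psi> - kb (N \<phi>) \<psi> - kb \<phi> (N \<psi>)"
    and uv: "\<And>j. j < n \<Longrightarrow> u j \<in> D" "\<And>j. j < n \<Longrightarrow> v j \<in> D"
  shows "norm (\<Sum>j<n::nat. kb (u j) (v j)) \<le> norm ((\<Sum>j<n. kb (u j) (v j)) - (\<Sum>j<n. K (u j) (v j)))"
proof -
  define \<rho> where "\<rho> = (\<Sum>j<n. kb (u j) (v j))"
  have "\<rho> \<in> fr D" unfolding \<rho>_def by (rule frI[OF uv])
  then obtain m g h s where svd: "orthonormal_fam m g" "orthonormal_fam m h" "\<And>i. i < m \<Longrightarrow> s i > (0::real)"
    "\<And>i. i < m \<Longrightarrow> g i \<in> D" "\<And>i. i < m \<Longrightarrow> h i \<in> D"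
    "\<rho> = (\<Sum>i<m. s i *\<^sub>R kb (g i) (h i))" "(\<Sum>i<m. s i) \<le> norm \<rho>"
    by (rule fr_svd[OF D]) blast
  have Nadd: "N (x + y) = N x + N y" and Nsc: "N (c *\<^sub>C x) = c *\<^sub>C N x" if "x \<in> D" "y \<in> D" for x y c
    using N that by (auto simp: clinear_on_def)
  have Ks: "sesq D K" unfolding sesq_def K
    by (auto simp: sesqD[OF J(1)] Nadd Nsc kb_add_left kb_add_right kb_scaleC_left kb_scaleC_right cmul_diff_right)
  have \<rho>': "\<rho> = (\<Sum>i<m. kb (of_real (s i) *\<^sub>C g i) (h i))"
    unfolding svd(6) by (simp add: kb_scaleC_left scaleR_cmul)
  \<comment> \<open>The given decomposition is exchanged for the singular one, which is legitimate
    because \<open>K\<close> is sesquilinear and the singular vectors lie in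
    \<open>D\<close>.\<close>
  have "(\<Sum>j<n. K (u j) (v j)) = (\<Sum>i<m. K (of_real (s i) *\<^sub>C g i) (h i))"
    by (rule sesq_well_defined[OF D Ks]) (use uv svd(4,5) csubspace_scale[OF D] \<rho>' \<rho>_def in auto)
  then have Ksum: "(\<Sum>j<n. K (u j) (v j)) = (\<Sum>i<m. s i *\<^sub>R K (g i) (h i))"
    using svd(4,5) by (simp add: sesqD(3)[OF Ks] scaleR_cmul)
  define F where "F A = (\<Sum>j<m. cinner (g j) (tc_op A (h j)))" for A
  have Fle: "Re (F A) \<le> norm A" for A
  proof -
    have "Re (F A) \<le> cmod (F A)" by (rule complex_Re_le_cmod)
    also have "\<dots> \<le> (\<Sum>j<m. cmod (cinner (g j) (tc_op A (h j))))" unfolding F_def by (rule norm_sum)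
    also have "\<dots> \<le> norm A" by (rule tc_norm_upper[OF svd(2,1)])
    finally show ?thesis .
  qed
  have Fadd: "F (A + A') = F A + F A'" "F (A - A') = F A - F A'" "F (r *\<^sub>R A) = of_real r * F A" for A A' r
    by (simp_all add: F_def tc_op_simps cinner_lin sum.distrib sum_subtractf sum_distrib_left)
  have Fsum: "F (\<Sum>i<m. f i) = (\<Sum>i<m. F (f i))" for f
    by (simp add: F_def tc_op_sum cinner_lin) (rule sum.swap)
  have Fkb1: "F (kb x (h i)) = cinner (g i) x" if i: "i < m" for x i
  proof -
    have "F (kb x (h i)) = (\<Sum>j<m. if i = j then cinner (g j) x else 0)" unfolding F_def
      by (intro sum.cong refl) (use svd(2) i in \<open>simp add: tc_op_kb cinner_lin orthonormal_fam_def\<close>)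
    then show ?thesis using i by simp
  qed
  have Fkb2: "F (kb (g i) x) = cinner x (h i)" if i: "i < m" for x i
  proof -
    have "F (kb (g i) x) = (\<Sum>j<m. if j = i then cinner x (h j) else 0)" unfolding F_def
      by (intro sum.cong refl) (use svd(1) i in \<open>simp add: tc_op_kb cinner_lin orthonormal_fam_def\<close>)
    then show ?thesis using i by simp
  qed
  \<comment> \<open>At a singular pair, \<open>F\<close> turns the two drift terms into <g i, N (g
    i)> and the conjugate of <h i, N (h i)>. Their real parts dominate the jump term, whose norm is
    at most the mean of the two diagonal traces.\<close>
  have FK: "Re (F (K (g i) (h i))) \<le> 0" if i: "i < m" for i
  proof -
    have "Re (cinner (N (h i)) (h i)) = Re (cinner (h i) (N (h i)))"
      using cinner_commute[of "N (h i)" "h i"] by simp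
    then have "Re (F (K (g i) (h i))) = Re (F (J (g i) (h i))) - Re (cinner (g i) (N (g i))) - Re (cinner (h i) (N (h i)))"
      by (simp add: K Fadd Fkb1[OF i] Fkb2[OF i])
    moreover have "Re (F (J (g i) (h i))) \<le> norm (J (g i) (h i))" by (rule Fle)
    moreover have "norm (J (g i) (h i)) \<le> (Re (tr (J (g i) (g i))) + Re (tr (J (h i) (h i)))) / 2"
      by (rule cp_kernel_norm[OF onb J(2) svd(4,5)[OF i]])
    moreover note sub[OF svd(4)[OF i]] sub[OF svd(5)[OF i]]
    moreover have "x \<le> 0" if "x = f - a - b" "f \<le> y" "y \<le> (p + q) / 2" "p \<le> 2 * a" "q \<le> 2 * b"
      for x f a b y p q :: real
    proof -
      have "2 * y \<le> p + q" using that(3) by simp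
      then show ?thesis using that by linarith
    qed
    ultimately show ?thesis by blast
  qed
  have "norm \<rho> \<le> (\<Sum>i<m. s i)"
    unfolding svd(6)
  proof (rule sum_norm_le)
    fix i assume i: "i \<in> {..<m}"
    then have "norm (kb (g i) (h i)) \<le> 1"
      using norm_kb_le[of "g i" "h i"] orthonormal_fam_norm[OF svd(1)] orthonormal_fam_norm[OF svd(2)] by simp
    then show "norm (s i *\<^sub>R kb (g i) (h i)) \<le> s i"
      using svd(3)[of i] i mult_left_mono[of "norm (kb (g i) (h i))" 1 "s i"] by simp
  qed
  also have "\<dots> = Re (F \<rho>)"
  proof -
    have "F \<rho> = (\<Sum>i<m. of_real (s i) * cinner (g i) (g i))" unfolding svd(6) by (simp add: Fsum Fadd Fkb1)
    also have "\<dots> = (\<Sum>i<m. of_real (s i))"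
      by (intro sum.cong refl) (use svd(1) in \<open>simp add: orthonormal_fam_def\<close>)
    finally show ?thesis by simp
  qed
  also have "\<dots> \<le> Re (F \<rho>) - (\<Sum>i<m. s i * Re (F (K (g i) (h i))))"
  proof -
    have "(\<Sum>i<m. s i * Re (F (K (g i) (h i)))) \<le> 0"
      using svd(3) FK by (intro sum_nonpos mult_nonneg_nonpos) (auto simp: less_imp_le)
    then show ?thesis by simp
  qed
  also have "\<dots> = Re (F (\<rho> - (\<Sum>i<m. s i *\<^sub>R K (g i) (h i))))"
    by (simp add: Fadd Fsum)
  also have "\<dots> \<le> norm (\<rho> - (\<Sum>i<m. s i *\<^sub>R K (g i) (h i)))" by (rule Fle)
  finally show ?thesis unfolding Ksum \<rho>_def[symmetric] .
qed

lemma trace_class_imp_tc_op: "trace_class A \<Longrightarrow> \<exists>\<rho>. A = tc_op \<rho>"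
  by (metis tc_op_Abs)

section \<open>Quantum dynamical semigroups\<close>

locale qds =
  fixes T :: "real \<Rightarrow> ('h::chilbert \<Rightarrow> 'h) \<Rightarrow> ('h \<Rightarrow> 'h)"
  assumes tp: "tp_qds T" and onb: "has_onb TYPE('h)"
begin

definition U :: "real \<Rightarrow> 'h tc \<Rightarrow> 'h tc" where "U t = tc_map (T t)"

lemma T_map: "t \<ge> 0 \<Longrightarrow> tp_cp_map (T t)"
  using tp by (simp add: tp_qds_def)

lemma tc_op_U: "t \<ge> 0 \<Longrightarrow> tc_op (U t \<rho>) = T t (tc_op \<rho>)"
  by (simp add: U_def tc_op_tc_map T_map)

sublocale contraction_semigroup U
proof
  fix s t :: real and x :: "'h tc"
  show "U t (b1 + b2) = U t b1 + U t b2" "U t (r *\<^sub>R b1) = r *\<^sub>R U t b1" if "t \<ge> 0" for b1 b2 r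
    unfolding U_def using tc_map_linear[OF T_map[OF that]] by (simp_all add: linear_add linear_scale)
  show "norm (U t x) \<le> norm x" if "t \<ge> 0" unfolding U_def by (rule tc_map_contraction[OF onb T_map[OF that]])
  show "U 0 x = x" using tp by (intro tc_eqI) (simp add: tc_op_U tp_qds_def)
  show "U (s + t) x = U s (U t x)" if "s \<ge> 0" "t \<ge> 0"
    using tp that by (intro tc_eqI) (simp add: tc_op_U tp_qds_def)
  have "((\<lambda>t. trace_norm (\<lambda>y. T t (tc_op x) y - tc_op x y)) \<longlongrightarrow> 0) (at_right 0)"
    using tp by (simp add: tp_qds_def)
  moreover have "\<forall>\<^sub>F t in at_right 0. trace_norm (\<lambda>y. T t (tc_op x) y - tc_op x y) = norm (U t x - x)"
    using eventually_at_right_less[of 0]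
    by eventually_elim (simp add: norm_tc.rep_eq minus_tc.rep_eq tc_op_U)
  ultimately have "((\<lambda>t. norm (U t x - x)) \<longlongrightarrow> 0) (at_right 0)" by (rule Lim_transform_eventually)
  then show "((\<lambda>t. U t x) \<longlongrightarrow> x) (at_right 0)"
    by (simp add: tendsto_norm_zero_iff LIM_zero_iff)
qed

lemma is_gen_iff: "is_gen T (tc_op \<rho>) (tc_op \<sigma>) \<longleftrightarrow> gens \<rho> \<sigma>"
proof -
  have ev: "\<forall>\<^sub>F t in at_right 0. trace_norm (\<lambda>x. (1 / t) *\<^sub>R (T t (tc_op \<rho>) x - tc_op \<rho> x) - tc_op \<sigma> x)
      = norm ((1 / t) *\<^sub>R (U t \<rho> - \<rho>) - \<sigma>)"
    using eventually_at_right_less[of 0]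
    by eventually_elim (simp add: norm_tc.rep_eq minus_tc.rep_eq scaleR_tc.rep_eq tc_op_U)
  have "is_gen T (tc_op \<rho>) (tc_op \<sigma>) \<longleftrightarrow> ((\<lambda>t. norm ((1 / t) *\<^sub>R (U t \<rho> - \<rho>) - \<sigma>)) \<longlongrightarrow> 0) (at_right 0)"
    unfolding is_gen_def using tendsto_cong[OF ev] by simp
  also have "\<dots> \<longleftrightarrow> gens \<rho> \<sigma>" unfolding gens_def by (simp add: tendsto_norm_zero_iff LIM_zero_iff)
  finally show ?thesis .
qed

lemma is_genE:
  assumes "is_gen T A C" obtains \<rho> \<sigma> where "A = tc_op \<rho>" "C = tc_op \<sigma>" "gens \<rho> \<sigma>"
proof -
  have "trace_class A" "trace_class C" using assms by (auto simp: is_gen_def)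
  then obtain \<rho> \<sigma> where "A = tc_op \<rho>" "C = tc_op \<sigma>" using trace_class_imp_tc_op by metis
  then show ?thesis using that assms is_gen_iff by blast
qed

lemma gen_eq: assumes "gens \<rho> \<sigma>" shows "gen T (tc_op \<rho>) = tc_op \<sigma>"
  unfolding gen_def
proof (rule the_equality)
  show "is_gen T (tc_op \<rho>) (tc_op \<sigma>)" using assms by (simp add: is_gen_iff)
  fix C assume "is_gen T (tc_op \<rho>) C"
  then obtain \<rho>' \<sigma>' where *: "tc_op \<rho> = tc_op \<rho>'" "C = tc_op \<sigma>'" "gens \<rho>' \<sigma>'" by (rule is_genE)
  then have "\<rho>' = \<rho>" by (simp add: tc_op_inject)
  then show "C = tc_op \<sigma>" using * gens_unique[OF assms] by simp
qed

lemma gen_dom_iff: "tc_op \<rho> \<in> gen_dom T \<longleftrightarrow> (\<exists>\<sigma>. gens \<rho> \<sigma>)"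
proof
  assume "tc_op \<rho> \<in> gen_dom T"
  then obtain C where "is_gen T (tc_op \<rho>) C" by (auto simp: gen_dom_def)
  then obtain \<rho>' \<sigma>' where "tc_op \<rho> = tc_op \<rho>'" "gens \<rho>' \<sigma>'" by (rule is_genE)
  then show "\<exists>\<sigma>. gens \<rho> \<sigma>" by (auto simp: tc_op_inject)
qed (auto simp: gen_dom_def is_gen_iff[symmetric])

lemma gen_domE:
  assumes "A \<in> gen_dom T" obtains \<rho> \<sigma> where "A = tc_op \<rho>" "gens \<rho> \<sigma>"
  using assms is_genE unfolding gen_dom_def by blast

text \<open>A sum of two trace norms tends to zero iff both do, so graph density becomes convergence
  of argument and value as sequences in \<open>tc\<close>.\<close>

lemma graph_dense_iff:
  "graph_dense T (tc_op ` F) \<longleftrightarrow> (\<forall>\<rho>\<in>F. \<exists>\<sigma>. gens \<rho> \<sigma>) \<and>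
    (\<forall>\<rho> \<sigma>. gens \<rho> \<sigma> \<longrightarrow> (\<exists>X Y. (\<forall>n. X n \<in> F \<and> gens (X n) (Y n)) \<and> X \<longlonglongrightarrow> \<rho> \<and> Y \<longlonglongrightarrow> \<sigma>))"
    (is "?L \<longleftrightarrow> ?A \<and> ?B")
proof -
  have dom: "tc_op ` F \<subseteq> gen_dom T \<longleftrightarrow> ?A" using gen_dom_iff by blast
  have conv: "((\<lambda>n. trace_norm (\<lambda>x. tc_op (X n) x - tc_op \<rho> x) + trace_norm (\<lambda>x. gen T (tc_op (X n)) x - gen T (tc_op \<rho>) x)) \<longlonglongrightarrow> 0)
      \<longleftrightarrow> X \<longlonglongrightarrow> \<rho> \<and> Y \<longlonglongrightarrow> \<sigma>"
    if "gens \<rho> \<sigma>" "\<And>n. gens (X n) (Y n)" for X Y \<rho> \<sigma>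
  proof -
    have eq: "trace_norm (\<lambda>x. tc_op (X n) x - tc_op \<rho> x) + trace_norm (\<lambda>x. gen T (tc_op (X n)) x - gen T (tc_op \<rho>) x)
        = norm (X n - \<rho>) + norm (Y n - \<sigma>)" for n
      by (simp add: gen_eq[OF that(1)] gen_eq[OF that(2)] norm_tc.rep_eq minus_tc.rep_eq)
    show ?thesis unfolding eq
    proof
      assume l: "(\<lambda>n. norm (X n - \<rho>) + norm (Y n - \<sigma>)) \<longlonglongrightarrow> 0"
      have "(\<lambda>n. X n - \<rho>) \<longlonglongrightarrow> 0" "(\<lambda>n. Y n - \<sigma>) \<longlonglongrightarrow> 0"
        by (rule Lim_null_comparison[OF _ l], simp)+
      then show "X \<longlonglongrightarrow> \<rho> \<and> Y \<longlonglongrightarrow> \<sigma>" by (simp add: LIM_zero_iff)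
    next
      assume "X \<longlonglongrightarrow> \<rho> \<and> Y \<longlonglongrightarrow> \<sigma>"
      then have "(\<lambda>n. norm (X n - \<rho>) + norm (Y n - \<sigma>)) \<longlonglongrightarrow> norm (\<rho> - \<rho>) + norm (\<sigma> - \<sigma>)"
        by (intro tendsto_intros) auto
      then show "(\<lambda>n. norm (X n - \<rho>) + norm (Y n - \<sigma>)) \<longlonglongrightarrow> 0" by simp
    qed
  qed
  show ?thesis
  proof
    assume L: ?L
    then have A: ?A using dom by (simp add: graph_dense_def)
    have ?B
    proof (intro allI impI)
      fix \<rho> \<sigma> assume g: "gens \<rho> \<sigma>"
      then have "tc_op \<rho> \<in> gen_dom T" by (auto simp: gen_dom_iff)
      then obtain R where R: "\<And>n. R n \<in> tc_op ` F"
        "(\<lambda>n. trace_norm (\<lambda>x. R n x - tc_op \<rho> x) + trace_norm (\<lambda>x. gen T (R n) x - gen T (tc_op \<rho>) x)) \<longlonglongrightarrow> 0"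
        using L unfolding graph_dense_def by blast
      have "\<forall>n. \<exists>X. X \<in> F \<and> R n = tc_op X" using R(1) by blast
      then obtain X where X: "\<And>n. X n \<in> F" "\<And>n. R n = tc_op (X n)" by metis
      have "\<forall>n. \<exists>Y. gens (X n) Y" using A X(1) by blast
      then obtain Y where Y: "\<And>n. gens (X n) (Y n)" by metis
      show "\<exists>X Y. (\<forall>n. X n \<in> F \<and> gens (X n) (Y n)) \<and> X \<longlonglongrightarrow> \<rho> \<and> Y \<longlonglongrightarrow> \<sigma>"
        using conv[of \<rho> \<sigma> X Y, OF g Y] R(2) X Y unfolding X(2) by blast
    qed
    with A show "?A \<and> ?B" by blast
  next
    assume AB: "?A \<and> ?B"
    show ?L unfolding graph_dense_def
    proof (intro conjI ballI)
      show "tc_op ` F \<subseteq> gen_dom T" using AB dom by blast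
      fix A assume "A \<in> gen_dom T"
      then obtain \<rho> \<sigma> where A: "A = tc_op \<rho>" and g: "gens \<rho> \<sigma>" by (rule gen_domE)
      obtain X Y where XY: "\<And>n. X n \<in> F" "\<And>n. gens (X n) (Y n)" "X \<longlonglongrightarrow> \<rho>" "Y \<longlonglongrightarrow> \<sigma>" using AB g by blast
      show "\<exists>R. (\<forall>n. R n \<in> tc_op ` F) \<and>
          (\<lambda>n. trace_norm (\<lambda>x. R n x - A x) + trace_norm (\<lambda>x. gen T (R n) x - gen T A x)) \<longlonglongrightarrow> 0"
        using conv[of \<rho> \<sigma> X Y, OF g XY(2)] XY unfolding A by (intro exI[of _ "\<lambda>n. tc_op (X n)"]) blast
    qed
  qed
qed

lemma gens_trace: assumes "gens \<rho> \<sigma>" shows "tr \<sigma> = 0"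
proof (rule tendsto_unique[of "at_right 0"])
  show "((\<lambda>t. tr ((1 / t) *\<^sub>R (U t \<rho> - \<rho>))) \<longlongrightarrow> tr \<sigma>) (at_right 0)"
    using assms unfolding gens_def by (rule tendsto_tr[OF onb])
  have "\<forall>\<^sub>F t in at_right 0. 0 = tr ((1 / t) *\<^sub>R (U t \<rho> - \<rho>))"
    using eventually_at_right_less[of 0]
    by eventually_elim (simp add: scaleR_cmul tr_cmul[OF onb] tr_diff[OF onb] U_def tr_tc_map T_map)
  then show "((\<lambda>t. tr ((1 / t) *\<^sub>R (U t \<rho> - \<rho>))) \<longlongrightarrow> 0) (at_right 0)"
    by (rule Lim_transform_eventually[OF tendsto_const])
qed simp

lemma gens_cmul: "gens \<rho> \<sigma> \<Longrightarrow> gens (cmul c \<rho>) (cmul c \<sigma>)"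
  by (rule gens_linear_map[OF _ bounded_linear_cmul]) (simp_all add: U_def tc_map_cmul T_map)

text \<open>Meaningful only where the generator is defined; membership in the domain is therefore
  written \<open>gens \<rho> (L \<rho>)\<close> below.\<close>

definition L :: "'h tc \<Rightarrow> 'h tc" where "L \<rho> = (THE \<sigma>. gens \<rho> \<sigma>)"

lemma L_eq: "gens \<rho> \<sigma> \<Longrightarrow> L \<rho> = \<sigma>"
  unfolding L_def using gens_unique by blast

text \<open>The constraint makes the form of the initial block |\<phi> i><\<phi> j| vanish at
  \<eta>. Subtracting that block in the difference quotient then leaves the nonnegative form of the
  evolved block.\<close>

lemma gens_conditionally_positive:
  assumes g: "\<And>i j. i < n \<Longrightarrow> j < n \<Longrightarrow> gens (kb (\<phi> i) (\<phi> j)) (G i j)"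
    and orth: "(\<Sum>i<n::nat. cinner (\<eta> i) (\<phi> i)) = 0"
  shows "nonneg_c (\<Sum>i<n. \<Sum>j<n. cinner (\<eta> i) (tc_op (G i j) (\<eta> j)))"
proof (rule nonneg_c_limit[of "at_right (0::real)"])
  have gl: "((\<lambda>t. (1 / t) *\<^sub>R (U t (kb (\<phi> i) (\<phi> j)) - kb (\<phi> i) (\<phi> j))) \<longlongrightarrow> G i j) (at_right 0)"
    if "i \<in> {..<n}" "j \<in> {..<n}" for i j using g that by (simp add: gens_def)
  show "((\<lambda>t. \<Sum>i<n. \<Sum>j<n. cinner (\<eta> i) (tc_op ((1 / t) *\<^sub>R (U t (kb (\<phi> i) (\<phi> j)) - kb (\<phi> i) (\<phi> j))) (\<eta> j)))
     \<longlongrightarrow> (\<Sum>i<n. \<Sum>j<n. cinner (\<eta> i) (tc_op (G i j) (\<eta> j)))) (at_right 0)"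
    by (intro tendsto_sum tendsto_cinner tendsto_const tendsto_tc_op gl)
  have sumkb: "(\<Sum>i<n. \<Sum>j<n. cinner (x i) (tc_op (kb (\<phi> i) (\<phi> j)) (x j))) = (\<Sum>i<n. cinner (x i) (\<phi> i)) * cnj (\<Sum>i<n. cinner (x i) (\<phi> i))" for x
    unfolding cnj_sum cinner_cnj sum_product by (simp add: tc_op_kb cinner_lin mult.commute)
  show "\<forall>\<^sub>F t in at_right 0. nonneg_c (\<Sum>i<n. \<Sum>j<n. cinner (\<eta> i) (tc_op ((1 / t) *\<^sub>R (U t (kb (\<phi> i) (\<phi> j)) - kb (\<phi> i) (\<phi> j))) (\<eta> j)))"
    using eventually_at_right_less[of 0]
  proof eventually_elim
    case (elim t)
    have "nonneg_c (\<Sum>i<n. \<Sum>j<n. cinner (\<eta> i) (tc_op (tc_map (T t) (kb (\<phi> i) (\<phi> j))) (\<eta> j)))"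
    proof (rule tc_map_block_positive)
      show "nonneg_c (\<Sum>i<n. \<Sum>j<n. cinner (x i) (tc_op (kb (\<phi> i) (\<phi> j)) (x j)))" for x
        unfolding sumkb by (rule nonneg_c_cnj_mult)
    qed (use T_map elim in simp)
    then have "nonneg_c (of_real (1 / t) * ((\<Sum>i<n. \<Sum>j<n. cinner (\<eta> i) (tc_op (U t (kb (\<phi> i) (\<phi> j))) (\<eta> j)))
        - (\<Sum>i<n. \<Sum>j<n. cinner (\<eta> i) (tc_op (kb (\<phi> i) (\<phi> j)) (\<eta> j)))))"
      unfolding sumkb orth using elim by (intro nonneg_c_scaleR) (auto simp: U_def)
    also have "of_real (1 / t) * ((\<Sum>i<n. \<Sum>j<n. cinner (\<eta> i) (tc_op (U t (kb (\<phi> i) (\<phi> j))) (\<eta> j)))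
        - (\<Sum>i<n. \<Sum>j<n. cinner (\<eta> i) (tc_op (kb (\<phi> i) (\<phi> j)) (\<eta> j)))) =
        (\<Sum>i<n. \<Sum>j<n. cinner (\<eta> i) (tc_op ((1 / t) *\<^sub>R (U t (kb (\<phi> i) (\<phi> j)) - kb (\<phi> i) (\<phi> j))) (\<eta> j)))"
      by (simp only: tc_op_simps cinner_scaleR_right cinner_diff_right sum_subtractf[symmetric] sum_distrib_left)
    finally show ?case .
  qed
qed simp

lemma gens_hermitian:
  assumes "gens (kb \<phi> \<psi>) \<sigma>" "gens (kb \<psi> \<phi>) \<sigma>'"
  shows "cinner y (tc_op \<sigma>' x) = cnj (cinner x (tc_op \<sigma> y))"
proof (rule tendsto_unique[of "at_right 0"])
  show "((\<lambda>t. cinner y (tc_op ((1 / t) *\<^sub>R (U t (kb \<psi> \<phi>) - kb \<psi> \<phi>)) x)) \<longlongrightarrow> cinner y (tc_op \<sigma>' x)) (at_right 0)"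
    by (intro tendsto_intros assms(2)[unfolded gens_def])
  have l: "((\<lambda>t. cnj (cinner x (tc_op ((1 / t) *\<^sub>R (U t (kb \<phi> \<psi>) - kb \<phi> \<psi>)) y))) \<longlongrightarrow> cnj (cinner x (tc_op \<sigma> y))) (at_right 0)"
    by (intro tendsto_intros assms(1)[unfolded gens_def])
  have "\<forall>\<^sub>F t in at_right 0. cnj (cinner x (tc_op ((1 / t) *\<^sub>R (U t (kb \<phi> \<psi>) - kb \<phi> \<psi>)) y))
      = cinner y (tc_op ((1 / t) *\<^sub>R (U t (kb \<psi> \<phi>) - kb \<psi> \<phi>)) x)"
    using eventually_at_right_less[of 0]
  proof eventually_elim
    case (elim t)
    have "block2_pos (1 *\<^sub>R kb \<phi> \<phi>) (1 *\<^sub>R kb \<phi> \<psi>) (1 *\<^sub>R kb \<psi> \<phi>) (1 *\<^sub>R kb \<psi> \<psi>)" by (rule block2_pos_kb) simp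
    then have b: "block2_pos (kb \<phi> \<phi>) (kb \<phi> \<psi>) (kb \<psi> \<phi>) (kb \<psi> \<psi>)" by simp
    have "cinner y (tc_op (U t (kb \<psi> \<phi>)) x) = cnj (cinner x (tc_op (U t (kb \<phi> \<psi>)) y))"
      unfolding U_def by (rule block2_pos_bounds(3)[OF tc_map_block2[OF T_map b]]) (use elim in simp)
    moreover have "cinner y (tc_op (kb \<psi> \<phi>) x) = cnj (cinner x (tc_op (kb \<phi> \<psi>) y))" by (rule block2_pos_bounds(3)[OF b])
    ultimately show ?case by (simp add: tc_op_simps cinner_lin)
  qed
  then show "((\<lambda>t. cinner y (tc_op ((1 / t) *\<^sub>R (U t (kb \<psi> \<phi>) - kb \<psi> \<phi>)) x)) \<longlongrightarrow> cnj (cinner x (tc_op \<sigma> y))) (at_right 0)"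
    by (rule Lim_transform_eventually[OF l])
qed simp

text \<open>Lindblad's choice, for which \<open>\<langle>e|L\<^sub>k e\<rangle> = 0\<close>.\<close>
definition Mop :: "'h \<Rightarrow> 'h \<Rightarrow> 'h" where
  "Mop e \<phi> = - tc_op (L (kb \<phi> e)) e + (1/2) *\<^sub>R (Re (cinner e (tc_op (L (kb e e)) e)) *\<^sub>R \<phi>)"

definition Jop :: "'h \<Rightarrow> 'h \<Rightarrow> 'h \<Rightarrow> 'h tc" where
  "Jop e \<phi> \<psi> = L (kb \<phi> \<psi>) + kb (Mop e \<phi>) \<psi> + kb \<phi> (Mop e \<psi>)"

context
  fixes e :: 'h and D :: "'h set"
  assumes e: "norm e = 1 \<or> (\<forall>x::'h. x = 0)" and eD: "e \<in> D" and D: "csubspace D"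
    and dom: "\<And>\<phi> \<psi>. \<phi> \<in> D \<Longrightarrow> \<psi> \<in> D \<Longrightarrow> gens (kb \<phi> \<psi>) (L (kb \<phi> \<psi>))"
begin

lemma L_sesq: "sesq D (\<lambda>\<phi> \<psi>. L (kb \<phi> \<psi>))"
  unfolding sesq_def
  by (auto simp: kb_add_left kb_add_right kb_scaleC_left kb_scaleC_right intro!: L_eq gens_add gens_cmul dom)

lemma Mop_clinear_on: "clinear_on D (Mop e)"
  unfolding clinear_on_def Mop_def
  by (auto simp: D sesqD[OF L_sesq _ eD] eD tc_op_simps cmul.rep_eq scaleC_diff_right scaleC_add_right scaleR_add_right scaleR_scaleC mult.commute)

lemma Jop_sesq: "sesq D (Jop e)"
  using Mop_clinear_on unfolding sesq_def Jop_def clinear_on_def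
  by (simp add: sesqD[OF L_sesq]) (simp add: kb_add_left kb_add_right kb_scaleC_left kb_scaleC_right cmul_add_right)

text \<open>Appending the vector \<open>e\<close> with a suitable coefficient turns an arbitrary family into one
  satisfying the orthogonality constraint of conditional complete positivity.\<close>
lemma Jop_cp_kernel: "cp_kernel D (Jop e)"
  unfolding cp_kernel_def
proof (intro allI impI)
  fix n :: nat and \<phi> \<eta> :: "nat \<Rightarrow> 'h" assume \<phi>: "\<forall>i<n. \<phi> i \<in> D"
  define s where "s = (\<Sum>i<n. cinner (\<eta> i) (\<phi> i))"
  define m where "m = (\<Sum>i<n. cinner (\<eta> i) (Mop e (\<phi> i)))"
  define d where "d = Re (cinner e (tc_op (L (kb e e)) e))"
  \<comment> \<open>Since \<open>e\<close> is a unit vector, the appended term contributes -s and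
    cancels the constraint sum.\<close>
  define \<alpha> where "\<alpha> = - cnj s"
  define \<phi>' where "\<phi>' i = (if i < n then \<phi> i else e)" for i
  define \<eta>' where "\<eta>' i = (if i < n then \<eta> i else \<alpha> *\<^sub>C e)" for i
  have \<phi>'D: "\<phi>' i \<in> D" for i using \<phi> eD by (simp add: \<phi>'_def)
  let ?l = "\<lambda>\<phi> \<psi>. tc_op (L (kb \<phi> \<psi>))"
  have d: "cinner e (?l e e e) = of_real d"
  proof -
    have "cinner e (?l e e e) = cnj (cinner e (?l e e e))" by (rule gens_hermitian[OF dom dom]) (rule eD)+
    then show ?thesis by (simp add: d_def complex_eq_iff)
  qed
  \<comment> \<open>The second case is the zero space, which contains no unit vector and where every
    form vanishes.\<close>
  have "s + cnj \<alpha> * cinner e e = 0"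
  proof (cases "norm e = 1")
    case True then show ?thesis by (simp add: \<alpha>_def cinner_self_norm)
  next
    case False
    then have z: "x = 0" for x :: 'h using e by blast
    have "s = 0" unfolding s_def using z[of "\<phi> _"] by simp
    then show ?thesis by (simp add: \<alpha>_def)
  qed
  then have "(\<Sum>i<Suc n. cinner (\<eta>' i) (\<phi>' i)) = 0"
    by (simp add: \<eta>'_def \<phi>'_def s_def cinner_lin)
  then have "nonneg_c (\<Sum>i<Suc n. \<Sum>j<Suc n. cinner (\<eta>' i) (?l (\<phi>' i) (\<phi>' j) (\<eta>' j)))"
    by (rule gens_conditionally_positive[rotated]) (rule dom[OF \<phi>'D \<phi>'D])
  also have "(\<Sum>i<Suc n. \<Sum>j<Suc n. cinner (\<eta>' i) (?l (\<phi>' i) (\<phi>' j) (\<eta>' j))) =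
      (\<Sum>i<n. \<Sum>j<n. cinner (\<eta> i) (?l (\<phi> i) (\<phi> j) (\<eta> j)))
      + \<alpha> * (\<Sum>i<n. cinner (\<eta> i) (?l (\<phi> i) e e)) + cnj \<alpha> * (\<Sum>j<n. cinner e (?l e (\<phi> j) (\<eta> j))) + cnj \<alpha> * \<alpha> * of_real d"
    by (simp add: \<eta>'_def \<phi>'_def sum.distrib cinner_lin clinear_scaleC[OF tc_clinear] sum_distrib_left d mult.assoc)
  also have "(\<Sum>j<n. cinner e (?l e (\<phi> j) (\<eta> j))) = cnj (\<Sum>i<n. cinner (\<eta> i) (?l (\<phi> i) e e))"
    unfolding cnj_sum by (intro sum.cong refl gens_hermitian[OF dom dom] eD) (use \<phi> in auto)
  \<comment> \<open>The definition of \<open>Mop\<close> solved for the generator. The two halves of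
    \<open>d\<close> arising here cancel the term |\<alpha>|^2 d, which is the reason for the factor
    1/2 in \<open>Mop\<close>.\<close>
  also have "(\<Sum>i<n. cinner (\<eta> i) (?l (\<phi> i) e e)) = - m + of_real (d / 2) * s"
  proof -
    have "?l (\<phi> i) e e = - Mop e (\<phi> i) + (d / 2) *\<^sub>R \<phi> i" for i by (simp add: Mop_def d_def)
    then show ?thesis by (simp add: m_def s_def cinner_lin sum.distrib sum_negf sum_distrib_left sum_subtractf)
  qed
  also have "(\<Sum>i<n. \<Sum>j<n. cinner (\<eta> i) (?l (\<phi> i) (\<phi> j) (\<eta> j))) + \<alpha> * (- m + of_real (d / 2) * s)
      + cnj \<alpha> * cnj (- m + of_real (d / 2) * s) + cnj \<alpha> * \<alpha> * of_real d =
      (\<Sum>i<n. \<Sum>j<n. cinner (\<eta> i) (?l (\<phi> i) (\<phi> j) (\<eta> j))) + cnj s * m + s * cnj m"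
    by (simp add: \<alpha>_def algebra_simps)
  also have "\<dots> = (\<Sum>i<n. \<Sum>j<n. cinner (\<eta> i) (tc_op (Jop e (\<phi> i) (\<phi> j)) (\<eta> j)))"
  proof -
    have "cnj s * m = (\<Sum>i<n. \<Sum>j<n. cinner (\<eta> i) (tc_op (kb (Mop e (\<phi> i)) (\<phi> j)) (\<eta> j)))"
      unfolding s_def m_def cnj_sum cinner_cnj sum_product
      by (subst sum.swap) (simp add: tc_op_kb cinner_lin)
    moreover have "s * cnj m = (\<Sum>i<n. \<Sum>j<n. cinner (\<eta> i) (tc_op (kb (\<phi> i) (Mop e (\<phi> j))) (\<eta> j)))"
      unfolding s_def m_def cnj_sum cinner_cnj sum_product by (simp add: tc_op_kb cinner_lin mult.commute)
    ultimately show ?thesis by (simp add: Jop_def tc_op_simps cinner_lin sum.distrib)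
  qed
  finally show "nonneg_c (\<Sum>i<n. \<Sum>j<n. cinner (\<eta> i) (tc_op (Jop e (\<phi> i) (\<phi> j)) (\<eta> j)))" .
qed

lemma Jop_trace: "\<phi> \<in> D \<Longrightarrow> tr (Jop e \<phi> \<phi>) = cinner \<phi> (Mop e \<phi>) + cinner (Mop e \<phi>) \<phi>"
  using gens_trace[OF dom] by (simp add: Jop_def tr_add[OF onb] tr_kb[OF onb])

lemma Jop_trace_Re: "\<phi> \<in> D \<Longrightarrow> Re (tr (Jop e \<phi> \<phi>)) = 2 * Re (cinner \<phi> (Mop e \<phi>))"
  using cinner_commute[of "Mop e \<phi>" \<phi>] by (simp add: Jop_trace)

lemma Mop_accretive: "\<phi> \<in> D \<Longrightarrow> Re (cinner \<phi> (Mop e \<phi>)) \<ge> 0"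
  using tr_pos[OF onb cp_kernel_pos[OF Jop_cp_kernel]] Jop_trace_Re by (simp add: nonneg_c_def)

end

end

section \<open>From a standard form to matrix normality\<close>

text \<open>The graph of \<open>M\<close> over \<open>D\<close> is a subset of a separable product,
  hence separable: one graph point is chosen for each pair of points of \<open>Q\<close> and each
  radius that admits one.\<close>

lemma countable_graph_dense:
  fixes M :: "'h::chilbert \<Rightarrow> 'h"
  assumes sep: "separable_space TYPE('h)"
  shows "\<exists>X. countable X \<and> X \<subseteq> D \<and>
    (\<forall>x\<in>D. \<exists>f::nat \<Rightarrow> 'h. (\<forall>n. f n \<in> X) \<and> f \<longlonglongrightarrow> x \<and> (\<lambda>n. M (f n)) \<longlonglongrightarrow> M x)"
proof -
  obtain Q :: "'h set" where Q: "countable Q" "closure Q = UNIV" using sep by (auto simp: separable_space_def)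
  define P where "P p x \<longleftrightarrow> x \<in> D \<and> dist x (fst p) < inverse (real (Suc (snd (snd p)))) \<and> dist (M x) (fst (snd p)) < inverse (real (Suc (snd (snd p))))"
    for p :: "'h \<times> 'h \<times> nat" and x
  define c where "c p = (SOME x. P p x)" for p
  define I where "I = {p \<in> Q \<times> Q \<times> UNIV. \<exists>x. P p x}"
  have Pc: "P p (c p)" if "p \<in> I" for p using that unfolding I_def c_def by (auto intro: someI)
  have "countable I" unfolding I_def
    by (rule countable_subset[of _ "Q \<times> Q \<times> UNIV"]) (use Q in auto)
  then have "countable (c ` I)" by simp
  moreover have "c ` I \<subseteq> D" using Pc by (auto simp: P_def)
  moreover have "\<exists>f::nat \<Rightarrow> 'h. (\<forall>n. f n \<in> c ` I) \<and> f \<longlonglongrightarrow> x \<and> (\<lambda>n. M (f n)) \<longlonglongrightarrow> M x" if x: "x \<in> D" for x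
  proof -
    have near: "\<exists>q\<in>Q. dist y q < inverse (real (Suc n))" for y :: 'h and n
      using Q(2) closure_approachable[of y Q] by (auto simp: dist_commute)
    have "\<exists>z\<in>c ` I. dist z x < 2 * inverse (real (Suc n)) \<and> dist (M z) (M x) < 2 * inverse (real (Suc n))" for n
    proof -
      obtain q q' where q: "q \<in> Q" "dist x q < inverse (real (Suc n))" "q' \<in> Q" "dist (M x) q' < inverse (real (Suc n))"
        using near by metis
      have "P (q, q', n) x" using x q by (simp add: P_def del: of_nat_Suc)
      then have I: "(q, q', n) \<in> I" using q unfolding I_def by blast
      from Pc[OF this] have "dist (c (q, q', n)) q < inverse (real (Suc n))" "dist (M (c (q, q', n))) q' < inverse (real (Suc n))"
        by (simp_all add: P_def del: of_nat_Suc)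
      then have "dist (c (q, q', n)) x < 2 * inverse (real (Suc n))" "dist (M (c (q, q', n))) (M x) < 2 * inverse (real (Suc n))"
        using dist_triangle2[of "c (q, q', n)" x q] dist_triangle2[of "M (c (q, q', n))" "M x" q'] q by linarith+
      then show ?thesis using I by blast
    qed
    then obtain f where f: "\<And>n. f n \<in> c ` I" "\<And>n. dist (f n) x < 2 * inverse (real (Suc n))"
      "\<And>n. dist (M (f n)) (M x) < 2 * inverse (real (Suc n))" by metis
    have z: "(\<lambda>n. 2 * inverse (real (Suc n))) \<longlonglongrightarrow> 0"
      using tendsto_mult[OF tendsto_const[of 2] LIMSEQ_inverse_real_of_nat] by simp
    have lim: "g \<longlonglongrightarrow> y" if "\<And>n. dist (g n) y < 2 * inverse (real (Suc n))" for g and y :: 'h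
      by (rule iffD2[OF tendsto_dist_iff], rule tendsto_sandwich[OF _ _ tendsto_const z])
         (intro always_eventually allI zero_le_dist less_imp_le that)+
    have "f \<longlonglongrightarrow> x" "(\<lambda>n. M (f n)) \<longlonglongrightarrow> M x" by (rule lim, rule f)+
    then show ?thesis using f(1) by blast
  qed
  ultimately show ?thesis by (intro exI[of _ "c ` I"]) auto
qed

lemma gram_schmidt_countable:
  assumes D: "csubspace (D::'h::chilbert set)" and X: "countable X" "X \<subseteq> D"
  shows "\<exists>B. B \<subseteq> D \<and> orthonormal_set B \<and> X \<subseteq> cspan B"
proof -
  define v where "v = from_nat_into (insert 0 X)"
  have v: "range v = insert 0 X" unfolding v_def using X(1) by (intro range_from_nat_into) auto
  have vD: "v n \<in> D" for n
  proof -
    have "v n \<in> insert 0 X" unfolding v[symmetric] by (rule rangeI)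
    then show ?thesis using X(2) csubspace_0[OF D] by auto
  qed
  have "\<exists>f. \<forall>n. (finite (f n) \<and> f n \<subseteq> D \<and> orthonormal_set (f n)) \<and> (f n \<subseteq> f (Suc n) \<and> v n \<in> cspan (f (Suc n)))"
  proof (rule dependent_nat_choice)
    show "\<exists>x. finite x \<and> x \<subseteq> D \<and> orthonormal_set x" by (intro exI[of _ "{}"]) (auto simp: orthonormal_set_def)
    fix B n assume "finite B \<and> B \<subseteq> D \<and> orthonormal_set B"
    then show "\<exists>B'. (finite B' \<and> B' \<subseteq> D \<and> orthonormal_set B') \<and> B \<subseteq> B' \<and> v n \<in> cspan B'"
      using gram_schmidt_step[OF D _ _ _ vD[of n], of B] by (elim conjE) auto
  qed
  then obtain f where f: "\<And>n. f n \<subseteq> D" "\<And>n. orthonormal_set (f n)" "\<And>n. f n \<subseteq> f (Suc n)" "\<And>n. v n \<in> cspan (f (Suc n))"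
    by auto
  have mono: "f m \<subseteq> f n" if "m \<le> n" for m n using lift_Suc_mono_le[of f, OF f(3) that] .
  let ?B = "\<Union>n. f n"
  have "orthonormal_set ?B" unfolding orthonormal_set_def
  proof (intro ballI)
    fix x y assume "x \<in> ?B" "y \<in> ?B"
    then obtain m n where "x \<in> f m" "y \<in> f n" by auto
    then have "x \<in> f (max m n)" "y \<in> f (max m n)" using mono[of m "max m n"] mono[of n "max m n"] by auto
    then show "cinner x y = (if x = y then 1 else 0)" using orthonormal_setD[OF f(2)] by blast
  qed
  moreover have "X \<subseteq> cspan ?B"
  proof
    fix x assume "x \<in> X"
    then obtain n where "x = v n" using v by (metis insertCI rangeE)
    moreover have "cspan (f (Suc n)) \<subseteq> cspan ?B" by (rule cspan_mono) blast
    ultimately show "x \<in> cspan ?B" using f(4)[of n] by blast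
  qed
  moreover have "?B \<subseteq> D" using f(1) by blast
  ultimately show ?thesis by blast
qed

text \<open>Orthonormalizing a countable graph-dense set keeps the span inside the subspace
  \<open>D\<close> and contains that set, so the span is dense for the graph norm of
  \<open>M\<close> and not only for the norm of the space.\<close>

lemma ex_onb_core:
  fixes M :: "'h::chilbert \<Rightarrow> 'h"
  assumes sep: "separable_space TYPE('h)" and D: "csubspace D" "closure D = UNIV"
  shows "\<exists>B. is_onb B \<and> cspan B \<subseteq> D \<and>
    (\<forall>x\<in>D. \<exists>f::nat \<Rightarrow> 'h. (\<forall>n. f n \<in> cspan B) \<and> f \<longlonglongrightarrow> x \<and> (\<lambda>n. M (f n)) \<longlonglongrightarrow> M x)"
proof -
  obtain X where X: "countable X" "X \<subseteq> D"
    "\<forall>x\<in>D. \<exists>f::nat \<Rightarrow> 'h. (\<forall>n. f n \<in> X) \<and> f \<longlonglongrightarrow> x \<and> (\<lambda>n. M (f n)) \<longlonglongrightarrow> M x"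
    using countable_graph_dense[OF sep, of D M] by (elim exE conjE)
  obtain B where B: "B \<subseteq> D" "orthonormal_set B" "X \<subseteq> cspan B"
    using gram_schmidt_countable[OF D(1) X(1,2)] by (elim exE conjE)
  have app: "\<exists>f::nat \<Rightarrow> 'h. (\<forall>n. f n \<in> cspan B) \<and> f \<longlonglongrightarrow> x \<and> (\<lambda>n. M (f n)) \<longlonglongrightarrow> M x" if "x \<in> D" for x
    using bspec[OF X(3) that] B(3) by (meson subsetD)
  have "D \<subseteq> closure (cspan B)"
  proof
    fix x assume "x \<in> D"
    then show "x \<in> closure (cspan B)" using app unfolding closure_sequential by blast
  qed
  then have "closure D \<subseteq> closure (cspan B)" by (rule closure_minimal) simp
  then have "is_onb B" using B(2) D(2) by (simp add: is_onb_def top.extremum_unique)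
  moreover have "cspan B \<subseteq> D" by (rule cspan_subset[OF D(1) B(1)])
  ultimately show ?thesis using app by (intro exI[of _ B]) blast
qed

lemma separable_has_onb:
  assumes "separable_space TYPE('h::chilbert)" shows "has_onb TYPE('h)"
  using ex_onb_core[OF assms csubspace_UNIV closure_UNIV, of id] unfolding has_onb_def by blast

section \<open>Finite rank elements and the sets \<open>D0\<close> and
  \<open>ketbra_span\<close>\<close>

lemma fr_sum: "finite F \<Longrightarrow> (\<And>i. i \<in> F \<Longrightarrow> f i \<in> fr D) \<Longrightarrow> (\<Sum>i\<in>F. f i) \<in> fr D"
  by (induction F rule: finite_induct) (auto intro: fr_zero fr_add)

lemma tc_op_fr_eq_D0: "tc_op ` fr D = D0 D"
proof (intro set_eqI iffI)
  fix A assume "A \<in> tc_op ` fr D"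
  then obtain \<rho> where A: "A = tc_op \<rho>" and "\<rho> \<in> fr D" by blast
  then obtain n x y where xy: "\<And>j. j < n \<Longrightarrow> x j \<in> D" "\<And>j. j < n \<Longrightarrow> y j \<in> D" "\<rho> = (\<Sum>j<n::nat. kb (x j) (y j))"
    by (elim frE) blast
  have "A = (\<lambda>z. \<Sum>j\<in>{..<n}. ketbra (x j) (y j) z)"
    by (rule ext) (simp add: A xy(3) tc_op_sum kb.rep_eq)
  then show "A \<in> D0 D" unfolding D0_def mem_Collect_eq
    by (rule_tac exI[of _ "{..<n}"], rule_tac exI[of _ x], rule_tac exI[of _ y]) (use xy in auto)
next
  fix A assume "A \<in> D0 D"
  then obtain F x y where *: "finite (F::nat set)" "\<forall>n\<in>F. x n \<in> D \<and> y n \<in> D" "A = (\<lambda>z. \<Sum>n\<in>F. ketbra (x n) (y n) z)"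
    unfolding D0_def mem_Collect_eq by (elim exE conjE)
  have "A = tc_op (\<Sum>n\<in>F. kb (x n) (y n))" by (rule ext) (simp add: *(3) tc_op_sum kb.rep_eq)
  moreover have "(\<Sum>n\<in>F. kb (x n) (y n)) \<in> fr D" by (rule fr_sum) (use * fr_kb in auto)
  ultimately show "A \<in> tc_op ` fr D" by blast
qed

lemma ketbra_spanI:
  "finite F \<Longrightarrow> F \<subseteq> B \<times> B \<Longrightarrow> tc_op (\<Sum>p\<in>F. cmul (c p) (kb (fst p) (snd p))) \<in> ketbra_span B"
  unfolding ketbra_span_def
  by (rule CollectI, rule exI[of _ F], rule exI[of _ c]) (simp add: fun_eq_iff tc_op_sum cmul.rep_eq kb.rep_eq)

lemma ketbra_spanE:
  assumes "A \<in> ketbra_span B"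
  obtains F c where "finite F" "F \<subseteq> B \<times> B" "A = tc_op (\<Sum>p\<in>F. cmul (c p) (kb (fst p) (snd p)))"
proof -
  obtain F c where "finite F" "F \<subseteq> B \<times> B" "A = (\<lambda>x. \<Sum>p\<in>F. c p *\<^sub>C ketbra (fst p) (snd p) x)"
    using assms unfolding ketbra_span_def mem_Collect_eq by (elim exE conjE)
  then show ?thesis by (intro that[of F c]) (simp_all add: fun_eq_iff tc_op_sum cmul.rep_eq kb.rep_eq)
qed

lemma ketbra_span_add:
  assumes "tc_op \<rho> \<in> ketbra_span B" "tc_op \<sigma> \<in> ketbra_span B" shows "tc_op (\<rho> + \<sigma>) \<in> ketbra_span B"
proof -
  let ?k = "\<lambda>p. kb (fst p) (snd p)"
  obtain F c where F: "finite F" "F \<subseteq> B \<times> B" "tc_op \<rho> = tc_op (\<Sum>p\<in>F. cmul (c p) (?k p))"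
    using assms(1) by (rule ketbra_spanE)
  obtain G d where G: "finite G" "G \<subseteq> B \<times> B" "tc_op \<sigma> = tc_op (\<Sum>p\<in>G. cmul (d p) (?k p))"
    using assms(2) by (rule ketbra_spanE)
  let ?c = "\<lambda>p. if p \<in> F then c p else 0" and ?d = "\<lambda>p. if p \<in> G then d p else 0"
  have "\<rho> = (\<Sum>p\<in>F. cmul (c p) (?k p))" using F(3) by (simp only: tc_op_inject)
  also have "\<dots> = (\<Sum>p\<in>F \<union> G. cmul (?c p) (?k p))"
    by (rule sum.mono_neutral_cong_left) (use F(1,2) G(1,2) in auto)
  finally have 1: "\<rho> = (\<Sum>p\<in>F \<union> G. cmul (?c p) (?k p))" .
  have "\<sigma> = (\<Sum>p\<in>G. cmul (d p) (?k p))" using G(3) by (simp only: tc_op_inject)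
  also have "\<dots> = (\<Sum>p\<in>F \<union> G. cmul (?d p) (?k p))"
    by (rule sum.mono_neutral_cong_left) (use F(1,2) G(1,2) in auto)
  finally have 2: "\<sigma> = (\<Sum>p\<in>F \<union> G. cmul (?d p) (?k p))" .
  have "\<rho> + \<sigma> = (\<Sum>p\<in>F \<union> G. cmul (?c p + ?d p) (?k p))"
    by (simp only: cmul_add_left sum.distrib 1[symmetric] 2[symmetric])
  then show ?thesis using F(1,2) G(1,2) by (elim ssubst) (intro ketbra_spanI, auto)
qed

lemma ketbra_span_sum:
  "finite I \<Longrightarrow> (\<And>i. i \<in> I \<Longrightarrow> tc_op (f i) \<in> ketbra_span B) \<Longrightarrow> tc_op (\<Sum>i\<in>I. f i) \<in> ketbra_span B"
proof (induction I rule: finite_induct)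
  case empty
  show ?case using ketbra_spanI[of "{}" B] by simp
qed (auto intro: ketbra_span_add)

lemma ketbra_span_kb:
  assumes "x \<in> cspan B" "y \<in> cspan B" shows "tc_op (kb x y) \<in> ketbra_span B"
proof -
  obtain F a where F: "finite F" "F \<subseteq> B" "x = (\<Sum>b\<in>F. a b *\<^sub>C b)" using assms(1) by (rule cspanE)
  obtain G b where G: "finite G" "G \<subseteq> B" "y = (\<Sum>c\<in>G. b c *\<^sub>C c)" using assms(2) by (rule cspanE)
  have "kb x y = (\<Sum>c\<in>G. \<Sum>d\<in>F. cmul (cnj (b c) * a d) (kb d c))"
    unfolding F(3) G(3)
    by (simp add: bounded_bilinear.sum_left[OF bounded_bilinear_kb] bounded_bilinear.sum_right[OF bounded_bilinear_kb]
        kb_scaleC_left kb_scaleC_right cmul_sum_right mult.commute) (rule sum.swap)?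
  moreover have "tc_op (\<Sum>c\<in>G. \<Sum>d\<in>F. cmul (cnj (b c) * a d) (kb d c)) \<in> ketbra_span B"
  proof (intro ketbra_span_sum F G)
    fix c d assume "c \<in> G" "d \<in> F"
    then show "tc_op (cmul (cnj (b c) * a d) (kb d c)) \<in> ketbra_span B"
      using ketbra_spanI[of "{(d, c)}" B "\<lambda>_. cnj (b c) * a d"] F(2) G(2) by auto
  qed
  ultimately show ?thesis by simp
qed

lemma tc_op_fr_eq_ketbra_span: "tc_op ` fr (cspan B) = ketbra_span (B::'h::chilbert set)"
proof (intro set_eqI iffI)
  fix A assume "A \<in> ketbra_span B"
  then obtain F c where *: "finite F" "F \<subseteq> B \<times> B" "A = (\<lambda>x. \<Sum>p\<in>F. c p *\<^sub>C ketbra (fst p) (snd p) x)"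
    unfolding ketbra_span_def mem_Collect_eq by (elim exE conjE)
  have "A = tc_op (\<Sum>p\<in>F. cmul (c p) (kb (fst p) (snd p)))"
    by (rule ext) (simp add: *(3) tc_op_sum cmul.rep_eq kb.rep_eq)
  moreover have "(\<Sum>p\<in>F. cmul (c p) (kb (fst p) (snd p))) \<in> fr (cspan B)"
  proof (rule fr_sum[OF *(1)])
    fix p assume "p \<in> F"
    then have "fst p \<in> B" "snd p \<in> B" using *(2) by auto
    then show "cmul (c p) (kb (fst p) (snd p)) \<in> fr (cspan B)"
      by (intro fr_cmul fr_kb csubspace_cspan cspan_base)
  qed
  ultimately show "A \<in> tc_op ` fr (cspan B)" by blast
next
  fix A assume "A \<in> tc_op ` fr (cspan B)"
  then obtain \<rho> where A: "A = tc_op \<rho>" and "\<rho> \<in> fr (cspan B)" by blast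
  then obtain n x y where xy: "\<And>j. j < n \<Longrightarrow> x j \<in> cspan B" "\<And>j. j < n \<Longrightarrow> y j \<in> cspan B" "\<rho> = (\<Sum>j<n::nat. kb (x j) (y j))"
    by (elim frE) blast
  have "tc_op \<rho> \<in> ketbra_span B" unfolding xy(3)
    by (intro ketbra_span_sum ketbra_span_kb xy) auto
  then show "A \<in> ketbra_span B" by (simp add: A)
qed

section \<open>Continuity of sesquilinear maps for the graph norm\<close>

definition gnorm :: "('h::chilbert \<Rightarrow> 'h) \<Rightarrow> 'h \<Rightarrow> real" where
  "gnorm M x = norm x + norm (M x)"

lemma gnorm_nonneg: "gnorm M x \<ge> 0"
  by (simp add: gnorm_def)

lemma form_le_gnorm: "2 * Re (cinner \<phi> (M \<phi>)) \<le> (gnorm M \<phi>)\<^sup>2"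
proof -
  have "Re (cinner \<phi> (M \<phi>)) \<le> norm \<phi> * norm (M \<phi>)"
    using cinner_cauchy_schwarz complex_Re_le_cmod order_trans by blast
  then show ?thesis unfolding gnorm_def power2_sum using zero_le_power2[of "norm \<phi>"] zero_le_power2[of "norm (M \<phi>)"] by linarith
qed

lemma sesq_diff_gnorm_bound:
  assumes D: "csubspace D" and J: "sesq D J"
    and bd: "\<And>\<phi> \<psi>. \<phi> \<in> D \<Longrightarrow> \<psi> \<in> D \<Longrightarrow> norm (J \<phi> \<psi>) \<le> gnorm M \<phi> * gnorm M \<psi>"
    and M: "clinear_on D M" and in_D: "x \<in> D" "x' \<in> D" "y \<in> D" "y' \<in> D"
  shows "norm (J x y - J x' y') \<le> (norm (x - x') + norm (M x - M x')) * gnorm M y + gnorm M x' * (norm (y - y') + norm (M y - M y'))"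
proof -
  have Md: "M (u - w) = M u - M w" if "u \<in> D" "w \<in> D" for u w
  proof -
    have w: "(-1) *\<^sub>C w \<in> D" by (rule csubspace_scale[OF D that(2)])
    have "M (u + (-1) *\<^sub>C w) = M u + M ((-1) *\<^sub>C w)" using M that(1) w unfolding clinear_on_def by blast
    moreover have "M ((-1) *\<^sub>C w) = (-1) *\<^sub>C M w" using M that(2) unfolding clinear_on_def by blast
    ultimately show ?thesis by simp
  qed
  have "J x y - J x' y' = J (x - x') y + J x' (y - y')"
    using sesq_diff(1)[OF D J in_D(1,2,3)] sesq_diff(2)[OF D J in_D(3,4,2)] by simp
  also have "norm \<dots> \<le> norm (J (x - x') y) + norm (J x' (y - y'))" by (rule norm_triangle_ineq)
  also have "\<dots> \<le> gnorm M (x - x') * gnorm M y + gnorm M x' * gnorm M (y - y')"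
    by (intro add_mono bd csubspace_diff D in_D)
  finally show ?thesis by (simp add: gnorm_def Md in_D)
qed

lemma sesq_graph_tendsto:
  assumes D: "csubspace D" and J: "sesq D J"
    and bd: "\<And>\<phi> \<psi>. \<phi> \<in> D \<Longrightarrow> \<psi> \<in> D \<Longrightarrow> norm (J \<phi> \<psi>) \<le> gnorm M \<phi> * gnorm M \<psi>"
    and M: "clinear_on D M"
    and x: "\<And>n::nat. X n \<in> D" "X \<longlonglongrightarrow> x" "(\<lambda>n. M (X n)) \<longlonglongrightarrow> M x" "x \<in> D"
    and y: "\<And>n. Y n \<in> D" "Y \<longlonglongrightarrow> y" "(\<lambda>n. M (Y n)) \<longlonglongrightarrow> M y" "y \<in> D"
  shows "(\<lambda>n. J (X n) (Y n)) \<longlonglongrightarrow> J x y"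
proof -
  have "(\<lambda>n. J (X n) (Y n) - J x y) \<longlonglongrightarrow> 0"
  proof (rule Lim_null_comparison)
    show "\<forall>\<^sub>F n in sequentially. norm (J (X n) (Y n) - J x y)
        \<le> (norm (X n - x) + norm (M (X n) - M x)) * gnorm M (Y n) + gnorm M x * (norm (Y n - y) + norm (M (Y n) - M y))"
      by (intro always_eventually allI sesq_diff_gnorm_bound[OF D J bd M] x y) auto
    have "(\<lambda>n. (norm (X n - x) + norm (M (X n) - M x)) * gnorm M (Y n) + gnorm M x * (norm (Y n - y) + norm (M (Y n) - M y)))
      \<longlonglongrightarrow> (norm (x - x) + norm (M x - M x)) * gnorm M y + gnorm M x * (norm (y - y) + norm (M y - M y))"
      unfolding gnorm_def by (intro tendsto_intros x y)
    then show "(\<lambda>n. (norm (X n - x) + norm (M (X n) - M x)) * gnorm M (Y n) + gnorm M x * (norm (Y n - y) + norm (M (Y n) - M y))) \<longlonglongrightarrow> 0"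
      by simp
  qed
  then show ?thesis by (simp add: LIM_zero_iff)
qed

text \<open>Meant for limits not yet known to lie in the domain: convergence of \<open>J\<close>
  along the sequences is what places the limiting rank-one operator in the domain of the
  generator.\<close>

lemma sesq_graph_Cauchy:
  assumes D: "csubspace D" and J: "sesq D J"
    and bd: "\<And>\<phi> \<psi>. \<phi> \<in> D \<Longrightarrow> \<psi> \<in> D \<Longrightarrow> norm (J \<phi> \<psi>) \<le> gnorm M \<phi> * gnorm M \<psi>"
    and M: "clinear_on D M"
    and x: "\<And>n::nat. X n \<in> D" "Cauchy X" "Cauchy (\<lambda>n. M (X n))"
    and y: "\<And>n. Y n \<in> D" "Cauchy Y" "Cauchy (\<lambda>n. M (Y n))"
  shows "Cauchy (\<lambda>n. J (X n) (Y n))"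
proof (rule CauchyI)
  fix e :: real assume e: "e > 0"
  obtain C1 where C1: "\<And>n. gnorm M (X n) \<le> C1"
  proof -
    obtain a b where "\<And>n. norm (X n) \<le> a" "\<And>n. norm (M (X n)) \<le> b"
      using cauchy_imp_bounded[OF x(2)] cauchy_imp_bounded[OF x(3)] by (auto simp: bounded_iff)
    then show ?thesis by (intro that[of "a + b"]) (simp add: gnorm_def add_mono)
  qed
  obtain C2 where C2: "\<And>n. gnorm M (Y n) \<le> C2"
  proof -
    obtain a b where "\<And>n. norm (Y n) \<le> a" "\<And>n. norm (M (Y n)) \<le> b"
      using cauchy_imp_bounded[OF y(2)] cauchy_imp_bounded[OF y(3)] by (auto simp: bounded_iff)
    then show ?thesis by (intro that[of "a + b"]) (simp add: gnorm_def add_mono)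
  qed
  define C where "C = max C1 C2 + 1"
  have C: "gnorm M (X n) \<le> C" "gnorm M (Y n) \<le> C" for n using C1[of n] C2[of n] by (auto simp: C_def)
  have C0: "C > 0" using gnorm_nonneg[of M "X 0"] C1[of 0] by (simp add: C_def)
  \<comment> \<open>Four differences occur, each multiplied by a graph norm of at most
    \<open>C\<close>.\<close>
  define d where "d = e / (4 * C)"
  have d: "d > 0" using e C0 by (simp add: d_def)
  obtain N1 where N1: "\<And>m n. m \<ge> N1 \<Longrightarrow> n \<ge> N1 \<Longrightarrow> norm (X m - X n) < d" using CauchyD[OF x(2) d] by blast
  obtain N2 where N2: "\<And>m n. m \<ge> N2 \<Longrightarrow> n \<ge> N2 \<Longrightarrow> norm (M (X m) - M (X n)) < d" using CauchyD[OF x(3) d] by blast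
  obtain N3 where N3: "\<And>m n. m \<ge> N3 \<Longrightarrow> n \<ge> N3 \<Longrightarrow> norm (Y m - Y n) < d" using CauchyD[OF y(2) d] by blast
  obtain N4 where N4: "\<And>m n. m \<ge> N4 \<Longrightarrow> n \<ge> N4 \<Longrightarrow> norm (M (Y m) - M (Y n)) < d" using CauchyD[OF y(3) d] by blast
  define N where "N = N1 + N2 + N3 + N4"
  have "norm (J (X m) (Y m) - J (X n) (Y n)) < e" if mn: "m \<ge> N" "n \<ge> N" for m n
  proof -
    have "norm (J (X m) (Y m) - J (X n) (Y n)) \<le> (norm (X m - X n) + norm (M (X m) - M (X n))) * gnorm M (Y m)
        + gnorm M (X n) * (norm (Y m - Y n) + norm (M (Y m) - M (Y n)))"
      by (rule sesq_diff_gnorm_bound[OF D J bd M x(1) x(1) y(1) y(1)])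
    also have "\<dots> \<le> (norm (X m - X n) + norm (M (X m) - M (X n))) * C + C * (norm (Y m - Y n) + norm (M (Y m) - M (Y n)))"
      by (intro add_mono mult_left_mono mult_right_mono C) auto
    also have "\<dots> = C * (norm (X m - X n) + norm (M (X m) - M (X n)) + (norm (Y m - Y n) + norm (M (Y m) - M (Y n))))"
      by (simp add: algebra_simps)
    also have "\<dots> < C * (d + d + (d + d))"
      using mn C0 by (intro mult_strict_left_mono add_strict_mono N1 N2 N3 N4) (auto simp: N_def)
    also have "\<dots> = e" using C0 by (simp add: d_def)
    finally show ?thesis .
  qed
  then show "\<exists>M. \<forall>m\<ge>M. \<forall>n\<ge>M. norm (J (X m) (Y m) - J (X n) (Y n)) < e" by blast
qed

context qds
begin

lemma standard_form_imp_matrix_normal: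
  assumes sep: "separable_space TYPE('h)" and gsf: "gen_standard_form T K DM M Lk"
  shows "\<exists>B. matrix_normal_witness T B \<and> cspan B \<subseteq> DM"
proof -
  have M: "clinear_on DM M" and dense: "closure DM = UNIV"
    and Llin: "\<And>k. k \<in> K \<Longrightarrow> clinear_on DM (Lk k)"
    and form: "\<And>\<phi> \<psi>. \<phi> \<in> DM \<Longrightarrow> \<psi> \<in> DM \<Longrightarrow> \<exists>\<sigma>. tc_has_sum (\<lambda>k. ketbra (Lk k \<phi>) (Lk k \<psi>)) K \<sigma> \<and>
        is_gen T (ketbra \<phi> \<psi>) (\<lambda>x. \<sigma> x - ketbra (M \<phi>) \<psi> x - ketbra \<phi> (M \<psi>) x)"
    and gd: "graph_dense T (D0 DM)"
    and cons: "\<And>\<phi>. \<phi> \<in> DM \<Longrightarrow> ((\<lambda>k. complex_of_real ((norm (Lk k \<phi>))\<^sup>2)) has_sum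
                 (cinner \<phi> (M \<phi>) + cinner (M \<phi>) \<phi>)) K"
    using gsf unfolding gen_standard_form_def densely_defined_def by blast+
  have D: "csubspace DM" using M by (simp add: clinear_on_def)
  have "\<exists>\<sigma>. ((\<lambda>F. \<Sum>k\<in>F. kb (Lk k \<phi>) (Lk k \<psi>)) \<longlongrightarrow> \<sigma>) (finite_subsets_at_top K) \<and>
      gens (kb \<phi> \<psi>) (\<sigma> - kb (M \<phi>) \<psi> - kb \<phi> (M \<psi>))" if d: "\<phi> \<in> DM" "\<psi> \<in> DM" for \<phi> \<psi>
  proof -
    obtain A where A: "tc_has_sum (\<lambda>k. ketbra (Lk k \<phi>) (Lk k \<psi>)) K A"
      and g: "is_gen T (ketbra \<phi> \<psi>) (\<lambda>x. A x - ketbra (M \<phi>) \<psi> x - ketbra \<phi> (M \<psi>) x)"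
      using form[OF d] by (elim exE conjE)
    have "trace_class A" using A by (simp add: tc_has_sum_def)
    then obtain \<sigma> where \<sigma>: "A = tc_op \<sigma>" using trace_class_imp_tc_op by blast
    have "is_gen T (tc_op (kb \<phi> \<psi>)) (tc_op (\<sigma> - kb (M \<phi>) \<psi> - kb \<phi> (M \<psi>)))"
      using g by (simp add: \<sigma> minus_tc.rep_eq kb.rep_eq)
    then have 1: "gens (kb \<phi> \<psi>) (\<sigma> - kb (M \<phi>) \<psi> - kb \<phi> (M \<psi>))" by (simp only: is_gen_iff)
    have "norm ((\<Sum>k\<in>F. kb (Lk k \<phi>) (Lk k \<psi>)) - \<sigma>) = trace_norm (\<lambda>x. (\<Sum>k\<in>F. ketbra (Lk k \<phi>) (Lk k \<psi>) x) - A x)" for F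
    proof -
      have "tc_op ((\<Sum>k\<in>F. kb (Lk k \<phi>) (Lk k \<psi>)) - \<sigma>) = (\<lambda>x. (\<Sum>k\<in>F. ketbra (Lk k \<phi>) (Lk k \<psi>) x) - A x)"
        by (rule ext) (simp add: \<sigma> minus_tc.rep_eq tc_op_sum kb.rep_eq)
      then show ?thesis by (simp only: norm_tc.rep_eq)
    qed
    then have "((\<lambda>F. norm ((\<Sum>k\<in>F. kb (Lk k \<phi>) (Lk k \<psi>)) - \<sigma>)) \<longlongrightarrow> 0) (finite_subsets_at_top K)"
      using A by (simp add: tc_has_sum_def)
    then have "((\<lambda>F. \<Sum>k\<in>F. kb (Lk k \<phi>) (Lk k \<psi>)) \<longlongrightarrow> \<sigma>) (finite_subsets_at_top K)"
      by (simp add: tendsto_norm_zero_iff LIM_zero_iff)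
    with 1 show ?thesis by blast
  qed
  note ex_J = this
  define J where "J \<phi> \<psi> = (SOME \<sigma>. ((\<lambda>F. \<Sum>k\<in>F. kb (Lk k \<phi>) (Lk k \<psi>)) \<longlongrightarrow> \<sigma>) (finite_subsets_at_top K) \<and>
      gens (kb \<phi> \<psi>) (\<sigma> - kb (M \<phi>) \<psi> - kb \<phi> (M \<psi>)))" for \<phi> \<psi>
  have J: "((\<lambda>F. \<Sum>k\<in>F. kb (Lk k \<phi>) (Lk k \<psi>)) \<longlongrightarrow> J \<phi> \<psi>) (finite_subsets_at_top K)"
    and Jg: "gens (kb \<phi> \<psi>) (J \<phi> \<psi> - kb (M \<phi>) \<psi> - kb \<phi> (M \<psi>))" if "\<phi> \<in> DM" "\<psi> \<in> DM" for \<phi> \<psi>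
    using someI_ex[OF ex_J[OF that]] unfolding J_def[symmetric] by blast+
  have Ju: "J \<phi> \<psi> = \<sigma>" if "\<phi> \<in> DM" "\<psi> \<in> DM" "((\<lambda>F. \<Sum>k\<in>F. kb (Lk k \<phi>) (Lk k \<psi>)) \<longlongrightarrow> \<sigma>) (finite_subsets_at_top K)" for \<phi> \<psi> \<sigma>
    using tendsto_unique[OF _ J[OF that(1,2)] that(3)] by simp
  have Ladd: "Lk k (x + y) = Lk k x + Lk k y" and Lsc: "Lk k (c *\<^sub>C x) = c *\<^sub>C Lk k x" if "k \<in> K" "x \<in> DM" "y \<in> DM" for k x y c
    using Llin[OF that(1)] that by (auto simp: clinear_on_def)
  have evK: "\<forall>\<^sub>F F in finite_subsets_at_top K. (\<Sum>k\<in>F. f k) = (\<Sum>k\<in>F. g k)" if "\<And>k. k \<in> K \<Longrightarrow> f k = g k" for f g :: "nat \<Rightarrow> 'h tc"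
    by (rule eventually_finite_subsets_at_top_weakI) (use that in \<open>auto intro!: sum.cong\<close>)
  have sq: "sesq DM J" unfolding sesq_def
  proof (intro conjI ballI allI)
    fix \<phi> \<phi>' \<psi> assume d: "\<phi> \<in> DM" "\<phi>' \<in> DM" "\<psi> \<in> DM"
    show "J (\<phi> + \<phi>') \<psi> = J \<phi> \<psi> + J \<phi>' \<psi>"
    proof (rule Ju[OF csubspace_add[OF D d(1,2)] d(3)])
      show "((\<lambda>F. \<Sum>k\<in>F. kb (Lk k (\<phi> + \<phi>')) (Lk k \<psi>)) \<longlongrightarrow> J \<phi> \<psi> + J \<phi>' \<psi>) (finite_subsets_at_top K)"
        using tendsto_add[OF J[OF d(1,3)] J[OF d(2,3)]] unfolding sum.distrib[symmetric]
        by (rule Lim_transform_eventually) (rule evK, simp add: Ladd d kb_add_left)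
    qed
    show "J \<psi> (\<phi> + \<phi>') = J \<psi> \<phi> + J \<psi> \<phi>'"
    proof (rule Ju[OF d(3) csubspace_add[OF D d(1,2)]])
      show "((\<lambda>F. \<Sum>k\<in>F. kb (Lk k \<psi>) (Lk k (\<phi> + \<phi>'))) \<longlongrightarrow> J \<psi> \<phi> + J \<psi> \<phi>') (finite_subsets_at_top K)"
        using tendsto_add[OF J[OF d(3,1)] J[OF d(3,2)]] unfolding sum.distrib[symmetric]
        by (rule Lim_transform_eventually) (rule evK, simp add: Ladd d kb_add_right)
    qed
  next
    fix c \<phi> \<psi> assume d: "\<phi> \<in> DM" "\<psi> \<in> DM"
    show "J (c *\<^sub>C \<phi>) \<psi> = cmul c (J \<phi> \<psi>)"
    proof (rule Ju[OF csubspace_scale[OF D d(1)] d(2)])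
      show "((\<lambda>F. \<Sum>k\<in>F. kb (Lk k (c *\<^sub>C \<phi>)) (Lk k \<psi>)) \<longlongrightarrow> cmul c (J \<phi> \<psi>)) (finite_subsets_at_top K)"
        using tendsto_cmul[OF J[OF d]] unfolding cmul_sum_right
        by (rule Lim_transform_eventually) (rule evK, simp add: Lsc[OF _ d(1) d(1)] kb_scaleC_left)
    qed
    show "J \<phi> (c *\<^sub>C \<psi>) = cmul (cnj c) (J \<phi> \<psi>)"
    proof (rule Ju[OF d(1) csubspace_scale[OF D d(2)]])
      show "((\<lambda>F. \<Sum>k\<in>F. kb (Lk k \<phi>) (Lk k (c *\<^sub>C \<psi>))) \<longlongrightarrow> cmul (cnj c) (J \<phi> \<psi>)) (finite_subsets_at_top K)"
        using tendsto_cmul[OF J[OF d]] unfolding cmul_sum_right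
        by (rule Lim_transform_eventually) (rule evK, simp add: Lsc[OF _ d(2) d(2)] kb_scaleC_right)
    qed
  qed
  \<comment> \<open>Finite parts of the conservativity sum are at most 2 Re <\<phi>, M \<phi>>,
    hence at most the squared graph norm.\<close>
  have Lsum: "(\<Sum>k\<in>F. (norm (Lk k \<phi>))\<^sup>2) \<le> (gnorm M \<phi>)\<^sup>2" if \<phi>: "\<phi> \<in> DM" and F: "finite F" "F \<subseteq> K" for \<phi> F
  proof -
    have "((\<lambda>k. Re (complex_of_real ((norm (Lk k \<phi>))\<^sup>2))) has_sum Re (cinner \<phi> (M \<phi>) + cinner (M \<phi>) \<phi>)) K"
      by (rule has_sum_Re[OF cons[OF \<phi>]])
    moreover have "Re (cinner \<phi> (M \<phi>) + cinner (M \<phi>) \<phi>) = 2 * Re (cinner \<phi> (M \<phi>))"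
      using cinner_commute[of "M \<phi>" \<phi>] by simp
    ultimately have "((\<lambda>k. (norm (Lk k \<phi>))\<^sup>2) has_sum (2 * Re (cinner \<phi> (M \<phi>)))) K" by simp
    then have "(\<Sum>k\<in>F. (norm (Lk k \<phi>))\<^sup>2) \<le> 2 * Re (cinner \<phi> (M \<phi>))"
      by (rule has_sum_mono2[OF has_sum_finite[OF F(1)]]) (use F in auto)
    then show ?thesis using form_le_gnorm order_trans by blast
  qed
  \<comment> \<open>Cauchy-Schwarz over finitely many \<open>k\<close>, with a bound independent of
    the finite set, passes to the trace norm limit.\<close>
  have bd: "norm (J \<phi> \<psi>) \<le> gnorm M \<phi> * gnorm M \<psi>" if d: "\<phi> \<in> DM" "\<psi> \<in> DM" for \<phi> \<psi>
  proof (rule tendsto_upperbound[OF tendsto_norm[OF J[OF d]]])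
    show "\<forall>\<^sub>F F in finite_subsets_at_top K. norm (\<Sum>k\<in>F. kb (Lk k \<phi>) (Lk k \<psi>)) \<le> gnorm M \<phi> * gnorm M \<psi>"
    proof (rule eventually_finite_subsets_at_top_weakI)
      fix F assume F: "finite F" "F \<subseteq> K"
      have "norm (\<Sum>k\<in>F. kb (Lk k \<phi>) (Lk k \<psi>)) \<le> (\<Sum>k\<in>F. \<bar>norm (Lk k \<phi>)\<bar> * \<bar>norm (Lk k \<psi>)\<bar>)"
        by (rule sum_norm_le) (simp add: norm_kb_le)
      also have "\<dots> \<le> sqrt (\<Sum>k\<in>F. (norm (Lk k \<phi>))\<^sup>2) * sqrt (\<Sum>k\<in>F. (norm (Lk k \<psi>))\<^sup>2)"
        by (rule sum_mult_le_sqrt)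
      also have "\<dots> \<le> sqrt ((gnorm M \<phi>)\<^sup>2) * sqrt ((gnorm M \<psi>)\<^sup>2)"
        by (intro mult_mono real_sqrt_le_mono Lsum F d) (auto intro: sum_nonneg)
      finally show "norm (\<Sum>k\<in>F. kb (Lk k \<phi>) (Lk k \<psi>)) \<le> gnorm M \<phi> * gnorm M \<psi>"
        by (simp add: gnorm_nonneg)
    qed
  qed simp
  obtain B where B: "is_onb B" "cspan B \<subseteq> DM"
    "\<forall>x\<in>DM. \<exists>f::nat \<Rightarrow> 'h. (\<forall>n. f n \<in> cspan B) \<and> f \<longlonglongrightarrow> x \<and> (\<lambda>n. M (f n)) \<longlonglongrightarrow> M x"
    using ex_onb_core[OF sep D dense, of M] by (elim exE conjE)
  let ?K = "\<lambda>\<phi> \<psi>. J \<phi> \<psi> - kb (M \<phi>) \<psi> - kb \<phi> (M \<psi>)"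
  \<comment> \<open>The finitely many vectors in \<rho> are approximated in graph norm from the span
    of the basis; the bound on \<open>J\<close> makes the generator values converge along with the
    operators.\<close>
  have approx: "\<exists>\<rho>' \<sigma>'. \<rho>' \<in> fr (cspan B) \<and> gens \<rho>' \<sigma>' \<and> dist \<rho>' \<rho> < e \<and> dist \<sigma>' \<sigma> < e"
    if "\<rho> \<in> fr DM" and g: "gens \<rho> \<sigma>" and e: "e > 0" for \<rho> \<sigma> e
  proof -
    obtain n x y where xy: "\<And>j. j < n \<Longrightarrow> x j \<in> DM" "\<And>j. j < n \<Longrightarrow> y j \<in> DM" "\<rho> = (\<Sum>j<n::nat. kb (x j) (y j))"
      using \<open>\<rho> \<in> fr DM\<close> by (elim frE) blast
    have "\<sigma> = (\<Sum>j<n. ?K (x j) (y j))"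
      by (rule gens_unique[OF g]) (unfold xy(3), intro gens_sum Jg xy, auto)
    have "\<forall>j. \<exists>f::nat \<Rightarrow> 'h. j < n \<longrightarrow> (\<forall>m. f m \<in> cspan B) \<and> f \<longlonglongrightarrow> x j \<and> (\<lambda>m. M (f m)) \<longlonglongrightarrow> M (x j)"
      using bspec[OF B(3) xy(1)] by blast
    then obtain X where X: "\<And>j m. j < n \<Longrightarrow> X j m \<in> cspan B" "\<And>j. j < n \<Longrightarrow> X j \<longlonglongrightarrow> x j"
      "\<And>j. j < n \<Longrightarrow> (\<lambda>m. M (X j m)) \<longlonglongrightarrow> M (x j)" by (metis (mono_tags))
    have "\<forall>j. \<exists>f::nat \<Rightarrow> 'h. j < n \<longrightarrow> (\<forall>m. f m \<in> cspan B) \<and> f \<longlonglongrightarrow> y j \<and> (\<lambda>m. M (f m)) \<longlonglongrightarrow> M (y j)"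
      using bspec[OF B(3) xy(2)] by blast
    then obtain Y where Y: "\<And>j m. j < n \<Longrightarrow> Y j m \<in> cspan B" "\<And>j. j < n \<Longrightarrow> Y j \<longlonglongrightarrow> y j"
      "\<And>j. j < n \<Longrightarrow> (\<lambda>m. M (Y j m)) \<longlonglongrightarrow> M (y j)" by (metis (mono_tags))
    have XD: "X j m \<in> DM" "Y j m \<in> DM" if "j < n" for j m using X(1)[OF that] Y(1)[OF that] B(2) by auto
    have l1: "(\<lambda>m. \<Sum>j<n. kb (X j m) (Y j m)) \<longlonglongrightarrow> \<rho>"
      unfolding xy(3) by (intro tendsto_intros X Y) auto
    have l2: "(\<lambda>m. \<Sum>j<n. ?K (X j m) (Y j m)) \<longlonglongrightarrow> \<sigma>"
      unfolding \<open>\<sigma> = _\<close>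
    proof (rule tendsto_sum)
      fix j assume "j \<in> {..<n}"
      then have j: "j < n" by simp
      show "(\<lambda>m. ?K (X j m) (Y j m)) \<longlonglongrightarrow> ?K (x j) (y j)"
        by (intro tendsto_diff tendsto_kb sesq_graph_tendsto[OF D sq bd M] X[OF j] Y[OF j] xy j XD) auto
    qed
    have "\<forall>\<^sub>F m in sequentially. dist (\<Sum>j<n. kb (X j m) (Y j m)) \<rho> < e \<and> dist (\<Sum>j<n. ?K (X j m) (Y j m)) \<sigma> < e"
      using l1 l2 e unfolding tendsto_iff by (auto intro: eventually_conj)
    then obtain m where m: "dist (\<Sum>j<n. kb (X j m) (Y j m)) \<rho> < e" "dist (\<Sum>j<n. ?K (X j m) (Y j m)) \<sigma> < e"
      unfolding eventually_sequentially by blast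
    have "(\<Sum>j<n. kb (X j m) (Y j m)) \<in> fr (cspan B)" by (rule frI; intro X Y)
    moreover have "gens (\<Sum>j<n. kb (X j m) (Y j m)) (\<Sum>j<n. ?K (X j m) (Y j m))"
      by (intro gens_sum Jg XD) auto
    ultimately show ?thesis using m by blast
  qed
  have gd': "\<And>\<rho>. \<rho> \<in> fr DM \<Longrightarrow> \<exists>\<sigma>. gens \<rho> \<sigma>"
    and gd'': "\<And>\<rho> \<sigma>. gens \<rho> \<sigma> \<Longrightarrow> \<exists>X Y. (\<forall>n. X n \<in> fr DM \<and> gens (X n) (Y n)) \<and> X \<longlonglongrightarrow> \<rho> \<and> Y \<longlonglongrightarrow> \<sigma>"
    using gd unfolding tc_op_fr_eq_D0[symmetric] graph_dense_iff by blast+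
  have "graph_dense T (tc_op ` fr (cspan B))"
    unfolding graph_dense_iff
  proof (intro conjI ballI allI impI)
    fix \<rho> assume "\<rho> \<in> fr (cspan B)"
    then show "\<exists>\<sigma>. gens \<rho> \<sigma>" using gd' fr_mono[OF B(2)] by blast
  next
    fix \<rho> \<sigma> assume "gens \<rho> \<sigma>"
    then obtain X Y where XY: "\<And>n. X n \<in> fr DM" "\<And>n. gens (X n) (Y n)" "X \<longlonglongrightarrow> \<rho>" "Y \<longlonglongrightarrow> \<sigma>"
      using gd'' by blast
    \<comment> \<open>A diagonal choice: replacing each approximant and its generator value within
      1/(n+1) leaves both limits unchanged.\<close>
    have "\<forall>n. \<exists>p. fst p \<in> fr (cspan B) \<and> gens (fst p) (snd p) \<and> dist (fst p) (X n) < inverse (real (Suc n)) \<and> dist (snd p) (Y n) < inverse (real (Suc n))"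
      using approx[OF XY(1,2)] by (metis fst_conv snd_conv inverse_positive_iff_positive of_nat_0_less_iff zero_less_Suc)
    then obtain p where p: "\<And>n. fst (p n) \<in> fr (cspan B)" "\<And>n. gens (fst (p n)) (snd (p n))"
      "\<And>n. dist (fst (p n)) (X n) < inverse (real (Suc n))" "\<And>n. dist (snd (p n)) (Y n) < inverse (real (Suc n))"
      by metis
    have lim: "Z \<longlonglongrightarrow> z" if "W \<longlonglongrightarrow> z" "\<And>n. dist (Z n) (W n) < inverse (real (Suc n))" for Z W and z :: "'h tc"
    proof (rule Lim_transform2[OF that(1)])
      show "(\<lambda>n. W n - Z n) \<longlonglongrightarrow> 0"
      proof (rule Lim_null_comparison[OF _ LIMSEQ_inverse_real_of_nat], intro always_eventually allI)
        show "norm (W n - Z n) \<le> inverse (real (Suc n))" for n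
          using that(2)[of n] by (simp only: dist_norm norm_minus_commute less_imp_le)
      qed
    qed
    show "\<exists>X Y. (\<forall>n. X n \<in> fr (cspan B) \<and> gens (X n) (Y n)) \<and> X \<longlonglongrightarrow> \<rho> \<and> Y \<longlonglongrightarrow> \<sigma>"
      using p(1,2) lim[OF XY(3) p(3)] lim[OF XY(4) p(4)]
      by (intro exI[of _ "\<lambda>n. fst (p n)"] exI[of _ "\<lambda>n. snd (p n)"]) auto
  qed
  then have "matrix_normal_witness T B"
    unfolding matrix_normal_witness_def is_core_def tc_op_fr_eq_ketbra_span using B(1) by blast
  then show ?thesis using B(2) by blast
qed

end

section \<open>From matrix normality to a standard form\<close>

lemma gnorm_scaleC:
  "clinear_on D M \<Longrightarrow> x \<in> D \<Longrightarrow> gnorm M (c *\<^sub>C x) = cmod c * gnorm M x"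
  by (simp add: gnorm_def clinear_on_def distrib_left)

text \<open>Replacing the arguments by s \<phi> and \<psi>/s leaves \<open>J \<phi> \<psi>\<close>
  unchanged, so the additive bound may be optimized over \<open>s\<close>. The choice of
  \<open>s\<close> balances the two terms and gives the geometric mean.\<close>

lemma sesq_gnorm_bound:
  assumes D: "csubspace D" and J: "sesq D J" and M: "clinear_on D M"
    and bd: "\<And>\<phi> \<psi>. \<phi> \<in> D \<Longrightarrow> \<psi> \<in> D \<Longrightarrow> 2 * norm (J \<phi> \<psi>) \<le> (gnorm M \<phi>)\<^sup>2 + (gnorm M \<psi>)\<^sup>2"
    and \<phi>: "\<phi> \<in> D" and \<psi>: "\<psi> \<in> D"
  shows "norm (J \<phi> \<psi>) \<le> gnorm M \<phi> * gnorm M \<psi>"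
proof (cases "gnorm M \<phi> = 0 \<or> gnorm M \<psi> = 0")
  case True
  then have "\<phi> = 0 \<or> \<psi> = 0" by (auto simp: gnorm_def add_nonneg_eq_0_iff)
  then have "J \<phi> \<psi> = 0" using sesq_zero[OF D J] \<phi> \<psi> by auto
  then show ?thesis using gnorm_nonneg[of M \<phi>] gnorm_nonneg[of M \<psi>] by simp
next
  case False
  then have g: "gnorm M \<phi> > 0" "gnorm M \<psi> > 0" using gnorm_nonneg[of M] by (auto simp: less_le)
  define s where "s = sqrt (gnorm M \<psi> / gnorm M \<phi>)"
  have s: "s > 0" "s\<^sup>2 = gnorm M \<psi> / gnorm M \<phi>" using g by (simp_all add: s_def)
  have D': "of_real s *\<^sub>C \<phi> \<in> D" "of_real (1 / s) *\<^sub>C \<psi> \<in> D" by (intro csubspace_scale D \<phi> \<psi>)+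
  have "J (of_real s *\<^sub>C \<phi>) (of_real (1 / s) *\<^sub>C \<psi>) = cmul (of_real s) (J \<phi> (of_real (1 / s) *\<^sub>C \<psi>))"
    by (rule sesqD(3)[OF J \<phi> D'(2)])
  also have "\<dots> = J \<phi> \<psi>" unfolding sesqD(4)[OF J \<phi> \<psi>] using s(1) by simp
  finally have "2 * norm (J \<phi> \<psi>) \<le> (gnorm M (of_real s *\<^sub>C \<phi>))\<^sup>2 + (gnorm M (of_real (1 / s) *\<^sub>C \<psi>))\<^sup>2"
    using bd[OF D'] by simp
  also have "\<dots> = s\<^sup>2 * (gnorm M \<phi>)\<^sup>2 + (1 / s\<^sup>2) * (gnorm M \<psi>)\<^sup>2"
    unfolding gnorm_scaleC[OF M \<phi>] gnorm_scaleC[OF M \<psi>] using s(1)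
    by (simp add: power_mult_distrib power_divide norm_divide)
  also have "\<dots> = 2 * (gnorm M \<phi> * gnorm M \<psi>)"
    unfolding s(2) using g by (simp add: power2_eq_square field_simps)
  finally show ?thesis by simp
qed

context qds
begin

lemma Jop_gnorm_bound:
  assumes e: "norm e = 1 \<or> (\<forall>x::'h. x = 0)" and eD: "e \<in> D" and D: "csubspace D"
    and dom: "\<And>\<phi> \<psi>. \<phi> \<in> D \<Longrightarrow> \<psi> \<in> D \<Longrightarrow> gens (kb \<phi> \<psi>) (L (kb \<phi> \<psi>))"
    and "\<phi> \<in> D" "\<psi> \<in> D"
  shows "norm (Jop e \<phi> \<psi>) \<le> gnorm (Mop e) \<phi> * gnorm (Mop e) \<psi>"
proof (rule sesq_gnorm_bound[OF D Jop_sesq[OF e eD D dom] Mop_clinear_on[OF e eD D dom] _ assms(5,6)])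
  fix \<phi> \<psi> assume d: "\<phi> \<in> D" "\<psi> \<in> D"
  have "2 * norm (Jop e \<phi> \<psi>) \<le> Re (tr (Jop e \<phi> \<phi>)) + Re (tr (Jop e \<psi> \<psi>))"
    using cp_kernel_norm[OF onb Jop_cp_kernel[OF e eD D dom] d] by simp
  also have "\<dots> \<le> (gnorm (Mop e) \<phi>)\<^sup>2 + (gnorm (Mop e) \<psi>)\<^sup>2"
  proof -
    have t: "Re (tr (Jop e x x)) = 2 * Re (cinner x (Mop e x))" if "x \<in> D" for x
      by (rule Jop_trace_Re[OF e eD D dom that])
    show ?thesis unfolding t[OF d(1)] t[OF d(2)] by (intro add_mono form_le_gnorm)
  qed
  finally show "2 * norm (Jop e \<phi> \<psi>) \<le> (gnorm (Mop e) \<phi>)\<^sup>2 + (gnorm (Mop e) \<psi>)\<^sup>2" .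
qed

end

section \<open>Maximality of the operator \<open>M\<close> on a matrix normal core\<close>

locale qds_matrix_normal = qds T for T :: "real \<Rightarrow> ('h::chilbert \<Rightarrow> 'h) \<Rightarrow> ('h \<Rightarrow> 'h)" +
  fixes B :: "'h set" and e :: 'h
  assumes B: "is_onb B" and core: "graph_dense T (ketbra_span B)"
    and e: "norm e = 1 \<or> (\<forall>x::'h. x = 0)" and eB: "e \<in> cspan B"
begin

abbreviation "De \<equiv> cspan B"
abbreviation "M \<equiv> Mop e"
abbreviation "J \<equiv> Jop e"

lemma De: "csubspace De"
  by (rule csubspace_cspan)

lemma De_dense: "closure De = UNIV"
  using B by (simp add: is_onb_def)

lemma fr_dom: "\<rho> \<in> fr De \<Longrightarrow> gens \<rho> (L \<rho>)"
  and core_approx: "gens \<rho> \<sigma> \<Longrightarrow> \<exists>X Y. (\<forall>n. X n \<in> fr De \<and> gens (X n) (Y n)) \<and> X \<longlonglongrightarrow> \<rho> \<and> Y \<longlonglongrightarrow> \<sigma>"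
  using core unfolding tc_op_fr_eq_ketbra_span[symmetric] graph_dense_iff by (metis L_eq, blast)

lemma De_dom: "\<phi> \<in> De \<Longrightarrow> \<psi> \<in> De \<Longrightarrow> gens (kb \<phi> \<psi>) (L (kb \<phi> \<psi>))"
  by (intro fr_dom fr_kb)

lemma De_sesq: "sesq De J"
  by (rule Jop_sesq[OF e eB De De_dom])

lemma De_cp_kernel: "cp_kernel De J"
  by (rule Jop_cp_kernel[OF e eB De De_dom])

lemma De_lin: "clinear_on De M"
  by (rule Mop_clinear_on[OF e eB De De_dom])

lemma De_trace: "\<phi> \<in> De \<Longrightarrow> Re (tr (J \<phi> \<phi>)) = 2 * Re (cinner \<phi> (M \<phi>))"
  by (rule Jop_trace_Re[OF e eB De De_dom])

lemma De_accretive: "\<phi> \<in> De \<Longrightarrow> Re (cinner \<phi> (M \<phi>)) \<ge> 0"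
  by (rule Mop_accretive[OF e eB De De_dom])

lemma De_bound: "\<phi> \<in> De \<Longrightarrow> \<psi> \<in> De \<Longrightarrow> norm (J \<phi> \<psi>) \<le> gnorm M \<phi> * gnorm M \<psi>"
  by (rule Jop_gnorm_bound[OF e eB De De_dom])

lemma M_add: "\<phi> \<in> De \<Longrightarrow> \<psi> \<in> De \<Longrightarrow> M (\<phi> + \<psi>) = M \<phi> + M \<psi>"
  and M_scaleC: "\<phi> \<in> De \<Longrightarrow> M (c *\<^sub>C \<phi>) = c *\<^sub>C M \<phi>"
  using De_lin by (auto simp: clinear_on_def)

text \<open>A vector \<open>z\<close> orthogonal to the range of \<open>1 + h M\<close> yields an accretive extension of \<open>M\<close> with
  \<open>M z = z / h\<close>. Keeping the jump part unchanged gives a dissipative extension of the generator which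
  no longer preserves the trace at \<open>|z\<rangle>\<langle>z|\<close>, contradicting the core property.\<close>
lemma range_dense:
  assumes h: "h > 0" shows "closure ((\<lambda>\<phi>. \<phi> + h *\<^sub>R M \<phi>) ` De) = UNIV"
proof (rule ccontr)
  let ?W = "(\<lambda>\<phi>. \<phi> + h *\<^sub>R M \<phi>) ` De"
  assume nd: "closure ?W \<noteq> UNIV"
  have "csubspace ?W" unfolding csubspace_def
  proof (intro conjI ballI allI)
    have "M 0 = 0" using M_scaleC[OF csubspace_0[OF De], of 0] by simp
    then show "0 \<in> ?W" using csubspace_0[OF De] by (intro image_eqI[of _ _ 0]) auto
    fix x y c assume "x \<in> ?W"
    then obtain \<phi> where \<phi>: "\<phi> \<in> De" "x = \<phi> + h *\<^sub>R M \<phi>" by blast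
    show "c *\<^sub>C x \<in> ?W" using \<phi> csubspace_scale[OF De \<phi>(1)]
      by (intro image_eqI[of _ _ "c *\<^sub>C \<phi>"]) (simp_all add: M_scaleC scaleC_add_right scaleR_scaleC mult.commute)
    assume "y \<in> ?W"
    then obtain \<psi> where \<psi>: "\<psi> \<in> De" "y = \<psi> + h *\<^sub>R M \<psi>" by blast
    show "x + y \<in> ?W" using \<phi> \<psi> csubspace_add[OF De \<phi>(1) \<psi>(1)]
      by (intro image_eqI[of _ _ "\<phi> + \<psi>"]) (simp_all add: M_add scaleR_add_right)
  qed
  then obtain z where z: "z \<noteq> 0" "\<And>w. w \<in> ?W \<Longrightarrow> cinner w z = 0" using ex_orthogonal_vector nd by blast
  have orth: "cinner z (M \<phi>) = - cinner z \<phi> / of_real h" if "\<phi> \<in> De" for \<phi>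
  proof -
    have "cinner (\<phi> + h *\<^sub>R M \<phi>) z = 0" using z(2) that by blast
    then have "cnj (cinner (\<phi> + h *\<^sub>R M \<phi>) z) = 0" by simp
    then have "cinner z \<phi> + of_real h * cinner z (M \<phi>) = 0" by (simp add: cinner_cnj cinner_lin del: complex_cnj_zero_iff)
    then show ?thesis using h by (simp add: field_simps eq_neg_iff_add_eq_0)
  qed
  \<comment> \<open>On \<open>De\<close> the operator is accretive, while orthogonality would give
    <z, M z> the negative real part -|z|^2/h.\<close>
  have zD: "z \<notin> De"
  proof
    assume zD: "z \<in> De"
    have "Re (cinner z (M z)) = - (norm z)\<^sup>2 / h"
      unfolding orth[OF zD] cinner_self_norm by (simp flip: of_real_minus of_real_divide)
    moreover have "(norm z)\<^sup>2 / h > 0" using z(1) h by simp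
    ultimately show False using De_accretive[OF zD] by simp
  qed
  have uniq: "\<phi> = \<psi> \<and> a = b" if eq: "\<phi> + a *\<^sub>C z = \<psi> + b *\<^sub>C z" and d: "\<phi> \<in> De" "\<psi> \<in> De" for \<phi> \<psi> a b
  proof -
    have "a = b"
    proof (rule ccontr)
      assume "a \<noteq> b"
      have "(a - b) *\<^sub>C z = \<psi> - \<phi>" using eq by (simp add: scaleC_diff_left algebra_simps)
      then have "(1 / (a - b)) *\<^sub>C ((a - b) *\<^sub>C z) \<in> De" by (simp only: csubspace_scale csubspace_diff De d)
      then show False using zD \<open>a \<noteq> b\<close> by simp
    qed
    then show ?thesis using eq by simp
  qed
  define D1 where "D1 = {u. \<exists>\<phi>\<in>De. \<exists>a. u = \<phi> + a *\<^sub>C z}"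
  \<comment> \<open>The component in \<open>De\<close> along \<open>z\<close>, well defined by
    \<open>uniq\<close>; on \<open>De\<close> it is the identity, and it sends \<open>z\<close> to
    zero.\<close>
  define p where "p u = (SOME \<phi>. \<phi> \<in> De \<and> (\<exists>a. u = \<phi> + a *\<^sub>C z))" for u
  have p: "p (\<phi> + a *\<^sub>C z) = \<phi>" if d: "\<phi> \<in> De" for \<phi> a
  proof -
    have "\<exists>\<psi>. \<psi> \<in> De \<and> (\<exists>b. \<phi> + a *\<^sub>C z = \<psi> + b *\<^sub>C z)" using d by blast
    from someI_ex[OF this] have "p (\<phi> + a *\<^sub>C z) \<in> De \<and> (\<exists>b. \<phi> + a *\<^sub>C z = p (\<phi> + a *\<^sub>C z) + b *\<^sub>C z)"
      unfolding p_def .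
    then show ?thesis using uniq[OF _ d] by metis
  qed
  have D1I: "\<phi> + a *\<^sub>C z \<in> D1" if "\<phi> \<in> De" for \<phi> a using that unfolding D1_def by blast
  have D1E: "\<exists>\<phi> a. \<phi> \<in> De \<and> u = \<phi> + a *\<^sub>C z" if "u \<in> D1" for u using that unfolding D1_def by blast
  have padd: "p (u + v) = p u + p v" and pD: "p u \<in> De" and psc: "p (c *\<^sub>C u) = c *\<^sub>C p u"
    and Dadd: "u + v \<in> D1" and Dsc: "c *\<^sub>C u \<in> D1"
    if uv: "u \<in> D1" "v \<in> D1" for u v c
  proof -
    obtain \<phi> a where u: "\<phi> \<in> De" "u = \<phi> + a *\<^sub>C z" using D1E[OF uv(1)] by blast
    obtain \<psi> b where v: "\<psi> \<in> De" "v = \<psi> + b *\<^sub>C z" using D1E[OF uv(2)] by blast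
    have 1: "u + v = (\<phi> + \<psi>) + (a + b) *\<^sub>C z" by (simp add: u v scaleC_add_left)
    have 2: "c *\<^sub>C u = c *\<^sub>C \<phi> + (c * a) *\<^sub>C z" by (simp add: u scaleC_add_right)
    have 3: "\<phi> + \<psi> \<in> De" "c *\<^sub>C \<phi> \<in> De" by (intro csubspace_add csubspace_scale De u v)+
    show "p (u + v) = p u + p v" unfolding 1 p[OF 3(1)] unfolding u v p[OF u(1)] p[OF v(1)] ..
    show "p u \<in> De" unfolding u(2) p[OF u(1)] by (rule u(1))
    show "p (c *\<^sub>C u) = c *\<^sub>C p u" unfolding 2 p[OF 3(2)] unfolding u p[OF u(1)] ..
    show "u + v \<in> D1" unfolding 1 by (rule D1I[OF 3(1)])
    show "c *\<^sub>C u \<in> D1" unfolding 2 by (rule D1I[OF 3(2)])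
  qed
  have zero: "0 \<in> D1" using D1I[OF csubspace_0[OF De], of 0] by simp
  have D1: "csubspace D1" using zero Dadd Dsc by (auto simp: csubspace_def)
  have De1: "\<phi> \<in> D1 \<and> p \<phi> = \<phi>" if "\<phi> \<in> De" for \<phi> using D1I[OF that, of 0] p[OF that, of 0] by simp
  have z1: "z \<in> D1 \<and> p z = 0" using D1I[OF csubspace_0[OF De], of 1] p[OF csubspace_0[OF De], of 1] by simp
  define N where "N u = M (p u) + (1 / h) *\<^sub>R (u - p u)" for u
  define J1 where "J1 u v = J (p u) (p v)" for u v
  define K where "K u v = J1 u v - kb (N u) v - kb u (N v)" for u v
  have J1s: "sesq D1 J1" unfolding sesq_def J1_def
    by (intro conjI ballI allI) (simp_all add: padd psc sesqD[OF De_sesq] pD)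
  have J1c: "cp_kernel D1 J1" unfolding cp_kernel_def J1_def
    by (intro allI impI cp_kernelD[OF De_cp_kernel]) (use pD in blast)
  have Nlin: "clinear_on D1 N" unfolding clinear_on_def N_def
    by (intro conjI ballI allI D1)
       (simp_all add: padd psc M_add M_scaleC pD scaleR_add_right scaleC_add_right scaleC_diff_right scaleR_diff_right scaleR_scaleC mult.commute)
  \<comment> \<open>By orthogonality the two mixed terms are a <\<phi>, z>/h and minus its
    conjugate, so their sum is imaginary. What remains of the new direction is |a|^2 |z|^2/h, which
    is nonnegative.\<close>
  have sub: "Re (tr (J1 u u)) \<le> 2 * Re (cinner u (N u))" if u1: "u \<in> D1" for u
  proof -
    obtain \<phi> a where u: "\<phi> \<in> De" "u = \<phi> + a *\<^sub>C z" using D1E[OF u1] by blast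
    have pu: "p u = \<phi>" unfolding u(2) by (rule p[OF u(1)])
    have N: "N u = M \<phi> + (a / of_real h) *\<^sub>C z" by (simp add: N_def pu) (simp add: u scaleR_scaleC)
    have "cinner u (N u) = cinner \<phi> (M \<phi>) + (a * cinner \<phi> z - cnj (a * cinner \<phi> z)) / of_real h + of_real ((cmod a)\<^sup>2 * (norm z)\<^sup>2 / h)"
    proof -
      have "a * cnj a = of_real ((cmod a)\<^sup>2)" by (rule complex_norm_square[symmetric])
      then have aa: "cnj a * (a * w) = of_real ((cmod a)\<^sup>2) * w" for w by (metis mult.assoc mult.commute)
      have "cinner u (N u) = cinner \<phi> (M \<phi>) + (a / of_real h) * cinner \<phi> z + cnj a * cinner z (M \<phi>) + cnj a * (a * (cinner z z / of_real h))"
        unfolding N by (simp add: u cinner_lin distrib_left)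
      also have "\<dots> = cinner \<phi> (M \<phi>) + (a * cinner \<phi> z - cnj (a * cinner \<phi> z)) / of_real h + of_real ((cmod a)\<^sup>2) * (of_real ((norm z)\<^sup>2) / of_real h)"
        unfolding aa orth[OF u(1)] cinner_self_norm by (simp add: cinner_cnj diff_divide_distrib)
      finally show ?thesis by simp
    qed
    moreover have "Re ((w - cnj w) / of_real h) = 0" for w by simp
    ultimately have "Re (cinner u (N u)) = Re (cinner \<phi> (M \<phi>)) + (cmod a)\<^sup>2 * (norm z)\<^sup>2 / h"
      by (simp only: plus_complex.sel Re_complex_of_real)
    moreover have "(cmod a)\<^sup>2 * (norm z)\<^sup>2 / h \<ge> 0" using h by simp
    ultimately show ?thesis unfolding J1_def pu De_trace[OF u(1)] by simp
  qed
  note diss = standard_form_dissipative[OF onb D1 J1s J1c Nlin sub K_def]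
  define \<xi> where "\<xi> = kb z z"
  have Kz: "K z z = - (2 / h) *\<^sub>R \<xi>"
  proof -
    have "J1 z z = 0" unfolding J1_def using z1 sesq_zero(1)[OF De De_sesq csubspace_0[OF De]] by simp
    moreover have "N z = (1 / h) *\<^sub>R z"
      using z1 M_scaleC[OF csubspace_0[OF De], of 0] by (simp add: N_def)
    ultimately have "K z z = 0 - (1 / h) *\<^sub>R \<xi> - (1 / h) *\<^sub>R \<xi>"
      unfolding K_def \<xi>_def
      by (simp only: bounded_bilinear.scaleR_left[OF bounded_bilinear_kb] bounded_bilinear.scaleR_right[OF bounded_bilinear_kb])
    also have "\<dots> = - ((1 / h + 1 / h) *\<^sub>R \<xi>)" unfolding scaleR_add_left by simp
    finally show ?thesis by simp
  qed
  have KL: "K \<phi> \<psi> = L (kb \<phi> \<psi>)" if "\<phi> \<in> De" "\<psi> \<in> De" for \<phi> \<psi>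
    using De1[OF that(1)] De1[OF that(2)] by (simp add: K_def J1_def N_def Jop_def)
  \<comment> \<open>Dissipativity of the extension, applied to x - \<xi>; the second summand is
    written as \<open>kb z' z\<close> with z' = -z.\<close>
  have key: "norm (x - \<xi>) \<le> norm (x - y - (1 + 2 / h) *\<^sub>R \<xi>)" if x: "x \<in> fr De" and g: "gens x y" for x y
  proof -
    obtain n u v where uv: "\<And>j. j < n \<Longrightarrow> u j \<in> De" "\<And>j. j < n \<Longrightarrow> v j \<in> De" "x = (\<Sum>j<n::nat. kb (u j) (v j))"
      using x by (elim frE) blast
    have y: "y = (\<Sum>j<n. K (u j) (v j))"
    proof (rule gens_unique[OF g])
      show "gens x (\<Sum>j<n. K (u j) (v j))" unfolding uv(3)
        by (rule gens_sum) (use uv KL De_dom in auto)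
    qed
    define z' where "z' = (-1) *\<^sub>C z"
    have z': "z' \<in> D1" unfolding z'_def using Dsc z1 by blast
    have kz': "kb z' z = - \<xi>" unfolding z'_def kb_scaleC_left cmul_minus_left cmul_one \<xi>_def ..
    have Ks: "sesq D1 K" unfolding sesq_def K_def
      using Nlin unfolding clinear_on_def
      by (auto simp: sesqD[OF J1s] kb_add_left kb_add_right kb_scaleC_left kb_scaleC_right cmul_diff_right)
    have Kz': "K z' z = (2 / h) *\<^sub>R \<xi>"
      unfolding z'_def sesqD(3)[OF Ks conjunct1[OF z1] conjunct1[OF z1]] Kz cmul_minus_left cmul_one by simp
    let ?u = "\<lambda>j. if j < n then u j else z'" and ?v = "\<lambda>j. if j < n then v j else z"
    have "norm (\<Sum>j<Suc n. kb (?u j) (?v j)) \<le> norm ((\<Sum>j<Suc n. kb (?u j) (?v j)) - (\<Sum>j<Suc n. K (?u j) (?v j)))"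
      by (rule diss) (use uv De1 z1 z' in auto)
    also have "(\<Sum>j<Suc n. kb (?u j) (?v j)) = x - \<xi>" by (simp add: uv(3) kz')
    also have "(\<Sum>j<Suc n. K (?u j) (?v j)) = y + (2 / h) *\<^sub>R \<xi>" by (simp add: y Kz')
    also have "x - \<xi> - (y + (2 / h) *\<^sub>R \<xi>) = x - y - (1 + 2 / h) *\<^sub>R \<xi>" by (simp add: scaleR_add_left)
    finally show ?thesis .
  qed
  define \<eta> where "\<eta> = (1 + 2 / h) *\<^sub>R \<xi>"
  have small: "(2 / h) * (norm z)\<^sup>2 \<le> 8 * \<epsilon>" if \<epsilon>: "\<epsilon> > 0" for \<epsilon>
  proof -
    have "\<exists>x0. x0 \<in> fr De \<and> norm (x0 - \<eta>) < \<epsilon>"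
    proof -
      have "z \<in> closure De" using De_dense by simp
      then obtain Z where Z: "\<And>n. Z n \<in> De" "Z \<longlonglongrightarrow> z" unfolding closure_sequential by blast
      have "(\<lambda>n. norm ((1 + 2 / h) *\<^sub>R kb (Z n) (Z n) - \<eta>)) \<longlonglongrightarrow> norm ((1 + 2 / h) *\<^sub>R kb z z - \<eta>)"
        by (intro tendsto_intros Z)
      then have "\<forall>\<^sub>F n in sequentially. norm ((1 + 2 / h) *\<^sub>R kb (Z n) (Z n) - \<eta>) < \<epsilon>"
        by (rule order_tendstoD(2)) (use \<epsilon> in \<open>simp add: \<eta>_def \<xi>_def\<close>)
      then obtain n where "norm ((1 + 2 / h) *\<^sub>R kb (Z n) (Z n) - \<eta>) < \<epsilon>"
        unfolding eventually_sequentially by blast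
      moreover have "(1 + 2 / h) *\<^sub>R kb (Z n) (Z n) \<in> fr De"
        unfolding scaleR_cmul by (intro fr_cmul De fr_kb Z)
      ultimately show ?thesis by blast
    qed
    \<comment> \<open>Three approximations, each within \<epsilon>: a core element near \<eta>, an
      approximate solution of the resolvent equation for it, and core elements converging to that
      solution in graph norm.\<close>
    then obtain x0 where x0: "x0 \<in> fr De" "norm (x0 - \<eta>) < \<epsilon>" by blast
    obtain r w where r: "gens r w" "norm (r - 1 *\<^sub>R w - x0) < \<epsilon>"
      using gens_approx_resolvent[OF fr_dom[OF x0(1)], of 1 \<epsilon>] \<epsilon> by auto
    obtain X Y where XY: "\<And>n. X n \<in> fr De" "\<And>n. gens (X n) (Y n)" "X \<longlonglongrightarrow> r" "Y \<longlonglongrightarrow> w"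
      using core_approx[OF r(1)] by blast
    have "(\<lambda>n. norm ((X n - Y n) - (r - w))) \<longlonglongrightarrow> norm ((r - w) - (r - w))" by (intro tendsto_intros XY)
    then have "\<forall>\<^sub>F n in sequentially. norm ((X n - Y n) - (r - w)) < \<epsilon>"
      by (rule order_tendstoD(2)) (use \<epsilon> in simp)
    then obtain n where n: "norm ((X n - Y n) - (r - w)) < \<epsilon>" unfolding eventually_sequentially by blast
    have "X n - Y n - \<eta> = ((X n - Y n) - (r - w)) + ((r - 1 *\<^sub>R w - x0) + (x0 - \<eta>))" by simp
    also have "norm \<dots> \<le> norm ((X n - Y n) - (r - w)) + (norm (r - 1 *\<^sub>R w - x0) + norm (x0 - \<eta>))"
      by (intro order_trans[OF norm_triangle_ineq] add_mono norm_triangle_ineq order_refl)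
    also have "\<dots> < 4 * \<epsilon>" using n r(2) x0(2) \<epsilon> by linarith
    finally have a: "norm (X n - Y n - \<eta>) < 4 * \<epsilon>" .
    have b: "norm (X n - \<xi>) < 4 * \<epsilon>" using key[OF XY(1,2), of n] a by (simp add: \<eta>_def)
    \<comment> \<open>Generator values have trace zero, so the traces of \<open>X n - \<xi>\<close>
      and \<open>X n - Y n - \<eta>\<close> differ by the fixed amount (2/h) |z|^2, although both
      operators have norm below 4 \<epsilon>.\<close>
    have "tr (X n - Y n - \<eta>) = tr (X n) - (1 + 2 / of_real h) * tr \<xi>"
      using gens_trace[OF XY(2)[of n]] by (simp add: tr_diff[OF onb] \<eta>_def scaleR_cmul tr_cmul[OF onb])
    moreover have "tr (X n - \<xi>) = tr (X n) - tr \<xi>" by (simp add: tr_diff[OF onb])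
    ultimately have "tr (X n - \<xi>) - tr (X n - Y n - \<eta>) = (2 / of_real h) * tr \<xi>" by (simp only: distrib_right) simp
    moreover have "tr \<xi> = of_real ((norm z)\<^sup>2)" by (simp only: \<xi>_def tr_kb[OF onb] cinner_self_norm)
    ultimately have "tr (X n - \<xi>) - tr (X n - Y n - \<eta>) = of_real ((2 / h) * (norm z)\<^sup>2)" by simp
    then have "cmod (of_real ((2 / h) * (norm z)\<^sup>2)) \<le> cmod (tr (X n - \<xi>)) + cmod (tr (X n - Y n - \<eta>))"
      by (metis norm_triangle_ineq4)
    moreover have "cmod (of_real ((2 / h) * (norm z)\<^sup>2)) = (2 / h) * (norm z)\<^sup>2"
      using h by (simp only: norm_of_real) simp
    ultimately show ?thesis using a b tr_norm[OF onb, of "X n - \<xi>"] tr_norm[OF onb, of "X n - Y n - \<eta>"] by linarith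
  qed
  have "(2 / h) * (norm z)\<^sup>2 > 0" using h z(1) by simp
  then show False using small[of "(2 / h) * (norm z)\<^sup>2 / 16"] by simp
qed

end

section \<open>The closure of \<open>M\<close> and its maximality\<close>

context qds_matrix_normal
begin

text \<open>The domain of the closure of \<open>M\<close>. No new operator is needed there: since \<open>L\<close> is closed, the formula
  defining \<open>M\<close> on the span of the basis already computes the closure.\<close>
definition DM :: "'h set" where
  "DM = {x. \<exists>X. (\<forall>n. X n \<in> De) \<and> X \<longlonglongrightarrow> x \<and> convergent (\<lambda>n. M (X n))}"

lemma DM_I: "(\<And>n. X n \<in> De) \<Longrightarrow> X \<longlonglongrightarrow> x \<Longrightarrow> (\<lambda>n. M (X n)) \<longlonglongrightarrow> y \<Longrightarrow> x \<in> DM"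
  unfolding DM_def convergent_def by blast

lemma DM_E:
  assumes "x \<in> DM"
  obtains X y where "\<And>n. X n \<in> De" "X \<longlonglongrightarrow> x" "(\<lambda>n. M (X n)) \<longlonglongrightarrow> y"
  using assms unfolding DM_def convergent_def by blast

text \<open>\<open>J\<close> converges along graph-convergent sequences, hence so do the generator
  values, and closedness of the generator puts the limiting rank-one operator in its domain.\<close>

lemma kb_graph_limit:
  assumes X: "\<And>n. X n \<in> De" "X \<longlonglongrightarrow> x" "(\<lambda>n. M (X n)) \<longlonglongrightarrow> x'"
    and Y: "\<And>n. Y n \<in> De" "Y \<longlonglongrightarrow> y" "(\<lambda>n. M (Y n)) \<longlonglongrightarrow> y'"
  shows "gens (kb x y) (L (kb x y))" "(\<lambda>n. L (kb (X n) (Y n))) \<longlonglongrightarrow> L (kb x y)"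
proof -
  have "Cauchy (\<lambda>n. J (X n) (Y n))"
    by (rule sesq_graph_Cauchy[OF De De_sesq De_bound De_lin X(1) LIMSEQ_imp_Cauchy[OF X(2)] LIMSEQ_imp_Cauchy[OF X(3)]
          Y(1) LIMSEQ_imp_Cauchy[OF Y(2)] LIMSEQ_imp_Cauchy[OF Y(3)]])
  then obtain j where j: "(\<lambda>n. J (X n) (Y n)) \<longlonglongrightarrow> j" using Cauchy_convergent convergent_def by blast
  have "(\<lambda>n. J (X n) (Y n) - kb (M (X n)) (Y n) - kb (X n) (M (Y n))) \<longlonglongrightarrow> j - kb x' y - kb x y'"
    by (intro tendsto_intros j X Y)
  then have lim: "(\<lambda>n. L (kb (X n) (Y n))) \<longlonglongrightarrow> j - kb x' y - kb x y'" by (simp add: Jop_def)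
  have "(\<lambda>n. kb (X n) (Y n)) \<longlonglongrightarrow> kb x y" by (intro tendsto_intros X Y)
  from gens_closed[OF De_dom[OF X(1) Y(1)] this lim]
  have g: "gens (kb x y) (j - kb x' y - kb x y')" .
  then have "L (kb x y) = j - kb x' y - kb x y'" by (rule L_eq)
  then show "gens (kb x y) (L (kb x y))" "(\<lambda>n. L (kb (X n) (Y n))) \<longlonglongrightarrow> L (kb x y)"
    using g lim by simp_all
qed

lemma DM_dom: "\<phi> \<in> DM \<Longrightarrow> \<psi> \<in> DM \<Longrightarrow> gens (kb \<phi> \<psi>) (L (kb \<phi> \<psi>))"
  by (elim DM_E) (rule kb_graph_limit(1))

lemma M_limit:
  assumes X: "\<And>n. X n \<in> De" "X \<longlonglongrightarrow> x" "(\<lambda>n. M (X n)) \<longlonglongrightarrow> y"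
  shows "M x = y"
proof -
  have "(\<lambda>n. L (kb (X n) e)) \<longlonglongrightarrow> L (kb x e)"
    by (rule kb_graph_limit(2)[OF X eB tendsto_const tendsto_const])
  then have "(\<lambda>n. M (X n)) \<longlonglongrightarrow> M x" unfolding Mop_def by (intro tendsto_intros X)
  then show ?thesis using X(3) LIMSEQ_unique by blast
qed

lemma De_subset_DM: "De \<subseteq> DM"
  using DM_I[of "\<lambda>_. x" x for x] by auto

lemma DM: "csubspace DM"
  unfolding csubspace_def
proof (intro conjI ballI allI)
  show "0 \<in> DM" using De_subset_DM csubspace_0[OF De] by blast
next
  fix x y assume "x \<in> DM" "y \<in> DM"
  then obtain X x' Y y' where "\<And>n. X n \<in> De" "X \<longlonglongrightarrow> x" "(\<lambda>n. M (X n)) \<longlonglongrightarrow> x'"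
    "\<And>n. Y n \<in> De" "Y \<longlonglongrightarrow> y" "(\<lambda>n. M (Y n)) \<longlonglongrightarrow> y'" by (elim DM_E) blast
  note XY = this
  have "(\<lambda>n. M (X n + Y n)) \<longlonglongrightarrow> x' + y'" unfolding M_add[OF XY(1,4)] by (intro tendsto_intros XY)
  then show "x + y \<in> DM" by (rule DM_I[rotated 2]) (intro tendsto_intros csubspace_add De XY)+
next
  fix c x assume "x \<in> DM"
  then obtain X x' where X: "\<And>n. X n \<in> De" "X \<longlonglongrightarrow> x" "(\<lambda>n. M (X n)) \<longlonglongrightarrow> x'" by (elim DM_E) blast
  have "(\<lambda>n. M (c *\<^sub>C X n)) \<longlonglongrightarrow> c *\<^sub>C x'" unfolding M_scaleC[OF X(1)] by (intro tendsto_intros X)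
  then show "c *\<^sub>C x \<in> DM" by (rule DM_I[rotated 2]) (intro tendsto_intros csubspace_scale De X)+
qed

lemma eDM: "e \<in> DM"
  using eB De_subset_DM by blast

lemma DM_sesq: "sesq DM J"
  by (rule Jop_sesq[OF e eDM DM DM_dom])

lemma DM_cp_kernel: "cp_kernel DM J"
  by (rule Jop_cp_kernel[OF e eDM DM DM_dom])

lemma DM_lin: "clinear_on DM M"
  by (rule Mop_clinear_on[OF e eDM DM DM_dom])

lemma DM_trace: "\<phi> \<in> DM \<Longrightarrow> tr (J \<phi> \<phi>) = cinner \<phi> (M \<phi>) + cinner (M \<phi>) \<phi>"
  by (rule Jop_trace[OF e eDM DM DM_dom])

lemma DM_trace_Re: "\<phi> \<in> DM \<Longrightarrow> Re (tr (J \<phi> \<phi>)) = 2 * Re (cinner \<phi> (M \<phi>))"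
  by (rule Jop_trace_Re[OF e eDM DM DM_dom])

lemma DM_accretive: "\<phi> \<in> DM \<Longrightarrow> Re (cinner \<phi> (M \<phi>)) \<ge> 0"
  by (rule Mop_accretive[OF e eDM DM DM_dom])

lemma DM_dense: "closure DM = UNIV"
  using closure_mono[OF De_subset_DM] De_dense by auto

lemma M_closed: "closed_op DM M"
  unfolding closed_op_def
proof (intro allI impI)
  fix X x y assume X: "\<forall>n. X n \<in> DM" "X \<longlonglongrightarrow> x" "(\<lambda>n. M (X n)) \<longlonglongrightarrow> y"
  \<comment> \<open>Graph points over \<open>DM\<close> are limits of graph points over
    \<open>De\<close>, so a diagonal choice reduces closedness to sequences in
    \<open>De\<close>.\<close>
  have "\<exists>z. z \<in> De \<and> norm (X n - z) < inverse (real (Suc n)) \<and> norm (M (X n) - M z) < inverse (real (Suc n))" for n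
  proof -
    obtain Z z' where Z: "\<And>n. Z n \<in> De" "Z \<longlonglongrightarrow> X n" "(\<lambda>n. M (Z n)) \<longlonglongrightarrow> z'"
      by (rule DM_E[OF X(1)[rule_format, of n]]) blast
    have Z3: "(\<lambda>n. M (Z n)) \<longlonglongrightarrow> M (X n)" using Z(3) M_limit[OF Z] by simp
    have l: "(\<lambda>m. norm (X n - Z m)) \<longlonglongrightarrow> norm (X n - X n)" "(\<lambda>m. norm (M (X n) - M (Z m))) \<longlonglongrightarrow> norm (M (X n) - M (X n))"
      by (intro tendsto_intros Z(2) Z3)+
    have "\<forall>\<^sub>F m in sequentially. norm (X n - Z m) < inverse (real (Suc n))"
      "\<forall>\<^sub>F m in sequentially. norm (M (X n) - M (Z m)) < inverse (real (Suc n))"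
      by (rule order_tendstoD(2)[OF l(1)], simp, rule order_tendstoD(2)[OF l(2)], simp)
    then have "\<forall>\<^sub>F m in sequentially. norm (X n - Z m) < inverse (real (Suc n)) \<and> norm (M (X n) - M (Z m)) < inverse (real (Suc n))"
      by (rule eventually_conj)
    then show ?thesis using Z(1) unfolding eventually_sequentially by blast
  qed
  then obtain Z where Z: "\<And>n. Z n \<in> De" "\<And>n. norm (X n - Z n) < inverse (real (Suc n))"
    "\<And>n. norm (M (X n) - M (Z n)) < inverse (real (Suc n))" by metis
  have lim: "V \<longlonglongrightarrow> v" if "W \<longlonglongrightarrow> v" "\<And>n. norm (W n - V n) < inverse (real (Suc n))" for V W and v :: 'h
    by (rule Lim_transform2[OF that(1)], rule Lim_null_comparison[OF _ LIMSEQ_inverse_real_of_nat])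
       (intro always_eventually allI less_imp_le that(2))
  have Zx: "Z \<longlonglongrightarrow> x" by (rule lim[OF X(2) Z(2)])
  have Zy: "(\<lambda>n. M (Z n)) \<longlonglongrightarrow> y" by (rule lim[OF X(3) Z(3)])
  show "x \<in> DM \<and> M x = y" using DM_I[OF Z(1) Zx Zy] M_limit[OF Z(1) Zx Zy] by blast
qed

sublocale accretive_generator DM M
proof
  show "clinear_on DM M" by (rule DM_lin)
  show "closure DM = UNIV" by (rule DM_dense)
  show acc: "norm x \<le> norm (x + h *\<^sub>R M x)" if x: "x \<in> DM" and h: "h > 0" for x h
  proof -
    have "(norm x)\<^sup>2 \<le> (norm (x + h *\<^sub>R M x))\<^sup>2"
      using DM_accretive[OF x] h by (simp add: norm_add_sq cinner_scaleR_right)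
    then show ?thesis by (rule power2_le_imp_le) simp
  qed
  show "\<exists>x\<in>DM. x + h *\<^sub>R M x = y" if h: "h > 0" for h y
  proof -
    have "y \<in> closure ((\<lambda>\<phi>. \<phi> + h *\<^sub>R M \<phi>) ` De)" using range_dense[OF h] by simp
    then obtain W where W: "\<And>n. W n \<in> (\<lambda>\<phi>. \<phi> + h *\<^sub>R M \<phi>) ` De" "W \<longlonglongrightarrow> y" unfolding closure_sequential by blast
    then have "\<forall>n. \<exists>\<phi>. \<phi> \<in> De \<and> W n = \<phi> + h *\<^sub>R M \<phi>" by blast
    then obtain X where X: "\<And>n. X n \<in> De" "\<And>n. W n = X n + h *\<^sub>R M (X n)" by metis
    \<comment> \<open>Expansivity of 1 + h M makes the preimages Cauchy along with the
      \<open>W n\<close>. Then M (X n) = (W n - X n)/h converges too, and the limit belongs to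
      \<open>DM\<close>.\<close>
    have le: "norm (X m - X n) \<le> norm (W m - W n)" for m n
    proof -
      have d: "X m - X n \<in> De" by (intro csubspace_diff De X)
      have "M (X m - X n) = M (X m) - M (X n)"
        using M_add[OF X(1)[of m] csubspace_scale[OF De X(1)[of n], of "-1"]] M_scaleC[OF X(1)[of n], of "-1"] by simp
      then have "(X m - X n) + h *\<^sub>R M (X m - X n) = W m - W n" by (simp add: X(2) scaleR_diff_right)
      then show ?thesis using acc[OF _ h, of "X m - X n"] d De_subset_DM by auto
    qed
    have "Cauchy X"
    proof (rule CauchyI)
      fix e :: real assume "e > 0"
      then obtain N where "\<forall>m\<ge>N. \<forall>n\<ge>N. norm (W m - W n) < e" using CauchyD[OF LIMSEQ_imp_Cauchy[OF W(2)]] by blast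
      then show "\<exists>N. \<forall>m\<ge>N. \<forall>n\<ge>N. norm (X m - X n) < e" using le by (meson le_less_trans)
    qed
    then obtain x where x: "X \<longlonglongrightarrow> x" using Cauchy_convergent convergent_def by blast
    have "(\<lambda>n. (1 / h) *\<^sub>R (W n - X n)) \<longlonglongrightarrow> (1 / h) *\<^sub>R (y - x)" by (intro tendsto_intros W x)
    then have MX: "(\<lambda>n. M (X n)) \<longlonglongrightarrow> (1 / h) *\<^sub>R (y - x)" using h by (simp add: X(2))
    have "x \<in> DM" by (rule DM_I[OF X(1) x MX])
    moreover have "x + h *\<^sub>R M x = y" unfolding M_limit[OF X(1) x MX] using h by simp
    ultimately show ?thesis by blast
  qed
qed

end

text \<open>If the diagonal entry vanishes, then \<open>1 / sqrt 0 = 0\<close> makes the vector zero, as it should be.\<close>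
definition schur_vec :: "('h::chilbert \<Rightarrow> 'h \<Rightarrow> 'h tc) \<Rightarrow> 'h \<Rightarrow> 'h \<Rightarrow> 'h \<Rightarrow> 'h" where
  "schur_vec G x \<eta> \<phi> = complex_of_real (1 / sqrt (Re (cinner \<eta> (tc_op (G x x) \<eta>)))) *\<^sub>C tc_op (G \<phi> x) \<eta>"

text \<open>The Schur complement of a positive kernel with the pair (x, \<eta>) as pivot: the
  rank-one kernel carrying the form at this pair is removed.\<close>

definition schur :: "('h::chilbert \<Rightarrow> 'h \<Rightarrow> 'h tc) \<Rightarrow> 'h \<Rightarrow> 'h \<Rightarrow> 'h \<Rightarrow> 'h \<Rightarrow> 'h tc" where
  "schur G x \<eta> \<phi> \<psi> = G \<phi> \<psi> - kb (schur_vec G x \<eta> \<phi>) (schur_vec G x \<eta> \<psi>)"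

section \<open>Schur complements and the Kraus decomposition of a kernel\<close>

lemma schur_vec_clinear_on:
  assumes D: "csubspace D" and G: "sesq D G" and x: "x \<in> D"
  shows "clinear_on D (schur_vec G x \<eta>)"
  unfolding clinear_on_def schur_vec_def
  by (intro conjI ballI allI D)
     (simp_all add: sesqD(1,3)[OF G _ x] tc_op_simps cmul.rep_eq scaleC_add_right mult.commute)

lemma schur_sesq:
  assumes D: "csubspace D" and G: "sesq D G" and x: "x \<in> D"
  shows "sesq D (schur G x \<eta>)"
  using schur_vec_clinear_on[OF assms, of \<eta>] unfolding sesq_def schur_def clinear_on_def
  by (auto simp: sesqD[OF G] kb_add_left kb_add_right kb_scaleC_left kb_scaleC_right cmul_diff_right)

lemma cp_kernel_diag:
  assumes G: "cp_kernel D G" and x: "x \<in> D"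
  shows "cinner \<eta> (tc_op (G x x) \<eta>) = of_real (Re (cinner \<eta> (tc_op (G x x) \<eta>)))" "Re (cinner \<eta> (tc_op (G x x) \<eta>)) \<ge> 0"
  using cp_kernel_pos[OF G x] by (auto simp: tc_pos_def nonneg_c_def complex_eq_iff)

text \<open>Append the pivot \<open>x\<close>, \<eta> with a coefficient \<alpha> to an arbitrary
  family. The form is nonnegative for every \<alpha>, and its minimum over \<alpha> is the form of
  the complement.\<close>

lemma schur_cp_kernel:
  assumes D: "csubspace D" and G: "sesq D G" "cp_kernel D G" and x: "x \<in> D"
  shows "cp_kernel D (schur G x \<eta>)"
  unfolding cp_kernel_def
proof (intro allI impI)
  fix n :: nat and \<phi> \<xi> assume \<phi>: "\<forall>i<n. \<phi> i \<in> D"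
  define g where "g = Re (cinner \<eta> (tc_op (G x x) \<eta>))"
  have g: "cinner \<eta> (tc_op (G x x) \<eta>) = of_real g" "g \<ge> 0" using cp_kernel_diag[OF G(2) x] by (auto simp: g_def)
  define S where "S = (\<Sum>i<n. \<Sum>j<n. cinner (\<xi> i) (tc_op (G (\<phi> i) (\<phi> j)) (\<xi> j)))"
  define v where "v = (\<Sum>i<n. cinner (\<xi> i) (tc_op (G (\<phi> i) x) \<eta>))"
  have w: "(\<Sum>i<n. cinner (\<xi> i) (schur_vec G x \<eta> (\<phi> i))) = of_real (1 / sqrt g) * v"
    by (simp only: schur_vec_def g_def[symmetric] cinner_scaleC_right v_def sum_distrib_left)
  have "(\<Sum>i<n. \<Sum>j<n. cinner (\<xi> i) (tc_op (kb (schur_vec G x \<eta> (\<phi> i)) (schur_vec G x \<eta> (\<phi> j))) (\<xi> j)))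
      = (of_real (1 / sqrt g) * v) * cnj (of_real (1 / sqrt g) * v)"
    unfolding w[symmetric] cnj_sum cinner_cnj sum_product by (simp add: tc_op_kb cinner_lin mult.commute)
  also have "\<dots> = of_real (1 / sqrt g * (1 / sqrt g)) * (v * cnj v)" by (simp only: complex_cnj_mult complex_cnj_complex_of_real of_real_mult mult_ac)
  also have "1 / sqrt g * (1 / sqrt g) = 1 / g" using g(2) by simp
  finally have T: "(\<Sum>i<n. \<Sum>j<n. cinner (\<xi> i) (tc_op (schur G x \<eta> (\<phi> i) (\<phi> j)) (\<xi> j))) = S - of_real (1 / g) * (v * cnj v)"
    by (simp add: schur_def tc_op_simps cinner_lin sum_subtractf S_def)
  show "nonneg_c (\<Sum>i<n. \<Sum>j<n. cinner (\<xi> i) (tc_op (schur G x \<eta> (\<phi> i) (\<phi> j)) (\<xi> j)))"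
  proof (cases "g = 0")
    case True
    \<comment> \<open>Here \<open>1 / g\<close> is 0, so nothing is subtracted.\<close>
    then show ?thesis unfolding T using cp_kernelD[OF G(2), of n \<phi> \<xi>] \<phi> by (simp add: S_def)
  next
    case False
    \<comment> \<open>The minimizer of the quadratic expression in \<alpha>.\<close>
    define \<alpha> where "\<alpha> = - cnj v / of_real g"
    define \<phi>' where "\<phi>' i = (if i < n then \<phi> i else x)" for i
    define \<xi>' where "\<xi>' i = (if i < n then \<xi> i else \<alpha> *\<^sub>C \<eta>)" for i
    have "nonneg_c (\<Sum>i<Suc n. \<Sum>j<Suc n. cinner (\<xi>' i) (tc_op (G (\<phi>' i) (\<phi>' j)) (\<xi>' j)))"
      by (rule cp_kernelD[OF G(2)]) (use \<phi> x in \<open>simp add: \<phi>'_def\<close>)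
    also have "(\<Sum>i<Suc n. \<Sum>j<Suc n. cinner (\<xi>' i) (tc_op (G (\<phi>' i) (\<phi>' j)) (\<xi>' j)))
       = S + \<alpha> * v + cnj \<alpha> * (\<Sum>j<n. cinner \<eta> (tc_op (G x (\<phi> j)) (\<xi> j))) + cnj \<alpha> * (\<alpha> * of_real g)"
      by (simp add: \<phi>'_def \<xi>'_def sum.distrib cinner_lin clinear_scaleC[OF tc_clinear] sum_distrib_left g(1) S_def v_def)
    also have "(\<Sum>j<n. cinner \<eta> (tc_op (G x (\<phi> j)) (\<xi> j))) = cnj v"
      unfolding v_def cnj_sum by (intro sum.cong refl cp_kernel_hermitian[OF G(2)] x) (use \<phi> in auto)
    also have "S + \<alpha> * v + cnj \<alpha> * cnj v + cnj \<alpha> * (\<alpha> * of_real g) = S - of_real (1 / g) * (v * cnj v)"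
      using False by (simp add: \<alpha>_def)
    finally show ?thesis unfolding T .
  qed
qed

lemma schur_at_pair:
  assumes G: "cp_kernel D G" and x: "x \<in> D"
  shows "cinner \<eta> (tc_op (schur G x \<eta> x x) \<eta>) = 0"
proof -
  define g where "g = Re (cinner \<eta> (tc_op (G x x) \<eta>))"
  have g: "cinner \<eta> (tc_op (G x x) \<eta>) = of_real g" "g \<ge> 0" using cp_kernel_diag[OF G x] by (auto simp: g_def)
  have "cinner \<eta> (schur_vec G x \<eta> x) = of_real (g / sqrt g)"
    unfolding schur_vec_def g_def[symmetric] cinner_scaleC_right g(1) by simp
  moreover have "cinner (schur_vec G x \<eta> x) \<eta> = cnj (cinner \<eta> (schur_vec G x \<eta> x))" by (rule cinner_commute)
  ultimately have "cinner \<eta> (tc_op (schur G x \<eta> x x) \<eta>) = of_real g - of_real (g / sqrt g) * of_real (g / sqrt g)"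
    by (simp only: schur_def tc_op_simps tc_op_kb cinner_diff_right cinner_scaleC_right g(1) complex_cnj_complex_of_real)
  also have "\<dots> = of_real (g - g / sqrt g * (g / sqrt g))" by (simp only: of_real_diff of_real_mult)
  also have "g - g / sqrt g * (g / sqrt g) = 0" using g(2) by (simp add: real_div_sqrt)
  finally show ?thesis by simp
qed

primrec schur_iter :: "('h::chilbert \<Rightarrow> 'h \<Rightarrow> 'h tc) \<Rightarrow> (nat \<Rightarrow> 'h \<times> 'h) \<Rightarrow> nat \<Rightarrow> 'h \<Rightarrow> 'h \<Rightarrow> 'h tc" where
  "schur_iter G p 0 = G"
| "schur_iter G p (Suc n) = schur (schur_iter G p n) (fst (p n)) (snd (p n))"

text \<open>Successive Schur complements over a dense sequence of pairs peel off rank-one kernels until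
  nothing is left.\<close>
lemma cp_kernel_kraus:
  fixes M :: "'h::chilbert \<Rightarrow> 'h"
  assumes sep: "separable_space TYPE('h)" and D: "csubspace D" and J: "sesq D J" "cp_kernel D J"
    and M: "clinear_on D M"
    and bd: "\<And>\<phi>. \<phi> \<in> D \<Longrightarrow> Re (tr (J \<phi> \<phi>)) \<le> (gnorm M \<phi>)\<^sup>2"
  shows "\<exists>l. (\<forall>k::nat. clinear_on D (l k)) \<and>
    (\<forall>\<phi>\<in>D. (\<lambda>k. (norm (l k \<phi>))\<^sup>2) sums Re (tr (J \<phi> \<phi>))) \<and>
    (\<forall>\<phi>\<in>D. \<forall>\<psi>\<in>D. ((\<lambda>k. kb (l k \<phi>) (l k \<psi>)) has_sum J \<phi> \<psi>) UNIV)"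
proof -
  note onb = separable_has_onb[OF sep]
  obtain X where X: "countable X" "X \<subseteq> D"
    "\<forall>x\<in>D. \<exists>f::nat \<Rightarrow> 'h. (\<forall>n. f n \<in> X) \<and> f \<longlonglongrightarrow> x \<and> (\<lambda>n. M (f n)) \<longlonglongrightarrow> M x"
    using countable_graph_dense[OF sep, of D M] by (elim exE conjE)
  obtain Q :: "'h set" where Q: "countable Q" "closure Q = UNIV" using sep by (auto simp: separable_space_def)
  define p where "p = from_nat_into (X \<times> Q)"
  have "X \<noteq> {}" using bspec[OF X(3) csubspace_0[OF D]] by blast
  moreover have "Q \<noteq> {}" using Q(2) by auto
  ultimately have "range p = X \<times> Q" unfolding p_def using X(1) Q(1) by (intro range_from_nat_into) auto
  have pX: "fst (p n) \<in> D" for n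
  proof -
    have "p n \<in> X \<times> Q" unfolding \<open>range p = X \<times> Q\<close>[symmetric] by (rule rangeI)
    then show ?thesis using X(2) by auto
  qed
  define G where "G n = schur_iter J p n" for n
  define l where "l n = schur_vec (G n) (fst (p n)) (snd (p n))" for n
  have G0: "G 0 = J" by (simp add: G_def)
  have GS: "G (Suc n) \<phi> \<psi> = G n \<phi> \<psi> - kb (l n \<phi>) (l n \<psi>)" for n \<phi> \<psi> by (simp add: G_def l_def schur_def)
  have GG: "sesq D (G n) \<and> cp_kernel D (G n)" for n
    by (induction n) (auto simp: G_def J intro: schur_sesq[OF D _ pX] schur_cp_kernel[OF D _ _ pX])
  then have Gs: "sesq D (G n)" and Gc: "cp_kernel D (G n)" for n by auto
  have l: "clinear_on D (l n)" for n unfolding l_def by (rule schur_vec_clinear_on[OF D Gs pX])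
  have partial: "J \<phi> \<psi> - G n \<phi> \<psi> = (\<Sum>k<n. kb (l k \<phi>) (l k \<psi>))" for n \<phi> \<psi>
    by (induction n) (auto simp: G0 GS algebra_simps)
  define a where "a n \<phi> b = Re (cinner b (tc_op (G n \<phi> \<phi>) b))" for n \<phi> b
  have a0: "a n \<phi> b \<ge> 0" if "\<phi> \<in> D" for n \<phi> b unfolding a_def by (rule cp_kernel_diag(2)[OF Gc that])
  have aS: "a (Suc n) \<phi> b \<le> a n \<phi> b" for n \<phi> b
  proof -
    have "Re (cinner b (tc_op (kb (l n \<phi>) (l n \<phi>)) b)) \<ge> 0"
      using tc_pos_kb[of "l n \<phi>"] by (simp add: tc_pos_def nonneg_c_def)
    then show ?thesis by (simp add: a_def GS tc_op_simps cinner_lin)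
  qed
  have anti: "a m \<phi> b \<le> a n \<phi> b" if "n \<le> m" for m n \<phi> b
    by (rule lift_Suc_antimono_le[of "\<lambda>n. a n \<phi> b", OF aS that])
  \<comment> \<open>The diagonal value vanishes right after the step with this pivot and stays zero,
    since later steps only decrease it.\<close>
  have apair: "a n (fst (p k)) (snd (p k)) = 0" if "n > k" for n k
  proof -
    have "a (Suc k) (fst (p k)) (snd (p k)) = 0"
      unfolding a_def G_def schur_iter.simps
      using schur_at_pair[OF Gc[of k, unfolded G_def] pX] by simp
    then show ?thesis using anti[of "Suc k" n] a0[OF pX, of n k "snd (p k)"] that by (metis Suc_leI antisym)
  qed
  \<comment> \<open>Parallelogram identity for a positive form, with one of its terms dropped; it
    replaces the triangle inequality at the price of a factor 2.\<close>
  have a_left: "a n \<phi> b \<le> 2 * a n x b + 2 * a n (\<phi> - x) b" if d: "\<phi> \<in> D" "x \<in> D" for n \<phi> x b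
  proof -
    let ?y = "\<phi> - x"
    have y: "?y \<in> D" by (intro csubspace_diff D d)
    have "G n \<phi> \<phi> + G n (x - ?y) (x - ?y) = 2 *\<^sub>R G n x x + 2 *\<^sub>R G n ?y ?y"
    proof -
      have "G n (x + ?y) (x + ?y) + G n (x - ?y) (x - ?y) = 2 *\<^sub>R G n x x + 2 *\<^sub>R G n ?y ?y"
        using sesqD(1,2)[OF Gs] sesq_diff[OF D Gs] d(2) y csubspace_add[OF D d(2) y] csubspace_diff[OF D d(2) y]
        by (simp add: scaleR_2)
      then show ?thesis by simp
    qed
    then have "cinner b (tc_op (G n \<phi> \<phi> + G n (x - ?y) (x - ?y)) b) = cinner b (tc_op (2 *\<^sub>R G n x x + 2 *\<^sub>R G n ?y ?y) b)" by simp
    then have "a n \<phi> b + a n (x - ?y) b = 2 * a n x b + 2 * a n ?y b"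
      by (simp add: a_def tc_op_simps cinner_lin complex_eq_iff)
    then show ?thesis using a0[OF csubspace_diff[OF D d(2) y], of n b] by linarith
  qed
  have a_right: "a n x b \<le> 2 * a n x \<eta> + 2 * a n x (b - \<eta>)" if d: "x \<in> D" for n x b \<eta>
  proof -
    let ?c = "b - \<eta>"
    have "cinner (\<eta> + ?c) (tc_op (G n x x) (\<eta> + ?c)) + cinner (\<eta> - ?c) (tc_op (G n x x) (\<eta> - ?c))
        = 2 * cinner \<eta> (tc_op (G n x x) \<eta>) + 2 * cinner ?c (tc_op (G n x x) ?c)"
      by (simp only: clinear_add[OF tc_clinear] clinear_diff[OF tc_clinear] cinner_add_left cinner_add_right cinner_diff_left cinner_diff_right) simp
    then have "a n x (\<eta> + ?c) + a n x (\<eta> - ?c) = 2 * a n x \<eta> + 2 * a n x ?c"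
      unfolding a_def by (metis plus_complex.sel(1) Re_complex_of_real mult_2)
    then show ?thesis using a0[OF d, of n "\<eta> - ?c"] by simp
  qed
  have abd: "a n \<phi> b \<le> (gnorm M \<phi>)\<^sup>2 * (norm b)\<^sup>2" if d: "\<phi> \<in> D" for n \<phi> b
  proof -
    have "a n \<phi> b \<le> a 0 \<phi> b" by (rule anti) simp
    also have "\<dots> \<le> norm b * norm (tc_op (J \<phi> \<phi>) b)"
      unfolding a_def G0 using cinner_cauchy_schwarz complex_Re_le_cmod order_trans by blast
    also have "\<dots> \<le> norm b * (norm (J \<phi> \<phi>) * norm b)" by (intro mult_left_mono tc_op_bound) simp
    also have "\<dots> = Re (tr (J \<phi> \<phi>)) * (norm b)\<^sup>2"
      unfolding tc_pos_norm[OF onb cp_kernel_pos[OF J(2) d]] by (simp add: power2_eq_square)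
    also have "\<dots> \<le> (gnorm M \<phi>)\<^sup>2 * (norm b)\<^sup>2" by (intro mult_right_mono bd d) simp
    finally show ?thesis .
  qed
  \<comment> \<open>Approximate \<phi> in graph norm and \<open>b\<close> in norm by an enumerated
    pair (x, \<eta>), at which the remaining kernel is eventually zero. The bounds
    \<open>abd\<close> are uniform in \<open>n\<close>, so the approximation errors persist
    unchanged.\<close>
  have a_lim: "(\<lambda>n. a n \<phi> b) \<longlonglongrightarrow> 0" if d: "\<phi> \<in> D" for \<phi> b
  proof (rule LIMSEQ_I)
    fix \<epsilon> :: real assume \<epsilon>: "\<epsilon> > 0"
    obtain f where f: "\<forall>n. f n \<in> X" "f \<longlonglongrightarrow> \<phi>" "(\<lambda>n. M (f n)) \<longlonglongrightarrow> M \<phi>" using bspec[OF X(3) d] by blast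
    have Mdiff: "M (\<phi> - f n) = M \<phi> - M (f n)" for n
    proof -
      have fn: "f n \<in> D" using f(1) X(2) by blast
      have "M (\<phi> + (-1) *\<^sub>C f n) = M \<phi> + M ((-1) *\<^sub>C f n)"
        using M d csubspace_scale[OF D fn, of "-1"] unfolding clinear_on_def by blast
      moreover have "M ((-1) *\<^sub>C f n) = (-1) *\<^sub>C M (f n)" using M fn unfolding clinear_on_def by blast
      ultimately show ?thesis by simp
    qed
    have "(\<lambda>n. 2 * ((norm (\<phi> - f n) + norm (M \<phi> - M (f n)))\<^sup>2 * (norm b)\<^sup>2)) \<longlonglongrightarrow> 2 * ((norm (\<phi> - \<phi>) + norm (M \<phi> - M \<phi>))\<^sup>2 * (norm b)\<^sup>2)"
      by (intro tendsto_intros f)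
    then have "\<forall>\<^sub>F n in sequentially. 2 * ((norm (\<phi> - f n) + norm (M \<phi> - M (f n)))\<^sup>2 * (norm b)\<^sup>2) < \<epsilon> / 2"
      by (rule order_tendstoD(2)) (use \<epsilon> in simp)
    then obtain m where m: "2 * ((norm (\<phi> - f m) + norm (M \<phi> - M (f m)))\<^sup>2 * (norm b)\<^sup>2) < \<epsilon> / 2"
      unfolding eventually_sequentially by blast
    define x where "x = f m"
    have x: "x \<in> X" "x \<in> D" using f(1) X(2) by (auto simp: x_def)
    have e1: "2 * ((gnorm M (\<phi> - x))\<^sup>2 * (norm b)\<^sup>2) < \<epsilon> / 2" using m by (simp add: gnorm_def Mdiff x_def)
    have "b \<in> closure Q" using Q(2) by simp
    then obtain q where q: "\<And>n. q n \<in> Q" "q \<longlonglongrightarrow> b" unfolding closure_sequential by blast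
    \<comment> \<open>The factor 4 arises because \<open>a_right\<close> doubles this error and
      \<open>a_left\<close> doubles it again.\<close>
    have "(\<lambda>n. 4 * ((gnorm M x)\<^sup>2 * (norm (b - q n))\<^sup>2)) \<longlonglongrightarrow> 4 * ((gnorm M x)\<^sup>2 * (norm (b - b))\<^sup>2)"
      by (intro tendsto_intros q)
    then have "\<forall>\<^sub>F n in sequentially. 4 * ((gnorm M x)\<^sup>2 * (norm (b - q n))\<^sup>2) < \<epsilon> / 2"
      by (rule order_tendstoD(2)) (use \<epsilon> in simp)
    then obtain m' where m': "4 * ((gnorm M x)\<^sup>2 * (norm (b - q m'))\<^sup>2) < \<epsilon> / 2"
      unfolding eventually_sequentially by blast
    define \<eta> where "\<eta> = q m'"
    have "(x, \<eta>) \<in> range p" unfolding \<open>range p = X \<times> Q\<close> using x(1) q(1) by (simp add: \<eta>_def)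
    then obtain k where k: "p k = (x, \<eta>)" by (metis rangeE)
    have "norm (a n \<phi> b - 0) < \<epsilon>" if n: "n \<ge> Suc k" for n
    proof -
      have "a n x \<eta> = 0" using apair[of k n] n by (simp add: k)
      then have "a n x b \<le> 2 * ((gnorm M x)\<^sup>2 * (norm (b - \<eta>))\<^sup>2)"
        using a_right[OF x(2), of n b \<eta>] abd[OF x(2), of n "b - \<eta>"] by linarith
      moreover have "a n (\<phi> - x) b \<le> (gnorm M (\<phi> - x))\<^sup>2 * (norm b)\<^sup>2" by (intro abd csubspace_diff D d x)
      ultimately have "a n \<phi> b < \<epsilon>" using a_left[OF d x(2), of n b] e1 m' unfolding \<eta>_def by linarith
      then show ?thesis using a0[OF d, of n b] by simp
    qed
    then show "\<exists>no. \<forall>n\<ge>no. norm (a n \<phi> b - 0) < \<epsilon>" by blast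
  qed
  define B0 where "B0 = (SOME B::'h set. is_onb B)"
  have tr_has_Re_sum: "((\<lambda>b. Re (cinner b (tc_op \<rho> b))) has_sum Re (tr \<rho>)) B0" for \<rho> :: "'h tc"
    unfolding B0_def by (rule has_sum_Re[OF tr_has_sum[OF onb]])
  have tr_nonneg: "Re (tr (G n \<phi> \<phi>)) \<ge> 0" if "\<phi> \<in> D" for n \<phi>
    using tr_pos[OF onb cp_kernel_pos[OF Gc that]] by (simp add: nonneg_c_def)
  \<comment> \<open>A dominated convergence argument: the diagonal entries of the remainder decrease
    in \<open>n\<close>, so the tail of its trace outside \<open>F\<close> is at most that of
    \<open>J\<close>, while on \<open>F\<close> every entry tends to zero.\<close>
  have t_lim: "(\<lambda>n. Re (tr (G n \<phi> \<phi>))) \<longlonglongrightarrow> 0" if d: "\<phi> \<in> D" for \<phi>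
  proof (rule LIMSEQ_I)
    fix \<epsilon> :: real assume \<epsilon>: "\<epsilon> > 0"
    have "\<forall>\<^sub>F F in finite_subsets_at_top B0. dist (\<Sum>b\<in>F. a 0 \<phi> b) (Re (tr (J \<phi> \<phi>))) < \<epsilon> / 2"
      using tr_has_Re_sum[of "J \<phi> \<phi>"] half_gt_zero[OF \<epsilon>] unfolding has_sum_def tendsto_iff a_def G0 by blast
    then obtain F where F: "finite F" "F \<subseteq> B0" "dist (\<Sum>b\<in>F. a 0 \<phi> b) (Re (tr (J \<phi> \<phi>))) < \<epsilon> / 2"
      unfolding eventually_finite_subsets_at_top by blast
    have "(\<lambda>n. \<Sum>b\<in>F. a n \<phi> b) \<longlonglongrightarrow> (\<Sum>b\<in>F. 0)" by (intro tendsto_sum a_lim d)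
    then have "\<forall>\<^sub>F n in sequentially. (\<Sum>b\<in>F. a n \<phi> b) < \<epsilon> / 2"
      by (rule order_tendstoD(2)) (use \<epsilon> in simp)
    then obtain N where N: "\<And>n. n \<ge> N \<Longrightarrow> (\<Sum>b\<in>F. a n \<phi> b) < \<epsilon> / 2" unfolding eventually_sequentially by blast
    have "norm (Re (tr (G n \<phi> \<phi>)) - 0) < \<epsilon>" if n: "n \<ge> N" for n
    proof -
      have eq: "Re (cinner b (tc_op (J \<phi> \<phi> - G n \<phi> \<phi>) b)) = a 0 \<phi> b - a n \<phi> b" for b
        by (simp add: a_def G0 tc_op_simps cinner_lin)
      have "((\<lambda>b. a 0 \<phi> b - a n \<phi> b) has_sum Re (tr (J \<phi> \<phi> - G n \<phi> \<phi>))) B0"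
        using tr_has_Re_sum[of "J \<phi> \<phi> - G n \<phi> \<phi>"] unfolding eq .
      then have "(\<Sum>b\<in>F. a 0 \<phi> b - a n \<phi> b) \<le> Re (tr (J \<phi> \<phi> - G n \<phi> \<phi>))"
        by (rule has_sum_mono2[OF has_sum_finite[OF F(1)]]) (use F anti[of 0 n] in auto)
      then have "Re (tr (G n \<phi> \<phi>)) \<le> Re (tr (J \<phi> \<phi>)) - (\<Sum>b\<in>F. a 0 \<phi> b) + (\<Sum>b\<in>F. a n \<phi> b)"
        by (simp add: tr_diff[OF onb] sum_subtractf)
      also have "\<dots> < \<epsilon>" using F(3) N[OF n] unfolding dist_real_def by linarith
      finally show ?thesis using tr_nonneg[OF d, of n] by simp
    qed
    then show "\<exists>no. \<forall>n\<ge>no. norm (Re (tr (G n \<phi> \<phi>)) - 0) < \<epsilon>" by blast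
  qed
  have sq_sums: "(\<lambda>k. (norm (l k \<phi>))\<^sup>2) sums Re (tr (J \<phi> \<phi>))" if d: "\<phi> \<in> D" for \<phi>
  proof -
    have "tr (J \<phi> \<phi>) - tr (G n \<phi> \<phi>) = of_real (\<Sum>k<n. (norm (l k \<phi>))\<^sup>2)" for n
      unfolding tr_diff[OF onb, symmetric] partial
      by (simp only: tr_sum[OF onb] tr_kb[OF onb] cinner_self_norm of_real_sum)
    then have "Re (tr (J \<phi> \<phi>) - tr (G n \<phi> \<phi>)) = (\<Sum>k<n. (norm (l k \<phi>))\<^sup>2)" for n by (simp only: Re_complex_of_real)
    moreover have "(\<lambda>n. Re (tr (J \<phi> \<phi>)) - Re (tr (G n \<phi> \<phi>))) \<longlonglongrightarrow> Re (tr (J \<phi> \<phi>)) - 0"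
      by (intro tendsto_intros t_lim d)
    ultimately show ?thesis unfolding sums_def by simp
  qed
  have "((\<lambda>k. kb (l k \<phi>) (l k \<psi>)) has_sum J \<phi> \<psi>) UNIV" if d: "\<phi> \<in> D" "\<psi> \<in> D" for \<phi> \<psi>
  proof (rule norm_summable_imp_has_sum)
    have "summable (\<lambda>k. (norm (l k \<phi>))\<^sup>2 + (norm (l k \<psi>))\<^sup>2)"
      by (intro summable_add sums_summable[OF sq_sums] d)
    then show "summable (\<lambda>k. norm (kb (l k \<phi>) (l k \<psi>)))"
    proof (rule summable_comparison_test'[where N = 0])
      fix k
      have "norm (kb (l k \<phi>) (l k \<psi>)) \<le> norm (l k \<phi>) * norm (l k \<psi>)" by (rule norm_kb_le)
      also have "\<dots> \<le> (norm (l k \<phi>))\<^sup>2 + (norm (l k \<psi>))\<^sup>2"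
        using sum_squares_bound[of "norm (l k \<phi>)" "norm (l k \<psi>)"] zero_le_power2[of "norm (l k \<phi>)"] zero_le_power2[of "norm (l k \<psi>)"] mult_nonneg_nonneg[of "norm (l k \<phi>)" "norm (l k \<psi>)"]
        by linarith
      finally show "norm (norm (kb (l k \<phi>) (l k \<psi>))) \<le> (norm (l k \<phi>))\<^sup>2 + (norm (l k \<psi>))\<^sup>2" by simp
    qed
    \<comment> \<open>The off-diagonal remainder is bounded in trace norm by the diagonal traces, so
      diagonal convergence suffices.\<close>
    have "(\<lambda>n. G n \<phi> \<psi>) \<longlonglongrightarrow> 0"
    proof (rule Lim_null_comparison)
      show "\<forall>\<^sub>F n in sequentially. norm (G n \<phi> \<psi>) \<le> (Re (tr (G n \<phi> \<phi>)) + Re (tr (G n \<psi> \<psi>))) / 2"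
        by (intro always_eventually allI cp_kernel_norm[OF onb Gc] d)
      have "(\<lambda>n. (Re (tr (G n \<phi> \<phi>)) + Re (tr (G n \<psi> \<psi>))) / 2) \<longlonglongrightarrow> (0 + 0) / 2"
        by (intro tendsto_intros t_lim d) simp
      then show "(\<lambda>n. (Re (tr (G n \<phi> \<phi>)) + Re (tr (G n \<psi> \<psi>))) / 2) \<longlonglongrightarrow> 0" by simp
    qed
    then have "(\<lambda>n. J \<phi> \<psi> - G n \<phi> \<psi>) \<longlonglongrightarrow> J \<phi> \<psi> - 0" by (intro tendsto_intros)
    then show "(\<lambda>k. kb (l k \<phi>) (l k \<psi>)) sums J \<phi> \<psi>" unfolding sums_def partial by simp
  qed
  then show ?thesis using l sq_sums by (intro exI[of _ l]) blast
qed

section \<open>The standard form of a matrix normal semigroup\<close>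

context qds_matrix_normal
begin

lemma matrix_normal_imp_standard_form:
  assumes sep: "separable_space TYPE('h)"
  shows "\<exists>K DM M Lk. gen_standard_form T K DM M Lk \<and> De \<subseteq> DM"
proof -
  have bd: "Re (tr (J \<phi> \<phi>)) \<le> (gnorm M \<phi>)\<^sup>2" if "\<phi> \<in> DM" for \<phi>
    unfolding DM_trace_Re[OF that] by (rule form_le_gnorm)
  obtain l where l: "\<forall>k::nat. clinear_on DM (l k)"
    "\<forall>\<phi>\<in>DM. (\<lambda>k. (norm (l k \<phi>))\<^sup>2) sums Re (tr (J \<phi> \<phi>))"
    "\<forall>\<phi>\<in>DM. \<forall>\<psi>\<in>DM. ((\<lambda>k. kb (l k \<phi>) (l k \<psi>)) has_sum J \<phi> \<psi>) UNIV"
    using cp_kernel_kraus[OF sep DM DM_sesq DM_cp_kernel DM_lin] bd by (elim meta_impE exE conjE)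
  have fr_DM: "\<exists>\<sigma>. gens \<rho> \<sigma>" if \<rho>: "\<rho> \<in> fr DM" for \<rho>
  proof -
    obtain n x y where xy: "\<And>j. j < n \<Longrightarrow> x j \<in> DM" "\<And>j. j < n \<Longrightarrow> y j \<in> DM" "\<rho> = (\<Sum>j<n::nat. kb (x j) (y j))"
      using \<rho> by (elim frE) blast
    have "gens \<rho> (\<Sum>j<n. L (kb (x j) (y j)))" unfolding xy(3) by (intro gens_sum DM_dom xy) auto
    then show ?thesis by blast
  qed
  have "gen_standard_form T UNIV DM M l"
    unfolding gen_standard_form_def
  proof (intro conjI ballI)
    show "closed_op DM M" by (rule M_closed)
    show "densely_defined DM M" unfolding densely_defined_def using DM_lin DM_dense by blast
    show "generates_C0 DM (\<lambda>x. - M x)" by (rule generates)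
    show "clinear_on DM (l k)" for k using l(1) by blast
    show "\<exists>a b. \<forall>\<phi>\<in>DM. norm (l k \<phi>) \<le> a * norm (M \<phi>) + b * norm \<phi>" for k
    proof (intro exI[of _ 1] ballI)
      fix \<phi> assume \<phi>: "\<phi> \<in> DM"
      have s: "(\<lambda>k. (norm (l k \<phi>))\<^sup>2) sums Re (tr (J \<phi> \<phi>))" using l(2) \<phi> by blast
      \<comment> \<open>A single square is at most the whole sum, hence at most the squared graph
        norm; this gives relative bounds with both constants 1.\<close>
      have "(\<Sum>j\<in>{k}. (norm (l j \<phi>))\<^sup>2) \<le> (\<Sum>j. (norm (l j \<phi>))\<^sup>2)"
        by (rule sum_le_suminf[OF sums_summable[OF s]]) auto
      then have "(norm (l k \<phi>))\<^sup>2 \<le> (gnorm M \<phi>)\<^sup>2" using sums_unique[OF s] bd[OF \<phi>] by simp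
      then have "norm (l k \<phi>) \<le> gnorm M \<phi>" by (rule power2_le_imp_le) (rule gnorm_nonneg)
      then show "norm (l k \<phi>) \<le> 1 * norm (M \<phi>) + 1 * norm \<phi>" by (simp add: gnorm_def)
    qed
    show "D0 DM \<subseteq> gen_dom T" unfolding tc_op_fr_eq_D0[symmetric] using fr_DM gen_dom_iff by blast
    show "\<exists>\<sigma>. tc_has_sum (\<lambda>k. ketbra (l k \<phi>) (l k \<psi>)) UNIV \<sigma> \<and>
        is_gen T (ketbra \<phi> \<psi>) (\<lambda>x. \<sigma> x - ketbra (M \<phi>) \<psi> x - ketbra \<phi> (M \<psi>) x)"
      if \<phi>: "\<phi> \<in> DM" and \<psi>: "\<psi> \<in> DM" for \<phi> \<psi>
    proof (intro exI[of _ "tc_op (J \<phi> \<psi>)"] conjI)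
      have "((\<lambda>F. \<Sum>k\<in>F. kb (l k \<phi>) (l k \<psi>)) \<longlongrightarrow> J \<phi> \<psi>) (finite_subsets_at_top UNIV)"
        using l(3) \<phi> \<psi> unfolding has_sum_def by blast
      then have "((\<lambda>F. norm ((\<Sum>k\<in>F. kb (l k \<phi>) (l k \<psi>)) - J \<phi> \<psi>)) \<longlongrightarrow> 0) (finite_subsets_at_top UNIV)"
        by (simp add: tendsto_norm_zero_iff LIM_zero_iff)
      moreover have "norm ((\<Sum>k\<in>F. kb (l k \<phi>) (l k \<psi>)) - J \<phi> \<psi>)
          = trace_norm (\<lambda>x. (\<Sum>k\<in>F. ketbra (l k \<phi>) (l k \<psi>) x) - tc_op (J \<phi> \<psi>) x)" for F
      proof -
        have "tc_op ((\<Sum>k\<in>F. kb (l k \<phi>) (l k \<psi>)) - J \<phi> \<psi>) = (\<lambda>x. (\<Sum>k\<in>F. ketbra (l k \<phi>) (l k \<psi>) x) - tc_op (J \<phi> \<psi>) x)"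
          by (rule ext) (simp add: minus_tc.rep_eq tc_op_sum kb.rep_eq)
        then show ?thesis by (simp only: norm_tc.rep_eq)
      qed
      ultimately show "tc_has_sum (\<lambda>k. ketbra (l k \<phi>) (l k \<psi>)) UNIV (tc_op (J \<phi> \<psi>))"
        by (simp add: tc_has_sum_def trace_class_ketbra)
      have "is_gen T (tc_op (kb \<phi> \<psi>)) (tc_op (J \<phi> \<psi> - kb (M \<phi>) \<psi> - kb \<phi> (M \<psi>)))"
        unfolding is_gen_iff using DM_dom[OF \<phi> \<psi>] by (simp add: Jop_def)
      then show "is_gen T (ketbra \<phi> \<psi>) (\<lambda>x. tc_op (J \<phi> \<psi>) x - ketbra (M \<phi>) \<psi> x - ketbra \<phi> (M \<psi>) x)"
        by (simp add: minus_tc.rep_eq kb.rep_eq)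
    qed
    show "graph_dense T (D0 DM)"
      unfolding tc_op_fr_eq_D0[symmetric] graph_dense_iff
    proof (intro conjI ballI allI impI fr_DM)
      fix \<rho> \<sigma> assume "gens \<rho> \<sigma>"
      then show "\<exists>X Y. (\<forall>n. X n \<in> fr DM \<and> gens (X n) (Y n)) \<and> X \<longlonglongrightarrow> \<rho> \<and> Y \<longlonglongrightarrow> \<sigma>"
        using core_approx fr_mono[OF De_subset_DM] by (meson subsetD)
    qed
    show "((\<lambda>k. complex_of_real ((norm (l k \<phi>))\<^sup>2)) has_sum (cinner \<phi> (M \<phi>) + cinner (M \<phi>) \<phi>)) UNIV"
      if \<phi>: "\<phi> \<in> DM" for \<phi>
    proof -
      have s: "(\<lambda>k. (norm (l k \<phi>))\<^sup>2) sums Re (tr (J \<phi> \<phi>))" using l(2) \<phi> by blast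
      have "((\<lambda>k. (norm (l k \<phi>))\<^sup>2) has_sum Re (tr (J \<phi> \<phi>))) UNIV"
        by (rule norm_summable_imp_has_sum) (use s sums_summable[OF s] in auto)
      then have "((\<lambda>k. complex_of_real ((norm (l k \<phi>))\<^sup>2)) has_sum complex_of_real (Re (tr (J \<phi> \<phi>)))) UNIV"
        by (rule has_sum_of_real)
      moreover have "complex_of_real (Re (tr (J \<phi> \<phi>))) = tr (J \<phi> \<phi>)"
        using tr_pos[OF onb cp_kernel_pos[OF DM_cp_kernel \<phi>]] by (simp add: nonneg_c_def complex_eq_iff)
      ultimately show ?thesis using DM_trace[OF \<phi>] by simp
    qed
  qed
  then show ?thesis using De_subset_DM by blast
qed

end

theorem theorem2p3:
  fixes T :: "real \<Rightarrow> ('h::chilbert \<Rightarrow> 'h) \<Rightarrow> ('h \<Rightarrow> 'h)"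
  assumes "separable_space TYPE('h)"
    and "tp_qds T"
  shows "(has_gen_standard_form T \<longleftrightarrow> matrix_normal T) \<and>
         (\<forall>B. matrix_normal_witness T B \<longrightarrow>
            (\<exists>K DM M L. gen_standard_form T K DM M L \<and> cspan B \<subseteq> DM)) \<and>
         (\<forall>K DM M L. gen_standard_form T K DM M L \<longrightarrow>
            (\<exists>B. matrix_normal_witness T B \<and> cspan B \<subseteq> DM))"
proof -
  interpret qds T by unfold_locales (fact assms(2), rule separable_has_onb[OF assms(1)])
  have 1: "\<exists>K DM M L. gen_standard_form T K DM M L \<and> cspan B \<subseteq> DM" if B: "matrix_normal_witness T B" for B
  proof -
    have onb_B: "is_onb B" and core: "graph_dense T (ketbra_span B)"
      using B by (auto simp: matrix_normal_witness_def is_core_def)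
    have "\<exists>e. (norm e = 1 \<or> (\<forall>x::'h. x = 0)) \<and> e \<in> cspan B"
    \<comment> \<open>An empty basis is possible only in the zero space, where \<open>e\<close> is
      the zero vector; otherwise any basis vector serves.\<close>
    proof (cases "B = {}")
      case True
      have "cspan B \<subseteq> {0}" by (rule cspan_subset) (auto simp: csubspace_def True)
      then have "closure (cspan B) \<subseteq> {0}" by (rule closure_minimal) simp
      then have "\<forall>x::'h. x = 0" using onb_B by (auto simp: is_onb_def)
      then show ?thesis using csubspace_0[OF csubspace_cspan] by blast
    next
      case False
      then obtain e where "e \<in> B" by blast
      then have "cinner e e = 1" using onb_B by (simp add: is_onb_def orthonormal_set_def)
      then have "(norm e)\<^sup>2 = 1\<^sup>2" using cinner_self_Re[of e] by simp
      then have "norm e = 1" using power2_eq_imp_eq by fastforce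
      then show ?thesis using cspan_base[OF \<open>e \<in> B\<close>] by blast
    qed
    then obtain e where e: "norm e = 1 \<or> (\<forall>x::'h. x = 0)" "e \<in> cspan B" by blast
    interpret qds_matrix_normal T B e by unfold_locales (fact onb_B core e)+
    show ?thesis by (rule matrix_normal_imp_standard_form[OF assms(1)])
  qed
  have 2: "\<exists>B. matrix_normal_witness T B \<and> cspan B \<subseteq> DM" if "gen_standard_form T K DM M L" for K DM M L
    by (rule standard_form_imp_matrix_normal[OF assms(1) that])
  show ?thesis
    using 1 2 unfolding has_gen_standard_form_def matrix_normal_def by meson
qed

end
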